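(* Let $H$ be the Hopf algebra associated to a group datum $(G,\chi,g,1)$ of non-nilpotent type, as in the context. The Jacobson radical of the Green ring $r(H)$ is the principal ideal generated by $(1-a)M[n,0]$.
   Context: $\Bbbk$ is an algebraically closed field of characteristic zero; modules are finite-dimensional left modules. Fix a finite group $G$, a $\Bbbk$-linear character $\chi$ of $G$ and a central element $g\in G$; let $n\ge 2$ be the order of $q=\chi(g)$, and assume $\chi^n=1$ and $g^n\neq 1$. $H$ is the Hopf algebra generated as an algebra by $y$ and $G$, with $\Bbbk G$ as a subalgebra and relations $y^n=g^n-1$, $yh=\chi(h)hy$ for $h\in G$; $\Delta(y)=y\otimes g+1\otimes y$, $\varepsilon(y)=0$, $S(y)=-yg^{-1}$, and the elements of $G$ are group-like. It has $\Bbbk$-basis $\{y^ih\mid h\in G,\ 0\le i\le n-1\}$. The Green ring $r(H)$ is the abelian group generated by isomorphism classes $[M]$ of finite-dimensional $H$-modules modulo $[M\oplus N]=[M]+[N]$, with product $[M][N]=[M\otimes N]$ and identity $1=[\Bbbk]$; it is commutative. $a=[V_{\chi^{-1}}]$ is the class of the one-dimensional $H$-module on which $G$ acts by $\chi^{-1}$ and $y$ acts by $0$. $M[n,0]$ is the class of the $H$-module $M(n,0)$ with basis $1,x,\dots,x^{n-1}$, $h\cdot x^k=\chi^{-k}(h)x^k$ for $h\in G$, $y\cdot x^k=x^{k+1}$ for $0\le k\le n-2$ and $y\cdot x^{n-1}=0$. *)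

theory Defs
  imports
    "HOL-Algebra.Algebra"
    "HOL-Algebra.Free_Abelian_Groups"
    "HOL-Computational_Algebra.Polynomial"
    "Jordan_Normal_Form.Matrix"
begin

section \<open>Group data of non-nilpotent type\<close>

text \<open>
  The order \<open>n\<close> of \<open>chi g\<close> in the multiplicative group of the field is spelled out by
  \<open>root_of_unity\<close> and \<open>primitive\<close>.
\<close>

locale nonnilpotent_group_datum = group G
  for G :: "('g, 'm) monoid_scheme" (structure)
    and chi :: "'g \<Rightarrow> 'k :: field" and g :: 'g and n :: nat +
  assumes finite_carrier: "finite (carrier G)"
    and chi_nonzero: "h \<in> carrier G \<Longrightarrow> chi h \<noteq> 0"
    and chi_mult: "h \<in> carrier G \<Longrightarrow> k \<in> carrier G \<Longrightarrow> chi (h \<otimes> k) = chi h * chi k"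
    and g_closed: "g \<in> carrier G"
    and g_central: "h \<in> carrier G \<Longrightarrow> g \<otimes> h = h \<otimes> g"
    and n_ge_2: "n \<ge> 2"
    and root_of_unity: "chi g ^ n = 1"
    and primitive: "0 < m \<Longrightarrow> m < n \<Longrightarrow> chi g ^ m \<noteq> 1"
    and chi_pow_n: "h \<in> carrier G \<Longrightarrow> chi h ^ n = 1"
    and g_pow_n: "g [^] n \<noteq> \<one>"


section \<open>Algebras given by structure constants\<close>

text \<open>
  An element \<open>\<Sum>b\<in>B. f b \<cdot> b\<close> of an algebra with finite basis \<open>B\<close> is represented by its coefficient
  function \<open>f\<close>, extended by \<open>0\<close> outside \<open>B\<close>; \<open>c b1 b2 b\<close> is the coefficient of \<open>b\<close> in the product
  of the basis elements \<open>b1\<close> and \<open>b2\<close>.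
\<close>

definition basis_vec :: "'b \<Rightarrow> 'b \<Rightarrow> 'k :: field" where
  "basis_vec b = (\<lambda>x. if x = b then 1 else 0)"

definition basis_algebra ::
  "'b set \<Rightarrow> ('b \<Rightarrow> 'b \<Rightarrow> 'b \<Rightarrow> 'k :: field) \<Rightarrow> ('b \<Rightarrow> 'k) \<Rightarrow> ('b \<Rightarrow> 'k) ring" where
  "basis_algebra B c u =
    \<lparr>carrier = {f. \<forall>b. b \<notin> B \<longrightarrow> f b = 0},
     monoid.mult = (\<lambda>f f' b. if b \<in> B then \<Sum>b1\<in>B. \<Sum>b2\<in>B. f b1 * f' b2 * c b1 b2 b else 0),
     monoid.one = u,
     ring.zero = (\<lambda>b. 0),
     ring.add = (\<lambda>f f' b. f b + f' b)\<rparr>"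


section \<open>The Hopf algebra\<close>

text \<open>
  The pair \<open>(i, h)\<close> stands for the basis element \<open>y\<^sup>ih\<close>. The relations \<open>yh = \<chi>(h)hy\<close> and
  \<open>y\<^sup>n = g\<^sup>n - 1\<close> give
  \<open>(y\<^sup>ih)(y\<^sup>jk) = \<chi>(h)\<^sup>-\<^sup>j y\<^sup>i\<^sup>+\<^sup>jhk\<close>, where, if \<open>i + j \<ge> n\<close>, the power \<open>y\<^sup>i\<^sup>+\<^sup>j\<close> is to be replaced by
  \<open>y\<^sup>i\<^sup>+\<^sup>j\<^sup>-\<^sup>n(g\<^sup>n - 1)\<close>.
\<close>

definition hopf_basis :: "('g, 'm) monoid_scheme \<Rightarrow> nat \<Rightarrow> (nat \<times> 'g) set" where
  "hopf_basis G n = {..<n} \<times> carrier G"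

definition hopf_const ::
  "('g, 'm) monoid_scheme \<Rightarrow> ('g \<Rightarrow> 'k :: field) \<Rightarrow> 'g \<Rightarrow> nat
    \<Rightarrow> nat \<times> 'g \<Rightarrow> nat \<times> 'g \<Rightarrow> nat \<times> 'g \<Rightarrow> 'k" where
  "hopf_const G chi g n = (\<lambda>(i, h) (j, k) b.
     inverse (chi h) ^ j *
       (if i + j < n then basis_vec (i + j, h \<otimes>\<^bsub>G\<^esub> k) b
        else basis_vec (i + j - n, (g [^]\<^bsub>G\<^esub> n) \<otimes>\<^bsub>G\<^esub> (h \<otimes>\<^bsub>G\<^esub> k)) b
             - basis_vec (i + j - n, h \<otimes>\<^bsub>G\<^esub> k) b))"

definition hopf ::
  "('g, 'm) monoid_scheme \<Rightarrow> ('g \<Rightarrow> 'k :: field) \<Rightarrow> 'g \<Rightarrow> nat \<Rightarrow> (nat \<times> 'g \<Rightarrow> 'k) ring" where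
  "hopf G chi g n =
     basis_algebra (hopf_basis G n) (hopf_const G chi g n) (basis_vec (0, \<one>\<^bsub>G\<^esub>))"

definition hopf_grp :: "'g \<Rightarrow> nat \<times> 'g \<Rightarrow> 'k :: field" where
  "hopf_grp h = basis_vec (0, h)"

definition hopf_y :: "('g, 'm) monoid_scheme \<Rightarrow> nat \<times> 'g \<Rightarrow> 'k :: field" where
  "hopf_y G = basis_vec (1, \<one>\<^bsub>G\<^esub>)"

definition hopf_tensor ::
  "('g, 'm) monoid_scheme \<Rightarrow> ('g \<Rightarrow> 'k :: field) \<Rightarrow> 'g \<Rightarrow> nat
    \<Rightarrow> ((nat \<times> 'g) \<times> (nat \<times> 'g) \<Rightarrow> 'k) ring" where
  "hopf_tensor G chi g n =
     basis_algebra (hopf_basis G n \<times> hopf_basis G n)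
       (\<lambda>(a, a') (b, b') (c, c'). hopf_const G chi g n a b c * hopf_const G chi g n a' b' c')
       (basis_vec ((0, \<one>\<^bsub>G\<^esub>), (0, \<one>\<^bsub>G\<^esub>)))"

definition pure_tensor :: "('b \<Rightarrow> 'k :: field) \<Rightarrow> ('c \<Rightarrow> 'k) \<Rightarrow> 'b \<times> 'c \<Rightarrow> 'k" where
  "pure_tensor f f' = (\<lambda>(b, c). f b * f' c)"

definition hopf_Delta_y ::
  "('g, 'm) monoid_scheme \<Rightarrow> ('g \<Rightarrow> 'k :: field) \<Rightarrow> 'g \<Rightarrow> nat
    \<Rightarrow> (nat \<times> 'g) \<times> (nat \<times> 'g) \<Rightarrow> 'k" where
  "hopf_Delta_y G chi g n =
     pure_tensor (hopf_y G) (hopf_grp g) \<oplus>\<^bsub>hopf_tensor G chi g n\<^esub>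
     pure_tensor \<one>\<^bsub>hopf G chi g n\<^esub> (hopf_y G)"

text \<open>
  The comultiplication is the linear map with
  \<open>\<Delta>(y\<^sup>ih) = \<Delta>(y)\<^sup>i \<Delta>(h) = (y \<otimes> g + 1 \<otimes> y)\<^sup>i (h \<otimes> h)\<close>, the counit the one with
  \<open>\<epsilon>(y\<^sup>ih) = 0\<^sup>i\<close>. The antipode plays no role in the Green ring.
\<close>

definition hopf_Delta ::
  "('g, 'm) monoid_scheme \<Rightarrow> ('g \<Rightarrow> 'k :: field) \<Rightarrow> 'g \<Rightarrow> nat
    \<Rightarrow> (nat \<times> 'g \<Rightarrow> 'k) \<Rightarrow> (nat \<times> 'g) \<times> (nat \<times> 'g) \<Rightarrow> 'k" where
  "hopf_Delta G chi g n f = (\<lambda>b. \<Sum>(i, h)\<in>hopf_basis G n. f (i, h) *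
     ((hopf_Delta_y G chi g n [^]\<^bsub>hopf_tensor G chi g n\<^esub> i) \<otimes>\<^bsub>hopf_tensor G chi g n\<^esub>
       pure_tensor (hopf_grp h) (hopf_grp h)) b)"

definition hopf_eps :: "('g, 'm) monoid_scheme \<Rightarrow> (nat \<times> 'g \<Rightarrow> 'k :: field) \<Rightarrow> 'k" where
  "hopf_eps G f = (\<Sum>h\<in>carrier G. f (0, h))"


section \<open>Finite-dimensional modules\<close>

text \<open>
  A finite-dimensional left module is given, after a choice of a basis of the underlying space, by
  its dimension \<open>d\<close> and a homomorphism of algebras from the Hopf algebra to the \<open>d \<times> d\<close> matrices.
\<close>

type_synonym ('g, 'k) hmodule = "nat \<times> ((nat \<times> 'g \<Rightarrow> 'k) \<Rightarrow> 'k mat)"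

definition hmodules ::
  "('g, 'm) monoid_scheme \<Rightarrow> ('g \<Rightarrow> 'k :: field) \<Rightarrow> 'g \<Rightarrow> nat \<Rightarrow> ('g, 'k) hmodule set" where
  "hmodules G chi g n =
     {(d, \<rho>). \<rho> \<in> Ring.ring_hom (hopf G chi g n) (ring_mat TYPE('k) d ()) \<and>
        (\<forall>c. \<forall>x\<in>carrier (hopf G chi g n). \<rho> (\<lambda>b. c * x b) = c \<cdot>\<^sub>m \<rho> x)}"

definition hmodule_iso ::
  "('g, 'm) monoid_scheme \<Rightarrow> ('g \<Rightarrow> 'k :: field) \<Rightarrow> 'g \<Rightarrow> nat
    \<Rightarrow> ('g, 'k) hmodule \<Rightarrow> ('g, 'k) hmodule \<Rightarrow> bool" where
  "hmodule_iso G chi g n = (\<lambda>(d, \<rho>) (d', \<rho>').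
     d = d' \<and> (\<exists>P\<in>carrier_mat d d. invertible_mat P \<and>
       (\<forall>x\<in>carrier (hopf G chi g n). P * \<rho> x = \<rho>' x * P)))"

definition hmodule_sum ::
  "('g, 'k :: field) hmodule \<Rightarrow> ('g, 'k) hmodule \<Rightarrow> ('g, 'k) hmodule" where
  "hmodule_sum = (\<lambda>(d, \<rho>) (d', \<rho>').
     (d + d', \<lambda>x. four_block_mat (\<rho> x) (0\<^sub>m d d') (0\<^sub>m d' d) (\<rho>' x)))"

definition kronecker_mat :: "'k :: field mat \<Rightarrow> 'k mat \<Rightarrow> 'k mat" where
  "kronecker_mat A B =
     mat (dim_row A * dim_row B) (dim_col A * dim_col B)
       (\<lambda>(r, s). A $$ (r div dim_row B, s div dim_col B) * B $$ (r mod dim_row B, s mod dim_col B))"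

text \<open>
  The action of \<open>x\<close> on the tensor product is that of
  \<open>\<Delta>(x) = \<Sum>b b'. \<Delta>(x) (b, b') \<cdot> (b \<otimes> b')\<close>.
\<close>

definition hmodule_tensor ::
  "('g, 'm) monoid_scheme \<Rightarrow> ('g \<Rightarrow> 'k :: field) \<Rightarrow> 'g \<Rightarrow> nat
    \<Rightarrow> ('g, 'k) hmodule \<Rightarrow> ('g, 'k) hmodule \<Rightarrow> ('g, 'k) hmodule" where
  "hmodule_tensor G chi g n = (\<lambda>(d, \<rho>) (d', \<rho>').
     (d * d', \<lambda>x. mat (d * d') (d * d') (\<lambda>rs.
        \<Sum>(b, b')\<in>hopf_basis G n \<times> hopf_basis G n. hopf_Delta G chi g n x (b, b') *
          kronecker_mat (\<rho> (basis_vec b)) (\<rho>' (basis_vec b')) $$ rs)))"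

definition hmodule_unit :: "('g, 'm) monoid_scheme \<Rightarrow> ('g, 'k :: field) hmodule" where
  "hmodule_unit G = (1, \<lambda>x. hopf_eps G x \<cdot>\<^sub>m 1\<^sub>m 1)"

text \<open>
  The module \<open>k\<^sup>d\<close> on which \<open>h \<in> G\<close> acts by the matrix \<open>R h\<close> and \<open>y\<close> by the matrix \<open>Y\<close>.
\<close>

definition hmodule_of ::
  "('g, 'm) monoid_scheme \<Rightarrow> nat \<Rightarrow> nat \<Rightarrow> ('g \<Rightarrow> 'k :: field mat) \<Rightarrow> 'k mat \<Rightarrow> ('g, 'k) hmodule" where
  "hmodule_of G n d R Y =
     (d, \<lambda>x. mat d d (\<lambda>rs. \<Sum>(i, h)\<in>hopf_basis G n. x (i, h) * ((Y ^\<^sub>m i) * R h) $$ rs))"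

definition hmodule_V :: "('g, 'm) monoid_scheme \<Rightarrow> nat \<Rightarrow> ('g \<Rightarrow> 'k :: field) \<Rightarrow> ('g, 'k) hmodule" where
  "hmodule_V G n psi = hmodule_of G n 1 (\<lambda>h. psi h \<cdot>\<^sub>m 1\<^sub>m 1) (0\<^sub>m 1 1)"

text \<open>
  In the basis \<open>1, x, \<dots>, x\<^sup>n\<^sup>-\<^sup>1\<close>, the element \<open>h\<close> acts diagonally by \<open>\<chi>(h)\<^sup>-\<^sup>k\<close>, and \<open>y\<close> sends the \<open>s\<close>-th
  basis vector to the \<open>(s + 1)\<close>-st one and the last one to \<open>0\<close>.
\<close>

definition hmodule_M0 :: "('g, 'm) monoid_scheme \<Rightarrow> ('g \<Rightarrow> 'k :: field) \<Rightarrow> nat \<Rightarrow> ('g, 'k) hmodule" where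
  "hmodule_M0 G chi n =
     hmodule_of G n n (\<lambda>h. mat_diag n (\<lambda>k. inverse (chi h) ^ k))
       (mat n n (\<lambda>(r, s). if r = Suc s then 1 else 0))"


section \<open>The Green ring\<close>

definition hmodule_class ::
  "('g, 'm) monoid_scheme \<Rightarrow> ('g \<Rightarrow> 'k :: field) \<Rightarrow> 'g \<Rightarrow> nat
    \<Rightarrow> ('g, 'k) hmodule \<Rightarrow> ('g, 'k) hmodule set" where
  "hmodule_class G chi g n M = {N \<in> hmodules G chi g n. hmodule_iso G chi g n M N}"

definition hmodule_classes ::
  "('g, 'm) monoid_scheme \<Rightarrow> ('g \<Rightarrow> 'k :: field) \<Rightarrow> 'g \<Rightarrow> nat \<Rightarrow> ('g, 'k) hmodule set set" where
  "hmodule_classes G chi g n = hmodule_class G chi g n ` hmodules G chi g n"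

definition class_tensor ::
  "('g, 'm) monoid_scheme \<Rightarrow> ('g \<Rightarrow> 'k :: field) \<Rightarrow> 'g \<Rightarrow> nat
    \<Rightarrow> ('g, 'k) hmodule set \<Rightarrow> ('g, 'k) hmodule set \<Rightarrow> ('g, 'k) hmodule set" where
  "class_tensor G chi g n A B =
     (\<Union>M\<in>A. \<Union>N\<in>B. hmodule_class G chi g n (hmodule_tensor G chi g n M N))"

text \<open>
  The free abelian group on the isomorphism classes, with the tensor product extended bilinearly.
\<close>

definition free_green_ring ::
  "('g, 'm) monoid_scheme \<Rightarrow> ('g \<Rightarrow> 'k :: field) \<Rightarrow> 'g \<Rightarrow> nat
    \<Rightarrow> (('g, 'k) hmodule set \<Rightarrow>\<^sub>0 int) ring" where
  "free_green_ring G chi g n =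
    \<lparr>carrier = carrier (free_Abelian_group (hmodule_classes G chi g n)),
     monoid.mult = (\<lambda>p q.
       frag_extend (\<lambda>A. frag_extend (\<lambda>B. frag_of (class_tensor G chi g n A B)) q) p),
     monoid.one = frag_of (hmodule_class G chi g n (hmodule_unit G)),
     ring.zero = 0,
     ring.add = (+)\<rparr>"

definition green_relations ::
  "('g, 'm) monoid_scheme \<Rightarrow> ('g \<Rightarrow> 'k :: field) \<Rightarrow> 'g \<Rightarrow> nat
    \<Rightarrow> (('g, 'k) hmodule set \<Rightarrow>\<^sub>0 int) set" where
  "green_relations G chi g n =
     generate (free_Abelian_group (hmodule_classes G chi g n))
       {frag_of (hmodule_class G chi g n (hmodule_sum M N))
          - (frag_of (hmodule_class G chi g n M) + frag_of (hmodule_class G chi g n N)) | M N.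
        M \<in> hmodules G chi g n \<and> N \<in> hmodules G chi g n}"

definition green_ring ::
  "('g, 'm) monoid_scheme \<Rightarrow> ('g \<Rightarrow> 'k :: field) \<Rightarrow> 'g \<Rightarrow> nat
    \<Rightarrow> (('g, 'k) hmodule set \<Rightarrow>\<^sub>0 int) set ring" where
  "green_ring G chi g n = free_green_ring G chi g n Quot green_relations G chi g n"

definition green_class ::
  "('g, 'm) monoid_scheme \<Rightarrow> ('g \<Rightarrow> 'k :: field) \<Rightarrow> 'g \<Rightarrow> nat
    \<Rightarrow> ('g, 'k) hmodule \<Rightarrow> (('g, 'k) hmodule set \<Rightarrow>\<^sub>0 int) set" where
  "green_class G chi g n M =
     green_relations G chi g n +>\<^bsub>free_green_ring G chi g n\<^esub> frag_of (hmodule_class G chi g n M)"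


section \<open>The Jacobson radical of a commutative ring\<close>

definition jacobson_radical :: "('a, 'b) ring_scheme \<Rightarrow> 'a set" where
  "jacobson_radical R = carrier R \<inter> \<Inter>{I. maximalideal I R}"


section \<open>The defining relations of the Hopf algebra\<close>

context nonnilpotent_group_datum
begin

abbreviation "H \<equiv> hopf G chi g n"

lemma finite_hopf_basis: "finite (hopf_basis G n)"
  using finite_carrier by (simp add: hopf_basis_def)

lemma chi_one: "chi \<one> = 1"
proof -
  have "chi \<one> * chi \<one> = chi \<one>" using chi_mult[of \<one> \<one>] by simp
  then show ?thesis using chi_nonzero[of \<one>] by simp
qed

lemma hopf_mult_basis:
  assumes "a \<in> hopf_basis G n" "b \<in> hopf_basis G n"
  shows "basis_vec a \<otimes>\<^bsub>H\<^esub> basis_vec b = hopf_const G chi g n a b"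
proof
  fix c
  have out: "hopf_const G chi g n a b c = 0" if "c \<notin> hopf_basis G n"
  proof -
    obtain i h j k where ab: "a = (i, h)" "b = (j, k)" by fastforce
    have ij: "i < n" "j < n" and hk: "h \<in> carrier G" "k \<in> carrier G"
      using assms ab by (auto simp: hopf_basis_def)
    then have "(i + j - n, h \<otimes> k) \<in> hopf_basis G n"
      "(i + j - n, (g [^] n) \<otimes> (h \<otimes> k)) \<in> hopf_basis G n"
      "i + j < n \<Longrightarrow> (i + j, h \<otimes> k) \<in> hopf_basis G n"
      using g_closed by (auto simp: hopf_basis_def)
    then show ?thesis using that by (auto simp: ab hopf_const_def basis_vec_def)
  qed
  have "(\<Sum>b1\<in>hopf_basis G n. \<Sum>b2\<in>hopf_basis G n.
          basis_vec a b1 * basis_vec b b2 * hopf_const G chi g n b1 b2 c)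
      = (\<Sum>b1\<in>hopf_basis G n. if b1 = a then hopf_const G chi g n a b c else 0)"
    using assms finite_hopf_basis
    by (intro sum.cong refl) (auto simp: basis_vec_def if_distrib[of "\<lambda>t. t * _"] cong: if_cong)
  also have "\<dots> = hopf_const G chi g n a b c"
    using assms finite_hopf_basis by simp
  finally show "(basis_vec a \<otimes>\<^bsub>H\<^esub> basis_vec b) c = hopf_const G chi g n a b c"
    using out by (simp add: hopf_def basis_algebra_def)
qed

lemma hopf_grp_mult:
  assumes "h \<in> carrier G" "k \<in> carrier G"
  shows "hopf_grp h \<otimes>\<^bsub>H\<^esub> hopf_grp k = (hopf_grp (h \<otimes> k) :: _ \<Rightarrow> 'k)"
  using assms n_ge_2 unfolding hopf_grp_def
  by (subst hopf_mult_basis) (auto simp: hopf_basis_def hopf_const_def)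

lemma hopf_y_grp:
  assumes "h \<in> carrier G"
  shows "hopf_y G \<otimes>\<^bsub>H\<^esub> hopf_grp h = (\<lambda>b. chi h * (hopf_grp h \<otimes>\<^bsub>H\<^esub> hopf_y G) b)"
  using assms n_ge_2 chi_nonzero unfolding hopf_grp_def hopf_y_def
  by (subst (1 2) hopf_mult_basis) (auto simp: hopf_basis_def hopf_const_def)

lemma hopf_y_pow: "i < n \<Longrightarrow> hopf_y G [^]\<^bsub>H\<^esub> i = (basis_vec (i, \<one>) :: _ \<Rightarrow> 'k)"
proof (induction i)
  case 0
  show ?case by (simp add: nat_pow_def hopf_def basis_algebra_def)
next
  case (Suc i)
  have "hopf_y G [^]\<^bsub>H\<^esub> Suc i = basis_vec (i, \<one>) \<otimes>\<^bsub>H\<^esub> hopf_y G"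
    using Suc by (simp add: nat_pow_def)
  also have "\<dots> = basis_vec (Suc i, \<one>)"
    using Suc.prems unfolding hopf_y_def
    by (subst hopf_mult_basis) (auto simp: hopf_basis_def hopf_const_def chi_one)
  finally show ?case .
qed

lemma hopf_y_pow_grp:
  assumes "i < n" "h \<in> carrier G"
  shows "(hopf_y G [^]\<^bsub>H\<^esub> i) \<otimes>\<^bsub>H\<^esub> hopf_grp h = (basis_vec (i, h) :: _ \<Rightarrow> 'k)"
  using assms n_ge_2 unfolding hopf_y_pow[OF assms(1)] hopf_grp_def
  by (subst hopf_mult_basis) (auto simp: hopf_basis_def hopf_const_def chi_one)

lemma hopf_y_pow_n:
  "hopf_y G [^]\<^bsub>H\<^esub> n = (\<lambda>b. hopf_grp (g [^] n) b - \<one>\<^bsub>H\<^esub> b :: 'k)"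
proof -
  obtain m where m: "n = Suc m" using n_ge_2 by (cases n) auto
  have "hopf_y G [^]\<^bsub>H\<^esub> n = (hopf_y G [^]\<^bsub>H\<^esub> m) \<otimes>\<^bsub>H\<^esub> hopf_y G"
    using m by (simp only: nat_pow_def) simp
  also have "\<dots> = basis_vec (m, \<one>) \<otimes>\<^bsub>H\<^esub> hopf_y G"
    using hopf_y_pow[of m] m by simp
  also have "\<dots> = hopf_const G chi g n (m, \<one>) (1, \<one>)"
    unfolding hopf_y_def using m n_ge_2 by (intro hopf_mult_basis) (auto simp: hopf_basis_def)
  also have "\<dots> = (\<lambda>b. hopf_grp (g [^] n) b - \<one>\<^bsub>H\<^esub> b)"
    using m n_ge_2 g_closed
    by (auto simp: hopf_const_def chi_one hopf_grp_def hopf_def basis_algebra_def)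
  finally show ?thesis .
qed

end

end

theory Submission
  imports Defs "HOL-Library.Nat_Bijection" "Jordan_Normal_Form.Char_Poly"
begin

text \<open>
  Write \<open>M(k,U)\<close> for the module \<open>U \<otimes> k[y]/(y\<^sup>k)\<close>, where \<open>U\<close> is a representation of the group. Every module
  is a sum of such modules with \<open>k \<le> n\<close> and of a module on which \<open>y\<close> is invertible, and it is determined by the
  characters of these pieces. Put \<open>\<zeta> = \<chi>(h)\<^sup>-\<^sup>1\<close>. By the Clebsch-Gordan rule, the function with values
  \<open>tr\<^sub>U(h) (s\<^sup>k - t\<^sup>k) / (s - t)\<close> at \<open>M(k,U)\<close> and zero where \<open>y\<close> is invertible is multiplicative if \<open>s\<close> and \<open>t\<close> are
  distinct roots of unity with \<open>st = \<zeta>\<close> and \<open>s\<^sup>n = t\<^sup>n\<close>; so is the character of the group. The values are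
  algebraic integers, and a ring homomorphism into the algebraic integers kills the Jacobson radical. Varying
  \<open>s\<close> and \<open>t\<close>, one finds that an element of the radical is of the form \<open>[M(n,U)] - [M(n,V)]\<close>, where
  \<open>(1 + \<zeta> + \<dots> + \<zeta>\<^sup>n\<^sup>-\<^sup>1) (tr\<^sub>U - tr\<^sub>V)(h) = 0\<close> for all \<open>h\<close>. Then \<open>U\<close> and some twist of \<open>V\<close> by a power of \<open>\<chi>\<close>
  have a common summand; splitting it off from \<open>U\<close> and, up to a twist, from \<open>V\<close> changes the element by a
  multiple of \<open>z = (1 - a) M[n,0]\<close>. Conversely, \<open>z\<close> is central with \<open>z\<^sup>2 = 0\<close>.
\<close>

text \<open>The shape of the generator and of the characters is dictated by blocks of length
  \<open>n\<close>. Tensoring \<open>M(n,U)\<close> with the two-dimensional block \<open>E2\<close>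
  gives two blocks of length \<open>n\<close>, with tops \<open>U\<close> and its twist. A character
  that takes the values F(k) at blocks with trivial top and the value x at \<open>E2\<close>
  therefore satisfies x F(n) = (1 + \<zeta>) F(n). Either x = 1 + \<zeta>, which is the group trace,
  or F(n) = 0, which is the condition on s and t. On \<open>M(n,U)\<close> the group trace is N tr_U
  with N = 1 + \<zeta> + ... + \<zeta>^(n-1), and \<zeta> N = N because chi^n = 1: a twist of
  \<open>U\<close> is invisible. Isomorphism classes are separated by the functions
  \<open>val\<close>. Their values lie in the field, so cancellation in the Green ring is
  cancellation in the field. The tensor product of two modules on which y is invertible may have a
  nilpotent part, which is never computed. Multiplicativity there comes from tensoring with a block
  of length \<open>n\<close>, which turns the first factor into \<open>n\<close> copies of
  itself.\<close>

no_notation ideal_prod (infixl "\<cdot>\<index>" 80)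

section \<open>Finitely supported matrices\<close>

text \<open>Square matrices of all sizes lie in one ring without unit. The identity of a space
  becomes an idempotent, and sums, summands and Kronecker products stay within the same
  type.\<close>

typedef (overloaded) 'k fmat =
  "{f :: nat \<Rightarrow> nat \<Rightarrow> 'k :: zero. \<exists>N. \<forall>i j. f i j \<noteq> 0 \<longrightarrow> i < N \<and> j < N}"
  morphisms ent Abs_fmat
  by (rule exI[of _ "\<lambda>_ _. 0"]) simp

lemma fmat_eqI: "(\<And>i j. ent A i j = ent B i j) \<Longrightarrow> A = B"
  by (metis ent_inject ext)

text \<open>An arbitrary bound of the support, not the least one. \<open>ent_mult\<close> and
  \<open>tr_eq\<close> remove it from statements.\<close>

definition fbd :: "'k :: zero fmat \<Rightarrow> nat" where
  "fbd A = (SOME N. \<forall>i j. ent A i j \<noteq> 0 \<longrightarrow> i < N \<and> j < N)"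

lemma fbd: "ent A i j \<noteq> 0 \<Longrightarrow> i < fbd A" "ent A i j \<noteq> 0 \<Longrightarrow> j < fbd A"
proof -
  have "\<exists>N. \<forall>i j. ent A i j \<noteq> 0 \<longrightarrow> i < N \<and> j < N"
    using ent[of A] by simp
  from someI_ex[OF this]
  show "ent A i j \<noteq> 0 \<Longrightarrow> i < fbd A" "ent A i j \<noteq> 0 \<Longrightarrow> j < fbd A"
    unfolding fbd_def by blast+
qed

lemma ent_Abs_bound:
  assumes "\<And>i j. f i j \<noteq> 0 \<Longrightarrow> i < N \<and> j < N"
  shows "ent (Abs_fmat f) = f"
  using assms by (intro Abs_fmat_inverse) blast

lemma ent_Abs_finite:
  assumes "finite S" "\<And>i j. f i j \<noteq> 0 \<Longrightarrow> i \<in> S \<and> j \<in> S"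
  shows "ent (Abs_fmat f) = f"
proof (rule ent_Abs_bound)
  fix i j assume "f i j \<noteq> 0"
  then have "i \<in> S" "j \<in> S" using assms(2) by blast+
  then show "i < Suc (Max S) \<and> j < Suc (Max S)"
    using Max_ge[OF assms(1)] by (simp add: le_imp_less_Suc)
qed

instantiation fmat :: (field) ring
begin

definition "0 = Abs_fmat (\<lambda>_ _. 0 :: 'a)"
definition "A + B = Abs_fmat (\<lambda>i j. ent A i j + ent B i j :: 'a)"
definition "- A = Abs_fmat (\<lambda>i j. - ent A i j :: 'a)"
definition "A - B = Abs_fmat (\<lambda>i j. ent A i j - ent B i j :: 'a)"
definition "A * B = Abs_fmat (\<lambda>i j. \<Sum>k<fbd A. ent A i k * ent B k j :: 'a)"

lemma ent_zero: "ent (0 :: 'a fmat) i j = 0"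
  unfolding zero_fmat_def by (subst ent_Abs_bound[of _ 0]) auto

lemma ent_add: "ent (A + B :: 'a fmat) i j = ent A i j + ent B i j"
  unfolding plus_fmat_def
proof (subst ent_Abs_bound[of _ "max (fbd A) (fbd B)"])
  fix i j assume "ent A i j + ent B i j \<noteq> 0"
  then have "ent A i j \<noteq> 0 \<or> ent B i j \<noteq> 0" by auto
  then show "i < max (fbd A) (fbd B) \<and> j < max (fbd A) (fbd B)"
    using fbd[of A i j] fbd[of B i j] by (auto simp: less_max_iff_disj)
qed simp

lemma ent_uminus: "ent (- A :: 'a fmat) i j = - ent A i j"
  unfolding uminus_fmat_def using fbd[of A]
  by (subst ent_Abs_bound[of _ "fbd A"]) auto

lemma ent_minus: "ent (A - B :: 'a fmat) i j = ent A i j - ent B i j"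
  unfolding minus_fmat_def
proof (subst ent_Abs_bound[of _ "max (fbd A) (fbd B)"])
  fix i j assume "ent A i j - ent B i j \<noteq> 0"
  then have "ent A i j \<noteq> 0 \<or> ent B i j \<noteq> 0" by auto
  then show "i < max (fbd A) (fbd B) \<and> j < max (fbd A) (fbd B)"
    using fbd[of A i j] fbd[of B i j] by (auto simp: less_max_iff_disj)
qed simp

lemma ent_mult_fbd: "ent (A * B :: 'a fmat) i j = (\<Sum>k<fbd A. ent A i k * ent B k j)"
proof -
  have "i < fbd A" "j < fbd B" if "(\<Sum>k<fbd A. ent A i k * ent B k j) \<noteq> 0" for i j
  proof -
    from that obtain k where "ent A i k * ent B k j \<noteq> 0" by (meson sum.neutral)
    then show "i < fbd A" "j < fbd B" using fbd(1)[of A i k] fbd(2)[of B k j] by auto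
  qed
  then show ?thesis unfolding times_fmat_def
    by (subst ent_Abs_bound[of _ "max (fbd A) (fbd B)"]) (simp_all add: less_max_iff_disj)
qed

lemma fbd_mult:
  fixes A B :: "'a fmat"
  assumes "ent (A * B) i j \<noteq> 0"
  shows "i < fbd A" "j < fbd B"
proof -
  from assms obtain k where "ent A i k * ent B k j \<noteq> 0"
    unfolding ent_mult_fbd by (meson sum.neutral)
  then show "i < fbd A" "j < fbd B" using fbd(1)[of A i k] fbd(2)[of B k j] by auto
qed

text \<open>Frees products from the choice of \<open>fbd\<close>: the index set only has to contain
  the indices at which both factors are nonzero.\<close>

lemma ent_mult:
  assumes "finite S" "\<And>k. ent A i k \<noteq> 0 \<Longrightarrow> ent B k j \<noteq> 0 \<Longrightarrow> k \<in> S"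
  shows "ent (A * B :: 'a fmat) i j = (\<Sum>k\<in>S. ent A i k * ent B k j)"
proof -
  have "(\<Sum>k<fbd A. ent A i k * ent B k j) = (\<Sum>k\<in>{..<fbd A} \<inter> S. ent A i k * ent B k j)"
    using assms(2) by (intro sum.mono_neutral_right) auto
  also have "\<dots> = (\<Sum>k\<in>S. ent A i k * ent B k j)"
    using assms(1) fbd(2)[of A i] by (intro sum.mono_neutral_left) auto
  finally show ?thesis by (simp add: ent_mult_fbd)
qed

instance
proof
  fix A B C :: "'a fmat"
  show "A + B + C = A + (B + C)" "A + B = B + A" "0 + A = A" "- A + A = 0" "A - B = A + - B"
    by (auto intro!: fmat_eqI simp: ent_add ent_zero ent_uminus ent_minus)
  show "A * B * C = A * (B * C)"
  proof (rule fmat_eqI)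
    fix i j
    have "ent (A * B * C) i j = (\<Sum>k<fbd B. ent (A * B) i k * ent C k j)"
      by (rule ent_mult) (auto dest: fbd_mult)
    also have "\<dots> = (\<Sum>k<fbd B. \<Sum>l<fbd A. ent A i l * ent B l k * ent C k j)"
      by (simp add: ent_mult_fbd sum_distrib_right)
    also have "\<dots> = (\<Sum>l<fbd A. \<Sum>k<fbd B. ent A i l * ent B l k * ent C k j)"
      by (rule sum.swap)
    also have "\<dots> = ent (A * (B * C)) i j"
      by (simp add: ent_mult_fbd sum_distrib_left mult.assoc)
    finally show "ent (A * B * C) i j = ent (A * (B * C)) i j" .
  qed
  show "(A + B) * C = A * C + B * C"
  proof (rule fmat_eqI)
    fix i j
    let ?S = "{..<fbd C}"
    have *: "ent (D * C) i j = (\<Sum>k\<in>?S. ent D i k * ent C k j)" for D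
      using fbd(1)[of C] by (intro ent_mult) auto
    show "ent ((A + B) * C) i j = ent (A * C + B * C) i j"
      by (simp add: * ent_add distrib_right sum.distrib)
  qed
  show "A * (B + C) = A * B + A * C"
    by (rule fmat_eqI) (simp add: ent_mult_fbd ent_add distrib_left sum.distrib)
qed

end

lemma ent_sum: "ent (\<Sum>x\<in>S. f x :: 'k :: field fmat) i j = (\<Sum>x\<in>S. ent (f x) i j)"
  by (induction S rule: infinite_finite_induct) (auto simp: ent_zero ent_add)

definition smul :: "'k :: field \<Rightarrow> 'k fmat \<Rightarrow> 'k fmat" (infixr "\<cdot>" 75) where
  "c \<cdot> A = Abs_fmat (\<lambda>i j. c * ent A i j)"

lemma ent_smul: "ent (c \<cdot> A) i j = c * ent A i j"
  unfolding smul_def using fbd[of A] by (subst ent_Abs_bound[of _ "fbd A"]) auto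

lemma smul_one [simp]: "1 \<cdot> A = A"
  and smul_zero [simp]: "0 \<cdot> A = 0" "c \<cdot> 0 = 0"
  and smul_smul [simp]: "c \<cdot> d \<cdot> A = (c * d) \<cdot> A"
  and smul_add_right: "c \<cdot> (A + B) = c \<cdot> A + c \<cdot> B"
  and smul_add_left: "(c + d) \<cdot> A = c \<cdot> A + d \<cdot> A"
  and smul_diff_right: "c \<cdot> (A - B) = c \<cdot> A - c \<cdot> B"
  and smul_diff_left: "(c - d) \<cdot> A = c \<cdot> A - d \<cdot> A"
  and smul_minus_left: "(- c) \<cdot> A = - (c \<cdot> A)"
  and smul_sum_right: "c \<cdot> (\<Sum>x\<in>S. f x) = (\<Sum>x\<in>S. c \<cdot> f x)"
  and smul_sum_left: "(\<Sum>x\<in>S. h x) \<cdot> A = (\<Sum>x\<in>S. h x \<cdot> A)"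
  by (auto intro!: fmat_eqI simp: ent_smul ent_zero ent_add ent_minus ent_uminus ent_sum
      algebra_simps sum_distrib_left sum_distrib_right)

lemma smul_mult_left [simp]: "(c \<cdot> A) * B = c \<cdot> (A * B)"
proof (rule fmat_eqI)
  fix i j
  have "ent ((c \<cdot> A) * B) i j = (\<Sum>k<fbd A. ent (c \<cdot> A) i k * ent B k j)"
    by (rule ent_mult) (auto simp: ent_smul dest: fbd(2))
  then show "ent ((c \<cdot> A) * B) i j = ent (c \<cdot> (A * B)) i j"
    by (simp add: ent_smul ent_mult_fbd sum_distrib_left mult.assoc)
qed

lemma smul_mult_right [simp]: "A * (c \<cdot> B) = c \<cdot> (A * B)"
  by (rule fmat_eqI) (simp add: ent_smul ent_mult_fbd sum_distrib_left mult.left_commute)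

lemma smul_eq_0_iff [simp]: "c \<cdot> A = 0 \<longleftrightarrow> c = 0 \<or> A = 0"
  by (metis smul_one smul_smul smul_zero left_inverse)

lemma smul_cancel: "c \<noteq> 0 \<Longrightarrow> c \<cdot> A = c \<cdot> B \<longleftrightarrow> A = B"
  by (metis smul_one smul_smul left_inverse)

subsection \<open>Trace, transpose, matrix units\<close>

definition tr :: "'k :: field fmat \<Rightarrow> 'k" where
  "tr A = (\<Sum>i<fbd A. ent A i i)"

lemma tr_eq:
  assumes "finite S" "\<And>i. ent A i i \<noteq> 0 \<Longrightarrow> i \<in> S"
  shows "tr A = (\<Sum>i\<in>S. ent A i i)"
proof -
  have "(\<Sum>i<fbd A. ent A i i) = (\<Sum>i\<in>{..<fbd A} \<inter> S. ent A i i)"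
    using assms(2) by (intro sum.mono_neutral_right) auto
  also have "\<dots> = (\<Sum>i\<in>S. ent A i i)"
    using assms(1) fbd(2)[of A] by (intro sum.mono_neutral_left) auto
  finally show ?thesis by (simp add: tr_def)
qed

lemma tr_zero [simp]: "tr 0 = 0"
  by (simp add: tr_def ent_zero)

lemma tr_add [simp]: "tr (A + B) = tr A + tr B"
proof -
  let ?S = "{..<max (fbd A) (fbd B)}"
  have A: "i < max (fbd A) (fbd B)" if "ent A i i \<noteq> 0" for i
    using fbd(1)[OF that] by simp
  have B: "i < max (fbd A) (fbd B)" if "ent B i i \<noteq> 0" for i
    using fbd(1)[OF that] by simp
  have AB: "i < max (fbd A) (fbd B)" if "ent (A + B) i i \<noteq> 0" for i
    using that A[of i] B[of i] by (cases "ent A i i = 0") (auto simp: ent_add)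
  have "tr A = (\<Sum>i\<in>?S. ent A i i)" "tr B = (\<Sum>i\<in>?S. ent B i i)"
    "tr (A + B) = (\<Sum>i\<in>?S. ent (A + B) i i)"
    by (rule tr_eq; use A B AB in simp)+
  then show ?thesis by (simp add: ent_add sum.distrib)
qed

lemma tr_smul [simp]: "tr (c \<cdot> A) = c * tr A"
proof -
  have "tr (c \<cdot> A) = (\<Sum>i<fbd A. ent (c \<cdot> A) i i)"
    by (rule tr_eq) (auto simp: ent_smul dest: fbd(1))
  then show ?thesis by (simp add: tr_def ent_smul sum_distrib_left)
qed

lemma tr_diff [simp]: "tr (A - B) = tr A - tr B"
  using tr_add[of "A - B" B] by simp

lemma tr_sum: "tr (\<Sum>x\<in>S. f x) = (\<Sum>x\<in>S. tr (f x))"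
  by (induction S rule: infinite_finite_induct) auto

lemma tr_mult_commute: "tr (A * B) = tr (B * A)"
proof -
  let ?S = "{..<fbd A}" and ?T = "{..<fbd B}"
  have "tr (A * B) = (\<Sum>i\<in>?S. ent (A * B) i i)"
    by (rule tr_eq) (auto dest: fbd_mult)
  also have "\<dots> = (\<Sum>i\<in>?S. \<Sum>k\<in>?T. ent A i k * ent B k i)"
    by (rule sum.cong[OF refl], rule ent_mult) (auto dest: fbd(1))
  also have "\<dots> = (\<Sum>k\<in>?T. \<Sum>i\<in>?S. ent B k i * ent A i k)"
    by (subst sum.swap) (simp add: mult.commute)
  also have "\<dots> = (\<Sum>k\<in>?T. ent (B * A) k k)"
    by (rule sum.cong[OF refl], rule ent_mult[symmetric]) (auto dest: fbd(1))
  also have "\<dots> = tr (B * A)"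
    by (rule tr_eq[symmetric]) (auto dest: fbd_mult)
  finally show ?thesis .
qed

definition transp :: "'k :: field fmat \<Rightarrow> 'k fmat" where
  "transp A = Abs_fmat (\<lambda>i j. ent A j i)"

lemma ent_transp: "ent (transp A) i j = ent A j i"
  unfolding transp_def using fbd[of A] by (subst ent_Abs_bound[of _ "fbd A"]) auto

lemma transp_mult: "transp (A * B) = transp B * transp A"
proof (rule fmat_eqI)
  fix i j
  have "ent (transp (A * B)) i j = (\<Sum>k<fbd A. ent B k i * ent A j k)"
    by (simp add: ent_transp ent_mult_fbd mult.commute)
  also have "\<dots> = ent (transp B * transp A) i j"
    by (subst ent_mult[of "{..<fbd A}"]) (auto simp: ent_transp dest: fbd(2))
  finally show "ent (transp (A * B)) i j = ent (transp B * transp A) i j" .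
qed

lemma tr_transp [simp]: "tr (transp A) = tr A"
  by (subst tr_eq[of "{..<fbd A}"]) (auto simp: ent_transp tr_def dest: fbd(1))

definition munit :: "nat \<Rightarrow> nat \<Rightarrow> 'k :: field fmat" where
  "munit a b = Abs_fmat (\<lambda>i j. if i = a \<and> j = b then 1 else 0)"

lemma ent_munit: "ent (munit a b) i j = (if i = a \<and> j = b then 1 else 0)"
  unfolding munit_def by (subst ent_Abs_bound[of _ "Suc (a + b)"]) (auto split: if_splits)

definition idm :: "nat \<Rightarrow> 'k :: field fmat" where
  "idm d = Abs_fmat (\<lambda>i j. if i = j \<and> i < d then 1 else 0)"

lemma ent_idm: "ent (idm d) i j = (if i = j \<and> i < d then 1 else 0)"
  unfolding idm_def by (subst ent_Abs_bound[of _ d]) (auto split: if_splits)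

lemma idm_0 [simp]: "idm 0 = 0"
  by (rule fmat_eqI) (simp add: ent_idm ent_zero)

lemma idm_Suc: "idm (Suc d) = idm d + munit d d"
  by (rule fmat_eqI) (auto simp: ent_idm ent_add ent_munit)

lemma idm_eq_sum: "idm d = (\<Sum>i<d. munit i i)"
  by (induction d) (auto simp: idm_Suc)

lemma munit_mult: "munit a b * munit c d = (if b = c then munit a d else 0)"
proof (rule fmat_eqI)
  fix i j
  have "ent (munit a b * munit c d) i j = (\<Sum>k\<in>{b}. ent (munit a b) i k * ent (munit c d) k j)"
    by (rule ent_mult) (auto simp: ent_munit split: if_splits)
  then show "ent (munit a b * munit c d) i j = ent (if b = c then munit a d else 0) i j"
    by (auto simp: ent_munit ent_zero)
qed

lemma munit_idem [simp]: "munit a a * munit a a = munit a a"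
  by (simp add: munit_mult)

lemma idm_mult: "ent (idm d * A) i j = (if i < d then ent A i j else 0)"
  by (subst ent_mult[of "{i}"]) (auto simp: ent_idm split: if_splits)

lemma mult_idm: "ent (A * idm d) i j = (if j < d then ent A i j else 0)"
  by (subst ent_mult[of "{j}"]) (auto simp: ent_idm split: if_splits)

lemma munit_mult_ent: "munit a b * A * munit c d = ent A b c \<cdot> munit a d"
proof (rule fmat_eqI)
  fix i j
  have 1: "ent (munit a b * A) i k = (if i = a then ent A b k else 0)" for k
    by (subst ent_mult[of "{b}"]) (auto simp: ent_munit split: if_splits)
  have "ent (munit a b * A * munit c d) i j
      = (\<Sum>k\<in>{c}. ent (munit a b * A) i k * ent (munit c d) k j)"
    by (rule ent_mult) (auto simp: ent_munit split: if_splits)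
  then show "ent (munit a b * A * munit c d) i j = ent (ent A b c \<cdot> munit a d) i j"
    by (auto simp: 1 ent_munit ent_smul)
qed

lemma tr_munit: "tr (munit a b) = (if a = b then 1 else 0)"
  by (subst tr_eq[of "{a}"]) (auto simp: ent_munit split: if_splits)

lemma tr_idm [simp]: "tr (idm d) = of_nat d"
  by (simp add: idm_eq_sum tr_sum tr_munit)

lemma idm_idem [simp]: "idm d * idm d = idm d"
  by (rule fmat_eqI) (simp add: idm_mult ent_idm)

lemma idm_munit: "idm d * munit a b = (if a < d then munit a b else 0)"
  "munit a b * idm d = (if b < d then munit a b else 0)"
  by (rule fmat_eqI; simp add: idm_mult mult_idm ent_munit ent_zero)+

subsection \<open>Kronecker product\<close>

text \<open>Pairs of indices are coded as numbers, which keeps the product in the same type. The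
  price is that associativity holds only up to the relabelling \<open>assoc_perm\<close>.\<close>

definition kron :: "'k :: field fmat \<Rightarrow> 'k fmat \<Rightarrow> 'k fmat" (infixr "\<boxtimes>" 73) where
  "A \<boxtimes> B = Abs_fmat (\<lambda>r s. ent A (fst (prod_decode r)) (fst (prod_decode s))
     * ent B (snd (prod_decode r)) (snd (prod_decode s)))"

lemma ent_kron: "ent (A \<boxtimes> B) r s = ent A (fst (prod_decode r)) (fst (prod_decode s))
     * ent B (snd (prod_decode r)) (snd (prod_decode s))"
proof -
  have "r \<in> prod_encode ` ({..<fbd A} \<times> {..<fbd B})"
    if "fst (prod_decode r) < fbd A" "snd (prod_decode r) < fbd B" for r
    using that by (intro image_eqI[of _ _ "prod_decode r"]) (auto simp: mem_Times_iff)
  then show ?thesis unfolding kron_def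
    by (subst ent_Abs_finite[of "prod_encode ` ({..<fbd A} \<times> {..<fbd B})"]) (auto dest: fbd)
qed

lemma kron_mult [simp]: "(A \<boxtimes> B) * (C \<boxtimes> D) = (A * C) \<boxtimes> (B * D)"
proof (rule fmat_eqI)
  fix r s
  let ?S = "{..<fbd A} \<times> {..<fbd B}"
  obtain a b where r: "prod_decode r = (a, b)" by fastforce
  obtain c d where s: "prod_decode s = (c, d)" by fastforce
  have in_S: "k \<in> prod_encode ` ?S"
    if "fst (prod_decode k) < fbd A" "snd (prod_decode k) < fbd B" for k
    using that by (intro image_eqI[of _ _ "prod_decode k"]) (auto simp: mem_Times_iff)
  have "ent ((A \<boxtimes> B) * (C \<boxtimes> D)) r s
      = (\<Sum>k\<in>prod_encode ` ?S. ent (A \<boxtimes> B) r k * ent (C \<boxtimes> D) k s)"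
    by (rule ent_mult) (auto simp: ent_kron intro!: in_S dest: fbd)
  also have "\<dots> = (\<Sum>k\<in>?S. ent (A \<boxtimes> B) r (prod_encode k) * ent (C \<boxtimes> D) (prod_encode k) s)"
    by (subst sum.reindex) (auto intro: inj_on_subset[OF inj_prod_encode])
  also have "\<dots> = (\<Sum>(k, l)\<in>?S. (ent A a k * ent C k c) * (ent B b l * ent D l d))"
    by (rule sum.cong) (auto simp: ent_kron r s)
  also have "\<dots> = ent ((A * C) \<boxtimes> (B * D)) r s"
    by (simp add: ent_kron r s ent_mult_fbd sum_product sum.cartesian_product)
  finally show "ent ((A \<boxtimes> B) * (C \<boxtimes> D)) r s = ent ((A * C) \<boxtimes> (B * D)) r s" .
qed

lemma tr_kron [simp]: "tr (A \<boxtimes> B) = tr A * tr B"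
proof -
  let ?S = "{..<fbd A} \<times> {..<fbd B}"
  have in_S: "k \<in> prod_encode ` ?S"
    if "fst (prod_decode k) < fbd A" "snd (prod_decode k) < fbd B" for k
    using that by (intro image_eqI[of _ _ "prod_decode k"]) (auto simp: mem_Times_iff)
  have "tr (A \<boxtimes> B) = (\<Sum>k\<in>prod_encode ` ?S. ent (A \<boxtimes> B) k k)"
    by (rule tr_eq) (auto simp: ent_kron intro!: in_S dest: fbd)
  also have "\<dots> = (\<Sum>k\<in>?S. ent (A \<boxtimes> B) (prod_encode k) (prod_encode k))"
    by (subst sum.reindex) (auto intro: inj_on_subset[OF inj_prod_encode])
  also have "\<dots> = (\<Sum>(k, l)\<in>?S. ent A k k * ent B l l)"
    by (rule sum.cong) (auto simp: ent_kron)
  finally show ?thesis by (simp add: tr_def sum_product sum.cartesian_product)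
qed

lemma kron_add_left: "(A + B) \<boxtimes> C = A \<boxtimes> C + B \<boxtimes> C"
  and kron_add_right: "A \<boxtimes> (B + C) = A \<boxtimes> B + A \<boxtimes> C"
  and kron_diff_left: "(A - B) \<boxtimes> C = A \<boxtimes> C - B \<boxtimes> C"
  and kron_diff_right: "A \<boxtimes> (B - C) = A \<boxtimes> B - A \<boxtimes> C"
  and kron_smul_left [simp]: "(c \<cdot> A) \<boxtimes> B = c \<cdot> (A \<boxtimes> B)"
  and kron_smul_right [simp]: "A \<boxtimes> (c \<cdot> B) = c \<cdot> (A \<boxtimes> B)"
  and kron_zero_left [simp]: "0 \<boxtimes> A = 0"
  and kron_zero_right [simp]: "A \<boxtimes> 0 = 0"
  by (auto intro!: fmat_eqI simp: ent_kron ent_add ent_minus ent_smul ent_zero algebra_simps)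

lemma kron_sum_left: "(\<Sum>x\<in>S. f x) \<boxtimes> B = (\<Sum>x\<in>S. f x \<boxtimes> B)"
  by (induction S rule: infinite_finite_induct) (auto simp: kron_add_left)

lemma kron_sum_right: "B \<boxtimes> (\<Sum>x\<in>S. f x) = (\<Sum>x\<in>S. B \<boxtimes> f x)"
  by (induction S rule: infinite_finite_induct) (auto simp: kron_add_right)

subsection \<open>Relabelling the index set\<close>

text \<open>Moving only the rows, or only the columns, of an identity along an injection gives the
  two inverse isomorphisms between a module and its relabelled copy
  (\<open>relm_iso\<close>).\<close>

definition relrow :: "(nat \<Rightarrow> nat) \<Rightarrow> 'k :: field fmat \<Rightarrow> 'k fmat" where
  "relrow p A = Abs_fmat (\<lambda>r s. if r \<in> range p then ent A (inv_into UNIV p r) s else 0)"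

definition relcol :: "(nat \<Rightarrow> nat) \<Rightarrow> 'k :: field fmat \<Rightarrow> 'k fmat" where
  "relcol p A = Abs_fmat (\<lambda>r s. if s \<in> range p then ent A r (inv_into UNIV p s) else 0)"

lemma inv_image_bound:
  fixes p :: "nat \<Rightarrow> nat"
  shows "r \<in> range p \<Longrightarrow> inv_into UNIV p r < N \<Longrightarrow> r \<in> p ` {..<N}"
  by (rule image_eqI[of _ _ "inv_into UNIV p r"]) (auto simp: f_inv_into_f)

lemma ent_relrow: "ent (relrow p A) r s = (if r \<in> range p then ent A (inv_into UNIV p r) s else 0)"
  unfolding relrow_def
proof (subst ent_Abs_finite[of "p ` {..<fbd A} \<union> {..<fbd A}"])
  fix i j assume "(if i \<in> range p then ent A (inv_into UNIV p i) j else 0) \<noteq> 0"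
  then show "i \<in> p ` {..<fbd A} \<union> {..<fbd A} \<and> j \<in> p ` {..<fbd A} \<union> {..<fbd A}"
    using fbd[of A "inv_into UNIV p i" j] inv_image_bound[of i p "fbd A"]
    by (auto split: if_splits)
qed auto

lemma ent_relcol: "ent (relcol p A) r s = (if s \<in> range p then ent A r (inv_into UNIV p s) else 0)"
  unfolding relcol_def
proof (subst ent_Abs_finite[of "p ` {..<fbd A} \<union> {..<fbd A}"])
  fix i j assume "(if j \<in> range p then ent A i (inv_into UNIV p j) else 0) \<noteq> 0"
  then show "i \<in> p ` {..<fbd A} \<union> {..<fbd A} \<and> j \<in> p ` {..<fbd A} \<union> {..<fbd A}"
    using fbd[of A i "inv_into UNIV p j"] inv_image_bound[of j p "fbd A"]
    by (auto split: if_splits)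
qed auto

definition relabel :: "(nat \<Rightarrow> nat) \<Rightarrow> 'k :: field fmat \<Rightarrow> 'k fmat" where
  "relabel p A = relrow p (relcol p A)"

lemma ent_relabel: "ent (relabel p A) r s = (if r \<in> range p \<and> s \<in> range p
    then ent A (inv_into UNIV p r) (inv_into UNIV p s) else 0)"
  by (simp add: relabel_def ent_relrow ent_relcol)

lemma relrow_mult: "relrow p A * B = relrow p (A * B)"
proof (rule fmat_eqI)
  fix i j
  have "ent (relrow p A * B) i j = (\<Sum>k<fbd A. ent (relrow p A) i k * ent B k j)"
    by (rule ent_mult) (auto simp: ent_relrow split: if_splits dest: fbd(2))
  then show "ent (relrow p A * B) i j = ent (relrow p (A * B)) i j"
    by (simp add: ent_relrow ent_mult_fbd)
qed

lemma mult_relcol: "A * relcol p B = relcol p (A * B)"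
  by (rule fmat_eqI) (simp add: ent_relcol ent_mult_fbd)

lemma relcol_relrow:
  assumes "inj p"
  shows "relcol p A * relrow p B = A * B"
proof (rule fmat_eqI)
  fix i j
  have "k \<in> p ` {..<fbd A}" if "ent (relcol p A) i k \<noteq> 0" for k
    using that fbd(2)[of A i "inv_into UNIV p k"] inv_image_bound[of k p "fbd A"]
    by (auto simp: ent_relcol split: if_splits)
  then have "ent (relcol p A * relrow p B) i j
      = (\<Sum>k\<in>p ` {..<fbd A}. ent (relcol p A) i k * ent (relrow p B) k j)"
    by (intro ent_mult) auto
  also have "\<dots> = (\<Sum>k<fbd A. ent (relcol p A) i (p k) * ent (relrow p B) (p k) j)"
    using assms by (subst sum.reindex) (auto intro: inj_on_subset)
  also have "\<dots> = ent (A * B) i j"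
    by (simp add: ent_relcol ent_relrow inv_f_f[OF assms] ent_mult_fbd)
  finally show "ent (relcol p A * relrow p B) i j = ent (A * B) i j" .
qed

lemma relabel_mult: "inj p \<Longrightarrow> relabel p (A * B) = relabel p A * relabel p B"
  by (simp add: relabel_def relrow_mult mult_relcol relcol_relrow flip: mult_relcol)

lemma relabel_add: "relabel p (A + B) = relabel p A + relabel p B"
  and relabel_diff: "relabel p (A - B) = relabel p A - relabel p B"
  and relabel_smul: "relabel p (c \<cdot> A) = c \<cdot> relabel p A"
  by (auto intro!: fmat_eqI simp: ent_relabel ent_add ent_minus ent_smul)

lemma relabel_unique:
  assumes "inj p" "\<And>r s. ent B (p r) (p s) = ent A r s"
    and "\<And>r s. ent B r s \<noteq> 0 \<Longrightarrow> r \<in> range p \<and> s \<in> range p"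
  shows "B = relabel p A"
proof (rule fmat_eqI)
  fix r s
  show "ent B r s = ent (relabel p A) r s"
  proof (cases "r \<in> range p \<and> s \<in> range p")
    case True
    then show ?thesis using assms(1,2) by (auto simp: ent_relabel inv_f_f)
  next
    case False
    then show ?thesis using assms(3)[of r s] by (auto simp: ent_relabel)
  qed
qed

definition assoc_perm :: "nat \<Rightarrow> nat" where
  "assoc_perm r = (let x = fst (prod_decode r) in
     prod_encode (fst (prod_decode x), prod_encode (snd (prod_decode x), snd (prod_decode r))))"

lemma inj_assoc_perm: "inj assoc_perm"
proof (rule injI)
  fix r s assume "assoc_perm r = assoc_perm s"
  then have "fst (prod_decode (fst (prod_decode r))) = fst (prod_decode (fst (prod_decode s)))"
    "snd (prod_decode (fst (prod_decode r))) = snd (prod_decode (fst (prod_decode s)))"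
    "snd (prod_decode r) = snd (prod_decode s)"
    by (simp_all add: assoc_perm_def Let_def prod_encode_eq)
  then show "r = s" by (metis prod_decode_eq prod_eq_iff)
qed

lemma assoc_perm_encode: "assoc_perm (prod_encode (prod_encode (a, b), c)) = prod_encode (a, prod_encode (b, c))"
  by (simp add: assoc_perm_def)

lemma range_assoc_perm: "r \<in> range assoc_perm"
proof -
  have "r = prod_encode (fst (prod_decode r),
      prod_encode (fst (prod_decode (snd (prod_decode r))), snd (prod_decode (snd (prod_decode r)))))"
    by simp
  then show ?thesis by (metis assoc_perm_encode rangeI)
qed

lemma kron_assoc: "A \<boxtimes> (B \<boxtimes> C) = relabel assoc_perm ((A \<boxtimes> B) \<boxtimes> C)"
proof (rule relabel_unique[OF inj_assoc_perm])
  show "ent (A \<boxtimes> (B \<boxtimes> C)) (assoc_perm r) (assoc_perm s) = ent ((A \<boxtimes> B) \<boxtimes> C) r s" for r s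
    by (simp add: ent_kron assoc_perm_def Let_def)
qed (simp add: range_assoc_perm)

lemma inj_pair_left: "inj (\<lambda>s. prod_encode (a, s))"
  and inj_pair_right: "inj (\<lambda>s. prod_encode (s, a))"
  by (auto intro: injI)

lemma relabel_kron_left: "munit a a \<boxtimes> A = relabel (\<lambda>s. prod_encode (a, s)) A"
proof (rule relabel_unique[OF inj_pair_left])
  have "r \<in> range (\<lambda>s. prod_encode (a, s))" if "fst (prod_decode r) = a" for r
    using that by (intro range_eqI[of _ _ "snd (prod_decode r)"]) auto
  then show "r \<in> range (\<lambda>s. prod_encode (a, s)) \<and> s \<in> range (\<lambda>s. prod_encode (a, s))"
    if "ent (munit a a \<boxtimes> A) r s \<noteq> 0" for r s
    using that by (auto simp: ent_kron ent_munit split: if_splits)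
qed (simp add: ent_kron ent_munit)

lemma relabel_kron_right: "A \<boxtimes> munit a a = relabel (\<lambda>s. prod_encode (s, a)) A"
proof (rule relabel_unique[OF inj_pair_right])
  have "r \<in> range (\<lambda>s. prod_encode (s, a))" if "snd (prod_decode r) = a" for r
    using that by (intro range_eqI[of _ _ "fst (prod_decode r)"]) auto
  then show "r \<in> range (\<lambda>s. prod_encode (s, a)) \<and> s \<in> range (\<lambda>s. prod_encode (s, a))"
    if "ent (A \<boxtimes> munit a a) r s \<noteq> 0" for r s
    using that by (auto simp: ent_kron ent_munit split: if_splits)
qed (simp add: ent_kron ent_munit)

section \<open>Idempotents and von Neumann regularity\<close>

lemma ent_mult_munit: "ent (A * munit j i) r k = (if k = i then ent A r j else 0)"
  by (subst ent_mult[of "{j}"]) (auto simp: ent_munit split: if_splits)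

lemma ent_sandwich_munit: "ent (A * munit j i * B) r s = ent A r j * ent B i s"
  by (subst ent_mult[of "{i}"]) (auto simp: ent_mult_munit split: if_splits)

lemma fmat_eq_sum: "A = (\<Sum>i<fbd A. \<Sum>j<fbd A. ent A i j \<cdot> munit i j)"
proof (rule fmat_eqI)
  fix r s
  have "ent (\<Sum>i<fbd A. \<Sum>j<fbd A. ent A i j \<cdot> munit i j) r s
      = (\<Sum>i<fbd A. \<Sum>j<fbd A. if r = i then (if s = j then ent A r s else 0) else 0)"
    by (simp add: ent_sum ent_smul ent_munit) (intro sum.cong refl, auto)
  also have "\<dots> = (if r < fbd A then if s < fbd A then ent A r s else 0 else 0)"
    by (subst sum.swap) (simp add: sum.delta)
  finally show "ent A r s = ent (\<Sum>i<fbd A. \<Sum>j<fbd A. ent A i j \<cdot> munit i j) r s"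
    using fbd[of A r s] by auto
qed

lemma finite_rows: "finite {i. \<exists>j. ent A i j \<noteq> 0}"
  by (rule finite_subset[of _ "{..<fbd A}"]) (auto dest: fbd(1))

text \<open>One step of elimination with pivot \<open>ent A i j\<close>: a multiple of row
  \<open>i\<close> is subtracted from each row \<open>r\<close>, the factor being proportional to
  \<open>ent A r j\<close>. Row \<open>i\<close> is cleared and zero rows stay zero.\<close>

lemma card_rows_decrease:
  assumes "ent A i j \<noteq> 0"
  shows "card {r. \<exists>s. ent (A - A * (inverse (ent A i j) \<cdot> munit j i) * A) r s \<noteq> 0}
    < card {r. \<exists>s. ent A r s \<noteq> 0}"
proof -
  have *: "ent (A - A * (inverse (ent A i j) \<cdot> munit j i) * A) r s
      = ent A r s - inverse (ent A i j) * (ent A r j * ent A i s)" for r s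
    by (simp add: ent_minus ent_smul ent_sandwich_munit)
  have "{r. \<exists>s. ent (A - A * (inverse (ent A i j) \<cdot> munit j i) * A) r s \<noteq> 0}
      \<subset> {r. \<exists>s. ent A r s \<noteq> 0}"
  proof (rule psubsetI)
    show "{r. \<exists>s. ent (A - A * (inverse (ent A i j) \<cdot> munit j i) * A) r s \<noteq> 0}
        \<subseteq> {r. \<exists>s. ent A r s \<noteq> 0}"
      unfolding * by (intro subsetI CollectI, elim CollectE, rule ccontr) simp
    have "i \<notin> {r. \<exists>s. ent (A - A * (inverse (ent A i j) \<cdot> munit j i) * A) r s \<noteq> 0}"
      unfolding * using assms by simp
    moreover have "i \<in> {r. \<exists>s. ent A r s \<noteq> 0}" using assms by auto
    ultimately show "{r. \<exists>s. ent (A - A * (inverse (ent A i j) \<cdot> munit j i) * A) r s \<noteq> 0}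
        \<noteq> {r. \<exists>s. ent A r s \<noteq> 0}"
      by (metis (no_types))
  qed
  then show ?thesis by (rule psubset_card_mono[OF finite_rows])
qed

text \<open>The idempotents \<open>A * Z\<close> and \<open>Z * A\<close> stand in for the image and
  for a complement of the kernel of \<open>A\<close>. The proof is elimination, by induction on the
  number of nonzero rows.\<close>

lemma regular: "\<exists>Z. A * Z * A = (A :: 'k :: field fmat)"
proof (induction "card {r. \<exists>s. ent A r s \<noteq> 0}" arbitrary: A rule: less_induct)
  case less
  show ?case
  proof (cases "A = 0")
    case False
    then obtain i j where ij: "ent A i j \<noteq> 0" by (metis fmat_eqI ent_zero)
    define B where "B = inverse (ent A i j) \<cdot> munit j i"
    obtain Z where Z: "(A - A * B * A) * Z * (A - A * B * A) = A - A * B * A"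
      using less[OF card_rows_decrease[OF ij]] unfolding B_def by blast
    \<comment> \<open>This is \<open>B + (1 - B A) Z (1 - A B)\<close>, multiplied out because the
      ring has no unit.\<close>
    have "A * (B + Z - Z * A * B - B * A * Z + B * A * Z * A * B) * A
        = A * B * A + (A - A * B * A) * Z * (A - A * B * A)"
      by (simp add: algebra_simps)
    then have "A * (B + Z - Z * A * B - B * A * Z + B * A * Z * A * B) * A = A"
      unfolding Z by simp
    then show ?thesis by blast
  qed simp
qed

text \<open>The choice of a basis of the image of \<open>e\<close>; \<open>d\<close> is its
  dimension. Each step of the induction splits an idempotent of rank one off
  \<open>e\<close>.\<close>

lemma idempotent_split:
  fixes e :: "'k :: field fmat"
  assumes "e * e = e"
  obtains d P Q where "P * Q = idm d" "Q * P = e" "P * e = P" "idm d * P = P" "e * Q = Q"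
    "Q * idm d = Q"
proof -
  have "\<exists>d P Q. P * Q = idm d \<and> Q * P = e"
    using assms
  proof (induction "card {r. \<exists>s. ent e r s \<noteq> 0}" arbitrary: e rule: less_induct)
    case less
    note e = \<open>e * e = e\<close>
    show ?case
    proof (cases "e = 0")
      case True
      then show ?thesis by (intro exI[of _ 0]) simp
    next
      case False
      then obtain i j where ij: "ent e i j \<noteq> 0" by (metis fmat_eqI ent_zero)
      define c where "c = ent e i j"
      have c: "c \<noteq> 0" using ij c_def by simp
      \<comment> \<open>The idempotent of rank one with pivot \<open>c\<close>: it squares to itself
        because \<open>munit j i * e * munit j i = c \<cdot> munit j i\<close>.\<close>
      define f where "f = e * (inverse c \<cdot> munit j i) * e"
      have sand: "munit j i * e * munit j i = c \<cdot> munit j i"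
        by (simp add: munit_mult_ent c_def)
      have ef: "e * f = f" "f * e = f" unfolding f_def by (metis e mult.assoc)+
      have "f * f = (inverse c * inverse c) \<cdot> (e * (munit j i * e * munit j i) * e)"
        unfolding f_def by (simp add: mult.assoc) (metis e mult.assoc)
      also have "\<dots> = f" using c by (simp add: sand) (simp add: f_def mult.assoc)
      finally have ff: "f * f = f" .
      have idem: "(e - f) * (e - f) = e - f" by (simp add: algebra_simps e ef ff)
      obtain d P Q where PQ: "P * Q = idm d" "Q * P = e - f"
        using less(1)[OF _ idem] card_rows_decrease[OF ij] unfolding f_def c_def by blast
      \<comment> \<open>Cutting down to the first \<open>d\<close> coordinates leaves the index
        \<open>d\<close> free for the new basis vector.\<close>
      define P' Q' where "P' = idm d * P" and "Q' = Q * idm d"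
      have P': "P' * Q' = idm d" "Q' * P' = e - f" "P' * f = 0" "f * Q' = 0"
      proof -
        show "P' * Q' = idm d" unfolding P'_def Q'_def using PQ(1) idm_idem by (metis mult.assoc)
        show *: "Q' * P' = e - f" unfolding P'_def Q'_def using PQ idem by (metis mult.assoc)
        have "P' * f = P' * (e - f) * f"
          unfolding P'_def using PQ by (metis mult.assoc idm_idem)
        then show "P' * f = 0" by (simp add: mult.assoc left_diff_distrib ef ff)
        have "f * Q' = f * ((e - f) * Q')"
          unfolding Q'_def using PQ by (metis mult.assoc idm_idem)
        then show "f * Q' = 0" by (simp add: right_diff_distrib ef ff flip: mult.assoc)
      qed
      \<comment> \<open>\<open>u\<close> and \<open>v\<close> factor \<open>f\<close> through the
        single coordinate \<open>d\<close>.\<close>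
      define u where "u = munit d i * e"
      define v where "v = e * (inverse c \<cdot> munit j d)"
      have uv: "u * v = munit d d"
      proof -
        have "u * v = inverse c \<cdot> (munit d i * e * munit j d)"
          unfolding u_def v_def using e by simp (metis e mult.assoc)
        then show ?thesis using c by (simp add: munit_mult_ent flip: c_def)
      qed
      have vu: "v * u = f"
        unfolding u_def v_def f_def by (simp add: mult.assoc) (metis munit_mult mult.assoc)
      have uf: "u * f = u" 
      proof -
        have "u * f = inverse c \<cdot> (munit d i * e * munit j i * e)"
          unfolding u_def f_def by simp (metis e mult.assoc)
        then show ?thesis using c by (simp add: munit_mult_ent u_def flip: c_def)
      qed
      have "f * v = v * (u * v)" by (simp add: vu[symmetric] mult.assoc)
      then have fv: "f * v = v" unfolding uv by (simp add: v_def munit_mult mult.assoc)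
      have id_u: "idm d * u = 0" "v * idm d = 0"
        unfolding u_def v_def by (simp_all add: idm_munit mult.assoc flip: mult.assoc)
          (simp add: idm_munit mult.assoc)
      have "P' * v = 0" "u * Q' = 0" using P' uf fv by (metis mult.assoc mult_zero_left mult_zero_right)+
      then have "(P' + u) * (Q' + v) = idm (Suc d)"
        using P' uv by (simp add: algebra_simps idm_Suc)
      moreover have "(Q' + v) * (P' + u) = e"
      proof -
        have "Q' * u = 0" "v * P' = 0"
          unfolding Q'_def P'_def using id_u by (metis mult.assoc mult_zero_right mult_zero_left)+
        then show ?thesis using P' vu by (simp add: algebra_simps)
      qed
      ultimately show ?thesis by blast
    qed
  qed
  then obtain d P Q where PQ: "P * Q = idm d" "Q * P = e" by blast
  show thesis
  proof (rule that[of "idm d * P" "Q * idm d" d])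
    show "idm d * P * (Q * idm d) = idm d" using PQ by (metis mult.assoc idm_idem)
    show "Q * idm d * (idm d * P) = e" using PQ assms by (metis mult.assoc)
    show "idm d * P * e = idm d * P" using PQ by (metis mult.assoc idm_idem)
    show "idm d * (idm d * P) = idm d * P" by (simp flip: mult.assoc)
    show "e * (Q * idm d) = Q * idm d" using PQ by (metis mult.assoc idm_idem)
    show "Q * idm d * idm d = Q * idm d" by (simp add: mult.assoc)
  qed
qed

text \<open>In characteristic zero the trace of an idempotent is its rank, so it serves as a measure
  for inductions and as a test for vanishing.\<close>

lemma idempotent_tr:
  fixes e :: "'k :: field_char_0 fmat"
  assumes "e * e = e"
  shows "\<exists>d. tr e = of_nat d" "tr e = 0 \<longleftrightarrow> e = 0"
proof -
  obtain d P Q where PQ: "P * Q = idm d" "Q * P = e" "P * e = P"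
    using idempotent_split[OF assms] by metis
  have d: "tr e = of_nat d" using PQ tr_mult_commute[of P Q] by simp
  then show "\<exists>d. tr e = of_nat d" by blast
  show "tr e = 0 \<longleftrightarrow> e = 0"
  proof
    assume "tr e = 0"
    then have "d = 0" using d by simp
    then have "e = e * (Q * P)" "P * Q = 0" using PQ assms by auto
    then have "e = Q * (P * Q) * P" using PQ by (metis mult.assoc)
    then show "e = 0" using \<open>P * Q = 0\<close> by simp
  qed simp
qed

lemma idempotent_eq_if_tr_eq:
  fixes e f :: "'k :: field_char_0 fmat"
  assumes "e * e = e" "f * f = f" "e * f = f" "f * e = f" "tr f = tr e"
  shows "f = e"
proof -
  have "(e - f) * (e - f) = e - f" using assms by (simp add: algebra_simps)
  then have "e - f = 0" using idempotent_tr(2) assms(5) by (metis tr_diff diff_self)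
  then show ?thesis by simp
qed

section \<open>Representations of finite groups\<close>

locale fin_group = group G for G (structure) +
  assumes finite_G: "finite (carrier G)"
begin

lemma card_G: "of_nat (card (carrier G)) \<noteq> (0 :: 'k :: field_char_0)"
  using finite_G by auto

text \<open>The space is the image of \<open>e\<close>, hence the neutral element acts by
  \<open>e\<close>.\<close>

definition grep :: "'k :: field fmat \<Rightarrow> ('a \<Rightarrow> 'k fmat) \<Rightarrow> bool" where
  "grep e R \<longleftrightarrow> R \<one> = e \<and> (\<forall>h\<in>carrier G. \<forall>k\<in>carrier G. R (h \<otimes> k) = R h * R k)"

definition gmor :: "'k :: field fmat \<Rightarrow> ('a \<Rightarrow> 'k fmat) \<Rightarrow> 'k fmat \<Rightarrow> ('a \<Rightarrow> 'k fmat) \<Rightarrow> 'k fmat \<Rightarrow> bool"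
  where "gmor e R e' R' P \<longleftrightarrow> e' * P = P \<and> P * e = P \<and> (\<forall>h\<in>carrier G. P * R h = R' h * P)"

definition giso :: "'k :: field fmat \<Rightarrow> ('a \<Rightarrow> 'k fmat) \<Rightarrow> 'k fmat \<Rightarrow> ('a \<Rightarrow> 'k fmat) \<Rightarrow> bool"
  where "giso e R e' R' \<longleftrightarrow> (\<exists>P Q. gmor e R e' R' P \<and> gmor e' R' e R Q \<and> Q * P = e \<and> P * Q = e')"

lemma grepD:
  assumes "grep e R"
  shows "R \<one> = e" "\<And>h k. h \<in> carrier G \<Longrightarrow> k \<in> carrier G \<Longrightarrow> R (h \<otimes> k) = R h * R k"
    "e * e = e" "\<And>h. h \<in> carrier G \<Longrightarrow> e * R h = R h" "\<And>h. h \<in> carrier G \<Longrightarrow> R h * e = R h"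
    "\<And>h. h \<in> carrier G \<Longrightarrow> R h * R (inv h) = e" "\<And>h. h \<in> carrier G \<Longrightarrow> R (inv h) * R h = e"
  using assms unfolding grep_def
  by (auto simp: r_inv l_inv) (metis one_closed l_one r_one inv_closed r_inv l_inv)+

lemma grep_cut:
  assumes "grep e R" "p * p = p" "e * p = p" "\<And>h. h \<in> carrier G \<Longrightarrow> p * R h = R h * p"
  shows "grep p (\<lambda>h. p * R h)"
  unfolding grep_def
proof (intro conjI ballI)
  show "p * R \<one> = p" using assms grepD(1)[OF assms(1)] by (metis one_closed)
  show "p * R (h \<otimes> k) = p * R h * (p * R k)" if "h \<in> carrier G" "k \<in> carrier G" for h k
    using that assms grepD(2)[OF assms(1)] by (metis mult.assoc)
qed

text \<open>The averaging argument of Maschke: every \<open>R h * Z * R' (inv h)\<close>, divided by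
  \<open>c h\<close>, is again a quasi-inverse of \<open>A\<close>, hence so is the mean, which
  commutes with the group up to \<open>c\<close>. The factor \<open>c\<close> is there for the
  powers of y, which commute with \<open>h\<close> up to a power of \<open>chi h\<close>.\<close>

lemma twisted_regular:
  fixes c :: "'a \<Rightarrow> 'k :: field_char_0"
  assumes R: "grep e R" and R': "grep e' R'"
    and c0: "\<And>h. h \<in> carrier G \<Longrightarrow> c h \<noteq> 0"
    and cm: "\<And>h k. h \<in> carrier G \<Longrightarrow> k \<in> carrier G \<Longrightarrow> c (h \<otimes> k) = c h * c k"
    and A: "e' * A = A" "A * e = A" "\<And>h. h \<in> carrier G \<Longrightarrow> A * R h = c h \<cdot> (R' h * A)"
  obtains Z where "A * Z * A = A" "e * Z = Z" "Z * e' = Z"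
    "\<And>h. h \<in> carrier G \<Longrightarrow> R h * Z = c h \<cdot> (Z * R' h)"
proof -
  obtain Z where Z: "A * Z * A = A" using regular by blast
  define N where "N = (inverse (of_nat (card (carrier G))) :: 'k)"
  define W where "W = N \<cdot> (\<Sum>h\<in>carrier G. inverse (c h) \<cdot> (R h * Z * R' (inv h)))"
  note Rd = grepD[OF R] and Rd' = grepD[OF R']
  have term_eq: "A * (inverse (c h) \<cdot> (R h * Z * R' (inv h))) * A = A" if h: "h \<in> carrier G" for h
  proof -
    have "A = A * R (inv h) * R h" using A(2) Rd(7)[OF h] by (simp add: mult.assoc)
    have "R' h * (R' (inv h) * A) = A" using A(1) Rd'(6)[OF h] by (simp flip: mult.assoc)
    have "c h \<cdot> (R' h * A) * R (inv h) = A"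
      using A(3)[OF h] Rd(6)[OF h] A(2) by (metis mult.assoc)
    then have "c h \<cdot> (R' (inv h) * (R' h * A * R (inv h))) = R' (inv h) * A"
      by (metis smul_mult_left smul_mult_right)
    then have 1: "R' (inv h) * A = c h \<cdot> (A * R (inv h))"
      using A(1) Rd'(7)[OF h] by (metis mult.assoc)
    have "A * (R h * Z * R' (inv h)) * A = (A * R h) * Z * (R' (inv h) * A)"
      by (simp add: mult.assoc)
    also have "\<dots> = c h \<cdot> c h \<cdot> (R' h * (A * Z * A) * R (inv h))"
      by (simp add: A(3)[OF h] 1 mult.assoc)
    also have "\<dots> = c h \<cdot> ((c h \<cdot> (R' h * A)) * R (inv h))"
      by (simp add: Z)
    also have "\<dots> = c h \<cdot> A" using \<open>c h \<cdot> (R' h * A) * R (inv h) = A\<close> by simp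
    finally show ?thesis using c0[OF h] by simp
  qed
  show thesis
  proof (rule that[of W])
    have "A * W * A = N \<cdot> (\<Sum>h\<in>carrier G. A * (inverse (c h) \<cdot> (R h * Z * R' (inv h))) * A)"
      by (simp add: W_def sum_distrib_left sum_distrib_right)
    also have "\<dots> = N \<cdot> (\<Sum>h\<in>carrier G. 1 \<cdot> A)" using term_eq by simp
    also have "\<dots> = (N * of_nat (card (carrier G))) \<cdot> A" 
      by (subst smul_sum_left[symmetric]) simp
    finally show "A * W * A = A" using card_G by (simp add: N_def)
    show "e * W = W" unfolding W_def
      by (simp add: sum_distrib_left Rd(4) flip: mult.assoc)
    show "W * e' = W" unfolding W_def
      by (simp add: sum_distrib_right mult.assoc Rd'(5))
    show "R k * W = c k \<cdot> (W * R' k)" if k: "k \<in> carrier G" for k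
    proof -
      have "R k * (\<Sum>h\<in>carrier G. inverse (c h) \<cdot> (R h * Z * R' (inv h)))
          = (\<Sum>h\<in>carrier G. inverse (c h) \<cdot> (R (k \<otimes> h) * Z * R' (inv h)))"
        using k by (simp add: sum_distrib_left Rd(2) mult.assoc)
      also have "\<dots> = (\<Sum>h\<in>carrier G. c k \<cdot> (inverse (c h) \<cdot> (R h * Z * R' (inv h)) * R' k))"
      proof (rule sum.reindex_bij_witness[of _ "\<lambda>h. inv k \<otimes> h" "\<lambda>h. k \<otimes> h"])
        fix h assume h: "h \<in> carrier G"
        have "R' (inv (k \<otimes> h)) * R' k = R' (inv h)"
          using h k Rd'(2)[of "inv (k \<otimes> h)" k] by (simp add: inv_mult_group m_assoc)
        then show "c k \<cdot> (inverse (c (k \<otimes> h)) \<cdot> (R (k \<otimes> h) * Z * R' (inv (k \<otimes> h))) * R' k)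
            = inverse (c h) \<cdot> (R (k \<otimes> h) * Z * R' (inv h))"
          using h k c0[OF k] right_inverse[OF c0[OF k]]
          by (simp add: mult.assoc cm flip: mult.assoc[of "c k"])
      qed (use k in \<open>auto simp: inv_solve_left m_assoc[symmetric]\<close>)
      finally have "R k * W = N \<cdot> (\<Sum>h\<in>carrier G. c k \<cdot> (inverse (c h) \<cdot> (R h * Z * R' (inv h)) * R' k))"
        by (simp add: W_def)
      then show ?thesis
        by (simp add: W_def smul_sum_right sum_distrib_right mult.left_commute)
    qed
  qed
qed

text \<open>The inner product of two characters without its normalisation, that is, the order of the
  group times the dimension of the space of intertwiners.\<close>

definition intertw :: "('a \<Rightarrow> 'k :: field fmat) \<Rightarrow> ('a \<Rightarrow> 'k fmat) \<Rightarrow> 'k" where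
  "intertw R R' = (\<Sum>h\<in>carrier G. tr (R' h) * tr (R (inv h)))"

text \<open>\<open>R' h \<boxtimes> transp (R (inv h))\<close> is the action of \<open>h\<close> on
  linear maps from the first space to the second; \<open>P\<close> is the projection onto the
  invariant maps.\<close>

lemma intertw_idempotent:
  fixes R R' :: "'a \<Rightarrow> 'k :: field_char_0 fmat"
  assumes "grep e R" "grep e' R'"
  defines "P \<equiv> inverse (of_nat (card (carrier G))) \<cdot> (\<Sum>h\<in>carrier G. R' h \<boxtimes> transp (R (inv h)))"
  shows "P * P = P" "intertw R R' = of_nat (card (carrier G)) * tr P"
proof -
  note Rd = grepD[OF assms(1)] and Rd' = grepD[OF assms(2)]
  let ?S = "\<Sum>h\<in>carrier G. R' h \<boxtimes> transp (R (inv h))"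
  have "(R' h \<boxtimes> transp (R (inv h))) * ?S = ?S" if h: "h \<in> carrier G" for h
  proof -
    have "(R' h \<boxtimes> transp (R (inv h))) * ?S
        = (\<Sum>k\<in>carrier G. R' (h \<otimes> k) \<boxtimes> transp (R (inv (h \<otimes> k))))"
      using h by (simp add: sum_distrib_left Rd(2) Rd'(2) inv_mult_group flip: transp_mult)
    also have "\<dots> = ?S"
      by (rule sum.reindex_bij_witness[of _ "\<lambda>k. inv h \<otimes> k" "\<lambda>k. h \<otimes> k"])
        (use h in \<open>auto simp: m_assoc[symmetric]\<close>)
    finally show ?thesis .
  qed
  then have "?S * ?S = (\<Sum>h\<in>carrier G. 1 \<cdot> ?S)" by (simp add: sum_distrib_right)
  also have "\<dots> = of_nat (card (carrier G)) \<cdot> ?S" by (subst smul_sum_left[symmetric]) simp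
  finally show "P * P = P" using card_G by (simp add: P_def)
  show "intertw R R' = of_nat (card (carrier G)) * tr P"
    using card_G by (simp add: P_def tr_sum intertw_def)
qed

lemma intertw_nat:
  fixes R R' :: "'a \<Rightarrow> 'k :: field_char_0 fmat"
  assumes "grep e R" "grep e' R'"
  shows "\<exists>d. intertw R R' = of_nat d"
  using intertw_idempotent(2)[OF assms] idempotent_tr(1)[OF intertw_idempotent(1)[OF assms]]
  by (metis of_nat_mult)

text \<open>A vanishing projection onto the invariants says that averaging kills every matrix unit,
  hence every matrix. But averaging \<open>e\<close> gives back a nonzero multiple of
  \<open>e\<close>.\<close>

lemma intertw_self:
  fixes R :: "'a \<Rightarrow> 'k :: field_char_0 fmat"
  assumes "grep e R" "intertw R R = 0"
  shows "e = 0"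
proof -
  note Rd = grepD[OF assms(1)]
  have "(\<Sum>h\<in>carrier G. R h \<boxtimes> transp (R (inv h))) = 0"
    using intertw_idempotent[OF assms(1) assms(1)] assms(2) card_G idempotent_tr(2) by fastforce
  have zero: "(\<Sum>h\<in>carrier G. ent (R h) a c * ent (R (inv h)) d b) = 0" for a b c d
    using arg_cong[of _ _ "\<lambda>M. ent M (prod_encode (a, b)) (prod_encode (c, d))",
        OF \<open>(\<Sum>h\<in>carrier G. R h \<boxtimes> transp (R (inv h))) = 0\<close>]
    by (simp add: ent_sum ent_kron ent_transp ent_zero)
  have "(\<Sum>h\<in>carrier G. R h * munit c d * R (inv h)) = 0" for c d
    by (rule fmat_eqI) (simp add: ent_sum ent_sandwich_munit zero ent_zero)
  then have "(\<Sum>c<fbd e. \<Sum>d<fbd e. ent e c d \<cdot> (\<Sum>h\<in>carrier G. R h * munit c d * R (inv h))) = 0"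
    by simp
  also have "(\<Sum>c<fbd e. \<Sum>d<fbd e. ent e c d \<cdot> (\<Sum>h\<in>carrier G. R h * munit c d * R (inv h)))
      = (\<Sum>h\<in>carrier G. R h * (\<Sum>c<fbd e. \<Sum>d<fbd e. ent e c d \<cdot> munit c d) * R (inv h))"
    by (simp add: sum_distrib_left sum_distrib_right smul_sum_right)
      (subst (2) sum.swap, subst sum.swap, rule refl)
  also have "\<dots> = (\<Sum>h\<in>carrier G. 1 \<cdot> e)"
    using Rd by (simp flip: fmat_eq_sum)
  also have "\<dots> = of_nat (card (carrier G)) \<cdot> e" by (subst smul_sum_left[symmetric]) simp
  finally show ?thesis using card_G by simp
qed

text \<open>An averaged matrix unit is an intertwiner. The number \<open>intertw R R'\<close> is a
  sum of entries of such averages, so they cannot all vanish.\<close>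

lemma intertw_nonzero:
  fixes R R' :: "'a \<Rightarrow> 'k :: field_char_0 fmat"
  assumes R: "grep e R" and R': "grep e' R'" and nz: "intertw R R' \<noteq> 0"
  obtains f where "f \<noteq> 0" "gmor e R e' R' f"
proof -
  note Rd = grepD[OF R] and Rd' = grepD[OF R']
  define F where "F c d = (\<Sum>h\<in>carrier G. R' h * munit c d * R (inv h))" for c d
  have "\<exists>c d. F c d \<noteq> 0"
  proof (rule ccontr)
    assume "\<not> ?thesis"
    then have F: "F c d = 0" for c d by blast
    have tr1: "tr (R (inv h)) = (\<Sum>d<fbd e. ent (R (inv h)) d d)" if "h \<in> carrier G" for h
      using Rd(4)[of "inv h"] that fbd_mult(1)[of e "R (inv h)"] by (intro tr_eq) auto
    have tr2: "tr (R' h) = (\<Sum>c<fbd e'. ent (R' h) c c)" if "h \<in> carrier G" for h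
      using Rd'(4)[of h] that fbd_mult(1)[of e' "R' h"] by (intro tr_eq) auto
    have "intertw R R' = (\<Sum>h\<in>carrier G. \<Sum>c<fbd e'. \<Sum>d<fbd e. ent (R' h) c c * ent (R (inv h)) d d)"
      unfolding intertw_def by (intro sum.cong refl) (simp add: tr1 tr2 sum_product)
    also have "\<dots> = (\<Sum>c<fbd e'. \<Sum>d<fbd e. ent (F c d) c d)"
      by (simp add: F_def ent_sum ent_sandwich_munit)
        (subst sum.swap, intro sum.cong refl, subst sum.swap, rule refl)
    finally show False using nz by (simp add: F ent_zero)
  qed
  then obtain c d where cd: "F c d \<noteq> 0" by blast
  have "gmor e R e' R' (F c d)"
    unfolding gmor_def
  proof (intro conjI ballI)
    show "e' * F c d = F c d" unfolding F_def
      by (simp add: sum_distrib_left Rd'(4) flip: mult.assoc)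
    show "F c d * e = F c d" unfolding F_def
      by (simp add: sum_distrib_right mult.assoc Rd(5))
    fix k assume k: "k \<in> carrier G"
    have "R' k * F c d = (\<Sum>h\<in>carrier G. R' (k \<otimes> h) * munit c d * R (inv h))"
      unfolding F_def using k by (simp add: sum_distrib_left Rd'(2) mult.assoc)
    also have "\<dots> = (\<Sum>h\<in>carrier G. R' h * munit c d * R (inv h) * R k)"
    proof (rule sum.reindex_bij_witness[of _ "\<lambda>h. inv k \<otimes> h" "\<lambda>h. k \<otimes> h"])
      fix h assume h: "h \<in> carrier G"
      have "R (inv (k \<otimes> h)) * R k = R (inv h)"
        using h k Rd(2)[of "inv (k \<otimes> h)" k] by (simp add: inv_mult_group m_assoc)
      then show "R' (k \<otimes> h) * munit c d * R (inv (k \<otimes> h)) * R k = R' (k \<otimes> h) * munit c d * R (inv h)"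
        by (simp add: mult.assoc)
    qed (use k in \<open>auto simp: m_assoc[symmetric]\<close>)
    finally show "F c d * R k = R' k * F c d" by (simp add: F_def sum_distrib_right)
  qed
  with cd show thesis by (rule that)
qed

lemma common_summand:
  fixes R R' :: "'a \<Rightarrow> 'k :: field_char_0 fmat"
  assumes R: "grep e R" and R': "grep e' R'" and nz: "intertw R R' \<noteq> 0"
  obtains f z where "z * f \<noteq> 0" "gmor e R e' R' f" "gmor e' R' e R z" "f * z * f = f" "z * f * z = z"
proof -
  note Rd = grepD[OF R] and Rd' = grepD[OF R']
  obtain f where f: "f \<noteq> 0" "gmor e R e' R' f" using intertw_nonzero[OF assms] .
  have fe: "e' * f = f" "f * e = f" "\<And>h. h \<in> carrier G \<Longrightarrow> f * R h = R' h * f"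
    using f(2) by (auto simp: gmor_def)
  obtain Z where Z: "f * Z * f = f" "e * Z = Z" "Z * e' = Z"
    "\<And>h. h \<in> carrier G \<Longrightarrow> R h * Z = 1 \<cdot> (Z * R' h)"
    by (rule twisted_regular[OF R R', of "\<lambda>_. 1" f]) (auto simp: fe)
  show thesis
  \<comment> \<open>Passing from \<open>Z\<close> to \<open>Z * f * Z\<close> makes the
    quasi-inverse reflexive, so that it is supported on the same pair of summands as
    \<open>f\<close>.\<close>
  proof (rule that[of "Z * f * Z" f])
    show "gmor e R e' R' f" by fact
    show "gmor e' R' e R (Z * f * Z)"
      unfolding gmor_def
    proof (intro conjI ballI)
      show "e * (Z * f * Z) = Z * f * Z" using Z(2) by (metis mult.assoc)
      show "Z * f * Z * e' = Z * f * Z" using Z(3) by (simp add: mult.assoc)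
      fix h assume h: "h \<in> carrier G"
      have "Z * f * Z * R' h = Z * (f * R h) * Z" using Z(4)[OF h] by (simp add: mult.assoc)
      also have "\<dots> = R h * (Z * f * Z)" using Z(4)[OF h] fe(3)[OF h] by (metis mult.assoc smul_one)
      finally show "Z * f * Z * R' h = R h * (Z * f * Z)" .
    qed
    show "f * (Z * f * Z) * f = f" using Z(1) by (metis mult.assoc)
    show "Z * f * Z * f * (Z * f * Z) = Z * f * Z" using Z(1) by (metis mult.assoc)
    show "Z * f * Z * f \<noteq> 0" using Z(1) f(1) by (metis mult.assoc mult_zero_right)
  qed
qed

text \<open>Induction on the dimension. Equal characters give
  \<open>intertw R R' = intertw R R\<close>, which is nonzero unless \<open>e\<close> is; so a
  common summand exists, and the complements again have equal characters.\<close>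

theorem giso_if_tr_eq:
  fixes R R' :: "'a \<Rightarrow> 'k :: field_char_0 fmat"
  assumes "grep e R" "grep e' R'" "\<And>h. h \<in> carrier G \<Longrightarrow> tr (R h) = tr (R' h)"
  shows "giso e R e' R'"
proof -
  obtain d where "tr e = of_nat d" using idempotent_tr(1)[OF grepD(3)[OF assms(1)]] by blast
  then show ?thesis using assms
  proof (induction d arbitrary: e R e' R' rule: less_induct)
    case (less d)
    note R = less(3) and R' = less(4)
    note Rd = grepD[OF R] and Rd' = grepD[OF R']
    show ?case
    proof (cases "e = 0")
      case True
      then have "tr e' = 0" using less(5)[of \<one>] Rd(1) Rd'(1) by simp
      then have "e' = 0" using idempotent_tr(2)[OF Rd'(3)] by simp
      then have "R h = 0" "R' h = 0" if "h \<in> carrier G" for h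
        using that True Rd(4)[of h] Rd'(4)[of h] by auto
      then show ?thesis using True \<open>e' = 0\<close>
        unfolding giso_def gmor_def by (intro exI[of _ 0]) auto
    next
      case False
      have "intertw R R' = intertw R R"
        unfolding intertw_def by (intro sum.cong refl) (simp add: less(5))
      then have "intertw R R' \<noteq> 0" using intertw_self[OF R] False by auto
      then obtain f z where fz: "z * f \<noteq> 0" "gmor e R e' R' f" "gmor e' R' e R z"
        "f * z * f = f" "z * f * z = z"
        using common_summand[OF R R'] by blast
      have f: "e' * f = f" "f * e = f" "\<And>h. h \<in> carrier G \<Longrightarrow> f * R h = R' h * f"
        and z: "e * z = z" "z * e' = z" "\<And>h. h \<in> carrier G \<Longrightarrow> z * R' h = R h * z"
        using fz(2,3) by (auto simp: gmor_def)
      define p p' where "p = z * f" and "p' = f * z"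
      have p: "p * p = p" "e * p = p" "p * e = p" "\<And>h. h \<in> carrier G \<Longrightarrow> p * R h = R h * p"
        unfolding p_def using fz f z by (metis mult.assoc)+
      have p': "p' * p' = p'" "e' * p' = p'" "p' * e' = p'"
        "\<And>h. h \<in> carrier G \<Longrightarrow> p' * R' h = R' h * p'"
        unfolding p'_def using fz f z by (metis mult.assoc)+
      have q: "(e - p) * (e - p) = e - p" "e * (e - p) = e - p"
        "\<And>h. h \<in> carrier G \<Longrightarrow> (e - p) * R h = R h * (e - p)"
        using p Rd by (simp_all add: algebra_simps)
      have q': "(e' - p') * (e' - p') = e' - p'" "e' * (e' - p') = e' - p'"
        "\<And>h. h \<in> carrier G \<Longrightarrow> (e' - p') * R' h = R' h * (e' - p')"
        using p' Rd' by (simp_all add: algebra_simps)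
      have trp: "tr (p * R h) = tr (p' * R' h)" if "h \<in> carrier G" for h
        using f(3)[OF that] tr_mult_commute[of z "f * R h"] tr_mult_commute[of "R' h" "f * z"]
        by (simp add: p_def p'_def mult.assoc)
      obtain d1 where d1: "tr p = of_nat d1" using idempotent_tr(1)[OF p(1)] by blast
      obtain d2 where d2: "tr (e - p) = of_nat d2" using idempotent_tr(1)[OF q(1)] by blast
      have "d1 \<noteq> 0" using d1 idempotent_tr(2)[OF p(1)] fz(1) p_def by auto
      moreover have "of_nat d = (of_nat (d1 + d2) :: 'k)" using less(2) d1 d2 by (simp add: diff_eq_eq)
      then have "d = d1 + d2" by (metis of_nat_eq_iff)
      ultimately have "d2 < d" by simp
      then have "giso (e - p) (\<lambda>h. (e - p) * R h) (e' - p') (\<lambda>h. (e' - p') * R' h)"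
        using less(1)[OF _ d2 grep_cut[OF R q] grep_cut[OF R' q']] less(5) trp Rd(4) Rd'(4)
        by (simp add: left_diff_distrib)
      then obtain P Q where P: "(e' - p') * P = P" "P * (e - p) = P"
          "\<And>h. h \<in> carrier G \<Longrightarrow> P * ((e - p) * R h) = (e' - p') * R' h * P"
        and Q: "(e - p) * Q = Q" "Q * (e' - p') = Q"
          "\<And>h. h \<in> carrier G \<Longrightarrow> Q * ((e' - p') * R' h) = (e - p) * R h * Q"
        and PQ: "Q * P = e - p" "P * Q = e' - p'"
        unfolding giso_def gmor_def by blast
      have P': "e' * P = P" "P * e = P" "\<And>h. h \<in> carrier G \<Longrightarrow> P * R h = R' h * P"
        and Q': "e * Q = Q" "Q * e' = Q" "\<And>h. h \<in> carrier G \<Longrightarrow> Q * R' h = R h * Q"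
        subgoal by (metis P(1) q'(2) mult.assoc)
        subgoal by (metis P(2) mult.assoc right_diff_distrib left_diff_distrib p(3) Rd(3))
        subgoal for h using P q'(3) by (metis mult.assoc)
        subgoal by (metis Q(1) q(2) mult.assoc)
        subgoal by (metis Q(2) mult.assoc left_diff_distrib p'(3) Rd'(3))
        subgoal for h using Q q(3) by (metis mult.assoc)
        done
      have "f * Q = 0"
      proof -
        have "f * (e - p) = 0" using f fz by (simp add: right_diff_distrib p_def mult.assoc[symmetric])
        then show ?thesis using Q(1) by (metis mult.assoc mult_zero_left)
      qed
      moreover have "Q * f = 0"
      proof -
        have "(e' - p') * f = 0" using f fz by (simp add: left_diff_distrib p'_def)
        then show ?thesis using Q(2) by (metis mult.assoc mult_zero_right)
      qed
      moreover have "z * P = 0"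
      proof -
        have "z * (e' - p') = 0" using z fz by (simp add: right_diff_distrib p'_def mult.assoc[symmetric])
        then show ?thesis using P(1) by (metis mult.assoc mult_zero_left)
      qed
      moreover have "P * z = 0"
      proof -
        have "(e - p) * z = 0" using z fz by (simp add: left_diff_distrib p_def)
        then show ?thesis using P(2) by (metis mult.assoc mult_zero_right)
      qed
      ultimately have "(z + Q) * (f + P) = e" "(f + P) * (z + Q) = e'"
        using PQ by (simp_all add: algebra_simps p_def p'_def)
      moreover have "gmor e R e' R' (f + P)" "gmor e' R' e R (z + Q)"
        using f z P' Q' by (auto simp: gmor_def algebra_simps)
      ultimately show ?thesis unfolding giso_def by blast
    qed
  qed
qed

end

section \<open>Modules over the Hopf algebra\<close>

text \<open>
  A module is an idempotent \<open>e\<close> in the ring of finitely supported matrices together with operators in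
  the corner \<open>e _ e\<close>; the underlying space is the image of \<open>e\<close>. In this way submodules, quotients,
  sums and tensor products need no choice of bases.
\<close>

declare [[typedef_overloaded]]

datatype ('g, 'k :: zero) hm = HM (idn: "'k fmat") (act: "'g \<Rightarrow> 'k fmat") (yop: "'k fmat")

text \<open>Powers taken in the corner of \<open>e\<close>, whose unit \<open>e\<close> is the power
  with exponent zero.\<close>

primrec mpow :: "'k :: field fmat \<Rightarrow> 'k fmat \<Rightarrow> nat \<Rightarrow> 'k fmat" where
  "mpow e A 0 = e"
| "mpow e A (Suc i) = A * mpow e A i"

definition ypow :: "('g, 'k :: field) hm \<Rightarrow> nat \<Rightarrow> 'k fmat" where
  "ypow M i = mpow (idn M) (yop M) i"

lemma ypow_0 [simp]: "ypow M 0 = idn M" and ypow_Suc: "ypow M (Suc i) = yop M * ypow M i"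
  by (simp_all add: ypow_def)

section \<open>Gaussian binomial coefficients and the q-binomial theorem\<close>

primrec qbin :: "'k :: field \<Rightarrow> nat \<Rightarrow> nat \<Rightarrow> 'k" where
  "qbin q 0 i = (if i = 0 then 1 else 0)"
| "qbin q (Suc m) i = (case i of 0 \<Rightarrow> 1 | Suc j \<Rightarrow> qbin q m j + q ^ Suc j * qbin q m (Suc j))"

lemma qbin_0 [simp]: "qbin q m 0 = 1"
  by (cases m) auto

lemma qbin_big: "m < i \<Longrightarrow> qbin q m i = 0"
proof (induction m arbitrary: i)
  case (Suc m)
  then obtain j where "i = Suc j" by (cases i) auto
  with Suc show ?case by simp
qed simp

lemma qbin_diag [simp]: "qbin q m m = 1"
  by (induction m) (auto simp: qbin_big)

text \<open>The quotient formula with the denominators multiplied out, so that it remains true when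
  \<open>q\<close> is a root of unity.\<close>

lemma qbin_product:
  "qbin q m i * (\<Prod>j<i. 1 - q ^ Suc j) = (\<Prod>j<i. 1 - q ^ (m - j))"
proof (induction m arbitrary: i)
  case 0
  show ?case by (cases i) auto
next
  case (Suc m)
  show ?case
  proof (cases i)
    case (Suc j)
    have shift: "(\<Prod>k<Suc j. 1 - q ^ (Suc m - k)) = (1 - q ^ Suc m) * (\<Prod>k<j. 1 - q ^ (m - k))"
      by (simp add: prod.lessThan_Suc_shift del: prod.lessThan_Suc power_Suc)
    have "qbin q (Suc m) (Suc j) * (\<Prod>k<Suc j. 1 - q ^ Suc k)
        = qbin q m j * (\<Prod>k<j. 1 - q ^ Suc k) * (1 - q ^ Suc j)
          + q ^ Suc j * (qbin q m (Suc j) * (\<Prod>k<Suc j. 1 - q ^ Suc k))"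
      by (simp add: algebra_simps)
    also have "\<dots> = (\<Prod>k<j. 1 - q ^ (m - k)) * (1 - q ^ Suc j + q ^ Suc j * (1 - q ^ (m - j)))"
      unfolding Suc.IH by (simp add: algebra_simps)
    also have "\<dots> = (\<Prod>k<j. 1 - q ^ (m - k)) * (1 - q ^ Suc m)"
    proof (cases "j \<le> m")
      case True
      then have "q ^ Suc j * q ^ (m - j) = q ^ Suc m" by (simp flip: power_add)
      then have "1 - q ^ Suc j + q ^ Suc j * (1 - q ^ (m - j)) = 1 - q ^ Suc m"
        by (simp add: right_diff_distrib del: power_Suc)
      then show ?thesis by (simp only:)
    next
      case False
      then have "(\<Prod>k<j. 1 - q ^ (m - k)) = 0" by (intro prod_zero bexI[of _ m]) auto
      then show ?thesis by simp
    qed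
    finally show ?thesis using shift Suc by (simp add: mult.commute)
  qed simp
qed

text \<open>In \<open>qbin_product\<close> the right side contains the factor
  \<open>1 - q ^ n = 0\<close>, while the product on the left has no zero factor as long as
  \<open>i < n\<close>.\<close>

lemma qbin_primitive:
  assumes "q ^ n = 1" "\<And>m. 0 < m \<Longrightarrow> m < n \<Longrightarrow> q ^ m \<noteq> 1" "0 < i" "i < n"
  shows "qbin q n i = 0"
proof -
  have "(\<Prod>j<i. 1 - q ^ (n - j)) = 0"
    using assms by (intro prod_zero) (auto intro!: bexI[of _ 0])
  moreover have "1 - q ^ Suc j \<noteq> 0" if "j < i" for j
    using assms(2)[of "Suc j"] that assms(4) by auto
  then have "(\<Prod>j<i. 1 - q ^ Suc j) \<noteq> 0" by (subst prod_zero_iff) auto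
  ultimately show ?thesis using qbin_product[of q n i] by (metis mult_eq_0_iff)
qed

lemma mpow_q_commute:
  assumes "B * A = q \<cdot> (A * B)" "B * e = B" "e * B = B"
  shows "B * mpow e A i = q ^ i \<cdot> (mpow e A i * B)"
proof (induction i)
  case (Suc i)
  have "B * mpow e A (Suc i) = q \<cdot> (A * (B * mpow e A i))"
    using assms(1) by (simp flip: mult.assoc)
  then show ?case by (simp add: Suc mult.assoc)
qed (simp add: assms)

text \<open>The q-binomial theorem, meant for the summands y \<otimes> g and 1 \<otimes> y of the
  comultiplication of y.\<close>

lemma mpow_add_q_commute:
  assumes BA: "B * A = q \<cdot> (A * B)" and e: "e * e = e" "B * e = B" "e * B = B" "A * e = A" "e * A = A"
  shows "mpow e (A + B) m = (\<Sum>i\<le>m. qbin q m i \<cdot> (mpow e A i * mpow e B (m - i)))"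
proof (induction m)
  case 0
  then show ?case by (simp add: e)
next
  case (Suc m)
  let ?t = "\<lambda>i j. mpow e A i * mpow e B j"
  have emB: "e * mpow e B j = mpow e B j" for j
    by (cases j) (simp_all add: e flip: mult.assoc)
  have "mpow e (A + B) (Suc m) = (\<Sum>i\<le>m. qbin q m i \<cdot> ((A + B) * ?t i (m - i)))"
    by (simp add: Suc sum_distrib_left)
  also have "\<dots> = (\<Sum>i\<le>m. qbin q m i \<cdot> ?t (Suc i) (m - i))
      + (\<Sum>i\<le>m. (q ^ i * qbin q m i) \<cdot> ?t i (Suc m - i))"
  proof -
    have "B * ?t i (m - i) = q ^ i \<cdot> ?t i (Suc m - i)" if "i \<le> m" for i
      using that mpow_q_commute[OF BA e(2,3), of i] by (simp add: Suc_diff_le flip: mult.assoc)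
    then have "qbin q m i \<cdot> ((A + B) * ?t i (m - i)) = qbin q m i \<cdot> ?t (Suc i) (m - i)
        + (q ^ i * qbin q m i) \<cdot> ?t i (Suc m - i)" if "i \<le> m" for i
      using that by (simp add: distrib_right smul_add_right mult.assoc mult.commute)
    then show ?thesis by (simp add: sum.distrib)
  qed
  also have "(\<Sum>i\<le>m. (q ^ i * qbin q m i) \<cdot> ?t i (Suc m - i))
      = (\<Sum>i\<le>Suc m. (q ^ i * qbin q m i) \<cdot> ?t i (Suc m - i))"
    by (simp add: qbin_big)
  also have "\<dots> = ?t 0 (Suc m) + (\<Sum>i\<le>m. (q ^ Suc i * qbin q m (Suc i)) \<cdot> ?t (Suc i) (m - i))"
    by (simp add: sum.atMost_Suc_shift del: power_Suc sum.atMost_Suc)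
  also have "(\<Sum>i\<le>m. qbin q m i \<cdot> ?t (Suc i) (m - i)) + \<dots>
      = ?t 0 (Suc m) + (\<Sum>i\<le>m. qbin q (Suc m) (Suc i) \<cdot> ?t (Suc i) (m - i))"
    by (simp add: sum.distrib smul_add_left)
  also have "\<dots> = (\<Sum>i\<le>Suc m. qbin q (Suc m) i \<cdot> ?t i (Suc m - i))"
    by (simp add: sum.atMost_Suc_shift del: sum.atMost_Suc)
  finally show ?case .
qed

locale datum = nonnilpotent_group_datum G chi g n
  for G :: "('g, 'm) monoid_scheme" (structure)
    and chi :: "'g \<Rightarrow> 'k :: {alg_closed_field, field_char_0}" and g n

sublocale datum \<subseteq> fin_group G
  by unfold_locales (rule finite_carrier)

context datum
begin

text \<open>Only the actions of the group and of y are recorded, with the defining relations as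
  conditions. \<open>ext\<close> recovers the action of the whole algebra.\<close>

definition hmod :: "('g, 'k) hm \<Rightarrow> bool" where
  "hmod M \<longleftrightarrow> grep (idn M) (act M) \<and> idn M * yop M = yop M \<and> yop M * idn M = yop M \<and>
    (\<forall>h\<in>carrier G. yop M * act M h = chi h \<cdot> (act M h * yop M)) \<and>
    ypow M n = act M (g [^] n) - idn M"

definition mor :: "('g, 'k) hm \<Rightarrow> ('g, 'k) hm \<Rightarrow> 'k fmat \<Rightarrow> bool" where
  "mor M N P \<longleftrightarrow> gmor (idn M) (act M) (idn N) (act N) P \<and> P * yop M = yop N * P"

definition hiso :: "('g, 'k) hm \<Rightarrow> ('g, 'k) hm \<Rightarrow> bool" (infix "\<asymp>" 50) where
  "M \<asymp> N \<longleftrightarrow> (\<exists>P Q. mor M N P \<and> mor N M Q \<and> Q * P = idn M \<and> P * Q = idn N)"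

lemma hmodD:
  assumes "hmod M"
  shows "grep (idn M) (act M)" "idn M * yop M = yop M" "yop M * idn M = yop M"
    "\<And>h. h \<in> carrier G \<Longrightarrow> yop M * act M h = chi h \<cdot> (act M h * yop M)"
    "ypow M n = act M (g [^] n) - idn M"
    "act M \<one> = idn M" "\<And>h k. h \<in> carrier G \<Longrightarrow> k \<in> carrier G \<Longrightarrow> act M (h \<otimes> k) = act M h * act M k"
    "idn M * idn M = idn M" "\<And>h. h \<in> carrier G \<Longrightarrow> idn M * act M h = act M h"
    "\<And>h. h \<in> carrier G \<Longrightarrow> act M h * idn M = act M h"
    "\<And>h. h \<in> carrier G \<Longrightarrow> act M h * act M (inv h) = idn M"
    "\<And>h. h \<in> carrier G \<Longrightarrow> act M (inv h) * act M h = idn M"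
  using assms grepD[of "idn M" "act M"] unfolding hmod_def by auto

lemma morD:
  assumes "mor M N P"
  shows "idn N * P = P" "P * idn M = P" "\<And>h. h \<in> carrier G \<Longrightarrow> P * act M h = act N h * P"
    "P * yop M = yop N * P"
  using assms unfolding mor_def gmor_def by auto

lemma morI:
  assumes "idn N * P = P" "P * idn M = P" "\<And>h. h \<in> carrier G \<Longrightarrow> P * act M h = act N h * P"
    "P * yop M = yop N * P"
  shows "mor M N P"
  using assms unfolding mor_def gmor_def by auto

lemma mor_id: "hmod M \<Longrightarrow> mor M M (idn M)"
  by (rule morI) (simp_all add: hmodD)

lemma mor_zero: "mor M N 0"
  by (rule morI) simp_all

lemma mor_add: "mor M N P \<Longrightarrow> mor M N Q \<Longrightarrow> mor M N (P + Q)"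
  by (rule morI) (simp_all add: morD algebra_simps)

lemma mor_diff: "mor M N P \<Longrightarrow> mor M N Q \<Longrightarrow> mor M N (P - Q)"
  by (rule morI) (simp_all add: morD algebra_simps)

lemma mor_comp: "mor M N P \<Longrightarrow> mor N L Q \<Longrightarrow> mor M L (Q * P)"
  by (rule morI)
    (simp_all add: morD mult.assoc, simp_all add: morD flip: mult.assoc)

lemma mor_ypow:
  assumes "mor M N P"
  shows "P * ypow M i = ypow N i * P"
proof (induction i)
  case (Suc i)
  then show ?case using morD[OF assms] by (metis ypow_Suc mult.assoc)
qed (use morD[OF assms] in simp)

lemma hiso_refl: "hmod M \<Longrightarrow> M \<asymp> M"
  unfolding hiso_def by (metis mor_id hmodD(8))

lemma hiso_sym: "M \<asymp> N \<Longrightarrow> N \<asymp> M"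
  unfolding hiso_def by blast

lemma hiso_trans [trans]: "M \<asymp> N \<Longrightarrow> N \<asymp> L \<Longrightarrow> M \<asymp> L"
proof -
  assume "M \<asymp> N" "N \<asymp> L"
  then obtain P Q P' Q' where PQ: "mor M N P" "mor N M Q" "Q * P = idn M" "P * Q = idn N"
    "mor N L P'" "mor L N Q'" "Q' * P' = idn N" "P' * Q' = idn L"
    unfolding hiso_def by blast
  show ?thesis
    unfolding hiso_def
  proof (intro exI conjI)
    show "mor M L (P' * P)" "mor L M (Q * Q')" using PQ mor_comp by blast+
    show "Q * Q' * (P' * P) = idn M" using PQ morD(1)[OF PQ(1)] by (metis mult.assoc)
    show "P' * P * (Q * Q') = idn L" using PQ morD(2)[OF PQ(5)] by (metis mult.assoc)
  qed
qed

subsection \<open>Powers of y\<close>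

lemma ypow_idn:
  assumes "hmod M"
  shows "idn M * ypow M i = ypow M i" "ypow M i * idn M = ypow M i"
proof -
  show "idn M * ypow M i = ypow M i"
    using hmodD[OF assms] by (cases i) (auto simp: ypow_Suc simp flip: mult.assoc)
  show "ypow M i * idn M = ypow M i"
    using hmodD[OF assms] by (induction i) (auto simp: ypow_Suc mult.assoc)
qed

lemma ypow_add: "hmod M \<Longrightarrow> ypow M i * ypow M j = ypow M (i + j)"
  by (induction i) (auto simp: ypow_Suc mult.assoc ypow_idn)

lemma ypow_1: "hmod M \<Longrightarrow> ypow M (Suc 0) = yop M"
  by (simp add: ypow_Suc hmodD)

lemma ypow_Suc_right: "hmod M \<Longrightarrow> ypow M (Suc i) = ypow M i * yop M"
  using ypow_add[of M i "Suc 0"] by (simp add: ypow_1)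

lemma ypow_act:
  assumes "hmod M" "h \<in> carrier G"
  shows "ypow M i * act M h = chi h ^ i \<cdot> (act M h * ypow M i)"
proof (induction i)
  case (Suc i)
  have "ypow M (Suc i) * act M h = chi h ^ i \<cdot> (yop M * act M h * ypow M i)"
    using Suc by (simp add: ypow_Suc mult.assoc)
  then show ?case using hmodD(4)[OF assms] by (simp add: ypow_Suc mult.assoc mult.commute)
qed (use hmodD[OF assms(1)] assms(2) in simp)

lemma ypow_ge_zero: "hmod M \<Longrightarrow> ypow M l = 0 \<Longrightarrow> l \<le> i \<Longrightarrow> ypow M i = 0"
  using ypow_add[of M "i - l" l] by simp

lemma chi_pow_g: "h \<in> carrier G \<Longrightarrow> chi (h [^] (m :: nat)) = chi h ^ m"
  by (induction m) (simp_all add: chi_one chi_mult)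

lemma g_pow_central: "h \<in> carrier G \<Longrightarrow> (g [^] (m :: nat)) \<otimes> h = h \<otimes> (g [^] m)"
proof (induction m)
  case (Suc m)
  then show ?case using g_closed g_central[of h]
    by (simp add: m_assoc) (metis m_assoc nat_pow_closed)
qed (simp add: g_closed)

lemma act_g_pow:
  assumes "hmod M"
  shows "act M (g [^] (m :: nat)) = mpow (idn M) (act M g) m"
proof (induction m)
  case (Suc m)
  have "act M (g [^] Suc m) = act M (g \<otimes> g [^] m)"
    using g_pow_central[of g m] g_closed by simp
  then show ?case using Suc hmodD(7)[OF assms] g_closed by simp
qed (use hmodD[OF assms] in simp)

subsection \<open>Direct summands and sums\<close>

definition cut :: "('g, 'k) hm \<Rightarrow> 'k fmat \<Rightarrow> ('g, 'k) hm" where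
  "cut M p = HM p (\<lambda>h. p * act M h) (p * yop M)"

lemma cut_simps [simp]:
  "idn (cut M p) = p" "act (cut M p) h = p * act M h" "yop (cut M p) = p * yop M"
  by (simp_all add: cut_def)

lemma ypow_cut:
  assumes "hmod M" "mor M M p" "p * p = p"
  shows "ypow (cut M p) i = p * ypow M i"
proof (induction i)
  case 0
  then show ?case using assms morD(2) by simp
next
  case (Suc i)
  have "p * yop M * (p * ypow M i) = p * p * (yop M * ypow M i)"
    using morD(4)[OF assms(2)] by (metis mult.assoc)
  with Suc show ?case using assms(3) by (simp add: ypow_Suc)
qed

lemma hmod_cut:
  assumes "hmod M" "mor M M p" "p * p = p"
  shows "hmod (cut M p)"
  unfolding hmod_def
proof (intro conjI ballI)
  note p = morD[OF assms(2)] and M = hmodD[OF assms(1)]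
  show "grep (idn (cut M p)) (act (cut M p))"
    using grep_cut[OF M(1) assms(3)] p by (simp add: cut_def)
  show "idn (cut M p) * yop (cut M p) = yop (cut M p)" using assms by (simp flip: mult.assoc)
  show "yop (cut M p) * idn (cut M p) = yop (cut M p)" using assms p by (simp add: mult.assoc)
  show "yop (cut M p) * act (cut M p) h = chi h \<cdot> (act (cut M p) h * yop (cut M p))"
    if h: "h \<in> carrier G" for h
  proof -
    have "p * yop M * (p * act M h) = p * p * (yop M * act M h)" using p(4) by (metis mult.assoc)
    moreover have "p * act M h * (p * yop M) = p * p * (act M h * yop M)"
      using p(3)[OF h] by (metis mult.assoc)
    ultimately show ?thesis using M(4)[OF h] assms(3) by simp
  qed
  show "ypow (cut M p) n = act (cut M p) (g [^] n) - idn (cut M p)"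
    unfolding ypow_cut[OF assms] M(5) using p by (simp add: right_diff_distrib)
qed

text \<open>The equational form of a direct sum: it survives isomorphisms and tensoring without any
  choice of a complement.\<close>

definition biprod :: "('g, 'k) hm \<Rightarrow> ('g, 'k) hm \<Rightarrow> ('g, 'k) hm \<Rightarrow> bool" where
  "biprod M A B \<longleftrightarrow> (\<exists>i1 i2 p1 p2. mor A M i1 \<and> mor B M i2 \<and> mor M A p1 \<and> mor M B p2 \<and>
     p1 * i1 = idn A \<and> p2 * i2 = idn B \<and> p1 * i2 = 0 \<and> p2 * i1 = 0 \<and> i1 * p1 + i2 * p2 = idn M)"

lemma biprod_unique:
  assumes "biprod M A B" "biprod N A B"
  shows "M \<asymp> N"
proof -
  obtain i1 i2 p1 p2 where M: "mor A M i1" "mor B M i2" "mor M A p1" "mor M B p2"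
     "p1 * i1 = idn A" "p2 * i2 = idn B" "p1 * i2 = 0" "p2 * i1 = 0" "i1 * p1 + i2 * p2 = idn M"
    using assms(1) unfolding biprod_def by blast
  obtain j1 j2 q1 q2 where N: "mor A N j1" "mor B N j2" "mor N A q1" "mor N B q2"
     "q1 * j1 = idn A" "q2 * j2 = idn B" "q1 * j2 = 0" "q2 * j1 = 0" "j1 * q1 + j2 * q2 = idn N"
    using assms(2) unfolding biprod_def by blast
  have zero: "q1 * (j2 * x) = 0" "q2 * (j1 * x) = 0" "p1 * (i2 * x) = 0" "p2 * (i1 * x) = 0" for x
    using M(7,8) N(7,8) by (simp_all flip: mult.assoc)
  have one: "q1 * (j1 * p1) = p1" "q2 * (j2 * p2) = p2" "p1 * (i1 * q1) = q1" "p2 * (i2 * q2) = q2"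
    using M(5,6) N(5,6) M(3,4)[THEN morD(1)] N(3,4)[THEN morD(1)] by (simp_all flip: mult.assoc)
  show ?thesis
    unfolding hiso_def
  proof (intro exI conjI)
    show "mor M N (j1 * p1 + j2 * p2)" using M N by (intro mor_add mor_comp)
    show "mor N M (i1 * q1 + i2 * q2)" using M N by (intro mor_add mor_comp)
    show "(i1 * q1 + i2 * q2) * (j1 * p1 + j2 * p2) = idn M"
      using M(9) by (simp add: algebra_simps zero one)
    show "(j1 * p1 + j2 * p2) * (i1 * q1 + i2 * q2) = idn N"
      using N(9) by (simp add: algebra_simps zero one)
  qed
qed

lemma biprod_iso:
  assumes "biprod M A B" "A \<asymp> A'" "B \<asymp> B'"
  shows "biprod M A' B'"
proof -
  obtain i1 i2 p1 p2 where M: "mor A M i1" "mor B M i2" "mor M A p1" "mor M B p2"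
     "p1 * i1 = idn A" "p2 * i2 = idn B" "p1 * i2 = 0" "p2 * i1 = 0" "i1 * p1 + i2 * p2 = idn M"
    using assms(1) unfolding biprod_def by blast
  obtain P Q where A: "mor A A' P" "mor A' A Q" "Q * P = idn A" "P * Q = idn A'"
    using assms(2) unfolding hiso_def by blast
  obtain R S where B: "mor B B' R" "mor B' B S" "S * R = idn B" "R * S = idn B'"
    using assms(3) unfolding hiso_def by blast
  have simps: "p1 * (i1 * Q) = Q" "p2 * (i2 * S) = S" "p1 * (i2 * x) = 0" "p2 * (i1 * x) = 0"
    "Q * (P * p1) = p1" "S * (R * p2) = p2" for x
    using M A B morD(1)[OF A(2)] morD(1)[OF B(2)] morD(1)[OF M(3)] morD(1)[OF M(4)]
    by (simp_all flip: mult.assoc)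
  show ?thesis
    unfolding biprod_def
  proof (intro exI conjI)
    show "mor A' M (i1 * Q)" "mor B' M (i2 * S)" "mor M A' (P * p1)" "mor M B' (R * p2)"
      using M A B by (auto intro: mor_comp)
    show "P * p1 * (i1 * Q) = idn A'" "R * p2 * (i2 * S) = idn B'" "P * p1 * (i2 * S) = 0"
      "R * p2 * (i1 * Q) = 0" "i1 * Q * (P * p1) + i2 * S * (R * p2) = idn M"
      using A B M by (simp_all add: mult.assoc simps)
  qed
qed

lemma biprod_iso_total:
  assumes "biprod M A B" "M \<asymp> M'"
  shows "biprod M' A B"
proof -
  obtain i1 i2 p1 p2 where M: "mor A M i1" "mor B M i2" "mor M A p1" "mor M B p2"
     "p1 * i1 = idn A" "p2 * i2 = idn B" "p1 * i2 = 0" "p2 * i1 = 0" "i1 * p1 + i2 * p2 = idn M"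
    using assms(1) unfolding biprod_def by blast
  obtain P Q where P: "mor M M' P" "mor M' M Q" "Q * P = idn M" "P * Q = idn M'"
    using assms(2) unfolding hiso_def by blast
  have QP: "Q * (P * i1) = i1" "Q * (P * i2) = i2"
    using P(3) M(1,2)[THEN morD(1)] by (simp_all flip: mult.assoc)
  show ?thesis
    unfolding biprod_def
  proof (intro exI conjI)
    show "mor A M' (P * i1)" "mor B M' (P * i2)" "mor M' A (p1 * Q)" "mor M' B (p2 * Q)"
      using M P by (auto intro: mor_comp)
    show "p1 * Q * (P * i1) = idn A" "p2 * Q * (P * i2) = idn B" "p1 * Q * (P * i2) = 0"
      "p2 * Q * (P * i1) = 0" using M by (simp_all add: mult.assoc QP)
    have "P * i1 * (p1 * Q) + P * i2 * (p2 * Q) = P * (i1 * p1 + i2 * p2) * Q"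
      by (simp add: algebra_simps)
    then show "P * i1 * (p1 * Q) + P * i2 * (p2 * Q) = idn M'"
      unfolding M(9) using P morD(2)[OF P(1)] by simp
  qed
qed

lemma mor_cut:
  assumes "mor M M p" "p * p = p"
  shows "mor (cut M p) M p" "mor M (cut M p) p"
proof -
  note p = morD[OF assms(1)]
  have pp: "p * (p * x) = p * x" for x using assms(2) by (simp flip: mult.assoc)
  have px: "p * (act M h * p) = p * act M h" if "h \<in> carrier G" for h
    using p(3)[OF that] pp by metis
  have py: "p * (yop M * p) = p * yop M" using p(4) pp by metis
  have "p * (act M h * p) = act M h * p" if "h \<in> carrier G" for h
    using p(3)[OF that] px[OF that] by simp
  moreover have "p * (yop M * p) = yop M * p" using p(4) py by simp
  ultimately show "mor (cut M p) M p"
    using p assms(2) by (intro morI) (simp_all add: pp)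
  show "mor M (cut M p) p"
    using p assms(2) by (intro morI) (simp_all add: mult.assoc px py)
qed

lemma biprod_cut:
  assumes "hmod M" "mor M M p" "p * p = p"
  shows "biprod M (cut M p) (cut M (idn M - p))"
proof -
  have q: "mor M M (idn M - p)" using assms mor_id mor_diff by blast
  have qq: "(idn M - p) * (idn M - p) = idn M - p"
    using morD[OF assms(2)] assms(3) hmodD(8)[OF assms(1)] by (simp add: algebra_simps)
  show ?thesis
    unfolding biprod_def
  proof (intro exI conjI)
    show "mor (cut M p) M p" "mor M (cut M p) p" using assms mor_cut by blast+
    show "mor (cut M (idn M - p)) M (idn M - p)" "mor M (cut M (idn M - p)) (idn M - p)"
      using q qq mor_cut by blast+
    show "p * p = idn (cut M p)" using assms by simp
    show "(idn M - p) * (idn M - p) = idn (cut M (idn M - p))" using qq by simp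
    show "p * (idn M - p) = 0" "(idn M - p) * p = 0" "p * p + (idn M - p) * (idn M - p) = idn M"
      using morD[OF assms(2)] assms(3) qq by (simp_all add: algebra_simps)
  qed
qed

definition relm :: "(nat \<Rightarrow> nat) \<Rightarrow> ('g, 'k) hm \<Rightarrow> ('g, 'k) hm" where
  "relm p M = HM (relabel p (idn M)) (\<lambda>h. relabel p (act M h)) (relabel p (yop M))"

lemma ypow_relm: "inj p \<Longrightarrow> ypow (relm p M) i = relabel p (ypow M i)"
  by (induction i) (simp_all add: ypow_Suc relm_def relabel_mult)

lemma hmod_iso_relm:
  assumes "hmod M" "inj p"
  shows "hmod (relm p M)"
  unfolding hmod_def grep_def ypow_relm[OF assms(2)] using hmodD[OF assms(1)]
  by (simp add: relm_def relabel_diff flip: relabel_mult[OF assms(2)] relabel_smul)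

lemma relm_iso:
  assumes "hmod M" "inj p"
  shows "M \<asymp> relm p M"
proof -
  let ?P = "relrow p (idn M)" and ?Q = "relcol p (idn M)"
  note M = hmodD[OF assms(1)]
  have rel: "relabel p A * relrow p B = relrow p (A * B)" "relcol p B * relabel p A = relcol p (B * A)"
    for A B :: "'k fmat"
    by (simp_all only: relabel_def relrow_mult relcol_relrow[OF assms(2)] mult_relcol)
  show ?thesis
    unfolding hiso_def
  proof (intro exI conjI)
    show "mor M (relm p M) ?P"
      using M by (intro morI) (simp_all add: relm_def rel relrow_mult)
    show "mor (relm p M) M ?Q"
      using M by (intro morI) (simp_all add: relm_def rel mult_relcol)
    show "?Q * ?P = idn M" using M by (simp add: relcol_relrow[OF assms(2)])
    show "?P * ?Q = idn (relm p M)"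
      using M by (subst relrow_mult) (simp add: mult_relcol relm_def relabel_def)
  qed
qed

text \<open>The record prescribes \<open>act\<close> on the whole type, so modules that agree on the
  group may be unequal as records; they are isomorphic by the identity.\<close>

lemma hiso_cong:
  assumes "hmod M" "idn N = idn M" "yop N = yop M" "\<And>h. h \<in> carrier G \<Longrightarrow> act N h = act M h"
  shows "M \<asymp> N"
  unfolding hiso_def using assms hmodD[OF assms(1)]
  by (intro exI[of _ "idn M"] conjI morI) auto

definition dsum :: "('g, 'k) hm \<Rightarrow> ('g, 'k) hm \<Rightarrow> ('g, 'k) hm" where
  "dsum A B = HM (munit 0 0 \<boxtimes> idn A + munit (Suc 0) (Suc 0) \<boxtimes> idn B)
     (\<lambda>h. munit 0 0 \<boxtimes> act A h + munit (Suc 0) (Suc 0) \<boxtimes> act B h)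
     (munit 0 0 \<boxtimes> yop A + munit (Suc 0) (Suc 0) \<boxtimes> yop B)"

lemma ypow_dsum: "ypow (dsum A B) i = munit 0 0 \<boxtimes> ypow A i + munit (Suc 0) (Suc 0) \<boxtimes> ypow B i"
  by (induction i) (simp_all add: ypow_Suc dsum_def distrib_left distrib_right munit_mult)

lemma hmod_dsum:
  assumes "hmod A" "hmod B"
  shows "hmod (dsum A B)"
  unfolding hmod_def ypow_dsum using hmodD[OF assms(1)] hmodD[OF assms(2)]
  by (simp add: dsum_def grep_def distrib_left distrib_right munit_mult kron_diff_right smul_add_right)

lemma dsum_biprod:
  assumes "hmod A" "hmod B"
  shows "biprod (dsum A B) A B"
proof -
  let ?M = "dsum A B"
  define p :: "'k fmat" where "p = munit 0 0 \<boxtimes> idn A"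
  note [simp] = munit_mult
  note A = hmodD[OF assms(1)] and B = hmodD[OF assms(2)]
  have p: "mor ?M ?M p" "p * p = p"
    using A B by (auto intro!: morI simp: p_def dsum_def distrib_left distrib_right)
  have "relm (\<lambda>s. prod_encode (0, s)) A \<asymp> cut ?M p"
    using A hmod_iso_relm[OF assms(1) inj_pair_left, of 0]
    by (intro hiso_cong) (auto simp: relm_def p_def dsum_def distrib_left simp flip: relabel_kron_left)
  then have "cut ?M p \<asymp> A"
    using relm_iso[OF assms(1) inj_pair_left] hiso_sym hiso_trans by blast
  moreover have "relm (\<lambda>s. prod_encode (Suc 0, s)) B \<asymp> cut ?M (idn ?M - p)"
    using B hmod_iso_relm[OF assms(2) inj_pair_left, of "Suc 0"]
    by (intro hiso_cong) (auto simp: relm_def p_def dsum_def distrib_left simp flip: relabel_kron_left)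
  then have "cut ?M (idn ?M - p) \<asymp> B"
    using relm_iso[OF assms(2) inj_pair_left] hiso_sym hiso_trans by blast
  ultimately show ?thesis
    using biprod_cut[OF hmod_dsum[OF assms] p] biprod_iso by blast
qed

subsection \<open>Tensor products and twists\<close>

definition ten :: "('g, 'k) hm \<Rightarrow> ('g, 'k) hm \<Rightarrow> ('g, 'k) hm" where
  "ten M N = HM (idn M \<boxtimes> idn N) (\<lambda>h. act M h \<boxtimes> act N h) (yop M \<boxtimes> act N g + idn M \<boxtimes> yop N)"

lemma ten_simps [simp]:
  "idn (ten M N) = idn M \<boxtimes> idn N" "act (ten M N) h = act M h \<boxtimes> act N h"
  "yop (ten M N) = yop M \<boxtimes> act N g + idn M \<boxtimes> yop N"
  by (simp_all add: ten_def)

text \<open>As 1 \<otimes> y and y \<otimes> g commute up to the primitive root of unity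
  \<open>chi g\<close>, only the two extreme terms of the n-th power survive: 1 \<otimes> (g^n - 1)
  + (g^n - 1) \<otimes> g^n = g^n \<otimes> g^n - 1 \<otimes> 1.\<close>

lemma hmod_ten:
  assumes "hmod M" "hmod N"
  shows "hmod (ten M N)"
proof -
  note M = hmodD[OF assms(1)] and N = hmodD[OF assms(2)] and g = g_closed
  let ?A = "yop M \<boxtimes> act N g" and ?B = "idn M \<boxtimes> yop N" and ?e = "idn M \<boxtimes> idn N"
  have "mpow ?e ?A i = ypow M i \<boxtimes> mpow (idn N) (act N g) i" for i
    by (induction i) (simp_all add: ypow_Suc)
  then have A: "mpow ?e ?A i = ypow M i \<boxtimes> act N (g [^] i)" for i
    by (simp add: act_g_pow[OF assms(2)])
  have B: "mpow ?e ?B i = idn M \<boxtimes> ypow N i" for i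
    by (induction i) (simp_all add: ypow_Suc M)
  have BA: "?B * ?A = chi g \<cdot> (?A * ?B)"
    using M N g by simp
  have corner: "?e * ?e = ?e" "?B * ?e = ?B" "?e * ?B = ?B" "?A * ?e = ?A" "?e * ?A = ?A"
    using M N g by simp_all
  have "ypow (ten M N) n = (\<Sum>i\<le>n. qbin (chi g) n i \<cdot> (mpow ?e ?A i * mpow ?e ?B (n - i)))"
    unfolding ypow_def using mpow_add_q_commute[OF BA corner] by simp
  also have "\<dots> = (\<Sum>i\<in>{0, n}. qbin (chi g) n i \<cdot> (mpow ?e ?A i * mpow ?e ?B (n - i)))"
  proof (rule sum.mono_neutral_right)
    show "\<forall>i\<in>{..n} - {0, n}. qbin (chi g) n i \<cdot> (mpow ?e ?A i * mpow ?e ?B (n - i)) = 0"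
      using qbin_primitive[OF root_of_unity primitive] by simp
  qed auto
  also have "\<dots> = act (ten M N) (g [^] n) - ?e"
  proof -
    have "mpow ?e ?A 0 * mpow ?e ?B n = idn M \<boxtimes> (act N (g [^] n) - idn N)"
      unfolding B using M(8) N(5,8,9) g by (simp add: right_diff_distrib)
    moreover have "mpow ?e ?A n * mpow ?e ?B 0 = (act M (g [^] n) - idn M) \<boxtimes> act N (g [^] n)"
      unfolding A using M(5) N(10)[of "g [^] n"] ypow_idn(2)[OF assms(1), of n] g by simp
    moreover have "n \<noteq> 0" using n_ge_2 by simp
    ultimately show ?thesis
      by (simp add: kron_diff_left kron_diff_right)
  qed
  finally have "ypow (ten M N) n = act (ten M N) (g [^] n) - ?e" .
  moreover have "yop (ten M N) * act (ten M N) h = chi h \<cdot> (act (ten M N) h * yop (ten M N))"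
    if h: "h \<in> carrier G" for h
  proof -
    have "act N g * act N h = act N h * act N g"
      using N(7)[OF g h] N(7)[OF h g] g_central[OF h] by simp
    then show ?thesis
      using M N h by (simp add: distrib_left distrib_right smul_add_right)
  qed
  ultimately show ?thesis
    unfolding hmod_def grep_def using M N g by (simp add: distrib_left distrib_right)
qed

lemma mor_ten:
  assumes "mor M M' P" "mor N N' Q"
  shows "mor (ten M N) (ten M' N') (P \<boxtimes> Q)"
  using morD[OF assms(1)] morD[OF assms(2)] g_closed
  by (intro morI) (simp_all add: distrib_left distrib_right)

lemma ten_iso:
  assumes "M \<asymp> M'" "N \<asymp> N'"
  shows "ten M N \<asymp> ten M' N'"
proof -
  obtain P Q where A: "mor M M' P" "mor M' M Q" "Q * P = idn M" "P * Q = idn M'"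
    using assms(1) unfolding hiso_def by blast
  obtain R S where B: "mor N N' R" "mor N' N S" "S * R = idn N" "R * S = idn N'"
    using assms(2) unfolding hiso_def by blast
  show ?thesis
    unfolding hiso_def using mor_ten[OF A(1) B(1)] mor_ten[OF A(2) B(2)] A B
    by (intro exI[of _ "P \<boxtimes> R"] exI[of _ "Q \<boxtimes> S"]) simp
qed

lemma biprod_ten_left:
  assumes "biprod M A B" "hmod N"
  shows "biprod (ten M N) (ten A N) (ten B N)"
proof -
  obtain i1 i2 p1 p2 where M: "mor A M i1" "mor B M i2" "mor M A p1" "mor M B p2"
     "p1 * i1 = idn A" "p2 * i2 = idn B" "p1 * i2 = 0" "p2 * i1 = 0" "i1 * p1 + i2 * p2 = idn M"
    using assms(1) unfolding biprod_def by blast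
  note N = mor_id[OF assms(2)] hmodD(8)[OF assms(2)]
  show ?thesis
    unfolding biprod_def using M(5-) mor_ten[OF M(1) N(1)] mor_ten[OF M(2) N(1)]
      mor_ten[OF M(3) N(1)] mor_ten[OF M(4) N(1)] N(2)
    by (intro exI[of _ "i1 \<boxtimes> idn N"] exI[of _ "i2 \<boxtimes> idn N"] exI[of _ "p1 \<boxtimes> idn N"]
        exI[of _ "p2 \<boxtimes> idn N"]) (simp flip: kron_add_left)
qed

lemma biprod_ten_right:
  assumes "biprod M A B" "hmod N"
  shows "biprod (ten N M) (ten N A) (ten N B)"
proof -
  obtain i1 i2 p1 p2 where M: "mor A M i1" "mor B M i2" "mor M A p1" "mor M B p2"
     "p1 * i1 = idn A" "p2 * i2 = idn B" "p1 * i2 = 0" "p2 * i1 = 0" "i1 * p1 + i2 * p2 = idn M"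
    using assms(1) unfolding biprod_def by blast
  note N = mor_id[OF assms(2)] hmodD(8)[OF assms(2)]
  show ?thesis
    unfolding biprod_def using M(5-) mor_ten[OF N(1) M(1)] mor_ten[OF N(1) M(2)]
      mor_ten[OF N(1) M(3)] mor_ten[OF N(1) M(4)] N(2)
    by (intro exI[of _ "idn N \<boxtimes> i1"] exI[of _ "idn N \<boxtimes> i2"] exI[of _ "idn N \<boxtimes> p1"]
        exI[of _ "idn N \<boxtimes> p2"]) (simp flip: kron_add_right)
qed

lemma ten_assoc:
  assumes "hmod L" "hmod M" "hmod N"
  shows "ten (ten L M) N \<asymp> ten L (ten M N)"
proof -
  have "relm assoc_perm (ten (ten L M) N) = ten L (ten M N)"
    by (simp add: relm_def ten_def kron_assoc[symmetric] relabel_add kron_add_left kron_add_right add.assoc)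
  then show ?thesis
    using relm_iso[OF hmod_ten[OF hmod_ten[OF assms(1,2)] assms(3)] inj_assoc_perm] by simp
qed

definition triv :: "('g, 'k) hm" where
  "triv = HM (munit 0 0) (\<lambda>_. munit 0 0) 0"

text \<open>Multiplication by the power \<open>m\<close> of the class a, realised without changing
  the underlying space; y is unchanged because y acts by zero on the one-dimensional factor, which
  stands on the left (\<open>ten_tw_triv\<close>).\<close>

definition tw :: "nat \<Rightarrow> ('g, 'k) hm \<Rightarrow> ('g, 'k) hm" where
  "tw m M = HM (idn M) (\<lambda>h. inverse (chi h) ^ m \<cdot> act M h) (yop M)"

lemma tw_simps [simp]:
  "idn (tw m M) = idn M" "act (tw m M) h = inverse (chi h) ^ m \<cdot> act M h" "yop (tw m M) = yop M"
  by (simp_all add: tw_def)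

lemma ypow_tw [simp]: "ypow (tw m M) i = ypow M i"
  by (simp add: ypow_def)

lemma triv_simps [simp]: "idn triv = munit 0 0" "act triv h = munit 0 0" "yop triv = 0"
  by (simp_all add: triv_def)

lemma ypow_yop_zero: "yop M = 0 \<Longrightarrow> 0 < i \<Longrightarrow> ypow M i = 0"
  by (cases i) (simp_all add: ypow_Suc)

lemma hmod_triv: "hmod triv"
  unfolding hmod_def grep_def using n_ge_2 by (simp add: munit_mult ypow_yop_zero)

lemma hmod_tw:
  assumes "hmod M"
  shows "hmod (tw m M)"
proof -
  have "inverse (chi (g [^] n)) ^ m = 1"
    using g_closed by (simp add: chi_pow_g root_of_unity)
  then show ?thesis
    using hmodD[OF assms] unfolding hmod_def grep_def
    by (auto simp: chi_one chi_mult power_mult_distrib mult.commute g_closed)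
qed

lemma tw_iso:
  assumes "M \<asymp> N"
  shows "tw m M \<asymp> tw m N"
proof -
  have *: "mor (tw m M) (tw m N) P" if "mor M N P" for M N P
    using morD[OF that] by (intro morI) simp_all
  show ?thesis using assms * unfolding hiso_def by (metis tw_simps(1))
qed

lemma ten_tw_triv:
  assumes "hmod M"
  shows "ten (tw m triv) M \<asymp> tw m M"
proof -
  have "relm (\<lambda>s. prod_encode (0, s)) (tw m M) = ten (tw m triv) M"
    by (simp add: relm_def ten_def tw_def relabel_kron_left[symmetric])
  then show ?thesis
    using relm_iso[OF hmod_tw[OF assms] inj_pair_left] hiso_sym by metis
qed

lemma tw_0: "hmod M \<Longrightarrow> tw 0 M \<asymp> M"
  by (rule hiso_sym, rule hiso_cong) simp_all

lemma ten_triv_left: "hmod M \<Longrightarrow> ten triv M \<asymp> M"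
proof -
  assume M: "hmod M"
  have "ten triv M \<asymp> ten (tw 0 triv) M"
    by (intro ten_iso hiso_refl hiso_sym[OF tw_0] hmod_triv M)
  then show ?thesis using ten_tw_triv[OF M] tw_0[OF M] hiso_trans by blast
qed

lemma ten_triv_right: "hmod M \<Longrightarrow> ten M triv \<asymp> M"
proof -
  assume M: "hmod M"
  have "relm (\<lambda>s. prod_encode (s, 0)) M = ten M triv"
    by (simp add: relm_def ten_def relabel_kron_right[symmetric])
  then show ?thesis using relm_iso[OF M inj_pair_right] hiso_sym by metis
qed

subsection \<open>Numerical invariants\<close>

text \<open>
  \<open>tinv M j h\<close> is the trace of \<open>h\<close> on the subspace \<open>y\<^sup>j M\<close>: the idempotent \<open>y\<^sup>j Z\<close> projects onto it.
\<close>

definition tinv :: "('g, 'k) hm \<Rightarrow> nat \<Rightarrow> 'g \<Rightarrow> 'k" where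
  "tinv M j h = tr (act M h * ypow M j * (SOME Z. ypow M j * Z * ypow M j = ypow M j))"

text \<open>Independence of the quasi-inverse: \<open>A * Z\<close> and \<open>A * W\<close> are
  projections onto the same image, and \<open>h\<close> preserves that image since it commutes with
  \<open>A\<close> up to a scalar. Cyclicity of the trace exchanges them.\<close>

lemma tinv_eq:
  assumes M: "hmod M" and h: "h \<in> carrier G" and Z: "ypow M j * Z * ypow M j = ypow M j"
  shows "tinv M j h = tr (act M h * ypow M j * Z)"
proof -
  define A where "A = ypow M j"
  define W where "W = (SOME Z. A * Z * A = A)"
  have W: "A * W * A = A" unfolding W_def using someI_ex[OF regular] by metis
  have Z': "A * Z * A = A" using Z A_def by simp
  have hA: "act M h * A = inverse (chi h ^ j) \<cdot> (A * act M h)"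
    using ypow_act[OF M h, of j] chi_nonzero[OF h] by (simp add: A_def)
  have "tr (act M h * A * W) = tr (A * Z * (act M h * A * W))"
    using hA Z' by (simp flip: mult.assoc)
  also have "\<dots> = tr (act M h * A * W * (A * Z))" by (rule tr_mult_commute)
  also have "\<dots> = tr (act M h * A * Z)" using W by (metis mult.assoc)
  finally show ?thesis by (simp add: tinv_def A_def W_def)
qed

lemma tinv_0: "hmod M \<Longrightarrow> h \<in> carrier G \<Longrightarrow> tinv M 0 h = tr (act M h)"
  by (subst tinv_eq[of _ _ _ "idn M"]) (simp_all add: hmodD)

lemma tinv_zero: "ypow M j = 0 \<Longrightarrow> tinv M j h = 0"
  by (simp add: tinv_def)

text \<open>Quasi-inverses of the powers of y on the two summands combine to one on the sum.\<close>

lemma tinv_biprod: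
  assumes "biprod M A B" "hmod M" "hmod A" "hmod B" and h: "h \<in> carrier G"
  shows "tinv M j h = tinv A j h + tinv B j h"
proof -
  obtain i1 i2 p1 p2 where M: "mor A M i1" "mor B M i2" "mor M A p1" "mor M B p2"
     "p1 * i1 = idn A" "p2 * i2 = idn B" "p1 * i2 = 0" "p2 * i1 = 0" "i1 * p1 + i2 * p2 = idn M"
    using assms(1) unfolding biprod_def by blast
  obtain Z1 where Z1: "ypow A j * Z1 * ypow A j = ypow A j" using regular by blast
  obtain Z2 where Z2: "ypow B j * Z2 * ypow B j = ypow B j" using regular by blast
  let ?Z = "i1 * Z1 * p1 + i2 * Z2 * p2"
  have 1: "ypow M j * (i1 * Z1 * p1) * ypow M j = i1 * (ypow A j * Z1 * ypow A j) * p1"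
    by (simp only: mult.assoc mor_ypow[OF M(3)] mor_ypow[OF M(1), symmetric])
      (simp only: mor_ypow[OF M(1), symmetric] flip: mult.assoc)
  have 2: "ypow M j * (i2 * Z2 * p2) * ypow M j = i2 * (ypow B j * Z2 * ypow B j) * p2"
    by (simp only: mult.assoc mor_ypow[OF M(4)] mor_ypow[OF M(2), symmetric])
      (simp only: mor_ypow[OF M(2), symmetric] flip: mult.assoc)
  have "ypow M j * ?Z * ypow M j = i1 * ypow A j * p1 + i2 * ypow B j * p2"
    unfolding distrib_left distrib_right 1 2 Z1 Z2 ..
  also have "\<dots> = ypow M j * (i1 * p1 + i2 * p2)"
    using mor_ypow[OF M(1), of j] mor_ypow[OF M(2), of j] by (simp add: distrib_left flip: mult.assoc)
  also have "\<dots> = ypow M j" using M(9) ypow_idn[OF assms(2)] by simp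
  finally have "tinv M j h = tr (act M h * ypow M j * ?Z)"
    by (rule tinv_eq[OF assms(2) h])
  also have "\<dots> = tr (act M h * ypow M j * i1 * Z1 * p1) + tr (act M h * ypow M j * i2 * Z2 * p2)"
    by (simp add: distrib_left mult.assoc)
  also have "act M h * ypow M j * i1 = i1 * (act A h * ypow A j)"
    using mor_ypow[OF M(1), of j] morD(3)[OF M(1) h] by (metis mult.assoc)
  also have "act M h * ypow M j * i2 = i2 * (act B h * ypow B j)"
    using mor_ypow[OF M(2), of j] morD(3)[OF M(2) h] by (metis mult.assoc)
  also have "tr (i1 * (act A h * ypow A j) * Z1 * p1) = tr (p1 * i1 * (act A h * ypow A j * Z1))"
    using tr_mult_commute[of "i1 * (act A h * ypow A j) * Z1" p1] by (simp add: mult.assoc)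
  also have "\<dots> = tinv A j h"
    using tinv_eq[OF assms(3) h Z1] hmodD(9)[OF assms(3) h] M(5) by (simp flip: mult.assoc)
  also have "tr (i2 * (act B h * ypow B j) * Z2 * p2) = tr (p2 * i2 * (act B h * ypow B j * Z2))"
    using tr_mult_commute[of "i2 * (act B h * ypow B j) * Z2" p2] by (simp add: mult.assoc)
  also have "\<dots> = tinv B j h"
    using tinv_eq[OF assms(4) h Z2] hmodD(9)[OF assms(4) h] M(6) by (simp flip: mult.assoc)
  finally show ?thesis .
qed

lemma hmod_zero: "hmod (HM 0 (\<lambda>_. 0) 0)"
  unfolding hmod_def grep_def using n_ge_2 by (simp add: ypow_yop_zero)

text \<open>Turns an isomorphism into a biproduct, so that additive functions are automatically
  invariant under isomorphism.\<close>

lemma biprod_zero: 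
  assumes "M \<asymp> N"
  shows "biprod N M (HM 0 (\<lambda>_. 0) 0)"
proof -
  obtain P Q where A: "mor M N P" "mor N M Q" "Q * P = idn M" "P * Q = idn N"
    using assms unfolding hiso_def by blast
  show ?thesis
    unfolding biprod_def
    by (rule exI[of _ P], rule exI[of _ 0], rule exI[of _ Q], rule exI[of _ 0])
      (use A mor_zero in simp)
qed

lemma tinv_iso:
  assumes "M \<asymp> N" "hmod M" "hmod N" "h \<in> carrier G"
  shows "tinv M j h = tinv N j h"
proof -
  have zero: "ypow (HM 0 (\<lambda>_. 0) 0 :: ('g, 'k) hm) j = 0" by (cases j) (simp_all add: ypow_Suc)
  show ?thesis
    using tinv_biprod[OF biprod_zero[OF assms(1)] assms(3,2) hmod_zero assms(4)]
    by (simp add: tinv_zero[OF zero])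
qed

section \<open>Modules on which y is invertible, and the Fitting decomposition\<close>

definition einv :: "('g, 'k) hm \<Rightarrow> bool" where
  "einv M \<longleftrightarrow> (\<exists>Z. yop M * Z = idn M \<and> Z * yop M = idn M \<and> idn M * Z = Z \<and> Z * idn M = Z)"

lemma einvD:
  assumes "einv M" "hmod M"
  obtains Z where "\<And>j. ypow M j * mpow (idn M) Z j = idn M" "\<And>j. mpow (idn M) Z j * ypow M j = idn M"
    "yop M * Z = idn M" "Z * yop M = idn M" "idn M * Z = Z" "Z * idn M = Z"
proof -
  obtain Z where Z: "yop M * Z = idn M" "Z * yop M = idn M" "idn M * Z = Z" "Z * idn M = Z"
    using assms(1) einv_def by blast
  have Zc: "mpow (idn M) Z j * Z = Z * mpow (idn M) Z j" for j
    by (induction j) (use Z in \<open>simp_all add: mult.assoc\<close>)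
  have e: "idn M * mpow (idn M) Z j = mpow (idn M) Z j" for j
    using Z hmodD(8)[OF assms(2)] by (cases j) (simp_all flip: mult.assoc)
  have 1: "ypow M j * mpow (idn M) Z j = idn M" for j
  proof (induction j)
    case (Suc j)
    have "ypow M (Suc j) * mpow (idn M) Z (Suc j) = yop M * (ypow M j * mpow (idn M) Z j) * Z"
      by (simp add: ypow_Suc mult.assoc Zc)
    then show ?case unfolding Suc using Z hmodD[OF assms(2)] by simp
  qed (use hmodD[OF assms(2)] in simp)
  have 2: "mpow (idn M) Z j * ypow M j = idn M" for j
  proof (induction j)
    case (Suc j)
    have "mpow (idn M) Z (Suc j) * ypow M (Suc j) = mpow (idn M) Z j * (Z * yop M) * ypow M j"
      by (simp add: ypow_Suc mult.assoc Zc[symmetric])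
    then show ?case unfolding Z using Suc ypow_idn[OF assms(2)] by (simp add: mult.assoc)
  qed (use hmodD[OF assms(2)] in simp)
  show thesis using that 1 2 Z by blast
qed

lemma tinv_einv:
  assumes "einv M" "hmod M" "h \<in> carrier G"
  shows "tinv M j h = tr (act M h)"
proof -
  obtain Z where Z: "\<And>j. ypow M j * mpow (idn M) Z j = idn M"
    using einvD[OF assms(1,2)] by metis
  have "tinv M j h = tr (act M h * ypow M j * mpow (idn M) Z j)"
    using Z by (intro tinv_eq assms) (simp add: ypow_idn[OF assms(2)])
  then show ?thesis using Z[of j] hmodD(10)[OF assms(2,3)] by (simp add: mult.assoc)
qed

text \<open>Conjugation by the invertible operator \<open>ypow M m\<close> multiplies the action of
  \<open>h\<close> by a power of \<open>chi h\<close>. In particular the trace is zero unless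
  \<open>chi h = 1\<close>.\<close>

lemma tr_einv:
  assumes "einv M" "hmod M" "h \<in> carrier G"
  shows "tr (act M h) = inverse (chi h) ^ m * tr (act M h)"
proof -
  obtain Z where Z: "\<And>j. ypow M j * mpow (idn M) Z j = idn M" "\<And>j. mpow (idn M) Z j * ypow M j = idn M"
    using einvD[OF assms(1,2)] by metis
  have "tr (act M h) = tr (act M h * ypow M m * mpow (idn M) Z m)"
    using Z(1)[of m] hmodD(10)[OF assms(2,3)] by (simp add: mult.assoc)
  also have "act M h * ypow M m = inverse (chi h) ^ m \<cdot> (ypow M m * act M h)"
    using ypow_act[OF assms(2,3), of m] chi_nonzero[OF assms(3)] by (simp add: power_inverse)
  also have "tr (inverse (chi h) ^ m \<cdot> (ypow M m * act M h) * mpow (idn M) Z m)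
      = inverse (chi h) ^ m * tr (mpow (idn M) Z m * ypow M m * act M h)"
    using tr_mult_commute[of "ypow M m * act M h" "mpow (idn M) Z m"] by (simp add: mult.assoc)
  finally show ?thesis using Z(2)[of m] hmodD(9)[OF assms(2,3)] by simp
qed

text \<open>
  On a nilpotent module, \<open>val M k h\<close> is the trace of \<open>h\<close> on the space of tops of the Jordan blocks of
  length \<open>k\<close> of \<open>y\<close>. The trace on the part of the module where \<open>y\<close> is invertible is put at \<open>k = 0\<close>.
\<close>

definition val :: "('g, 'k) hm \<Rightarrow> nat \<Rightarrow> 'g \<Rightarrow> 'k" where
  "val M k h = (if h \<notin> carrier G \<or> n < k then 0 else if k = 0 then tinv M n h
     else chi h ^ (k - 1) * (tinv M (k - 1) h - tinv M k h)
        - chi h ^ k * (tinv M k h - tinv M (Suc k) h))"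

lemma val_biprod:
  assumes "biprod M A B" "hmod M" "hmod A" "hmod B"
  shows "val M k h = val A k h + val B k h"
  by (simp add: val_def tinv_biprod[OF assms] algebra_simps)

lemma val_iso: "M \<asymp> N \<Longrightarrow> hmod M \<Longrightarrow> hmod N \<Longrightarrow> val M = val N"
  by (intro ext) (simp add: val_def tinv_iso[of M N])

lemma val_dsum: "hmod A \<Longrightarrow> hmod B \<Longrightarrow> val (dsum A B) k h = val A k h + val B k h"
  by (rule val_biprod[OF dsum_biprod hmod_dsum])

lemma val_einv:
  assumes "einv M" "hmod M"
  shows "val M k h = (if h \<in> carrier G \<and> k = 0 then tr (act M h) else 0)"
  using tinv_einv[OF assms] by (simp add: val_def)

lemma einv_if_ypow_inverse:
  assumes "hmod M" "ypow M n * Z = idn M" "Z * ypow M n = idn M"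
  shows "einv M"
proof -
  obtain m where m: "n = Suc m" using n_ge_2 by (cases n) auto
  let ?L = "idn M * Z * ypow M m" and ?R = "ypow M m * Z * idn M"
  have "ypow M n = yop M * ypow M m" "ypow M n = ypow M m * yop M"
    unfolding m by (rule ypow_Suc, rule ypow_Suc_right[OF assms(1)])
  then have LR: "yop M * ?R = idn M" "?L * yop M = idn M"
    using assms hmodD(8)[OF assms(1)] by (metis mult.assoc)+
  have "?L = ?L * (yop M * ?R)" using LR ypow_idn[OF assms(1)] by (simp add: mult.assoc)
  also have "\<dots> = ?R" using LR(2) ypow_idn[OF assms(1)] by (metis mult.assoc)
  finally have "?L = ?R" .
  then show ?thesis
    unfolding einv_def using LR ypow_idn[OF assms(1)] hmodD(8)[OF assms(1)]
    by (intro exI[of _ ?L] conjI) (simp_all add: mult.assoc, simp_all flip: mult.assoc)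
qed

text \<open>The element \<open>u = g [^] n\<close> is central, commutes with y and has finite order.
  The mean of its powers projects onto the part where \<open>u\<close> acts trivially, that is,
  where y^n = u - 1 vanishes; on the complement \<open>u - 1\<close> is invertible.\<close>

lemma fitting:
  assumes "hmod M"
  obtains p where "mor M M p" "p * p = p" "ypow (cut M p) n = 0" "einv (cut M (idn M - p))"
proof -
  note M = hmodD[OF assms]
  define u where "u = g [^] n"
  have u: "u \<in> carrier G" using g_closed u_def by simp
  define N where "N = card (carrier G)"
  have N: "of_nat N \<noteq> (0 :: 'k)" using card_G N_def by simp
  define U where "U i = act M (u [^] (i :: nat))" for i
  have U_Suc: "act M u * U i = U (Suc i)" for i
    unfolding U_def using M(7)[of u "u [^] i"] u nat_pow_Suc2[OF u] by simp
  have U_N: "U N = idn M"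
    unfolding U_def N_def using u finite_carrier M(6) pow_order_eq_1[OF u] by (simp add: Coset.order_def)
  have U_0: "U 0 = idn M" unfolding U_def using M(6) by simp
  have U_central: "U i * act M h = act M h * U i" if h: "h \<in> carrier G" for i h
  proof -
    have "u [^] i = g [^] (n * i)" using g_closed by (simp add: u_def nat_pow_pow)
    then show ?thesis
      unfolding U_def using M(7)[OF h, of "u [^] i"] M(7)[of "u [^] i" h] h u g_pow_central[OF h]
        nat_pow_closed[OF g_closed, of "n * i"] by simp
  qed
  have U_y: "U i * yop M = yop M * U i" for i
  proof -
    have "chi (u [^] i) = 1"
      using u g_closed by (simp add: u_def chi_pow_g root_of_unity)
    then show ?thesis unfolding U_def using M(4)[of "u [^] i"] u by simp
  qed
  have U_e: "idn M * U i = U i" "U i * idn M = U i" for i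
    unfolding U_def using M u by auto
  define p where "p = inverse (of_nat N) \<cdot> (\<Sum>i<N. U i)"
  have up: "act M u * p = p"
  proof -
    have "act M u * (\<Sum>i<N. U i) = (\<Sum>i<N. U (Suc i))" by (simp add: sum_distrib_left U_Suc)
    also have "\<dots> = (\<Sum>i<N. U i)"
      using sum.lessThan_Suc_shift[of U N] U_0 U_N by (simp add: add.commute)
    finally show ?thesis by (simp add: p_def)
  qed
  have Up: "U i * p = p" for i
  proof (induction i)
    case 0
    show ?case by (simp add: U_0 p_def sum_distrib_left U_e)
  next
    case (Suc i)
    then show ?case using up U_Suc by (metis mult.assoc)
  qed
  have p: "mor M M p"
    unfolding p_def
    by (rule morI) (simp_all add: sum_distrib_left sum_distrib_right U_e U_central U_y)
  have pp: "p * p = p"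
  proof -
    have "(\<Sum>i<N. U i) * p = (\<Sum>i<N. 1 \<cdot> p)" by (simp add: sum_distrib_right Up)
    also have "\<dots> = of_nat N \<cdot> p" by (subst smul_sum_left[symmetric]) simp
    finally have "inverse (of_nat N) \<cdot> ((\<Sum>i<N. U i) * p) = p" using N by simp
    then show ?thesis by (subst (1) p_def) simp
  qed
  have "ypow (cut M p) n = 0"
    unfolding ypow_cut[OF assms p pp] M(5) using up morD[OF p] u
    by (simp add: right_diff_distrib u_def)
  moreover have "einv (cut M (idn M - p))"
  proof -
    let ?q = "idn M - p"
    have q: "mor M M ?q" using p mor_id[OF assms] mor_diff by blast
    have qq: "?q * ?q = ?q" using morD[OF p] pp M(8) by (simp add: algebra_simps)
    \<comment> \<open>Summation by parts gives (u - 1) \<Sum>i<N. i u^i = N - \<Sum>i<N. u^i, so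
      \<open>Z\<close> inverts \<open>u - 1\<close> on the image of \<open>?q\<close>.\<close>
    define Z where "Z = inverse (of_nat N) \<cdot> (\<Sum>i<N. of_nat i \<cdot> U i)"
    have sum_telescope: "(\<Sum>i<m. of_nat i \<cdot> (U (Suc i) - U i)) = of_nat m \<cdot> U m - (\<Sum>i<m. U (Suc i))" for m
    proof (induction m)
      case (Suc m)
      have "of_nat (Suc m) \<cdot> U (Suc m) = of_nat m \<cdot> U (Suc m) + U (Suc m)"
        by (simp add: smul_add_left)
      then show ?case unfolding sum.lessThan_Suc Suc by (simp add: smul_diff_right)
    qed simp
    have "(act M u - idn M) * (\<Sum>i<N. of_nat i \<cdot> U i) = (\<Sum>i<N. of_nat i \<cdot> (U (Suc i) - U i))"
      by (simp add: sum_distrib_left left_diff_distrib U_Suc U_e)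
    also have "\<dots> = of_nat N \<cdot> U N - (\<Sum>i<N. U i)"
      unfolding sum_telescope using sum.lessThan_Suc_shift[of U N] U_0 U_N by (simp add: add.commute)
    finally have 1: "(act M u - idn M) * Z = ?q"
      using N U_N by (simp add: Z_def p_def smul_diff_right)
    have "U i * (act M u - idn M) = (act M u - idn M) * U i" for i
      using U_central[OF u] by (simp add: left_diff_distrib right_diff_distrib U_e)
    then have "Z * (act M u - idn M) = (act M u - idn M) * Z"
      unfolding Z_def by (simp add: sum_distrib_left sum_distrib_right)
    then have 2: "Z * (act M u - idn M) = ?q" using 1 by simp
    have Zp: "Z * p = p * Z"
      unfolding Z_def by (simp add: sum_distrib_left sum_distrib_right)
        (intro arg_cong[of _ _ "smul _"] sum.cong refl, metis U_def u morD(3)[OF p] nat_pow_closed)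
    have y: "ypow (cut M ?q) n = ?q * (act M u - idn M)"
      unfolding ypow_cut[OF assms q qq] M(5) u_def ..
    have q_comm: "?q * (act M u - idn M) = (act M u - idn M) * ?q"
      using morD(3)[OF q u] morD(1,2)[OF q] by (simp add: algebra_simps)
    have "Z * idn M = Z" "idn M * Z = Z" unfolding Z_def
      by (simp_all add: sum_distrib_left sum_distrib_right U_e)
    then have Zq: "Z * ?q = ?q * Z" using Zp by (simp add: algebra_simps)
    show ?thesis
    proof (rule einv_if_ypow_inverse[OF hmod_cut[OF assms q qq]])
      show "ypow (cut M ?q) n * (?q * Z) = idn (cut M ?q)"
      proof -
        have "(act M u - idn M) * ?q * (?q * Z) = (act M u - idn M) * (?q * ?q * Z)"
          by (simp only: mult.assoc)
        also have "\<dots> = ?q" unfolding qq Zq[symmetric] using 1 qq by (simp only: flip: mult.assoc)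
        finally show ?thesis unfolding y q_comm by simp
      qed
      show "?q * Z * ypow (cut M ?q) n = idn (cut M ?q)"
      proof -
        have "?q * Z * (?q * (act M u - idn M)) = ?q * (Z * ?q) * (act M u - idn M)"
          by (simp only: mult.assoc)
        also have "\<dots> = ?q * ?q * (Z * (act M u - idn M))" unfolding Zq by (simp only: mult.assoc)
        finally show ?thesis unfolding y 2 qq by simp
      qed
    qed
  qed
  ultimately show thesis using that p pp by blast
qed

subsection \<open>Jordan blocks\<close>

text \<open>
  \<open>jframe m U N s t\<close> exhibits the module \<open>U \<otimes> k[y]/(y\<^sup>m\<^sup>+\<^sup>1)\<close> as a direct summand of \<open>N\<close>: the map \<open>s\<close>
  embeds its top \<open>U\<close>, and \<open>t\<close> projects onto its socle.
\<close>

definition jframe :: "nat \<Rightarrow> ('g, 'k) hm \<Rightarrow> ('g, 'k) hm \<Rightarrow> 'k fmat \<Rightarrow> 'k fmat \<Rightarrow> bool" where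
  "jframe m U N s t \<longleftrightarrow> hmod N \<and> hmod U \<and> yop U = 0 \<and> m < n \<and>
     idn N * s = s \<and> s * idn U = s \<and> (\<forall>h\<in>carrier G. act N h * s = s * act U h) \<and>
     idn U * t = t \<and> t * idn N = t \<and>
     (\<forall>h\<in>carrier G. t * act N h = inverse (chi h) ^ m \<cdot> (act U h * t)) \<and>
     (\<forall>j\<le>m. t * ypow N j * s = (if j = m then idn U else 0)) \<and>
     ypow N (Suc m) * s = 0 \<and> t * ypow N (Suc m) = 0"

text \<open>The map that sends y^i s to y^i s'. The operator t y^(m-i) reads off the coefficient of
  y^i s, since t y^m s = 1 and t y^j s = 0 for all other exponents j. For equal source and target it
  is the projection onto the block.\<close>

definition jmap :: "nat \<Rightarrow> ('g, 'k) hm \<Rightarrow> ('g, 'k) hm \<Rightarrow> 'k fmat \<Rightarrow> 'k fmat \<Rightarrow> 'k fmat" where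
  "jmap m N N' s' t = (\<Sum>i\<le>m. ypow N' i * s' * t * ypow N (m - i))"

text \<open>The equation of traces compares dimensions and forces the block cut out by the frame to
  be the whole of \<open>N\<close> (\<open>block_complete\<close>).\<close>

definition block :: "nat \<Rightarrow> ('g, 'k) hm \<Rightarrow> ('g, 'k) hm \<Rightarrow> bool" where
  "block l U N \<longleftrightarrow> (\<exists>m s t. l = Suc m \<and> jframe m U N s t \<and> tr (idn N) = of_nat l * tr (idn U))"

lemma jframeD:
  assumes "jframe m U N s t"
  shows "hmod N" "hmod U" "yop U = 0" "m < n" "idn N * s = s" "s * idn U = s"
    "\<And>h. h \<in> carrier G \<Longrightarrow> act N h * s = s * act U h" "idn U * t = t" "t * idn N = t"
    "\<And>h. h \<in> carrier G \<Longrightarrow> t * act N h = inverse (chi h) ^ m \<cdot> (act U h * t)"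
    "ypow N (Suc m) * s = 0" "t * ypow N (Suc m) = 0"
  using assms unfolding jframe_def by auto

lemma jframe_ypow:
  assumes "jframe m U N s t"
  shows "t * ypow N j * s = (if j = m then idn U else 0)"
proof (cases "j \<le> m")
  case True
  then show ?thesis using assms unfolding jframe_def by blast
next
  case False
  then have "ypow N j = ypow N (j - Suc m) * ypow N (Suc m)"
    using ypow_add[OF jframeD(1)[OF assms]] by simp
  then have "ypow N j * s = 0" using jframeD(11)[OF assms] by (simp add: mult.assoc)
  then show ?thesis using False by (simp add: mult.assoc)
qed

text \<open>Composition with y shifts the index of summation. The boundary terms vanish because
  \<open>ypow N' (Suc m)\<close> kills \<open>s'\<close> and \<open>t\<close> kills
  \<open>ypow N (Suc m)\<close>.\<close>

lemma jmap_mor: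
  assumes F: "jframe m U N s t" and F': "jframe m U N' s' t'"
  shows "mor N N' (jmap m N N' s' t)"
proof (rule morI)
  note D = jframeD[OF F] and D' = jframeD[OF F']
  let ?P = "jmap m N N' s' t"
  show "idn N' * ?P = ?P"
    using ypow_idn[OF D'(1)] by (simp add: jmap_def sum_distrib_left flip: mult.assoc)
  show "?P * idn N = ?P"
    using ypow_idn[OF D(1)] by (simp add: jmap_def sum_distrib_right mult.assoc)
  have "(\<Sum>i\<le>m. ypow N' i * s' * t * ypow N (m - i) * yop N)
      = (\<Sum>i\<le>m. ypow N' i * s' * t * ypow N (Suc m - i))"
    by (intro sum.cong refl) (simp add: Suc_diff_le mult.assoc ypow_Suc_right[OF D(1)])
  also have "\<dots> = (\<Sum>i\<le>Suc m. ypow N' i * s' * t * ypow N (Suc m - i))"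
    using D'(11) D(12) by simp
  also have "\<dots> = (\<Sum>i\<le>m. ypow N' (Suc i) * s' * t * ypow N (m - i))"
    using D(12) by (subst sum.atMost_Suc_shift) (simp add: mult.assoc)
  finally show "?P * yop N = yop N' * ?P"
    by (simp add: jmap_def sum_distrib_left sum_distrib_right ypow_Suc mult.assoc)
  fix h assume h: "h \<in> carrier G"
  have "ypow N' i * s' * t * ypow N (m - i) * act N h = act N' h * (ypow N' i * s' * t * ypow N (m - i))"
    if i: "i \<le> m" for i
  proof -
    have "act N' h * ypow N' i = inverse (chi h) ^ i \<cdot> (ypow N' i * act N' h)"
      using ypow_act[OF D'(1) h, of i] chi_nonzero[OF h] by (simp add: power_inverse)
    then have 1: "act N' h * (ypow N' i * s' * t * ypow N (m - i))
        = inverse (chi h) ^ i \<cdot> (ypow N' i * (act N' h * s') * t * ypow N (m - i))"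
      by (simp flip: mult.assoc)
    have "chi h ^ (m - i) * inverse (chi h) ^ m = inverse (chi h) ^ i"
      using i chi_nonzero[OF h] by (simp add: power_diff power_inverse field_simps)
    then have "t * (ypow N (m - i) * act N h) = inverse (chi h) ^ i \<cdot> (act U h * t * ypow N (m - i))"
      unfolding ypow_act[OF D(1) h] using D(10)[OF h] by (simp flip: mult.assoc)
    then have "ypow N' i * s' * t * ypow N (m - i) * act N h
        = inverse (chi h) ^ i \<cdot> (ypow N' i * (s' * act U h) * t * ypow N (m - i))"
      by (simp add: mult.assoc)
    with 1 D'(7)[OF h] show ?thesis by simp
  qed
  then show "?P * act N h = act N' h * ?P"
    by (simp add: jmap_def sum_distrib_left sum_distrib_right)
qed

lemma jmap_cross:
  assumes "hmod N'" "\<And>k. t' * ypow N' k * s' = (if k = m \<and> b then e else 0)"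
    and "m = m' \<Longrightarrow> s'' * e = s''"
  shows "jmap m' N' N'' s'' t' * jmap m N N' s' t = (if b \<and> m = m' then jmap m N N'' s'' t else
    (\<Sum>i\<le>m'. \<Sum>j\<le>m. if b \<and> m' - i + j = m then
       ypow N'' i * s'' * e * t * ypow N (m - j) else 0))"
proof -
  have *: "ypow N'' i * s'' * t' * ypow N' (m' - i) * (ypow N' j * s' * t * ypow N (m - j))
      = (if b \<and> m' - i + j = m then ypow N'' i * s'' * e * t * ypow N (m - j) else 0)" for i j
  proof -
    have "ypow N'' i * s'' * t' * ypow N' (m' - i) * (ypow N' j * s' * t * ypow N (m - j))
        = ypow N'' i * s'' * (t' * (ypow N' (m' - i) * ypow N' j) * s') * t * ypow N (m - j)"
      by (simp add: mult.assoc)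
    then show ?thesis unfolding ypow_add[OF assms(1)] assms(2) by (simp add: mult.assoc)
  qed
  have "jmap m' N' N'' s'' t' * jmap m N N' s' t = (\<Sum>i\<le>m'. \<Sum>j\<le>m.
      if b \<and> m' - i + j = m then ypow N'' i * s'' * e * t * ypow N (m - j) else 0)"
    by (simp only: jmap_def sum_product *)
  moreover have "\<dots> = jmap m N N'' s'' t" if "b" "m = m'"
  proof -
    have "(\<Sum>j\<le>m. if b \<and> m' - i + j = m then ypow N'' i * s'' * e * t * ypow N (m - j) else 0)
        = ypow N'' i * s'' * t * ypow N (m - i)" if i: "i \<le> m" for i
    proof -
      have "(\<Sum>j\<le>m. if b \<and> m' - i + j = m then ypow N'' i * s'' * e * t * ypow N (m - j) else 0)
          = (\<Sum>j\<le>m. if i = j then ypow N'' i * s'' * e * t * ypow N (m - j) else 0)"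
        using that \<open>b\<close> \<open>m = m'\<close> by (intro sum.cong refl) auto
      also have "\<dots> = ypow N'' i * (s'' * e) * t * ypow N (m - i)" using i by (simp add: mult.assoc)
      finally show ?thesis using assms(3) \<open>m = m'\<close> by simp
    qed
    then show ?thesis using that by (simp add: jmap_def)
  qed
  ultimately show ?thesis by auto
qed

lemma jmap_comp:
  assumes F: "jframe m U N' s' t'" and s: "s'' * idn U = s''"
  shows "jmap m N' N'' s'' t' * jmap m N N' s' t = jmap m N N'' s'' t"
  using jmap_cross[of N' t' s' m True "idn U" m s'' N'' N t] jframe_ypow[OF F] jframeD(1)[OF F] s
  by simp

lemma jmap_orth:
  assumes "hmod N'" "\<And>k. t' * ypow N' k * s' = 0"
  shows "jmap m' N' N'' s'' t' * jmap m N N' s' t = 0"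
proof -
  have "ypow N'' i * s'' * t' * ypow N' (m' - i) * (ypow N' j * s' * t * ypow N (m - j))
      = ypow N'' i * s'' * (t' * (ypow N' (m' - i) * ypow N' j) * s') * t * ypow N (m - j)" for i j
    by (simp add: mult.assoc)
  then show ?thesis unfolding jmap_def sum_product ypow_add[OF assms(1)] assms(2) by simp
qed

text \<open>A cyclic move under the trace brings t y^m s = 1 together. The power of
  \<open>chi h\<close> comes from moving \<open>h\<close> past \<open>ypow N i\<close>.\<close>

lemma jmap_tr:
  assumes F: "jframe m U N s t" and h: "h \<in> carrier G"
  shows "tr (act N h * (ypow N i * s * t * ypow N (m - i)))
    = (if i \<le> m then inverse (chi h) ^ i * tr (act U h) else
        tr (act N h * (ypow N i * s * t * ypow N (m - i))))"
proof (cases "i \<le> m")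
  case True
  note D = jframeD[OF F]
  have "act N h * ypow N i = inverse (chi h) ^ i \<cdot> (ypow N i * act N h)"
    using ypow_act[OF D(1) h, of i] chi_nonzero[OF h] by (simp add: power_inverse)
  then have "act N h * (ypow N i * s * t * ypow N (m - i))
      = inverse (chi h) ^ i \<cdot> (ypow N i * (act N h * s) * t * ypow N (m - i))"
    by (simp flip: mult.assoc)
  then have "tr (act N h * (ypow N i * s * t * ypow N (m - i)))
      = inverse (chi h) ^ i * tr (ypow N i * s * (act U h * t * ypow N (m - i)))"
    by (simp add: D(7)[OF h] mult.assoc)
  also have "tr (ypow N i * s * (act U h * t * ypow N (m - i)))
      = tr (act U h * (t * (ypow N (m - i) * ypow N i) * s))"
    by (subst tr_mult_commute) (simp add: mult.assoc)
  also have "\<dots> = tr (act U h)"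
    unfolding ypow_add[OF D(1)] using jframe_ypow[OF F, of m] True hmodD(10)[OF D(2) h] by simp
  finally show ?thesis using True by simp
qed simp

lemma jframe_idempotent:
  assumes F: "jframe m U N s t"
  defines "p \<equiv> jmap m N N s t"
  shows "mor N N p" "p * p = p" "tr p = of_nat (Suc m) * tr (idn U)" "p * s = s" "t * p = t"
proof -
  note D = jframeD[OF F]
  show "mor N N p" unfolding p_def by (rule jmap_mor[OF F F])
  show "p * p = p" unfolding p_def by (rule jmap_comp[OF F D(6)])
  have "tr (ypow N i * s * t * ypow N (m - i)) = tr (idn U)" if "i \<le> m" for i
  proof -
    have "idn N * (ypow N i * s * t * ypow N (m - i)) = ypow N i * s * t * ypow N (m - i)"
      using ypow_idn[OF D(1)] by (simp flip: mult.assoc)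
    then show ?thesis
      using jmap_tr[OF F one_closed, of i] that hmodD(6)[OF D(1)] hmodD(6)[OF D(2)]
      by (simp add: chi_one)
  qed
  then show "tr p = of_nat (Suc m) * tr (idn U)" by (simp add: p_def jmap_def tr_sum)
  have "p * s = (\<Sum>i\<le>m. ypow N i * s * (t * ypow N (m - i) * s))"
    by (simp add: p_def jmap_def sum_distrib_right mult.assoc)
  also have "\<dots> = (\<Sum>i\<le>m. if i = 0 then s else 0)"
    unfolding jframe_ypow[OF F] using D by (intro sum.cong refl) (auto simp: mult.assoc)
  finally show "p * s = s" by simp
  have "t * p = (\<Sum>i\<le>m. t * ypow N i * s * t * ypow N (m - i))"
    by (simp add: p_def jmap_def sum_distrib_left mult.assoc)
  also have "\<dots> = (\<Sum>i\<le>m. if i = m then t else 0)"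
    unfolding jframe_ypow[OF F] using D by (intro sum.cong refl) auto
  finally show "t * p = t" by simp
qed

lemma jframe_cut:
  assumes F: "jframe m U N s t"
  shows "block (Suc m) U (cut N (jmap m N N s t))"
proof -
  note D = jframeD[OF F] and P = jframe_idempotent[OF F]
  let ?p = "jmap m N N s t"
  have y: "ypow (cut N ?p) i = ?p * ypow N i" for i by (rule ypow_cut[OF D(1) P(1,2)])
  have "jframe m U (cut N ?p) s t"
    unfolding jframe_def y cut_simps
  proof (intro conjI ballI allI impI)
    show "?p * act N h * s = s * act U h" if "h \<in> carrier G" for h
      using D(7)[OF that] P(4) by (simp add: mult.assoc) (simp flip: mult.assoc)
    show "t * (?p * act N h) = inverse (chi h) ^ m \<cdot> (act U h * t)" if "h \<in> carrier G" for h
      using D(10)[OF that] P(5) by (simp flip: mult.assoc)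
    show "t * (?p * ypow N j) * s = (if j = m then idn U else 0)" for j
      using jframe_ypow[OF F, of j] P(5) by (simp flip: mult.assoc)
    show "?p * ypow N (Suc m) * s = 0" using D(11) by (simp add: mult.assoc)
    show "t * (?p * ypow N (Suc m)) = 0" using D(12) P(5) by (simp flip: mult.assoc)
  qed (use D P hmod_cut[OF D(1) P(1,2)] in auto)
  then show ?thesis unfolding block_def using P(3) by auto
qed

lemma block_complete:
  assumes "block l U N"
  obtains m s t where "l = Suc m" "jframe m U N s t" "jmap m N N s t = idn N"
proof -
  obtain m s t where m: "l = Suc m" "jframe m U N s t" "tr (idn N) = of_nat l * tr (idn U)"
    using assms block_def by blast
  note P = jframe_idempotent[OF m(2)] and D = jframeD[OF m(2)]
  have "jmap m N N s t = idn N"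
    by (rule idempotent_eq_if_tr_eq[OF hmodD(8)[OF D(1)] P(2) morD(1,2)[OF P(1)]])
      (simp only: P(3) m(1,3))
  then show thesis using that m by blast
qed

lemma blockD:
  assumes "block l U N"
  shows "hmod N" "hmod U" "yop U = 0" "1 \<le> l" "l \<le> n" "ypow N l = 0"
proof -
  obtain m s t where m: "l = Suc m" "jframe m U N s t" "jmap m N N s t = idn N"
    using block_complete[OF assms] .
  note D = jframeD[OF m(2)]
  show "hmod N" "hmod U" "yop U = 0" "1 \<le> l" "l \<le> n" using D m(1) by auto
  have "ypow N l = ypow N l * jmap m N N s t" using m(3) ypow_idn[OF D(1)] by simp
  also have "\<dots> = (\<Sum>i\<le>m. ypow N i * (ypow N (Suc m) * s) * t * ypow N (m - i))"
    by (simp add: jmap_def sum_distrib_left m(1) ypow_add[OF D(1)] add.commute flip: mult.assoc)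
  finally show "ypow N l = 0" using D(11) by simp
qed

lemma block_unique:
  assumes "block l U N" "block l U N'"
  shows "N \<asymp> N'"
proof -
  obtain m s t where m: "l = Suc m" "jframe m U N s t" "jmap m N N s t = idn N"
    using block_complete[OF assms(1)] .
  obtain m' s' t' where m': "l = Suc m'" "jframe m' U N' s' t'" "jmap m' N' N' s' t' = idn N'"
    using block_complete[OF assms(2)] .
  have "m' = m" using m m' by simp
  note F = m(2) and F' = m'(2)[unfolded this]
  show ?thesis
    unfolding hiso_def
  proof (intro exI conjI)
    show "mor N N' (jmap m N N' s' t)" by (rule jmap_mor[OF F F'])
    show "mor N' N (jmap m N' N s t')" by (rule jmap_mor[OF F' F])
    show "jmap m N' N s t' * jmap m N N' s' t = idn N"
      using jmap_comp[OF F' jframeD(6)[OF F]] m(3) by simp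
    show "jmap m N N' s' t * jmap m N' N s t' = idn N'"
      using jmap_comp[OF F jframeD(6)[OF F']] m'(3) \<open>m' = m\<close> by simp
  qed
qed

lemma hiso_tr: "M \<asymp> N \<Longrightarrow> hmod M \<Longrightarrow> hmod N \<Longrightarrow> h \<in> carrier G \<Longrightarrow> tr (act M h) = tr (act N h)"
  using tinv_iso[of M N h 0] tinv_0 by simp

lemma block_base:
  assumes "block l U N" "U \<asymp> U'" "hmod U'"
  shows "block l U' N"
proof -
  obtain m s t where m: "l = Suc m" "jframe m U N s t" "tr (idn N) = of_nat l * tr (idn U)"
    using assms(1) block_def by blast
  note D = jframeD[OF m(2)]
  obtain P Q where PQ: "mor U U' P" "mor U' U Q" "Q * P = idn U" "P * Q = idn U'"
    using assms(2) unfolding hiso_def by blast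
  have "yop U' = yop U' * (P * Q)" using PQ hmodD(3)[OF assms(3)] by simp
  also have "\<dots> = 0" using morD(4)[OF PQ(1)] D(3) by (metis mult.assoc mult_zero_left mult_zero_right)
  finally have y: "yop U' = 0" .
  have "jframe m U' N (s * Q) (P * t)"
    unfolding jframe_def
  proof (intro conjI ballI allI impI)
    show "act N h * (s * Q) = s * Q * act U' h" if "h \<in> carrier G" for h
      using D(7)[OF that] morD(3)[OF PQ(2) that] by (metis mult.assoc)
    show "P * t * act N h = inverse (chi h) ^ m \<cdot> (act U' h * (P * t))" if "h \<in> carrier G" for h
      using D(10)[OF that] morD(3)[OF PQ(1) that] by (simp add: mult.assoc) (metis mult.assoc)
    show "P * t * ypow N j * (s * Q) = (if j = m then idn U' else 0)" for j
    proof -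
      have "P * t * ypow N j * (s * Q) = P * (t * ypow N j * s) * Q" by (simp add: mult.assoc)
      then show ?thesis unfolding jframe_ypow[OF m(2)] using PQ morD(2)[OF PQ(1)] by simp
    qed
    show "idn N * (s * Q) = s * Q" "ypow N (Suc m) * (s * Q) = 0"
      using D(5,11) by (simp_all flip: mult.assoc)
    show "P * t * idn N = P * t" "P * t * ypow N (Suc m) = 0"
      using D(9,12) by (simp_all add: mult.assoc)
    show "s * Q * idn U' = s * Q" using morD(2)[OF PQ(2)] by (simp add: mult.assoc)
    show "idn U' * (P * t) = P * t" using morD(1)[OF PQ(1)] by (simp flip: mult.assoc)
  qed (use D assms(3) y in auto)
  moreover have "tr (idn U) = tr (idn U')"
    using hiso_tr[OF assms(2) D(2) assms(3) one_closed] hmodD(6)[OF D(2)] hmodD(6)[OF assms(3)] by simp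
  ultimately show ?thesis unfolding block_def using m by auto
qed

lemma block_iso:
  assumes "block l U N" "N \<asymp> N'" "hmod N'"
  shows "block l U N'"
proof -
  obtain m s t where m: "l = Suc m" "jframe m U N s t" "tr (idn N) = of_nat l * tr (idn U)"
    using assms(1) block_def by blast
  note D = jframeD[OF m(2)]
  obtain P Q where PQ: "mor N N' P" "mor N' N Q" "Q * P = idn N" "P * Q = idn N'"
    using assms(2) unfolding hiso_def by blast
  have Ps: "Q * (P * (ypow N i * s)) = ypow N i * s" for i
    using PQ(3) ypow_idn[OF D(1)] by (simp flip: mult.assoc)
  have yQ: "ypow N' i * (P * x) = P * (ypow N i * x)" "Q * (ypow N' i * x) = ypow N i * (Q * x)" for i x
    using mor_ypow[OF PQ(1)] mor_ypow[OF PQ(2)] by (simp_all flip: mult.assoc)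
  have "jframe m U N' (P * s) (t * Q)"
    unfolding jframe_def
  proof (intro conjI ballI allI impI)
    show "act N' h * (P * s) = P * s * act U h" if "h \<in> carrier G" for h
      using D(7)[OF that] morD(3)[OF PQ(1) that] by (metis mult.assoc)
    show "t * Q * act N' h = inverse (chi h) ^ m \<cdot> (act U h * (t * Q))" if "h \<in> carrier G" for h
      using D(10)[OF that] morD(3)[OF PQ(2) that] by (metis mult.assoc smul_mult_left)
    show "t * Q * ypow N' j * (P * s) = (if j = m then idn U else 0)" for j
      using jframe_ypow[OF m(2), of j] by (simp add: mult.assoc yQ Ps)
    show "ypow N' (Suc m) * (P * s) = 0" using D(11) by (simp add: yQ)
    have "Q * ypow N' (Suc m) = ypow N (Suc m) * Q" by (rule mor_ypow[OF PQ(2)])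
    then show "t * Q * ypow N' (Suc m) = 0"
      using D(12) by (simp add: mult.assoc) (simp flip: mult.assoc)
    show "idn N' * (P * s) = P * s" using morD(1)[OF PQ(1)] by (simp flip: mult.assoc)
    show "t * Q * idn N' = t * Q" using morD(2)[OF PQ(2)] by (simp add: mult.assoc)
    show "P * s * idn U = P * s" using D(6) by (simp add: mult.assoc)
    show "idn U * (t * Q) = t * Q" using D(8) by (simp flip: mult.assoc)
  qed (use D assms(3) in auto)
  moreover have "tr (idn N) = tr (idn N')"
    using hiso_tr[OF assms(2) D(1) assms(3) one_closed] hmodD(6)[OF D(1)] hmodD(6)[OF assms(3)] by simp
  ultimately show ?thesis unfolding block_def using m by auto
qed

text \<open>The image of \<open>ypow N j\<close> is the sum of the layers y^i U with j \<le> i < l,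
  and on the layer y^i U the element \<open>h\<close> acts as on \<open>U\<close>, times the power
  \<open>i\<close> of \<open>inverse (chi h)\<close>.\<close>

lemma tinv_block:
  assumes "block l U N" "h \<in> carrier G"
  shows "tinv N j h = (\<Sum>i\<in>{j..<l}. inverse (chi h) ^ i) * tr (act U h)"
proof -
  obtain m s t where m: "l = Suc m" "jframe m U N s t" "jmap m N N s t = idn N"
    using block_complete[OF assms(1)] .
  note D = jframeD[OF m(2)] and N = blockD[OF assms(1)]
  let ?F = "\<lambda>i. ypow N i * s * t * ypow N (m - i)"
  \<comment> \<open>The quasi-inverse of \<open>ypow N j\<close> that lowers y^i s to y^(i-j)
    s.\<close>
  define Z where "Z = (\<Sum>i\<in>{j..<l}. ypow N (i - j) * s * t * ypow N (m - i))"
  have YZ: "ypow N j * Z = (\<Sum>i\<in>{j..<l}. ?F i)"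
    unfolding Z_def by (simp add: sum_distrib_left ypow_add[OF N(1)] flip: mult.assoc)
  have "?F i * ypow N j = 0" if "i < j" "j \<le> m" for i
  proof -
    have "m - i + j = (j - i - 1) + Suc m" using that by simp
    then have "t * ypow N (m - i) * ypow N j = t * ypow N (Suc m) * ypow N (j - i - 1)"
      by (metis ypow_add[OF N(1)] add.commute mult.assoc)
    then have "t * (ypow N (m - i) * ypow N j) = 0" using D(12) by (simp add: mult.assoc)
    then show ?thesis by (simp add: mult.assoc)
  qed
  then have "(\<Sum>i<j. ?F i * ypow N j) = 0" if "j \<le> m" using that by simp
  moreover have "ypow N j = 0" if "\<not> j \<le> m" using that ypow_ge_zero[OF N(1,6)] m(1) by simp
  ultimately have "ypow N j * Z * ypow N j = ypow N j"
  proof (cases "j \<le> m")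
    case True
    have "ypow N j = jmap m N N s t * ypow N j" using m(3) ypow_idn[OF N(1)] by simp
    also have "\<dots> = (\<Sum>i<l. ?F i * ypow N j)"
      by (simp add: jmap_def sum_distrib_right m(1) lessThan_Suc_atMost)
    also have "\<dots> = (\<Sum>i<j. ?F i * ypow N j) + (\<Sum>i\<in>{j..<l}. ?F i * ypow N j)"
      using True m(1) sum.atLeastLessThan_concat[of 0 j l "\<lambda>i. ?F i * ypow N j"]
      by (simp add: lessThan_atLeast0 del: sum.op_ivl_Suc)
    finally show ?thesis
      using \<open>j \<le> m \<Longrightarrow> (\<Sum>i<j. ?F i * ypow N j) = 0\<close> True by (simp add: YZ sum_distrib_right)
  qed simp
  then have "tinv N j h = tr (act N h * (ypow N j * Z))"
    using tinv_eq[OF N(1) assms(2)] by (simp add: mult.assoc)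
  also have "\<dots> = (\<Sum>i\<in>{j..<l}. tr (act N h * ?F i))"
    unfolding YZ by (simp add: sum_distrib_left tr_sum)
  also have "\<dots> = (\<Sum>i\<in>{j..<l}. inverse (chi h) ^ i * tr (act U h))"
    using m(1) by (intro sum.cong refl) (subst jmap_tr[OF m(2) assms(2)], simp)
  finally show ?thesis by (simp add: sum_distrib_right)
qed

text \<open>\<open>chi h ^ i * (tinv N i h - tinv N (Suc i) h)\<close> is the trace on the tops of
  the blocks longer than \<open>i\<close>. The difference of two consecutive such terms leaves the
  blocks of length exactly \<open>k\<close>.\<close>

lemma val_block:
  assumes "block l U N"
  shows "val N k h = (if h \<in> carrier G \<and> k = l then tr (act U h) else 0)"
proof (cases "h \<in> carrier G \<and> k \<le> n")
  case True
  then have h: "h \<in> carrier G" by simp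
  note N = blockD[OF assms]
  have diff: "chi h ^ i * (tinv N i h - tinv N (Suc i) h) = (if i < l then tr (act U h) else 0)" for i
  proof (cases "i < l")
    case True
    then have "{i..<l} = insert i {Suc i..<l}" by auto
    then show ?thesis
      using True chi_nonzero[OF h] by (simp add: tinv_block[OF assms h] distrib_right power_inverse)
  qed (simp add: tinv_block[OF assms h])
  show ?thesis
  proof (cases k)
    case 0
    then show ?thesis using True N(4,5) by (simp add: val_def tinv_block[OF assms h])
  next
    case (Suc i)
    then show ?thesis using True diff[of i] diff[of "Suc i"] by (auto simp: val_def)
  qed
qed (use blockD(5)[OF assms] in \<open>auto simp: val_def\<close>)

text \<open>Orthogonality makes the sum of the two block projections an idempotent, and by the count
  of dimensions it is the identity.\<close>

lemma two_frames:
  assumes F1: "jframe m1 U1 N s1 t1" and F2: "jframe m2 U2 N s2 t2"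
    and orth: "\<And>k. t1 * ypow N k * s2 = 0" "\<And>k. t2 * ypow N k * s1 = 0"
    and trN: "tr (idn N) = of_nat (Suc m1) * tr (idn U1) + of_nat (Suc m2) * tr (idn U2)"
  obtains N1 N2 where "biprod N N1 N2" "block (Suc m1) U1 N1" "block (Suc m2) U2 N2"
proof -
  let ?p = "jmap m1 N N s1 t1" and ?p2 = "jmap m2 N N s2 t2"
  note N = jframeD(1)[OF F1] and P = jframe_idempotent[OF F1] and P2 = jframe_idempotent[OF F2]
  have o: "?p * ?p2 = 0" "?p2 * ?p = 0"
    using jmap_orth[OF N orth(1)] jmap_orth[OF N orth(2)] by auto
  have "(?p + ?p2) * (?p + ?p2) = ?p + ?p2"
    by (simp only: distrib_left distrib_right P(2) P2(2) o) simp
  moreover have "tr (?p + ?p2) = tr (idn N)" by (simp only: tr_add P(3) P2(3) trN)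
  ultimately have "?p + ?p2 = idn N"
    using morD(1,2)[OF mor_add[OF P(1) P2(1)]] by (intro idempotent_eq_if_tr_eq[OF hmodD(8)[OF N]])
  then have "idn N - ?p = ?p2" by (simp add: algebra_simps)
  then show thesis
    using that biprod_cut[OF N P(1,2)] jframe_cut[OF F1] jframe_cut[OF F2] by metis
qed

subsection \<open>Decomposition into blocks\<close>

text \<open>If the power \<open>m + 1\<close> of y vanishes, the image of \<open>ypow N m\<close> is
  the socle of all blocks of length \<open>m + 1\<close> together. A projection \<open>f\<close>
  onto it serves as the map to the socle. What remains is a section \<open>s\<close> that satisfies
  all the conditions of \<open>jframe\<close>.\<close>

lemma split_block:
  assumes N: "hmod N" and m: "m < n" and nil: "ypow N (Suc m) = 0"
  obtains U p where "mor N N p" "p * p = p" "block (Suc m) U (cut N p)"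
    "ypow (cut N (idn N - p)) m = 0"
proof -
  note D = hmodD[OF N]
  let ?Y = "ypow N m"
  have act_g: "act N (g [^] n) = idn N"
    using D(5) ypow_ge_zero[OF N nil, of n] m by simp
  obtain Z where Z: "?Y * Z * ?Y = ?Y" "idn N * Z = Z" "Z * idn N = Z"
    "\<And>h. h \<in> carrier G \<Longrightarrow> act N h * Z = chi h ^ m \<cdot> (Z * act N h)"
    by (rule twisted_regular[OF D(1) D(1), of "\<lambda>h. chi h ^ m" ?Y])
      (use ypow_idn[OF N] ypow_act[OF N] chi_nonzero in \<open>auto simp: chi_mult power_mult_distrib\<close>)
  define f where "f = ?Y * Z"
  have ff: "f * f = f" unfolding f_def using Z(1) by (simp flip: mult.assoc)
  have ef: "idn N * f = f" "f * idn N = f"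
    unfolding f_def using ypow_idn[OF N] Z(3) by (simp_all add: mult.assoc) (simp flip: mult.assoc)
  have fY: "f * ?Y = ?Y" using Z(1) by (simp add: f_def)
  have fh: "f * act N h = act N h * f" if h: "h \<in> carrier G" for h
  proof -
    have "chi h ^ m \<cdot> (act N h * f) = ?Y * act N h * Z"
      unfolding f_def ypow_act[OF N h] by (simp add: mult.assoc)
    also have "\<dots> = chi h ^ m \<cdot> (f * act N h)"
      by (simp add: mult.assoc Z(4)[OF h] f_def)
    finally show ?thesis using chi_nonzero[OF h] smul_cancel by (metis power_not_zero)
  qed
  \<comment> \<open>The image of \<open>f\<close> is the socle. The factor \<open>chi h ^ m\<close>
    turns its group action into that of the top.\<close>
  define U where "U = HM f (\<lambda>h. chi h ^ m \<cdot> (f * act N h)) (0 :: 'k fmat)"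
  have Us: "idn U = f" "act U h = chi h ^ m \<cdot> (f * act N h)" "yop U = 0" for h
    by (simp_all add: U_def)
  have ffx: "f * (f * x) = f * x" for x using ff by (simp flip: mult.assoc)
  have "hmod U"
    unfolding hmod_def grep_def Us
  proof (intro conjI ballI)
    show "chi \<one> ^ m \<cdot> (f * act N \<one>) = f" using D(6) ef by (simp add: chi_one)
    show "chi (h \<otimes> k) ^ m \<cdot> (f * act N (h \<otimes> k))
        = chi h ^ m \<cdot> (f * act N h) * (chi k ^ m \<cdot> (f * act N k))"
      if "h \<in> carrier G" "k \<in> carrier G" for h k
    proof -
      have "f * act N h * (f * act N k) = f * f * act N h * act N k"
        using fh[OF that(1)] by (metis mult.assoc)
      then show ?thesis
        using that by (simp add: ff D(7) chi_mult power_mult_distrib mult.assoc mult.commute)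
    qed
    have "chi (g [^] n) = 1" using g_closed by (simp add: chi_pow_g root_of_unity)
    then show "ypow U n = chi (g [^] n) ^ m \<cdot> (f * act N (g [^] n)) - f"
      using n_ge_2 by (simp add: ypow_yop_zero Us act_g ef)
  qed (auto simp: ff)
  have high: "ypow N i = 0" if "m < i" for i
    using that ypow_ge_zero[OF N nil] by simp
  \<comment> \<open>The section \<open>Z * f\<close> is right in degree \<open>m\<close>. The
    unwanted values in the degrees m-1, m-2, ... are removed one after the other, and
    \<open>r\<close> counts how many are already zero.\<close>
  have "\<exists>s. idn N * s = s \<and> s * f = s \<and> (\<forall>h\<in>carrier G. act N h * s = s * act U h) \<and>
      f * ?Y * s = f \<and> (\<forall>j. m - r \<le> j \<and> j < m \<longrightarrow> f * ypow N j * s = 0)" if "r \<le> m" for r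
    using that
  proof (induction r)
    case 0
    have "idn N * (Z * f) = Z * f" using Z(2) by (simp flip: mult.assoc)
    moreover have "act N h * (Z * f) = Z * f * act U h" if h: "h \<in> carrier G" for h
    proof -
      have "act N h * (Z * f) = chi h ^ m \<cdot> (Z * (act N h * f))"
        using Z(4)[OF h] by (simp flip: mult.assoc)
      then show ?thesis by (simp add: Us mult.assoc ffx fh[OF h, symmetric])
    qed
    moreover have "f * ?Y * (Z * f) = f" using fY ff by (simp add: f_def flip: mult.assoc)
    ultimately show ?case using ff by (intro exI[of _ "Z * f"]) (auto simp: mult.assoc)
  next
    case (Suc r)
    then obtain s where s: "idn N * s = s" "s * f = s"
        "\<And>h. h \<in> carrier G \<Longrightarrow> act N h * s = s * act U h"
        "f * ?Y * s = f" "\<And>j. m - r \<le> j \<Longrightarrow> j < m \<Longrightarrow> f * ypow N j * s = 0"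
      by auto
    define j0 where "j0 = m - Suc r"
    have j0: "Suc r + j0 = m" using Suc.prems j0_def by simp
    \<comment> \<open>The unwanted value in degree \<open>j0\<close>. Subtracting
      \<open>ypow N (Suc r) * s * a\<close> cancels it, because \<open>f * ?Y * s = f\<close>, and
      changes nothing in higher degrees, where the shifted exponent exceeds
      \<open>m\<close>.\<close>
    define a where "a = f * ypow N j0 * s"
    define s' where "s' = s - ypow N (Suc r) * s * a"
    have af: "f * a = a" "a * f = a"
      unfolding a_def using s(2) by (simp_all add: mult.assoc ffx)
    have 1: "idn N * s' = s'" "s' * f = s'"
      using s(1,2) af ypow_idn[OF N] by (simp_all add: s'_def algebra_simps) (simp flip: mult.assoc)
    have 2: "act N h * s' = s' * act U h" if h: "h \<in> carrier G" for h
    proof -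
      have c: "chi h \<noteq> 0" using chi_nonzero[OF h] .
      have sw: "act N h * ypow N i = inverse (chi h) ^ i \<cdot> (ypow N i * act N h)" for i
        using ypow_act[OF N h, of i] c by (simp add: power_inverse)
      have "a * act U h = f * ypow N j0 * (act N h * s)"
        using s(3)[OF h] by (simp add: a_def mult.assoc)
      also have "\<dots> = chi h ^ j0 \<cdot> (f * act N h * (ypow N j0 * s))"
        by (simp add: ypow_act[OF N h] mult.assoc flip: mult.assoc[of "ypow N j0"])
      finally have aU: "a * act U h = chi h ^ j0 \<cdot> (f * act N h * (ypow N j0 * s))" .
      have "act U h * a = chi h ^ m \<cdot> (f * act N h * (ypow N j0 * s))"
        using fh[OF h] by (simp add: Us a_def mult.assoc) (simp add: ffx flip: mult.assoc, simp add: mult.assoc ffx)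
      then have "act U h * a = chi h ^ Suc r \<cdot> (a * act U h)"
        unfolding aU by (simp add: j0[symmetric] power_add mult.assoc)
      then have "act N h * (ypow N (Suc r) * s * a)
          = inverse (chi h) ^ Suc r \<cdot> chi h ^ Suc r \<cdot> (ypow N (Suc r) * s * (a * act U h))"
        by (simp only: mult.assoc[symmetric] sw smul_mult_left)
          (simp only: s(3)[OF h] smul_mult_right mult.assoc)
      also have "\<dots> = ypow N (Suc r) * s * a * act U h"
        using c by (simp add: mult.assoc del: power_Suc flip: power_mult_distrib)
      finally have "act N h * (ypow N (Suc r) * s * a) = ypow N (Suc r) * s * a * act U h" .
      then show ?thesis using s(3)[OF h] by (simp add: s'_def algebra_simps)
    qed
    have 3: "f * ypow N j * s' = f * ypow N j * s - f * ypow N (j + Suc r) * s * a" for j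
    proof -
      have "f * ypow N j * (ypow N (Suc r) * s * a) = f * (ypow N j * ypow N (Suc r)) * s * a"
        by (simp only: mult.assoc)
      then show ?thesis unfolding ypow_add[OF N] s'_def by (simp add: right_diff_distrib)
    qed
    have "f * ?Y * s' = f" unfolding 3 using high[of "m + Suc r"] s(4) by simp
    moreover have "f * ypow N j * s' = 0" if "m - Suc r \<le> j" "j < m" for j
    proof (cases "j = j0")
      case True
      then show ?thesis unfolding 3 using j0 s(4) af by (simp add: a_def add.commute)
    next
      case False
      then have "m < j + Suc r" "m - r \<le> j" using that j0 by auto
      then show ?thesis unfolding 3 using high s(5) that by simp
    qed
    ultimately show ?case using 1 2 by (intro exI[of _ s']) simp
  qed
  from this[of m] obtain s where s: "idn N * s = s" "s * f = s"
      "\<And>h. h \<in> carrier G \<Longrightarrow> act N h * s = s * act U h"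
      "f * ?Y * s = f" "\<And>j. j < m \<Longrightarrow> f * ypow N j * s = 0"
    by auto
  have "f * act N h = inverse (chi h) ^ m \<cdot> (act U h * f)" if h: "h \<in> carrier G" for h
  proof -
    have "f * act N h * f = f * act N h" using fh[OF h] ff by (metis mult.assoc)
    then show ?thesis using chi_nonzero[OF h] by (simp add: Us power_inverse)
  qed
  then have F: "jframe m U N s f"
    unfolding jframe_def Us using N \<open>hmod U\<close> m s ef ff nil by (auto simp: Us)
  let ?p = "jmap m N N s f"
  note P = jframe_idempotent[OF F]
  have "?Y * ?p = (\<Sum>i\<le>m. ypow N (m + i) * s * f * ypow N (m - i))"
    by (simp add: jmap_def sum_distrib_left flip: mult.assoc ypow_add[OF N])
  also have "\<dots> = (\<Sum>i\<le>m. if i = 0 then ?Y * s * f * ?Y else 0)"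
    using high by (intro sum.cong refl) auto
  also have "\<dots> = ?Y" using s(4) by (simp add: fY ff)
  finally have Yp: "?Y * ?p = ?Y" .
  have "ypow (cut N (idn N - ?p)) m = (idn N - ?p) * ?Y"
    using P morD[OF P(1)] D(8) mor_diff[OF mor_id[OF N] P(1)]
    by (intro ypow_cut[OF N]) (auto simp: algebra_simps)
  also have "\<dots> = 0" using Yp mor_ypow[OF P(1), of m] ypow_idn[OF N] by (simp add: left_diff_distrib)
  finally show thesis using that[OF P(1,2) jframe_cut[OF F]] by simp
qed

end

section \<open>Spectral idempotents\<close>

definition runity :: "nat \<Rightarrow> 'k :: field set" where
  "runity N = {x. x ^ N = 1}"

lemma size_proots_alg_closed:
  fixes p :: "'k :: alg_closed_field poly"
  assumes "p \<noteq> 0"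
  shows "size (proots p) = degree p"
proof -
  obtain A where A: "size A = degree p" "p = smult (lead_coeff p) (\<Prod>x\<in>#A. [:-x, 1:])"
    using alg_closed_imp_factorization[OF assms] by blast
  have nz: "(\<Prod>x\<in>#B. [:-x, 1:]) \<noteq> (0 :: 'k poly)" for B
    by (induction B) (simp_all del: mult_pCons_left)
  have "proots (\<Prod>x\<in>#B. [:-x, 1:]) = B" for B :: "'k multiset"
  proof (induction B)
    case (add x B)
    then show ?case
      using proots_mult[OF _ nz, of "[:-x, 1:]" B] proots_linear_factor[of "-x"]
      by (simp del: mult_pCons_left)
  qed simp
  then have "proots p = A" using A(2) assms by (metis proots_smult leading_coeff_0_iff)
  then show ?thesis using A(1) by simp
qed

text \<open>The derivative of x^N - 1 vanishes only at zero, which is not a root, so all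
  \<open>N\<close> roots are simple.\<close>

lemma card_runity:
  assumes "N > 0"
  shows "card (runity N :: 'k :: {alg_closed_field, field_char_0} set) = N"
    "finite (runity N :: 'k set)"
proof -
  define p :: "'k poly" where "p = monom 1 N - 1"
  have poly_p: "poly p x = x ^ N - 1" for x by (simp add: p_def poly_monom)
  have deg: "degree p = N" 
    using degree_add_eq_left[of "- 1 :: 'k poly" "monom 1 N"] assms by (simp add: p_def degree_monom_eq)
  have p0: "p \<noteq> 0" using deg assms by auto
  have "rsquarefree p"
    unfolding rsquarefree_roots
  proof (intro allI notI)
    fix a assume a: "poly p a = 0 \<and> poly (pderiv p) a = 0"
    then have "a ^ N = 1" "of_nat N * a ^ (N - 1) = 0"
      by (auto simp: poly_p p_def pderiv_diff pderiv_monom poly_monom)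
    then show False using assms by (auto simp: power_0_left)
  qed
  then have ord: "order x p = 1" if "poly p x = 0" for x
    using rsquarefree_root_order that p0 by blast
  have set: "{x. poly p x = 0} = runity N" by (auto simp: runity_def poly_p)
  have "size (proots p) = (\<Sum>x\<in>set_mset (proots p). count (proots p) x)"
    by (rule size_multiset_overloaded_eq)
  also have "\<dots> = (\<Sum>x\<in>(runity N :: 'k set). 1)"
    using p0 ord set by (intro sum.cong) auto
  also have "\<dots> = card (runity N :: 'k set)" by simp
  finally show "card (runity N :: 'k set) = N"
    using size_proots_alg_closed[OF p0] deg by simp
  show "finite (runity N :: 'k set)" using poly_roots_finite[OF p0] set by simp
qed

text \<open>By counting there is an N-th root of unity \<open>w\<close> with
  \<open>w ^ m \<noteq> 1\<close>. The substitution of \<open>w * x\<close> for \<open>x\<close>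
  multiplies the sum by a number different from 1.\<close>

lemma sum_runity_power:
  assumes "0 < m" "m < N"
  shows "(\<Sum>x\<in>runity N. inverse x ^ m) = (0 :: 'k :: {alg_closed_field, field_char_0})"
proof -
  have "\<not> runity N \<subseteq> (runity m :: 'k set)"
  proof
    assume "runity N \<subseteq> (runity m :: 'k set)"
    then have "card (runity N :: 'k set) \<le> card (runity m :: 'k set)"
      using card_runity(2)[OF assms(1)] by (rule card_mono[rotated])
    then show False using card_runity(1) assms by (metis leD less_trans)
  qed
  then obtain w :: 'k where w: "w ^ N = 1" "w ^ m \<noteq> 1" by (auto simp: runity_def)
  have w0: "w \<noteq> 0" using w assms by (auto simp: power_0_left)
  have "(\<Sum>x\<in>runity N. inverse x ^ m) = (\<Sum>x\<in>runity N. inverse (w * x) ^ m)"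
    by (rule sum.reindex_bij_witness[of _ "\<lambda>x. w * x" "\<lambda>x. x / w"])
      (use w w0 in \<open>auto simp: runity_def power_mult_distrib power_divide\<close>)
  also have "\<dots> = inverse w ^ m * (\<Sum>x\<in>runity N. inverse x ^ m)"
    by (simp add: sum_distrib_left power_mult_distrib)
  finally have "(1 - inverse w ^ m) * (\<Sum>x\<in>runity N. inverse x ^ m) = (0 :: 'k)"
    by (simp add: algebra_simps)
  moreover have "1 - inverse w ^ m \<noteq> 0" using w by (auto simp: power_inverse)
  ultimately show ?thesis by simp
qed

context fin_group
begin

abbreviation gsz :: nat where "gsz \<equiv> card (carrier G)"

text \<open>The projection onto the eigenspace of \<open>h\<close> for the eigenvalue
  \<open>x\<close>, by Fourier inversion. The order of the group is a common exponent for all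
  \<open>h\<close>.\<close>

definition spec :: "('a \<Rightarrow> 'k :: field_char_0 fmat) \<Rightarrow> 'a \<Rightarrow> 'k \<Rightarrow> 'k fmat" where
  "spec R h x = inverse (of_nat gsz) \<cdot> (\<Sum>m<gsz. inverse x ^ m \<cdot> R (h [^] m))"

lemma order_pos: "gsz > 0"
  using finite_G by (simp add: card_gt_0_iff) blast

lemma pow_gsz: "h \<in> carrier G \<Longrightarrow> h [^] gsz = \<one>"
  using pow_order_eq_1[of h] by (simp add: Coset.order_def)

lemma spec_props:
  fixes R :: "'a \<Rightarrow> 'k :: {alg_closed_field, field_char_0} fmat"
  assumes R: "grep e R" and h: "h \<in> carrier G"
  shows "x \<in> runity gsz \<Longrightarrow> R h * spec R h x = x \<cdot> spec R h x"
    "x \<in> runity gsz \<Longrightarrow> x' \<in> runity gsz \<Longrightarrow>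
       spec R h x' * spec R h x = (if x = x' then spec R h x else 0)"
    "(\<Sum>x\<in>runity gsz. spec R h x) = e"
    "e * spec R h x = spec R h x" "spec R h x * e = spec R h x"
proof -
  define N where "N = gsz"
  have N: "N > 0" using order_pos N_def by simp
  have N': "(of_nat N :: 'k) \<noteq> 0" using N by simp
  note Rd = grepD[OF R]
  have R_Suc: "R h * R (h [^] m) = R (h [^] Suc m)" for m :: nat
    using Rd(2)[OF h, of "h [^] m"] h nat_pow_Suc2[OF h] by simp
  have R0: "R (h [^] (0 :: nat)) = e" using Rd(1) by simp
  have RN: "R (h [^] N) = e" unfolding N_def using Rd(1) pow_gsz[OF h] by simp
  show "e * spec R h x = spec R h x" "spec R h x * e = spec R h x" for x
    using Rd h by (simp_all add: spec_def sum_distrib_left sum_distrib_right)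
  have shift: "R h * spec R h x = x \<cdot> spec R h x" if x: "x \<in> runity N" for x
  proof -
    have x0: "x \<noteq> 0" using x N by (auto simp: runity_def power_0_left)
    have "inverse x ^ N = 1" using x by (simp add: runity_def power_inverse)
    then have "(\<Sum>m<N. inverse x ^ Suc m \<cdot> R (h [^] Suc m)) = (\<Sum>m<N. inverse x ^ m \<cdot> R (h [^] m))"
      using sum.lessThan_Suc_shift[of "\<lambda>m. inverse x ^ m \<cdot> R (h [^] m)" N] R0 RN
      by (simp del: power_Suc nat_pow_Suc add: add.commute)
    moreover have "R h * (\<Sum>m<N. inverse x ^ m \<cdot> R (h [^] m))
        = x \<cdot> (\<Sum>m<N. inverse x ^ Suc m \<cdot> R (h [^] Suc m))"
      using x0 by (simp add: sum_distrib_left R_Suc smul_sum_right mult.assoc[symmetric] del: nat_pow_Suc)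
    ultimately show ?thesis
      by (simp add: spec_def N_def mult.commute)
  qed
  then show "x \<in> runity gsz \<Longrightarrow> R h * spec R h x = x \<cdot> spec R h x" by (simp add: N_def)
  have pw: "R (h [^] m) * spec R h x = x ^ m \<cdot> spec R h x" if x: "x \<in> runity N" for x and m :: nat
  proof (induction m)
    case 0
    show ?case using R0 \<open>e * spec R h x = spec R h x\<close> by simp
  next
    case (Suc m)
    have "R (h [^] Suc m) * spec R h x = R h * (R (h [^] m) * spec R h x)"
      by (simp only: R_Suc[symmetric] mult.assoc)
    then show ?case by (simp add: Suc shift[OF x] mult.commute)
  qed
  show "spec R h x' * spec R h x = (if x = x' then spec R h x else 0)"
    if x: "x \<in> runity gsz" and x': "x' \<in> runity gsz"
  proof -
    have x0: "x \<noteq> 0" "x' \<noteq> 0" using x x' order_pos by (auto simp: runity_def power_0_left)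
    have "spec R h x' * spec R h x
        = inverse (of_nat N) \<cdot> (\<Sum>m<N. inverse x' ^ m \<cdot> (R (h [^] m) * spec R h x))"
      by (simp add: spec_def[of R h x'] N_def sum_distrib_right)
    also have "\<dots> = inverse (of_nat N) \<cdot> (\<Sum>m<N. (x / x') ^ m \<cdot> spec R h x)"
      using x by (simp add: pw N_def divide_inverse power_mult_distrib mult.commute)
    also have "\<dots> = (inverse (of_nat N) * (\<Sum>m<N. (x / x') ^ m)) \<cdot> spec R h x"
      by (simp flip: smul_sum_left)
    also have "(\<Sum>m<N. (x / x') ^ m) = (if x = x' then of_nat N else 0)"
    proof (cases "x = x'")
      case False
      then have "x / x' \<noteq> 1" using x0 by simp
      moreover have "(x / x') ^ N = 1" using x x' by (simp add: runity_def N_def power_divide)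
      ultimately show ?thesis using False by (simp add: sum_gp_strict)
    qed (use x0 in simp)
    finally show ?thesis using N' by simp
  qed
  have "(\<Sum>x\<in>runity N. spec R h x)
      = inverse (of_nat N) \<cdot> (\<Sum>m<N. (\<Sum>x\<in>runity N. inverse x ^ m) \<cdot> R (h [^] m))"
    by (simp add: spec_def N_def flip: smul_sum_right) (subst sum.swap, simp add: smul_sum_left)
  also have "\<dots> = inverse (of_nat N) \<cdot> (\<Sum>m<N. if m = 0 then of_nat N \<cdot> e else 0)"
    using sum_runity_power[of _ N, where 'k = 'k] card_runity[OF N, where 'k = 'k]
    by (intro arg_cong[of _ _ "smul _"] sum.cong refl) (auto simp: Rd(1))
  finally show "(\<Sum>x\<in>runity gsz. spec R h x) = e" using N N' by (simp add: N_def)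
qed

text \<open>The source of integrality: the trace is a sum of eigenvalues, whose multiplicities are
  the traces of the spectral idempotents.\<close>

lemma tr_eq_sum_runity:
  fixes R :: "'a \<Rightarrow> 'k :: {alg_closed_field, field_char_0} fmat"
  assumes R: "grep e R" and h: "h \<in> carrier G"
  shows "\<exists>d :: 'k \<Rightarrow> nat. tr (R h) = (\<Sum>x\<in>runity gsz. of_nat (d x) * x)"
proof -
  note S = spec_props[OF R h]
  have "\<exists>d. tr (spec R h x) = of_nat d" if "x \<in> runity gsz" for x
    using S(2)[OF that that] by (intro idempotent_tr(1)) simp
  then have "\<exists>d. \<forall>x\<in>runity gsz. tr (spec R h x) = of_nat (d x)"
    by (intro bchoice) blast
  then obtain d :: "'k \<Rightarrow> nat" where d: "\<And>x. x \<in> runity gsz \<Longrightarrow> tr (spec R h x) = of_nat (d x)"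
    by blast
  have "R h = R h * e" using grepD[OF R] h by simp
  also have "\<dots> = (\<Sum>x\<in>runity gsz. x \<cdot> spec R h x)"
    unfolding S(3)[symmetric] sum_distrib_left by (intro sum.cong refl S(1))
  finally have "tr (R h) = (\<Sum>x\<in>runity gsz. x * tr (spec R h x))" by (simp add: tr_sum)
  then show ?thesis using d by (auto intro!: exI[of _ d] sum.cong simp: mult.commute)
qed

end

context datum
begin

subsection \<open>Modules on which y is invertible\<close>

text \<open>
  On such a module \<open>y\<close> permutes the eigenspaces of \<open>g\<close> freely, so that the module is induced from the
  sum of the eigenspaces belonging to a set of representatives of the cosets of the group generated
  by \<open>chi g\<close>.
\<close>

lemma coset_reps:
  obtains S :: "'k set" where
    "\<forall>x\<in>runity gsz. \<exists>!i. i < n \<and> x * chi g ^ i \<in> S"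
proof -
  define q where "q = chi g"
  have q: "q ^ n = 1" "q \<noteq> 0" using root_of_unity chi_nonzero[OF g_closed] by (auto simp: q_def)
  define orb where "orb x = {x * q ^ i | i. True}" for x
  have orb_sub: "orb (x * q ^ j) \<subseteq> orb x" for x j
    by (auto simp: orb_def mult.assoc simp flip: power_add)
  have "x = x * q ^ j * q ^ ((n - 1) * j)" for x j
  proof -
    have "j + (n - 1) * j = n * j" using n_ge_2 by (cases n) auto
    then have "q ^ j * q ^ ((n - 1) * j) = (q ^ n) ^ j"
      by (simp only: power_mult[symmetric] power_add[symmetric])
    then show ?thesis using q by (simp add: mult.assoc)
  qed
  then have orb: "orb (x * q ^ j) = orb x" for x j
    using orb_sub by (metis subset_antisym)
  define rep where "rep x = (SOME z. z \<in> orb x)" for x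
  have rep: "rep x \<in> orb x" for x
  proof -
    have "x * q ^ 0 \<in> orb x" unfolding orb_def by blast
    then show ?thesis unfolding rep_def by (rule someI)
  qed
  have rep_eq: "rep (x * q ^ j) = rep x" for x j unfolding rep_def orb ..
  have inj: "i = j" if "q ^ i = q ^ j" "i < n" "j < n" for i j
  proof -
    have *: False if "i < j" "q ^ i = q ^ j" "j < n" for i j
    proof -
      have "q ^ i * q ^ (j - i) = q ^ j" using that(1) by (simp flip: power_add)
      then have "q ^ (j - i) = 1" using that q by simp
      then show False using primitive[of "j - i"] that by (simp add: q_def)
    qed
    then show ?thesis using that by (metis linorder_neqE_nat)
  qed
  show thesis
  proof (rule that[of "rep ` runity gsz"], rule ballI)
    fix x :: 'k assume x: "x \<in> runity gsz"
    then have x0: "x \<noteq> 0" using order_pos by (auto simp: runity_def power_0_left)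
    obtain i where i: "rep x = x * q ^ i" using rep[of x] orb_def by blast
    have "q ^ i = q ^ (i mod n)"
      using q(1) by (metis div_mult_mod_eq mult.commute mult_1 power_add power_mult power_one)
    then have 1: "x * q ^ (i mod n) = rep x" using i by simp
    have 2: "x * q ^ j = rep x" if j: "x * q ^ j \<in> rep ` runity gsz" for j
    proof -
      from j obtain x' where x': "x * q ^ j = rep x'" by blast
      obtain k where "rep x' = x' * q ^ k" using rep[of x'] orb_def by blast
      then have "rep x' = rep (x * q ^ j)" using x' rep_eq by metis
      then show ?thesis using x' rep_eq by metis
    qed
    show "\<exists>!i. i < n \<and> x * chi g ^ i \<in> rep ` runity gsz"
    proof (rule ex1I[of _ "i mod n"])
      show "i mod n < n \<and> x * chi g ^ (i mod n) \<in> rep ` runity gsz"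
        using 1 x n_ge_2 by (auto simp: q_def)
      fix j assume "j < n \<and> x * chi g ^ j \<in> rep ` runity gsz"
      then have "x * q ^ j = x * q ^ (i mod n)" "j < n" using 1 2 by (auto simp: q_def)
      then show "j = i mod n" using inj[of j "i mod n"] x0 n_ge_2 by simp
    qed
  qed
qed

text \<open>\<open>p\<close> projects onto the eigenspaces of \<open>g\<close> with eigenvalue in
  \<open>S\<close>. Since y^k takes the eigenvalue x to x / q^k, conjugating \<open>p\<close> by y^k
  gives the projection \<open>P k\<close> onto the eigenvalues \<open>x\<close> with
  \<open>x * q ^ k \<in> S\<close>. By the choice of \<open>S\<close> the \<open>P i\<close> with
  \<open>i < n\<close> are orthogonal with sum 1, so the module is the direct sum of the translates
  of the image of \<open>p\<close> by y^i.\<close>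

lemma einv_fundamental:
  assumes S: "\<forall>x\<in>runity gsz. \<exists>!i. i < n \<and> x * chi g ^ i \<in> S"
    and M: "hmod M"
    and Y: "\<And>j. ypow M j * mpow (idn M) Z j = idn M" "\<And>j. mpow (idn M) Z j * ypow M j = idn M"
    and Z: "idn M * Z = Z" "Z * idn M = Z"
  defines "p \<equiv> (\<Sum>x\<in>{x\<in>runity gsz. x \<in> S}. spec (act M) g x)"
  shows "p * p = p" "idn M * p = p" "p * idn M = p" "\<And>h. h \<in> carrier G \<Longrightarrow> p * act M h = act M h * p"
    "\<And>i j. i < n \<Longrightarrow> j < n \<Longrightarrow> p * (mpow (idn M) Z j * ypow M i) * p = (if i = j then p else 0)"
    "(\<Sum>i<n. ypow M i * p * mpow (idn M) Z i) = idn M"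
proof -
  let ?R = "runity gsz :: 'k set" and ?q = "chi g"
  define q where "q = chi g"
  have q: "q ^ n = 1" "q \<noteq> 0" using root_of_unity chi_nonzero[OF g_closed] by (auto simp: q_def)
  have qN: "q ^ gsz = 1"
    unfolding q_def using chi_pow_g[OF g_closed] pow_gsz[OF g_closed] chi_one by metis
  have fin: "finite ?R" using card_runity(2)[OF order_pos] .
  define sp where "sp x = spec (act M) g x" for x
  note D = hmodD[OF M]
  note sp = spec_props[OF D(1) g_closed, folded sp_def]
  define P where "P i = (\<Sum>x\<in>{x\<in>?R. x * q ^ i \<in> S}. sp x)" for i
  have p_P: "p = P 0" by (simp add: p_def P_def sp_def)
  have sp_act: "sp x * act M h = act M h * sp x" if h: "h \<in> carrier G" for x h
  proof -
    have "act M (g [^] m) * act M h = act M h * act M (g [^] m)" for m :: nat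
      using D(7)[of "g [^] m" h] D(7)[of h "g [^] m"] h g_closed g_pow_central[OF h, of m] by simp
    then show ?thesis by (simp add: sp_def spec_def sum_distrib_left sum_distrib_right)
  qed
  have sp_y: "ypow M k * sp x = sp (x / q ^ k) * ypow M k" for x k
  proof -
    have "inverse x ^ m * chi (g [^] m) ^ k = inverse (x / q ^ k) ^ m" for m :: nat
      using g_closed by (simp add: chi_pow_g q_def power_mult_distrib divide_inverse power_inverse
          flip: power_mult) (simp add: mult.commute)
    then have "inverse x ^ m \<cdot> (ypow M k * act M (g [^] m))
        = inverse (x / q ^ k) ^ m \<cdot> (act M (g [^] m) * ypow M k)" for m :: nat
      using ypow_act[OF M, of "g [^] m" k] g_closed by simp
    then show ?thesis by (simp add: sp_def spec_def sum_distrib_left sum_distrib_right)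
  qed
  have PP: "P i * P j = (if i = j then P i else 0)" if "i < n" "j < n" for i j
  proof -
    let ?A = "{x\<in>?R. x * q ^ i \<in> S}" and ?B = "{x\<in>?R. x * q ^ j \<in> S}"
    have "P i * P j = (\<Sum>x\<in>?A. \<Sum>x'\<in>?B. if x' = x then sp x' else 0)"
      unfolding P_def sum_product by (intro sum.cong refl) (simp add: sp(2))
    also have "\<dots> = (\<Sum>x\<in>?A. if x \<in> ?B then sp x else 0)"
      using fin by (simp add: sum.delta')
    also have "\<dots> = (if i = j then P i else 0)"
    proof (cases "i = j")
      case False
      then have "?A \<inter> ?B = {}" using S that unfolding q_def by blast
      then show ?thesis using False by (intro sum.neutral[THEN trans]) auto
    qed (auto simp: P_def intro!: sum.cong)
    finally show ?thesis .
  qed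
  have n0: "0 < n" using n_ge_2 by simp
  show "p * p = p" using PP[OF n0 n0] p_P by simp
  show "idn M * p = p" "p * idn M = p"
    unfolding p_P P_def by (simp_all add: sum_distrib_left sum_distrib_right sp)
  show "p * act M h = act M h * p" if "h \<in> carrier G" for h
    unfolding p_P P_def by (simp add: sum_distrib_left sum_distrib_right sp_act[OF that])
  have yP: "ypow M k * P 0 = P k * ypow M k" for k
  proof -
    have "(\<Sum>x\<in>{x\<in>?R. x * q ^ 0 \<in> S}. sp (x / q ^ k) * ypow M k)
        = (\<Sum>x\<in>{x\<in>?R. x * q ^ k \<in> S}. sp x * ypow M k)"
    proof (rule sum.reindex_bij_witness[of _ "\<lambda>x. x * q ^ k" "\<lambda>x. x / q ^ k"])
      have qk: "(q ^ k) ^ gsz = 1" using qN by (metis mult.commute power_mult power_one)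
      fix x assume "x \<in> {x\<in>?R. x * q ^ 0 \<in> S}"
      then show "x / q ^ k \<in> {x\<in>?R. x * q ^ k \<in> S}"
        using q qk by (simp add: runity_def power_divide)
    next
      have qk: "(q ^ k) ^ gsz = 1" using qN by (metis mult.commute power_mult power_one)
      fix x assume "x \<in> {x\<in>?R. x * q ^ k \<in> S}"
      then show "x * q ^ k \<in> {x\<in>?R. x * q ^ 0 \<in> S}"
        using q qk by (simp add: runity_def power_mult_distrib)
    qed (use q in auto)
    then show ?thesis unfolding P_def by (simp add: sum_distrib_left sum_distrib_right sp_y)
  qed
  let ?Z = "mpow (idn M) Z"
  have Ze: "idn M * ?Z k = ?Z k" "?Z k * idn M = ?Z k" for k
    using Z D(8) by (induction k) (simp_all add: mult.assoc, simp_all flip: mult.assoc)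
  have Zadd: "?Z (i + j) = ?Z i * ?Z j" for i j
    by (induction i) (simp_all add: Ze mult.assoc)
  have Pk: "P k * idn M = P k" for k
    unfolding P_def by (simp add: sum_distrib_right sp)
  have ZP: "P 0 * ?Z k = ?Z k * P k" for k
  proof -
    have "P 0 * ?Z k = ?Z k * (ypow M k * P 0) * ?Z k"
      using Y(2)[of k] \<open>idn M * p = p\<close> p_P by (simp flip: mult.assoc)
    also have "\<dots> = ?Z k * P k" unfolding yP using Y(1)[of k] Pk by (simp add: mult.assoc)
    finally show ?thesis .
  qed
  show "p * (?Z j * ypow M i) * p = (if i = j then p else 0)" if ij: "i < n" "j < n" for i j
  proof (cases i j rule: linorder_cases)
    case less
    then have "?Z j = ?Z (j - i) * ?Z i" by (simp flip: Zadd)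
    then have "p * (?Z j * ypow M i) * p = P 0 * ?Z (j - i) * P 0"
      using Y(2)[of i] \<open>idn M * p = p\<close> p_P by (simp add: mult.assoc)
    also have "\<dots> = 0" unfolding ZP using PP[of "j - i" 0] less ij by (simp add: mult.assoc)
    finally show ?thesis using less by simp
  next
    case equal
    then show ?thesis using Y(2) \<open>p * idn M = p\<close> \<open>p * p = p\<close> by simp
  next
    case greater
    then have "ypow M i = ypow M j * ypow M (i - j)" by (simp add: ypow_add[OF M])
    then have "?Z j * ypow M i = ypow M (i - j)"
      using Y(2)[of j] ypow_idn[OF M] by (simp flip: mult.assoc)
    then have "p * (?Z j * ypow M i) * p = P 0 * (ypow M (i - j) * P 0)" by (simp add: p_P mult.assoc)
    also have "\<dots> = 0" unfolding yP using PP[of 0 "i - j"] greater ij by (simp flip: mult.assoc)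
    finally show ?thesis using greater by simp
  qed
  have "(\<Sum>i<n. ypow M i * p * ?Z i) = (\<Sum>i<n. P i)"
    unfolding p_P yP using Y(1) Pk by (simp add: mult.assoc)
  also have "\<dots> = (\<Sum>i<n. \<Sum>x\<in>?R. if x * q ^ i \<in> S then sp x else 0)"
    unfolding P_def using fin by (simp add: sum.inter_filter)
  also have "\<dots> = (\<Sum>x\<in>?R. \<Sum>i<n. if x * q ^ i \<in> S then sp x else 0)" by (rule sum.swap)
  also have "\<dots> = (\<Sum>x\<in>?R. sp x)"
  proof (rule sum.cong[OF refl])
    fix x assume "x \<in> ?R"
    then obtain i0 where i0: "i0 < n" "x * q ^ i0 \<in> S" "\<And>i. i < n \<Longrightarrow> x * q ^ i \<in> S \<Longrightarrow> i = i0"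
      using S unfolding q_def by blast
    then have "(x * q ^ i \<in> S) = (i = i0)" if "i < n" for i using that by metis
    then have "(\<Sum>i<n. if x * q ^ i \<in> S then sp x else 0) = (\<Sum>i<n. if i = i0 then sp x else 0)"
      by (intro sum.cong refl) simp
    then show "(\<Sum>i<n. if x * q ^ i \<in> S then sp x else 0) = sp x" using i0(1) by simp
  qed
  finally show "(\<Sum>i<n. ypow M i * p * ?Z i) = idn M" using sp(3) by simp
qed

text \<open>\<open>p\<close> is a combination of powers of \<open>g\<close>, so its group character
  is determined by that of the whole module. Isomorphic images of \<open>p\<close> extend along the
  translates by y^i, and y^n = g^n - 1 acts on these images through the group alone.\<close>

lemma einv_iso:
  assumes M: "hmod M" "einv M" and N: "hmod N" "einv N"
    and tr: "\<And>h. h \<in> carrier G \<Longrightarrow> tr (act M h) = tr (act N h)"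
  shows "M \<asymp> N"
proof -
  obtain S :: "'k set" where S: "\<forall>x\<in>runity gsz. \<exists>!i. i < n \<and> x * chi g ^ i \<in> S"
    using coset_reps by blast
  let ?R = "{x\<in>runity gsz. x \<in> S}"
  define p where "p M = (\<Sum>x\<in>?R. spec (act M) g x)" for M :: "('g, 'k) hm"
  obtain Z where Z: "\<And>j. ypow M j * mpow (idn M) Z j = idn M" "\<And>j. mpow (idn M) Z j * ypow M j = idn M"
    "yop M * Z = idn M" "Z * yop M = idn M" "idn M * Z = Z" "Z * idn M = Z"
    by (rule einvD[OF M(2,1)]) blast
  obtain W where W: "\<And>j. ypow N j * mpow (idn N) W j = idn N" "\<And>j. mpow (idn N) W j * ypow N j = idn N"
    "yop N * W = idn N" "W * yop N = idn N" "idn N * W = W" "W * idn N = W"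
    by (rule einvD[OF N(2,1)]) blast
  note PM = einv_fundamental[OF S M(1) Z(1,2,5,6), folded p_def]
    and PN = einv_fundamental[OF S N(1) W(1,2,5,6), folded p_def]
  note DM = hmodD[OF M(1)] and DN = hmodD[OF N(1)]
  have tr_p: "tr (p M * act M h) = (\<Sum>x\<in>?R. inverse (of_nat gsz) *
      (\<Sum>m<gsz. inverse x ^ m * tr (act M (g [^] m \<otimes> h))))"
    if "hmod M" "h \<in> carrier G" for M h
    using that g_closed hmodD(7)[OF that(1)]
    by (simp add: p_def spec_def sum_distrib_right tr_sum)
  have "giso (p M) (\<lambda>h. p M * act M h) (p N) (\<lambda>h. p N * act N h)"
    using tr g_closed
    by (intro giso_if_tr_eq grep_cut[OF DM(1) PM(1,2,4)] grep_cut[OF DN(1) PN(1,2,4)])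
      (auto simp: tr_p[OF M(1)] tr_p[OF N(1)])
  then obtain f f' where f: "p N * f = f" "f * p M = f" "f' * f = p M"
      "\<And>h. h \<in> carrier G \<Longrightarrow> f * (p M * act M h) = p N * act N h * f"
    and f': "p M * f' = f'" "f' * p N = f'" "f * f' = p N"
      "\<And>h. h \<in> carrier G \<Longrightarrow> f' * (p N * act N h) = p M * act M h * f'"
    unfolding giso_def gmor_def by blast
  have key: "mor M N (\<Sum>i<n. ypow N i * f * mpow (idn M) Z i) \<and>
    (\<Sum>i<n. ypow M i * f' * mpow (idn N) W i) * (\<Sum>i<n. ypow N i * f * mpow (idn M) Z i) = idn M"
    if M: "hmod M" and N: "hmod N"
      and Z: "\<And>j. ypow M j * mpow (idn M) Z j = idn M" "\<And>j. mpow (idn M) Z j * ypow M j = idn M"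
        "yop M * Z = idn M" "Z * yop M = idn M" "idn M * Z = Z" "Z * idn M = Z"
      and W: "\<And>j. ypow N j * mpow (idn N) W j = idn N" "\<And>j. mpow (idn N) W j * ypow N j = idn N"
        "yop N * W = idn N" "W * yop N = idn N" "idn N * W = W" "W * idn N = W"
      and f: "p N * f = f" "f * p M = f" "f' * f = p M"
        "\<And>h. h \<in> carrier G \<Longrightarrow> f * (p M * act M h) = p N * act N h * f"
      and f': "f' * p N = f'"
    for M N :: "('g, 'k) hm" and Z W f f'
  proof
    note PM = einv_fundamental[OF S M Z(1,2,5,6), folded p_def]
      and PN = einv_fundamental[OF S N W(1,2,5,6), folded p_def]
    note DM = hmodD[OF M] and DN = hmodD[OF N]
    let ?Z = "mpow (idn M) Z" and ?W = "mpow (idn N) W"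
    have fe: "idn N * f = f" "f * idn M = f"
      using f PN(2) PM(3) by (metis mult.assoc)+
    have fh: "f * act M h = act N h * f" if h: "h \<in> carrier G" for h
      using f(4)[OF h] f(1,2) PN(4)[OF h] by (metis mult.assoc)
    have Zh: "act M h * ?Z i = chi h ^ i \<cdot> (?Z i * act M h)" if h: "h \<in> carrier G" for h i
    proof -
      have "act M h * ?Z i = ?Z i * (ypow M i * act M h) * ?Z i"
        using Z(2)[of i] DM(9)[OF h] by (simp flip: mult.assoc)
      also have "\<dots> = chi h ^ i \<cdot> (?Z i * act M h * (ypow M i * ?Z i))"
        by (simp add: ypow_act[OF M h] mult.assoc)
      finally show ?thesis using Z(1)[of i] DM(10)[OF h] by (simp add: mult.assoc)
    qed
    have Ze: "?Z i * idn M = ?Z i" "?Z i * Z = ?Z (Suc i)" for i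
      using Z(5,6) DM(8) by (induction i) (simp_all add: mult.assoc)
    show "mor M N (\<Sum>i<n. ypow N i * f * ?Z i)" (is "mor M N ?P")
    proof (rule morI)
      show "idn N * ?P = ?P"
        using ypow_idn[OF N] by (simp add: sum_distrib_left flip: mult.assoc)
      show "?P * idn M = ?P" using Ze by (simp add: sum_distrib_right mult.assoc)
      show "?P * act M h = act N h * ?P" if h: "h \<in> carrier G" for h
      proof -
        have "ypow N i * f * ?Z i * act M h = act N h * (ypow N i * f * ?Z i)" for i
        proof -
          have "chi h ^ i \<cdot> (ypow N i * f * ?Z i * act M h) = ypow N i * (f * act M h) * ?Z i"
            by (simp add: mult.assoc Zh[OF h])
          also have "\<dots> = ypow N i * act N h * f * ?Z i" by (simp add: fh[OF h] mult.assoc)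
          also have "\<dots> = chi h ^ i \<cdot> (act N h * (ypow N i * f * ?Z i))"
            by (simp add: ypow_act[OF N h] mult.assoc)
          finally show ?thesis using chi_nonzero[OF h] smul_cancel by (metis power_not_zero)
        qed
        then show ?thesis by (simp add: sum_distrib_left sum_distrib_right)
      qed
      obtain m where m: "n = Suc m" using n_ge_2 by (cases n) auto
      \<comment> \<open>The wrap-around: y leads from the last translate back to the first through
        y^n, which commutes with \<open>f\<close> as an element of the group algebra.\<close>
      have "ypow N n * f = f * ypow M n"
        using fh[of "g [^] n"] g_closed DM(5) DN(5) fe by (simp add: left_diff_distrib right_diff_distrib)
      then have "ypow N n * f * ?Z m = f * (yop M * (ypow M m * ?Z m))"
        by (simp add: m ypow_Suc mult.assoc)
      then have last: "ypow N n * f * ?Z m = f * yop M" using Z(1)[of m] DM(3) by simp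
      have step: "?Z (Suc i) * yop M = ?Z i" for i
        using Z(4) Ze by (simp add: mult.assoc del: mpow.simps flip: Ze(2))
      have "?P * yop M = f * yop M + (\<Sum>i<m. ypow N (Suc i) * f * ?Z i)"
        unfolding m sum_distrib_right
      proof (subst sum.lessThan_Suc_shift)
        have "ypow N 0 * f * ?Z 0 * yop M = f * yop M" by (simp add: fe)
        moreover have "ypow N (Suc i) * f * ?Z (Suc i) * yop M = ypow N (Suc i) * f * ?Z i" for i
          by (simp only: mult.assoc step)
        ultimately show "ypow N 0 * f * ?Z 0 * yop M + (\<Sum>i<m. ypow N (Suc i) * f * ?Z (Suc i) * yop M)
            = f * yop M + (\<Sum>i<m. ypow N (Suc i) * f * ?Z i)" by (simp only:)
      qed
      also have "\<dots> = (\<Sum>i<n. ypow N (Suc i) * f * ?Z i)" using last m by simp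
      finally show "?P * yop M = yop N * ?P"
        by (simp add: sum_distrib_left ypow_Suc mult.assoc)
    qed
    have "ypow M i * f' * ?W i * (ypow N j * f * ?Z j)
        = (if i = j then ypow M i * p M * ?Z i else 0)" if "i < n" "j < n" for i j
    proof -
      have "ypow M i * f' * ?W i * (ypow N j * f * ?Z j)
          = ypow M i * (f' * p N) * ?W i * (ypow N j * (p N * f) * ?Z j)"
        by (simp only: f(1) f')
      also have "\<dots> = ypow M i * f' * (p N * (?W i * ypow N j) * p N) * f * ?Z j"
        by (simp only: mult.assoc)
      also have "\<dots> = (if i = j then ypow M i * (f' * p N * f) * ?Z i else 0)"
        unfolding PN(5)[OF that(2,1)] by (simp add: mult.assoc)
      finally show ?thesis by (simp only: f' f(3))
    qed
    then have "(\<Sum>i<n. ypow M i * f' * ?W i) * ?P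
        = (\<Sum>i<n. \<Sum>j<n. if i = j then ypow M i * p M * ?Z i else 0)"
      unfolding sum_product by (intro sum.cong refl) auto
    then show "(\<Sum>i<n. ypow M i * f' * ?W i) * ?P = idn M" using PM(6) by simp
  qed
  show ?thesis
    unfolding hiso_def
    using key[OF M(1) N(1) Z W f f'(2)] key[OF N(1) M(1) W Z f'(1,2,3) f'(4) f(2)] by blast
qed

subsection \<open>Classification by the invariants\<close>

lemma val_high: "hmod M \<Longrightarrow> ypow M m = 0 \<Longrightarrow> m < k \<Longrightarrow> val M k h = 0"
  using ypow_ge_zero[of M m] by (simp add: val_def tinv_zero)

lemma val_nil_0: "hmod M \<Longrightarrow> ypow M n = 0 \<Longrightarrow> val M 0 h = 0"
  by (simp add: val_def tinv_zero)

lemma hiso_yop_zero: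
  assumes "hmod U" "yop U = 0" "hmod V" "yop V = 0"
    and "\<And>h. h \<in> carrier G \<Longrightarrow> tr (act U h) = tr (act V h)"
  shows "U \<asymp> V"
proof -
  have "giso (idn U) (act U) (idn V) (act V)"
    using assms by (intro giso_if_tr_eq hmodD(1))
  then show ?thesis unfolding giso_def hiso_def mor_def using assms by auto
qed

text \<open>Induction on the nilpotency length. The longest blocks are split off on both sides; the
  complements contribute nothing to \<open>val\<close> at \<open>Suc l\<close>, so the tops of the
  longest blocks have the same character.\<close>

lemma hiso_nil:
  assumes "hmod M" "hmod N" "ypow M l = 0" "ypow N l = 0" "l \<le> n"
    and "\<And>k h. 0 < k \<Longrightarrow> k \<le> l \<Longrightarrow> h \<in> carrier G \<Longrightarrow> val M k h = val N k h"
  shows "M \<asymp> N"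
  using assms
proof (induction l arbitrary: M N)
  case 0
  then have "idn M = 0" "idn N = 0" by simp_all
  then show ?case unfolding hiso_def using mor_zero by (intro exI[of _ 0]) simp
next
  case (Suc l)
  obtain U p where p: "mor M M p" "p * p = p" "block (Suc l) U (cut M p)"
    "ypow (cut M (idn M - p)) l = 0"
    by (rule split_block[of M l]) (use Suc.prems in auto)
  obtain V p' where p': "mor N N p'" "p' * p' = p'" "block (Suc l) V (cut N p')"
    "ypow (cut N (idn N - p')) l = 0"
    by (rule split_block[of N l]) (use Suc.prems in auto)
  have q: "hmod (cut M (idn M - p))" "hmod (cut N (idn N - p'))"
    using p p' Suc.prems mor_diff[OF mor_id p(1)] mor_diff[OF mor_id p'(1)]
      morD(1,2)[OF p(1)] morD(1,2)[OF p'(1)] hmodD(8)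
    by (auto intro!: hmod_cut simp: algebra_simps)
  note bM = biprod_cut[OF Suc.prems(1) p(1,2)] and bN = biprod_cut[OF Suc.prems(2) p'(1,2)]
  note vM = val_biprod[OF bM Suc.prems(1) blockD(1)[OF p(3)] q(1)]
    and vN = val_biprod[OF bN Suc.prems(2) blockD(1)[OF p'(3)] q(2)]
  have "tr (act U h) = tr (act V h)" if "h \<in> carrier G" for h
    using Suc.prems(6)[of "Suc l" h] that vM vN val_high[OF q(1) p(4)] val_high[OF q(2) p'(4)]
    by (simp add: val_block[OF p(3)] val_block[OF p'(3)])
  then have "V \<asymp> U"
    using blockD[OF p(3)] blockD[OF p'(3)] by (intro hiso_yop_zero) auto
  then have 1: "cut M p \<asymp> cut N p'"
    using block_unique[OF p(3)] block_base[OF p'(3)] blockD(2)[OF p(3)] by blast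
  have 2: "cut M (idn M - p) \<asymp> cut N (idn N - p')"
  proof (rule Suc.IH[OF q p(4) p'(4)])
    fix k h assume "0 < k" "k \<le> l" "h \<in> carrier G"
    then show "val (cut M (idn M - p)) k h = val (cut N (idn N - p')) k h"
      using Suc.prems(6)[of k h] vM vN by (simp add: val_block[OF p(3)] val_block[OF p'(3)])
  qed (use Suc.prems in simp)
  show ?case using biprod_unique[OF biprod_iso[OF bM 1 2] bN] .
qed

lemma hmod_idn_diff:
  assumes "hmod M" "mor M M p" "p * p = p"
  shows "hmod (cut M (idn M - p))"
  using assms mor_diff[OF mor_id assms(2)] morD(1,2)[OF assms(2)] hmodD(8)
  by (auto intro!: hmod_cut simp: algebra_simps)

text \<open>Plays the part of the Krull-Schmidt theorem: an additive invariant with values in a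
  field decides isomorphism, so summands can be cancelled.\<close>

theorem hiso_iff_val_eq:
  assumes "hmod M" "hmod N"
  shows "M \<asymp> N \<longleftrightarrow> val M = val N"
proof
  assume eq: "val M = val N"
  obtain p where p: "mor M M p" "p * p = p" "ypow (cut M p) n = 0" "einv (cut M (idn M - p))"
    using fitting[OF assms(1)] .
  obtain p' where p': "mor N N p'" "p' * p' = p'" "ypow (cut N p') n = 0" "einv (cut N (idn N - p'))"
    using fitting[OF assms(2)] .
  note h = hmod_cut[OF assms(1) p(1,2)] hmod_cut[OF assms(2) p'(1,2)]
    and h' = hmod_idn_diff[OF assms(1) p(1,2)] hmod_idn_diff[OF assms(2) p'(1,2)]
  note bM = biprod_cut[OF assms(1) p(1,2)] and bN = biprod_cut[OF assms(2) p'(1,2)]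
  have v: "val (cut M p) k h + val (cut M (idn M - p)) k h
      = val (cut N p') k h + val (cut N (idn N - p')) k h" for k h
    using eq val_biprod[OF bM assms(1) h(1) h'(1)] val_biprod[OF bN assms(2) h(2) h'(2)] by simp
  have "cut M p \<asymp> cut N p'"
  proof (rule hiso_nil[OF h p(3) p'(3) order_refl])
    show "val (cut M p) k h = val (cut N p') k h" if "0 < k" for k h
      using v[of k h] that by (simp only: val_einv[OF p(4) h'(1)] val_einv[OF p'(4) h'(2)]) simp
  qed
  moreover have "cut M (idn M - p) \<asymp> cut N (idn N - p')"
  proof (rule einv_iso[OF h'(1) p(4) h'(2) p'(4)])
    fix h assume "h \<in> carrier G"
    then show "tr (act (cut M (idn M - p)) h) = tr (act (cut N (idn N - p')) h)"
      using v[of 0 h] val_nil_0[OF h(1) p(3)] val_nil_0[OF h(2) p'(3)]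
      by (simp only: val_einv[OF p(4) h'(1)] val_einv[OF p'(4) h'(2)]) simp
  qed
  ultimately show "M \<asymp> N" using biprod_unique[OF biprod_iso[OF bM] bN] by blast
qed (use val_iso assms in blast)

lemma hmod_induct [consumes 1, case_names iso biprod block einv]:
  assumes "hmod M"
    and iso: "\<And>A B. hmod A \<Longrightarrow> hmod B \<Longrightarrow> A \<asymp> B \<Longrightarrow> P A \<Longrightarrow> P B"
    and biprod: "\<And>M A B. hmod M \<Longrightarrow> hmod A \<Longrightarrow> hmod B \<Longrightarrow> biprod M A B \<Longrightarrow> P A \<Longrightarrow> P B \<Longrightarrow> P M"
    and block: "\<And>l U N. block l U N \<Longrightarrow> P N"
    and einv: "\<And>N. hmod N \<Longrightarrow> einv N \<Longrightarrow> P N"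
  shows "P M"
proof -
  have nil: "P N" if "hmod N" "ypow N l = 0" "l \<le> n" for N l
    using that
  proof (induction l arbitrary: N)
    case 0
    then have "einv N" unfolding einv_def by (intro exI[of _ 0]) simp
    then show ?case using einv 0 by blast
  next
    case (Suc l)
    obtain U p where p: "mor N N p" "p * p = p" "block (Suc l) U (cut N p)"
      "ypow (cut N (idn N - p)) l = 0"
      by (rule split_block[of N l]) (use Suc.prems in auto)
    have q: "hmod (cut N (idn N - p))" using hmod_idn_diff[OF Suc.prems(1) p(1,2)] .
    show ?case
      using biprod[OF Suc.prems(1) blockD(1)[OF p(3)] q biprod_cut[OF Suc.prems(1) p(1,2)]]
        block[OF p(3)] Suc.IH[OF q p(4)] Suc.prems(3) by simp
  qed
  obtain p where p: "mor M M p" "p * p = p" "ypow (cut M p) n = 0" "einv (cut M (idn M - p))"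
    using fitting[OF assms(1)] .
  show ?thesis
    using biprod[OF assms(1) hmod_cut[OF assms(1) p(1,2)] hmod_idn_diff[OF assms(1) p(1,2)]
        biprod_cut[OF assms(1) p(1,2)]]
      nil[OF hmod_cut[OF assms(1) p(1,2)] p(3) order_refl]
      einv[OF hmod_idn_diff[OF assms(1) p(1,2)] p(4)] by blast
qed

section \<open>Tensor products of blocks\<close>

lemma ypow_ten_left:
  assumes "hmod V" "yop V = 0"
  shows "ypow (ten V N) i = idn V \<boxtimes> ypow N i"
  using hmodD(8)[OF assms(1)] assms(2) by (induction i) (simp_all add: ypow_Suc)

lemma ypow_ten_right:
  assumes "hmod V" "yop V = 0"
  shows "ypow (ten N V) i = ypow N i \<boxtimes> act V (g [^] i)"
proof (induction i)
  case (Suc i)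
  then show ?case
    using assms hmodD(7)[OF assms(1), of g "g [^] i"] g_closed g_pow_central[of g i]
    by (simp add: ypow_Suc)
qed (use hmodD[OF assms(1)] in simp)

lemma block_ten_left:
  assumes "block l U N" "hmod V" "yop V = 0"
  shows "block l (ten V U) (ten V N)"
proof -
  obtain m s t where m: "l = Suc m" "jframe m U N s t" "tr (idn N) = of_nat l * tr (idn U)"
    using assms(1) block_def by blast
  note D = jframeD[OF m(2)] and V = hmodD[OF assms(2)]
  have "jframe m (ten V U) (ten V N) (idn V \<boxtimes> s) (idn V \<boxtimes> t)"
    unfolding jframe_def ypow_ten_left[OF assms(2,3)]
    using D V hmod_ten assms jframe_ypow[OF m(2)] by simp
  then show ?thesis unfolding block_def using m by auto
qed

lemma block_ten_right:
  assumes "block l U N" "hmod V" "yop V = 0"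
  shows "block l (ten U V) (ten N V)"
proof -
  obtain m s t where m: "l = Suc m" "jframe m U N s t" "tr (idn N) = of_nat l * tr (idn U)"
    using assms(1) block_def by blast
  note D = jframeD[OF m(2)] and V = hmodD[OF assms(2)]
  define u where "u = g [^] m"
  have u: "u \<in> carrier G" using g_closed u_def by simp
  have comm: "act V (inv u) * act V h = act V h * act V (inv u)" if h: "h \<in> carrier G" for h
  proof -
    have "u \<otimes> h = h \<otimes> u" unfolding u_def using g_pow_central[OF h] .
    then have "inv u \<otimes> h = h \<otimes> inv u"
      using u h by (metis inv_closed inv_solve_left inv_solve_right m_assoc m_closed)
    then show ?thesis using V(7)[of "inv u" h] V(7)[of h "inv u"] u h by simp
  qed
  \<comment> \<open>On \<open>ten N V\<close> the power \<open>m\<close> of y acts as y^m \<otimes>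
    g^m. The factor \<open>act V (inv u)\<close> undoes g^m on the socle.\<close>
  have "jframe m (ten U V) (ten N V) (s \<boxtimes> idn V) (t \<boxtimes> act V (inv u))"
    unfolding jframe_def ypow_ten_right[OF assms(2,3)]
  proof (intro conjI ballI allI impI)
    show "(t \<boxtimes> act V (inv u)) * (ypow N j \<boxtimes> act V (g [^] j)) * (s \<boxtimes> idn V)
        = (if j = m then idn (ten U V) else 0)" for j
      using jframe_ypow[OF m(2), of j] V(12)[OF u] V(8) by (simp add: u_def)
    show "t \<boxtimes> act V (inv u) * act (ten N V) h
        = inverse (chi h) ^ m \<cdot> (act (ten U V) h * t \<boxtimes> act V (inv u))" if "h \<in> carrier G" for h
      using D(10)[OF that] comm[OF that] by simp
  qed (use D V u hmod_ten assms in auto)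
  then show ?thesis unfolding block_def using m by auto
qed

lemma block_tw:
  assumes "block l U N"
  shows "block l (tw j U) (tw j N)"
proof -
  obtain m s t where m: "l = Suc m" "jframe m U N s t" "tr (idn N) = of_nat l * tr (idn U)"
    using assms(1) block_def by blast
  have "jframe m (tw j U) (tw j N) s t"
    using m(2) hmod_tw unfolding jframe_def by (auto simp: mult.commute)
  then show ?thesis unfolding block_def using m by auto
qed

lemma block_1:
  assumes "hmod U" "yop U = 0"
  shows "block 1 U U"
proof -
  have "jframe 0 U U (idn U) (idn U)"
    unfolding jframe_def using assms hmodD[OF assms(1)] n_ge_2 by (auto simp: ypow_yop_zero)
  then show ?thesis unfolding block_def by auto
qed

text \<open>The block of length \<open>m + 1\<close> with trivial top; for \<open>m + 1 = n\<close>
  it is the module M(n,0).\<close>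

definition stdm :: "nat \<Rightarrow> ('g, 'k) hm" where
  "stdm m = HM (idm (Suc m)) (\<lambda>h. \<Sum>i\<le>m. inverse (chi h) ^ i \<cdot> munit i i) (\<Sum>i<m. munit (Suc i) i)"

lemma ent_sum_munit: "ent (\<Sum>i<m. munit (f i) i) r c = (if c < m \<and> r = f c then 1 else 0)"
  by (induction m) (auto simp: ent_zero ent_add ent_munit less_Suc_eq)

lemma ypow_stdm: "ypow (stdm m) j = (\<Sum>i<Suc m - j. munit (i + j) i)"
proof (induction j)
  case 0
  show ?case by (simp add: stdm_def idm_eq_sum)
next
  case (Suc j)
  have "(\<Sum>i<m. munit (Suc i) i) * (\<Sum>i<Suc m - j. munit (i + j) i)
      = (\<Sum>i<Suc m - j. \<Sum>k<m. if k = i + j then munit (Suc k) i else 0)"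
    unfolding sum_product by (subst sum.swap, intro sum.cong refl) (simp add: munit_mult)
  also have "\<dots> = (\<Sum>i<Suc m - j. if i + j < m then munit (Suc (i + j)) i else 0)" by simp
  also have "\<dots> = (\<Sum>i<Suc m - Suc j. munit (i + Suc j) i)"
    by (rule sum.mono_neutral_cong_right) auto
  finally show ?case using Suc by (simp add: ypow_Suc stdm_def)
qed

lemma block_stdm:
  assumes "m < n"
  shows "block (Suc m) triv (stdm m)"
proof -
  let ?N = "stdm m"
  have idn: "idn ?N = (\<Sum>i\<le>m. munit i i)"
    by (simp add: stdm_def idm_eq_sum lessThan_Suc_atMost)
  have mult: "(\<Sum>i\<le>m. a i \<cdot> munit i i) * (\<Sum>i\<le>m. b i \<cdot> munit i i) = (\<Sum>i\<le>m. (a i * b i) \<cdot> munit i i)"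
    for a b :: "nat \<Rightarrow> 'k"
  proof -
    have "(\<Sum>i\<le>m. a i \<cdot> munit i i) * (\<Sum>i\<le>m. b i \<cdot> munit i i)
        = (\<Sum>i\<le>m. \<Sum>j\<le>m. if j = i then (a i * b i) \<cdot> munit i i else 0)"
      unfolding sum_product by (intro sum.cong refl) (simp add: munit_mult mult.commute)
    then show ?thesis by simp
  qed
  have nil: "ypow ?N (Suc m) = 0" by (simp add: ypow_stdm)
  have y_act: "yop ?N * act ?N h = chi h \<cdot> (act ?N h * yop ?N)" if h: "h \<in> carrier G" for h
  proof -
    have "yop ?N * act ?N h = (\<Sum>i<m. \<Sum>j\<le>m. if j = i then inverse (chi h) ^ i \<cdot> munit (Suc i) i else 0)"
      unfolding stdm_def hm.sel sum_product by (intro sum.cong refl) (simp add: munit_mult)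
    moreover have "act ?N h * yop ?N
        = (\<Sum>i<m. \<Sum>j\<le>m. if j = Suc i then inverse (chi h) ^ Suc i \<cdot> munit (Suc i) i else 0)"
      unfolding stdm_def hm.sel sum_product
      by (subst sum.swap, intro sum.cong refl) (simp add: munit_mult)
    moreover have "chi h * inverse (chi h) = 1" using chi_nonzero[OF h] by simp
    ultimately show ?thesis by (simp add: smul_sum_right Suc_le_eq mult.assoc[symmetric])
  qed
  have "hmod ?N"
    unfolding hmod_def grep_def
  proof (intro conjI ballI)
    show "act ?N \<one> = idn ?N" by (simp add: idn) (simp add: stdm_def chi_one)
    show "act ?N (h \<otimes> k) = act ?N h * act ?N k" if "h \<in> carrier G" "k \<in> carrier G" for h k
      using that by (simp add: stdm_def mult chi_mult power_mult_distrib)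
    show "idn ?N * yop ?N = yop ?N" "yop ?N * idn ?N = yop ?N"
      by (rule fmat_eqI; simp add: stdm_def idm_mult mult_idm ent_sum_munit)+
    have "chi (g [^] n) = 1" using g_closed by (simp add: chi_pow_g root_of_unity)
    then have "act ?N (g [^] n) = idn ?N" by (simp add: idn) (simp add: stdm_def)
    moreover have "ypow ?N n = 0" using assms by (simp add: ypow_stdm)
    ultimately show "ypow ?N n = act ?N (g [^] n) - idn ?N" by simp
  qed (use y_act in simp)
  moreover have "act ?N h * munit 0 0 = munit 0 0" for h
    by (simp add: stdm_def sum_distrib_right munit_mult if_distrib cong: if_cong)
  moreover have "munit 0 m * act ?N h = inverse (chi h) ^ m \<cdot> munit 0 m" for h
    by (simp add: stdm_def sum_distrib_left munit_mult if_distrib cong: if_cong)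
  moreover have "munit 0 m * ypow ?N j * munit 0 0 = (if j = m then munit 0 0 else 0)" for j
    by (auto simp: munit_mult_ent ypow_stdm ent_sum_munit)
  ultimately have "jframe m triv ?N (munit 0 0) (munit 0 m)"
    unfolding jframe_def nil using hmod_triv assms
    by (simp add: munit_mult) (simp add: stdm_def idm_munit)
  then show ?thesis unfolding block_def by (auto simp: stdm_def tr_munit)
qed

lemma block_exists:
  assumes "hmod U" "yop U = 0" "1 \<le> l" "l \<le> n"
  obtains N where "block l U N"
proof -
  obtain m where m: "l = Suc m" using assms(3) by (cases l) auto
  have "block l (ten U triv) (ten U (stdm m))"
    unfolding m using assms m by (intro block_ten_left block_stdm) auto
  then have "block l U (ten U (stdm m))"
    using ten_triv_right[OF assms(1)] assms(1) by (rule block_base)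
  then show thesis by (rule that)
qed

section \<open>The Clebsch-Gordan rule for the two-dimensional block\<close>

abbreviation E2 :: "('g, 'k) hm" where "E2 \<equiv> stdm (Suc 0)"

lemma block_E2: "block 2 triv E2"
  using block_stdm[of "Suc 0"] n_ge_2 by (simp add: numeral_2_eq_2)

lemma hmod_E2: "hmod E2"
  using blockD(1)[OF block_E2] .

text \<open>The q-integers for \<open>q = chi g\<close>. They are nonzero for
  \<open>0 < j < n\<close> and vanish at \<open>n\<close>, which is what makes blocks of length
  \<open>n\<close> exceptional.\<close>

definition qs :: "nat \<Rightarrow> 'k" where
  "qs j = (\<Sum>i<j. chi g ^ i)"

lemma qs_0 [simp]: "qs 0 = 0" and qs_Suc: "qs (Suc j) = 1 + chi g * qs j"
  by (simp_all add: qs_def sum.lessThan_Suc_shift sum_distrib_left del: sum.lessThan_Suc)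

lemma qs_eq: "(chi g - 1) * qs j = chi g ^ j - 1"
  by (induction j) (simp_all add: qs_Suc algebra_simps)

lemma qs_n: "qs n = 0"
proof -
  have "chi g \<noteq> 1" using primitive[of 1] n_ge_2 by auto
  then show ?thesis using qs_eq[of n] root_of_unity by simp
qed

lemma qs_nonzero: "0 < j \<Longrightarrow> j < n \<Longrightarrow> qs j \<noteq> 0"
  using qs_eq[of j] primitive[of j] by auto

text \<open>The q-binomial theorem with a first summand of square zero, so that only two terms
  remain. At \<open>j = 0\<close> the truncated exponent \<open>j - 1\<close> is harmless, as
  \<open>qs 0 = 0\<close>.\<close>

lemma ypow_ten_E2:
  assumes N: "hmod N"
  shows "ypow (ten E2 N) j = idn E2 \<boxtimes> ypow N j + qs j \<cdot> (yop E2 \<boxtimes> (act N g * ypow N (j - 1)))"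
proof (induction j)
  case (Suc j)
  note E = hmodD[OF hmod_E2] and D = hmodD[OF N]
  have YY: "yop E2 * yop E2 = 0"
    using blockD(6)[OF block_E2] ypow_1[OF hmod_E2] by (simp add: numeral_2_eq_2 ypow_Suc[of E2 "Suc 0"])
  have "qs j \<cdot> (yop E2 \<boxtimes> (yop N * (act N g * ypow N (j - 1))))
      = (chi g * qs j) \<cdot> (yop E2 \<boxtimes> (act N g * ypow N j))"
  proof (cases j)
    case (Suc i)
    have "yop N * (act N g * ypow N i) = chi g \<cdot> (act N g * ypow N (Suc i))"
      using D(4)[OF g_closed] by (simp add: ypow_Suc flip: mult.assoc)
    then show ?thesis using Suc by (simp add: mult.commute)
  qed simp
  then show ?case
    using Suc E YY by (simp add: ypow_Suc distrib_left distrib_right qs_Suc smul_add_left)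
qed simp

text \<open>Let \<open>s\<close> and \<open>x\<close> embed the tops of \<open>E2\<close> and
  \<open>N\<close>. For \<open>l < n\<close>, the power \<open>l\<close> of y takes
  \<open>s \<boxtimes> x\<close> to a multiple of ys \<otimes> g y^(l-1) x with the factor
  \<open>qs l \<noteq> 0\<close>, so \<open>s \<boxtimes> x\<close> generates a block of length
  \<open>l + 1\<close>. For \<open>l > 1\<close> there remains a block of length
  \<open>l - 1\<close>, whose top lies one degree lower and is therefore twisted. For
  \<open>l = n\<close> the factor vanishes and two blocks of length \<open>n\<close> appear.\<close>

lemma clebsch_gordan:
  assumes B: "block l U N"
  shows "l = n \<Longrightarrow> \<exists>N1 N2. biprod (ten E2 N) N1 N2 \<and> block n U N1 \<and> block n (tw 1 U) N2"
    "l = 1 \<Longrightarrow> block 2 U (ten E2 N)"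
    "1 < l \<Longrightarrow> l < n \<Longrightarrow>
      \<exists>N1 N2. biprod (ten E2 N) N1 N2 \<and> block (l + 1) U N1 \<and> block (l - 1) (tw 1 U) N2"
proof -
  obtain s t where E: "jframe 1 triv E2 s t" "tr (idn E2) = 2 * tr (idn triv)"
    using block_E2 unfolding block_def by (auto simp: numeral_2_eq_2)
  obtain m x y where m: "l = Suc m" "jframe m U N x y" "tr (idn N) = of_nat l * tr (idn U)"
    using B block_def by blast
  note DE = jframeD[OF E(1)] and DN = jframeD[OF m(2)]
  note HE = hmodD[OF DE(1)] and HN = hmodD[OF DN(1)] and HU = hmodD[OF DN(2)]
  let ?T = "ten E2 N" and ?U = "ten triv U" and ?V = "tw 1 (ten triv U)"
  let ?o = "munit 0 0 :: 'k fmat" and ?Y = "yop E2"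
  \<comment> \<open>The scalar that arises when \<open>g\<close> is moved across the projection
    \<open>y\<close> onto the socle of \<open>N\<close>.\<close>
  define z where "z = inverse (chi g) ^ m"
  have q0: "chi g \<noteq> 0" "z \<noteq> 0" "z * chi g ^ m = 1"
    using chi_nonzero[OF g_closed] by (simp_all add: z_def power_inverse)
  have YY: "?Y * ?Y = 0"
    using blockD(6)[OF block_E2] ypow_1[OF hmod_E2] by (simp add: numeral_2_eq_2 ypow_Suc[of E2 "Suc 0"])
  have E_simps: "t * s = 0" "t * (?Y * s) = ?o" "?Y * (?Y * w) = 0" "idn E2 * s = s" "t * idn E2 = t"
      "idn E2 * (?Y * w) = ?Y * w" "s * ?o = s" "?o * t = t" "act E2 h * s = s" "t * (?Y * idn E2) = t * ?Y" 
      "?o * (t * w) = t * w" "idn E2 * (s * w) = s * w"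
    if "h \<in> carrier G" for w h
    using jframe_ypow[OF E(1), of 0] jframe_ypow[OF E(1), of 1] ypow_1[OF hmod_E2] DE HE YY that
    by (simp_all add: mult.assoc) (simp_all flip: mult.assoc)
  note E_simps = E_simps[OF g_closed] and E_act = E_simps(9)
  have act_Y: "act E2 h * (?Y * s) = inverse (chi h) \<cdot> (?Y * s)" and t_act: "t * act E2 h = inverse (chi h) \<cdot> t"
    and tY_act: "t * (?Y * act E2 h) = t * ?Y" if h: "h \<in> carrier G" for h
  proof -
    have "chi h \<cdot> (act E2 h * (?Y * s)) = ?Y * (act E2 h * s)"
      using HE(4)[OF h] by (simp flip: mult.assoc)
    also have "\<dots> = ?Y * s" using E_act[OF h] by simp
    finally have "inverse (chi h) \<cdot> chi h \<cdot> (act E2 h * (?Y * s)) = inverse (chi h) \<cdot> (?Y * s)" by simp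
    then show "act E2 h * (?Y * s) = inverse (chi h) \<cdot> (?Y * s)" using chi_nonzero[OF h] by simp
    show *: "t * act E2 h = inverse (chi h) \<cdot> t"
      using DE(10)[OF h] E_simps by simp
    show "t * (?Y * act E2 h) = t * ?Y"
      using HE(4)[OF h] * chi_nonzero[OF h] by simp (simp flip: mult.assoc)
  qed
  have T: "hmod ?T" "hmod ?U" "yop ?U = 0" "hmod ?V" "yop ?V = 0"
    using hmod_ten[OF DE(1) DN(1)] hmod_ten[OF hmod_triv DN(2)] hmod_tw DN(3) by auto
  have baseU: "?U \<asymp> U" and baseV: "?V \<asymp> tw 1 U"
    using ten_triv_left[OF DN(2)] tw_iso by blast+
  have trT: "tr (idn ?T) = 2 * (of_nat l * tr (idn U))"
    using E(2) m(3) by (simp add: tr_munit)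
  have trU: "tr (idn ?U) = tr (idn U)" "tr (idn ?V) = tr (idn U)" by (simp_all add: tr_munit)
  have nil: "ypow N j = 0" if "m < j" for j
    using ypow_ge_zero[OF blockD(1,6)[OF B]] that m(1) by simp
  note yT = ypow_ten_E2[OF DN(1)]
  have gx: "act N h * x = x * act U h" if "h \<in> carrier G" for h using DN(7)[OF that] .
  have pow: "y * (ypow N j * x) = (if j = m then idn U else 0)" for j
    using jframe_ypow[OF m(2), of j] by (simp add: mult.assoc)
  have pow': "y * (ypow N j * (x * w)) = (if j = m then idn U * w else 0)" for j w
    using jframe_ypow[OF m(2), of j] by (simp add: mult.assoc[symmetric])
  have yg: "y * (act N h * w) = inverse (chi h) ^ m \<cdot> (act U h * (y * w))" if "h \<in> carrier G" for h w
    using DN(10)[OF that] by (simp flip: mult.assoc)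
  show "\<exists>N1 N2. biprod ?T N1 N2 \<and> block n U N1 \<and> block n (tw 1 U) N2" if "l = n"
  proof -
    have mn: "Suc m = n" using that m(1) by simp
    \<comment> \<open>Since \<open>qs n = 0\<close>, no vector of the tensor product generates a
      block longer than \<open>n\<close>.\<close>
    have yT_zero: "ypow ?T (Suc m) = 0" using nil[of "Suc m"] qs_n mn by (simp add: yT)
    have F1: "jframe m ?U ?T (s \<boxtimes> x) ((t * ?Y) \<boxtimes> y)"
      unfolding jframe_def yT_zero
    proof (intro conjI ballI allI impI)
      fix h assume h: "h \<in> carrier G"
      show "act ?T h * s \<boxtimes> x = s \<boxtimes> x * act ?U h"
        using E_act[OF h] gx[OF h] E_simps by simp
      show "(t * ?Y) \<boxtimes> y * act ?T h = inverse (chi h) ^ m \<cdot> (act ?U h * (t * ?Y) \<boxtimes> y)"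
        using tY_act[OF h] DN(10)[OF h] E_simps by (simp add: mult.assoc)
    next
      fix j show "(t * ?Y) \<boxtimes> y * ypow ?T j * s \<boxtimes> x = (if j = m then idn ?U else 0)"
        using E_simps by (simp add: yT distrib_left distrib_right mult.assoc pow)
    qed (use T DN HE m mn E_simps in \<open>auto simp: mult.assoc\<close>)
    have F2: "jframe m ?V ?T ((?Y * s) \<boxtimes> x) (t \<boxtimes> y)"
      unfolding jframe_def yT_zero
    proof (intro conjI ballI allI impI)
      fix h assume h: "h \<in> carrier G"
      show "act ?T h * (?Y * s) \<boxtimes> x = (?Y * s) \<boxtimes> x * act ?V h"
        using act_Y[OF h] gx[OF h] E_simps by (simp add: mult.assoc)
      show "t \<boxtimes> y * act ?T h = inverse (chi h) ^ m \<cdot> (act ?V h * t \<boxtimes> y)"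
        using t_act[OF h] DN(10)[OF h] E_simps by (simp add: mult.commute)
    next
      fix j show "t \<boxtimes> y * ypow ?T j * (?Y * s) \<boxtimes> x = (if j = m then idn ?V else 0)"
        using E_simps by (simp add: yT distrib_left distrib_right mult.assoc pow)
    qed (use T DN HE m mn E_simps in \<open>auto simp: mult.assoc\<close>)
    have o1: "(t * ?Y) \<boxtimes> y * ypow ?T k * (?Y * s) \<boxtimes> x = 0" for k
      using E_simps by (simp add: yT distrib_left distrib_right mult.assoc)
    have o2: "t \<boxtimes> y * ypow ?T k * s \<boxtimes> x = 0" for k
    proof (cases "k = Suc m")
      case False
      then have "qs k = 0 \<or> k - 1 \<noteq> m" by (cases k) auto
      then show ?thesis
        using E_simps by (auto simp: yT distrib_left distrib_right mult.assoc yg[OF g_closed] pow)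
    qed (simp add: yT_zero)
    have tr: "tr (idn ?T) = of_nat (Suc m) * tr (idn ?U) + of_nat (Suc m) * tr (idn ?V)"
      unfolding trT trU m(1) by simp
    show ?thesis
    proof (rule two_frames[OF F1 F2 o1 o2 tr])
      fix N1 N2 assume "biprod ?T N1 N2" "block (Suc m) ?U N1" "block (Suc m) ?V N2"
      then show ?thesis
        using block_base baseU baseV DN(2) hmod_tw[OF DN(2)] unfolding mn by blast
    qed
  qed
  \<comment> \<open>The inverse of \<open>g\<close> on the top; it removes the factor
    \<open>g\<close> which y \<otimes> g leaves on the second tensor factor.\<close>
  define ai where "ai = act U (inv g)"
  have ai: "ai * act U g = idn U" "idn U * ai = ai" "ai * idn U = ai" "ai * (act U g * w) = idn U * w"
      "idn U * (ai * w) = ai * w" for w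
    using HU(12)[OF g_closed] HU(9,10)[of "inv g"] g_closed
    by (simp_all add: ai_def flip: mult.assoc)
  have ai_act: "ai * act U h = act U h * ai" if h: "h \<in> carrier G" for h
  proof -
    have "inv g \<otimes> h = h \<otimes> inv g"
      using g_central[OF h] g_closed h by (metis inv_closed inv_solve_left inv_solve_right m_assoc m_closed)
    then show ?thesis using HU(7)[of "inv g" h] HU(7)[of h "inv g"] g_closed h by (simp add: ai_def)
  qed
  have Ug: "idn U * act U g = act U g" using HU(9)[OF g_closed] .
  have Uy: "idn U * (y * w) = y * w" for w using DN(8) by (simp flip: mult.assoc)
  \<comment> \<open>The projection onto the socle of the longer block, up to the scalar
    \<open>qs (Suc m) * z\<close> which its pairing with \<open>s \<boxtimes> x\<close> yields in
    degree \<open>m + 1\<close>.\<close>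
  define f1 where "f1 = t \<boxtimes> (ai * y)"
  have f1v1: "f1 * ypow ?T j * s \<boxtimes> x = (if j = Suc m then (qs j * z) \<cdot> (?o \<boxtimes> idn U) else 0)" for j
  proof (cases j)
    case (Suc i)
    then show ?thesis using E_simps ai
      by (simp add: f1_def yT distrib_left distrib_right mult.assoc yg[OF g_closed] pow z_def Uy)
  qed (use E_simps in \<open>simp add: f1_def mult.assoc\<close>)
  have F1: "jframe (Suc m) ?U ?T (s \<boxtimes> x) (inverse (qs (Suc m) * z) \<cdot> f1)" if mn: "Suc m < n"
  proof -
    have qz: "qs (Suc m) * z \<noteq> 0" using qs_nonzero[of "Suc m"] mn q0 by simp
    have zero: "ypow ?T (Suc (Suc m)) = 0" using nil by (simp add: yT)
    show ?thesis
      unfolding jframe_def zero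
    proof (intro conjI ballI allI impI)
      fix h assume h: "h \<in> carrier G"
      show "act ?T h * s \<boxtimes> x = s \<boxtimes> x * act ?U h"
        using E_act[OF h] gx[OF h] E_simps by simp
      have "ai * (act U h * y) = act U h * (ai * y)" using ai_act[OF h] by (simp flip: mult.assoc)
      then show "inverse (qs (Suc m) * z) \<cdot> f1 * act ?T h
          = inverse (chi h) ^ Suc m \<cdot> (act ?U h * inverse (qs (Suc m) * z) \<cdot> f1)"
        using t_act[OF h] DN(10)[OF h] E_simps by (simp add: f1_def mult.assoc mult.left_commute mult.commute)
    next
      fix j show "inverse (qs (Suc m) * z) \<cdot> f1 * ypow ?T j * s \<boxtimes> x = (if j = Suc m then idn ?U else 0)"
        using qz by (simp add: f1v1 del: inverse_mult_distrib)
    qed (use T DN HE HU m mn E_simps ai in \<open>auto simp: mult.assoc f1_def\<close>)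
  qed
  show "block 2 U ?T" if "l = 1"
  proof -
    have m0: "m = 0" using that m(1) by simp
    have "block 2 ?U ?T"
      unfolding block_def using F1 m0 n_ge_2 trT trU m(1) by (auto simp: numeral_2_eq_2)
    then show ?thesis by (rule block_base[OF _ baseU DN(2)])
  qed
  show "\<exists>N1 N2. biprod ?T N1 N2 \<and> block (l + 1) U N1 \<and> block (l - 1) (tw 1 U) N2"
    if l: "1 < l" "l < n"
  proof -
    obtain m' where m': "m = Suc m'" using l m(1) by (cases m) auto
    have mn: "Suc m < n" using l m(1) by simp
    \<comment> \<open>The top \<open>v2\<close> and the socle map \<open>f2\<close> of the shorter
      block are corrected by these constants. \<open>b\<close> makes \<open>v2\<close> orthogonal to
      \<open>f1\<close>, and \<open>c\<close> makes \<open>f2\<close> orthogonal to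
      \<open>s \<boxtimes> x\<close>, both in degree \<open>m\<close>. \<open>W\<close> is the
      pairing of \<open>f2\<close> with \<open>v2\<close> in degree \<open>m - 1\<close>; it is
      nonzero because \<open>m + 1 < n\<close>.\<close>
    define b c W where "b = qs m * z" and "c = qs m * chi g * z" and "W = - (qs (Suc m) * z)"
    define v2 where "v2 = s \<boxtimes> (yop N * x) - b \<cdot> ((?Y * s) \<boxtimes> (act N g * x))"
    define f2 where "f2 = t \<boxtimes> (ai * y * yop N) - c \<cdot> ((t * ?Y) \<boxtimes> y)"
    have yy: "yop N * (ypow N j * w) = ypow N (Suc j) * w" "ypow N j * (yop N * w) = ypow N (Suc j) * w" for j w
      by (simp_all add: ypow_Suc ypow_Suc_right[OF DN(1)] mult.assoc flip: ypow_Suc_right[OF DN(1)])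
        (metis mult.assoc ypow_Suc ypow_Suc_right[OF DN(1)])
    have yact: "yop N * (act N g * w) = chi g \<cdot> (act N g * (yop N * w))" for w
      using HN(4)[OF g_closed] by (simp flip: mult.assoc)
    have yy0: "yop N * ypow N j = ypow N (Suc j)" for j by (simp add: ypow_Suc)
    have y1: "y * (yop N * x) = (if m = 1 then idn U else 0)"
      "y * (yop N * (x * w)) = (if m = 1 then idn U * w else 0)" for w
      using pow[of 1] pow'[of 1] ypow_1[OF DN(1)] by simp_all
    have Nx: "idn N * (yop N * w) = yop N * w" "idn N * (act N g * w) = act N g * w"
      "idn N * (x * w) = x * w" "y * (yop N * idn N) = y * yop N" for w
      using HN(2,3,9) DN(5) g_closed by (simp_all flip: mult.assoc)
    have gUx: "act N g * x = x * act U g" using gx[OF g_closed] .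
    have f1v2: "f1 * ypow ?T j * v2 = 0" for j
    proof (cases j)
      case 0
      then show ?thesis using E_simps m' pow'[of 0] DN(5) HN
        by (simp add: f1_def v2_def yT right_diff_distrib mult.assoc gUx)
    next
      case (Suc i)
      then show ?thesis using E_simps ai
        by (simp add: f1_def v2_def yT distrib_left distrib_right right_diff_distrib mult.assoc
            yg[OF g_closed] pow pow' yy gUx b_def Uy Ug flip: z_def)
    qed
    have f2v1: "f2 * ypow ?T j * s \<boxtimes> x = 0" for j
    proof (cases j)
      case 0
      then show ?thesis using E_simps m' pow[of 0] DN(5)
        by (simp add: f2_def yT left_diff_distrib mult.assoc)
    next
      case (Suc i)
      then show ?thesis using E_simps ai
        by (simp add: f2_def yT distrib_left distrib_right left_diff_distrib mult.assoc
            yg[OF g_closed] pow pow' yy yact c_def Uy mult.commute mult.left_commute flip: z_def)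
    qed
    have cc: "qs m' * chi g * z - b - c = W"
      by (simp add: b_def c_def W_def m' qs_Suc algebra_simps)
    have f2v2: "f2 * ypow ?T j * v2 = (if j = m' then W \<cdot> (?o \<boxtimes> idn U) else 0)" for j
    proof -
      have "f2 * ypow ?T j * v2 = (if j = m' then (qs j * chi g * z - b - c) \<cdot> (?o \<boxtimes> idn U) else 0)"
      proof (cases j)
        case 0
        then show ?thesis using E_simps ai m' HN Nx
          by (simp add: f2_def v2_def left_diff_distrib right_diff_distrib mult.assoc gUx y1 Ug
              smul_diff_left smul_minus_left algebra_simps)
      next
        case (Suc i)
        then show ?thesis using E_simps ai m'
          by (simp add: f2_def v2_def yT distrib_left distrib_right left_diff_distrib right_diff_distrib mult.assoc
            yg[OF g_closed] pow pow' yy yact gUx Uy Ug smul_diff_left mult.commute mult.left_commute z_def)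
      qed
      then show ?thesis using cc by auto
    qed
    have F2: "jframe m' ?V ?T v2 (inverse W \<cdot> f2)"
    proof -
      have qz: "W \<noteq> 0" using qs_nonzero[of "Suc m"] mn q0 by (simp add: W_def)
      show ?thesis
        unfolding jframe_def
      proof (intro conjI ballI allI impI)
        fix h assume h: "h \<in> carrier G"
        have yN: "act N h * (yop N * x) = inverse (chi h) \<cdot> (yop N * x * act U h)"
        proof -
          have "yop N * (x * act U h) = chi h \<cdot> (act N h * (yop N * x))"
            using HN(4)[OF h] gx[OF h] by (metis mult.assoc smul_mult_left)
          then show ?thesis using chi_nonzero[OF h] by (simp add: mult.assoc)
        qed
        have gh: "act U g * act U h = act U h * act U g"
          using HU(7)[OF g_closed h] HU(7)[OF h g_closed] g_central[OF h] by simp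
        have "act N h * (act N g * x) = act N g * x * act U h"
          using gx[OF h] gh by (simp add: gUx mult.assoc) (simp flip: mult.assoc)
        then show "act ?T h * v2 = v2 * act ?V h"
          using E_act[OF h] E_simps act_Y[OF h] yN
          by (simp add: v2_def right_diff_distrib left_diff_distrib smul_diff_right mult.assoc mult.commute)
        have "ai * (y * (yop N * act N h)) = (chi h * inverse (chi h) ^ m) \<cdot> (act U h * (ai * (y * yop N)))"
          using HN(4)[OF h] ai_act[OF h] by (simp add: yg[OF h]) (simp flip: mult.assoc)
        also have "chi h * inverse (chi h) ^ m = inverse (chi h) ^ m'"
          using chi_nonzero[OF h] by (simp add: m')
        finally show "inverse W \<cdot> f2 * act ?T h
            = inverse (chi h) ^ m' \<cdot> (act ?V h * inverse W \<cdot> f2)"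
          using t_act[OF h] tY_act[OF h] DN(10)[OF h] E_simps
          by (simp add: f2_def right_diff_distrib left_diff_distrib smul_diff_right mult.assoc m'
              mult.left_commute mult.commute)
      next
        fix j show "inverse W \<cdot> f2 * ypow ?T j * v2 = (if j = m' then idn ?V else 0)"
          using qz by (simp add: f2v2)
      next
        have "ypow N m * (act N g * x) = chi g ^ m \<cdot> (act N g * (ypow N m * x))"
          using ypow_act[OF DN(1) g_closed, of m] by (simp flip: mult.assoc)
        then show "ypow ?T (Suc m') * v2 = 0"
          using E_simps nil[of "Suc m"] q0
          by (simp add: v2_def yT right_diff_distrib distrib_left distrib_right mult.assoc yy b_def
              flip: m') (simp add: m' yy mult.assoc)
        show "inverse W \<cdot> f2 * ypow ?T (Suc m') = 0"
          using E_simps nil[of "Suc m"] ai YY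
          by (simp add: f2_def yT left_diff_distrib distrib_left smul_diff_right mult.assoc yact yy0
              yg[OF g_closed] Uy c_def mult.commute mult.left_commute flip: m' z_def) (simp add: m' yy0)
        show "idn ?T * v2 = v2" "v2 * idn ?V = v2" "idn ?V * inverse W \<cdot> f2 = inverse W \<cdot> f2"
           "inverse W \<cdot> f2 * idn ?T = inverse W \<cdot> f2"
          using E_simps DN(5,6,8,9) ai Nx
          by (simp_all add: v2_def f2_def left_diff_distrib right_diff_distrib smul_diff_right
              mult.assoc gUx HU(10)[OF g_closed])
      qed (use T DN m mn m' in auto)
    qed
    have o1: "inverse (qs (Suc m) * z) \<cdot> f1 * ypow ?T k * v2 = 0" for k using f1v2 by simp
    have o2: "inverse W \<cdot> f2 * ypow ?T k * s \<boxtimes> x = 0" for k using f2v1 by simp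
    have tr: "tr (idn ?T) = of_nat (Suc (Suc m)) * tr (idn ?U) + of_nat (Suc m') * tr (idn ?V)"
      unfolding trT trU m(1) m' by (simp add: algebra_simps)
    show ?thesis
    proof (rule two_frames[OF F1[OF mn] F2 o1 o2 tr])
      fix N1 N2 assume "biprod ?T N1 N2" "block (Suc (Suc m)) ?U N1" "block (Suc m') ?V N2"
      moreover have "l + 1 = Suc (Suc m)" "l - 1 = Suc m'" using m(1) m' by auto
      ultimately show ?thesis
        using block_base baseU baseV DN(2) hmod_tw[OF DN(2)] by metis
    qed
  qed
qed

subsection \<open>Invariants of tensor products\<close>

text \<open>On the nilpotent factor \<open>g [^] n\<close> acts trivially, so y^n acts on the tensor
  product as y^n on the other factor.\<close>

lemma einv_ten:
  assumes X: "hmod M" "einv M" and N: "hmod N" "ypow N n = 0"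
  shows "einv (ten M N)" "einv (ten N M)"
proof -
  obtain Z where Z: "ypow M n * mpow (idn M) Z n = idn M" "mpow (idn M) Z n * ypow M n = idn M"
    by (rule einvD[OF X(2,1)]) blast
  note DX = hmodD[OF X(1)] and DN = hmodD[OF N(1)]
  have "act N (g [^] n) = idn N" using DN(5) N(2) by simp
  then have 1: "ypow (ten M N) n = ypow M n \<boxtimes> idn N" "ypow (ten N M) n = idn N \<boxtimes> ypow M n"
    using hmodD(5)[OF hmod_ten[OF X(1) N(1)]] hmodD(5)[OF hmod_ten[OF N(1) X(1)]] DX(5)
    by (simp_all add: kron_diff_left kron_diff_right)
  show "einv (ten M N)"
    by (rule einv_if_ypow_inverse[OF hmod_ten[OF X(1) N(1)], of "mpow (idn M) Z n \<boxtimes> idn N"])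
      (simp_all add: 1 Z DN(8))
  show "einv (ten N M)"
    by (rule einv_if_ypow_inverse[OF hmod_ten[OF N(1) X(1)], of "idn N \<boxtimes> mpow (idn M) Z n"])
      (simp_all add: 1 Z DN(8))
qed

lemma ypow_n_block: "block l U N \<Longrightarrow> ypow N n = 0"
  using blockD[of l U N] ypow_ge_zero by blast

lemma ypow_n_yop_zero: "yop U = 0 \<Longrightarrow> ypow U n = 0"
  using n_ge_2 by (simp add: ypow_yop_zero)

lemma val_ten_yop_zero:
  assumes U: "hmod U" "yop U = 0" and h: "h \<in> carrier G" and N: "hmod N"
  shows "val (ten U N) k h = tr (act U h) * val N k h"
  using N
proof (induction N rule: hmod_induct)
  case (iso A B)
  then show ?case
    using val_iso[of A B] val_iso[OF ten_iso[OF hiso_refl[OF U(1)]], of A B] hmod_ten[OF U(1)] by simp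
next
  case (biprod M A B)
  then show ?case
    using val_biprod[OF biprod_ten_right[OF _ U(1)], of M A B] val_biprod[of M A B] hmod_ten[OF U(1)]
    by (simp add: distrib_left)
next
  case (block l V N)
  then show ?case using h by (simp add: val_block[OF block_ten_left[OF block U]] val_block[OF block])
next
  case (einv N)
  then show ?case
    using h hmod_ten[OF U(1)] einv_ten(2)[OF _ _ U(1) ypow_n_yop_zero[OF U(2)], of N] by (simp add: val_einv)
qed

lemma tr_act_E2: "h \<in> carrier G \<Longrightarrow> tr (act E2 h) = 1 + inverse (chi h)"
  by (simp add: stdm_def tr_munit)

text \<open>The Clebsch-Gordan rule read from the target. Length 1 receives nothing from below,
  because \<open>val\<close> at 0 belongs to the part where y is invertible. Length
  \<open>n - 1\<close> receives nothing from above, because blocks of length \<open>n\<close>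
  produce only blocks of length \<open>n\<close>.\<close>

lemma val_ten_E2:
  assumes h: "h \<in> carrier G" and N: "hmod N" and k: "k \<le> n"
  shows "val (ten E2 N) k h =
    (if k = 0 then (1 + inverse (chi h)) * val N 0 h
     else (if k = 1 then 0 else val N (k - 1) h) +
       (if k = n then (1 + inverse (chi h)) * val N n h
        else if k + 1 = n then 0 else inverse (chi h) * val N (k + 1) h))" (is "_ = ?E (val N)")
  using N
proof (induction N rule: hmod_induct)
  case (iso A B)
  then show ?case
    using val_iso[of A B] val_iso[OF ten_iso[OF hiso_refl[OF hmod_E2]], of A B] hmod_ten[OF hmod_E2]
    by metis
next
  case (biprod M A B)
  then have "val (ten E2 M) k h = val (ten E2 A) k h + val (ten E2 B) k h"
    using val_biprod[OF biprod_ten_right[OF _ hmod_E2]] hmod_ten[OF hmod_E2] by simp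
  moreover have "?E (val M) = ?E (val A) + ?E (val B)"
  proof -
    have V: "val M j h = val A j h + val B j h" for j using val_biprod biprod by blast
    have if_add: "(if P then a + b else c + d) = (if P then a else c) + (if P then b else d)"
      "(if P then 0 else c + d) = (if P then 0 else c) + (if P then 0 else d)" for P and a b c d :: 'k
      by simp_all
    show ?thesis
    proof (cases "k = 0")
      case False
      then show ?thesis unfolding V distrib_left if_add by (simp only: if_False add_ac)
    qed (simp add: V distrib_left)
  qed
  ultimately show ?case using biprod by simp
next
  case (block l U N)
  have l: "1 \<le> l" "l \<le> n" and T: "hmod (ten E2 N)" using blockD[OF block] hmod_ten[OF hmod_E2] by auto
  consider "l = n" | "l = 1" | "1 < l" "l < n" using l by linarith
  then show ?case
  proof cases
    case 1
    obtain N1 N2 where "biprod (ten E2 N) N1 N2" and b: "block n U N1" "block n (tw 1 U) N2"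
      using clebsch_gordan(1)[OF block 1] by blast
    then have "val (ten E2 N) k h = val N1 k h + val N2 k h"
      using val_biprod T blockD(1) by blast
    then have "val (ten E2 N) k h = (if k = n then (1 + inverse (chi h)) * tr (act U h) else 0)"
      using h by (simp add: val_block[OF b(1)] val_block[OF b(2)] distrib_right)
    moreover have v: "val N j h = (if j = n then tr (act U h) else 0)" for j
      using h 1 val_block[OF block] by simp
    moreover have "k - 1 \<noteq> n" using k n_ge_2 by auto
    ultimately show ?thesis using n_ge_2 by simp
  next
    case 2
    have b: "block 2 U (ten E2 N)" using clebsch_gordan(2)[OF block 2] .
    have T: "val (ten E2 N) k h = (if k = 2 then tr (act U h) else 0)"
      using h by (simp add: val_block[OF b])
    have v: "val N j h = (if j = 1 then tr (act U h) else 0)" for j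
      using h 2 val_block[OF block] by simp
    have e2: "(if k = n then (1 + inverse (chi h)) * val N n h
        else if k + 1 = n then 0 else inverse (chi h) * val N (k + 1) h) = 0" if "k \<noteq> 0"
      unfolding v using that n_ge_2 by simp
    have e1: "(if k = 1 then 0 else val N (k - 1) h) = (if k = 2 then tr (act U h) else 0)" if "k \<noteq> 0"
    proof (cases "k = 2")
      case False
      then have "k - 1 \<noteq> 1" using that by linarith
      then show ?thesis unfolding v by (simp only: False if_False if_cancel)
    qed (simp add: v)
    show ?thesis
    proof (cases "k = 0")
      case True
      then show ?thesis unfolding T v by simp
    next
      case False
      then show ?thesis by (simp only: T e1[OF False] e2[OF False] if_False add_0_right)
    qed
  next
    case 3
    obtain N1 N2 where "biprod (ten E2 N) N1 N2" and b: "block (l + 1) U N1" "block (l - 1) (tw 1 U) N2"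
      using clebsch_gordan(3)[OF block 3] by blast
    then have "val (ten E2 N) k h = val N1 k h + val N2 k h"
      using val_biprod T blockD(1) by blast
    then have T: "val (ten E2 N) k h = (if k = l + 1 then tr (act U h) else 0)
        + (if k = l - 1 then inverse (chi h) * tr (act U h) else 0)"
      using h by (simp add: val_block[OF b(1)] val_block[OF b(2)])
    have v: "val N j h = (if j = l then tr (act U h) else 0)" for j
      using h val_block[OF block] by simp
    have e1: "(if k = 1 then 0 else val N (k - 1) h) = (if k = l + 1 then tr (act U h) else 0)" if "k \<noteq> 0"
    proof (cases "k = l + 1")
      case True
      then have "k - 1 = l" "k \<noteq> 1" using 3(1) by linarith+
      then show ?thesis unfolding v by (simp only: if_True if_False True refl)
    next
      case False
      then have "k - 1 \<noteq> l" using that by linarith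
      then show ?thesis unfolding v by (simp only: False if_False if_cancel)
    qed
    have e2: "(if k = n then (1 + inverse (chi h)) * val N n h
        else if k + 1 = n then 0 else inverse (chi h) * val N (k + 1) h)
      = (if k = l - 1 then inverse (chi h) * tr (act U h) else 0)"
      unfolding v using 3 by auto
    show ?thesis
    proof (cases "k = 0")
      case True
      then show ?thesis unfolding T v using 3 by auto
    next
      case False
      then show ?thesis by (simp only: T e1[OF False] e2 if_False)
    qed
  qed
next
  case (einv N)
  then show ?case
    using h hmod_ten[OF hmod_E2] einv_ten(2)[OF _ _ hmod_E2 ypow_n_block[OF block_E2], of N] n_ge_2
    by (simp add: val_einv tr_act_E2)
qed

text \<open>The Clebsch-Gordan rule solved for its longest block, for inductions on the block length.\<close>

lemma block_Suc_E2:
  assumes "block (Suc (Suc m)) U N"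
  obtains N' where "block (Suc m) U N'" "m = 0 \<Longrightarrow> ten E2 N' \<asymp> N"
    "\<And>P. m > 0 \<Longrightarrow> (\<And>B. block m (tw 1 U) B \<Longrightarrow> biprod (ten E2 N') N B \<Longrightarrow> P) \<Longrightarrow> P"
proof -
  note D = blockD[OF assms]
  obtain N' where N': "block (Suc m) U N'"
    using block_exists[OF D(2,3), of "Suc m"] D(5) by auto
  show thesis
  proof (rule that[OF N'])
    show "ten E2 N' \<asymp> N" if "m = 0"
      using clebsch_gordan(2)[OF N'] assms that block_unique by (simp add: numeral_2_eq_2)
    fix P assume m: "m > 0" and P: "\<And>B. block m (tw 1 U) B \<Longrightarrow> biprod (ten E2 N') N B \<Longrightarrow> P"
    obtain N1 N2 where "biprod (ten E2 N') N1 N2" "block (Suc m + 1) U N1" "block (Suc m - 1) (tw 1 U) N2"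
      using clebsch_gordan(3)[OF N'] m D(5) by auto
    then show P
      using P[of N2] biprod_iso[OF _ block_unique[of "Suc (Suc m)" U N1 N] hiso_refl, of "ten E2 N'" N2]
        assms blockD(1) by simp
  qed
qed

lemma val_ten_right_iso:
  "A \<asymp> B \<Longrightarrow> hmod A \<Longrightarrow> hmod B \<Longrightarrow> hmod N \<Longrightarrow> val (ten A N) = val (ten B N)"
  by (intro val_iso ten_iso hmod_ten hiso_refl)

lemma val_ten_left_iso:
  "A \<asymp> B \<Longrightarrow> hmod A \<Longrightarrow> hmod B \<Longrightarrow> hmod N \<Longrightarrow> val (ten N A) = val (ten N B)"
  by (intro val_iso ten_iso hmod_ten hiso_refl)

lemma val_ten_biprod:
  assumes "biprod M A B" "hmod M" "hmod A" "hmod B" "hmod N"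
  shows "val (ten M N) k h = val (ten A N) k h + val (ten B N) k h"
    "val (ten N M) k h = val (ten N A) k h + val (ten N B) k h"
  using val_biprod[OF biprod_ten_left[OF assms(1,5)]] val_biprod[OF biprod_ten_right[OF assms(1,5)]]
    hmod_ten assms by auto

lemma val_ten_assoc:
  "hmod L \<Longrightarrow> hmod M \<Longrightarrow> hmod N \<Longrightarrow> val (ten (ten L M) N) = val (ten L (ten M N))"
  by (intro val_iso ten_assoc hmod_ten)

section \<open>Commutation of blocks in tensor products\<close>

definition hcomm :: "('g, 'k) hm \<Rightarrow> ('g, 'k) hm \<Rightarrow> bool" where
  "hcomm M N \<longleftrightarrow> val (ten M N) = val (ten N M)"

lemma hcomm_sym: "hcomm M N \<Longrightarrow> hcomm N M"
  by (simp add: hcomm_def)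

lemma hcomm_iso: "hcomm M N \<Longrightarrow> M \<asymp> M' \<Longrightarrow> hmod M \<Longrightarrow> hmod M' \<Longrightarrow> hmod N \<Longrightarrow> hcomm M' N"
  unfolding hcomm_def using val_ten_right_iso[of M M' N] val_ten_left_iso[of M M' N] by simp

lemma hcomm_hiso: "hmod M \<Longrightarrow> hmod N \<Longrightarrow> hcomm M N \<longleftrightarrow> ten M N \<asymp> ten N M"
  by (simp add: hcomm_def hiso_iff_val_eq hmod_ten)

lemma hcomm_ten:
  assumes "hcomm A N" "hcomm B N" "hmod A" "hmod B" "hmod N"
  shows "hcomm (ten A B) N"
proof -
  have c: "ten A N \<asymp> ten N A" "ten B N \<asymp> ten N B" using assms hcomm_hiso by blast+
  have "ten (ten A B) N \<asymp> ten A (ten B N)" using ten_assoc assms by blast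
  also have "\<dots> \<asymp> ten A (ten N B)" using ten_iso[OF hiso_refl c(2)] assms by blast
  also have "\<dots> \<asymp> ten (ten A N) B" using hiso_sym[OF ten_assoc] assms by blast
  also have "\<dots> \<asymp> ten (ten N A) B" using ten_iso[OF c(1) hiso_refl] assms by blast
  also have "\<dots> \<asymp> ten N (ten A B)" using ten_assoc assms by blast
  finally show ?thesis using hcomm_hiso hmod_ten assms by blast
qed

text \<open>The cancellation takes place among values of \<open>val\<close>, hence in the
  field.\<close>

lemma hcomm_cancel:
  assumes "biprod M A B" "hcomm M N" "hcomm B N" "hmod M" "hmod A" "hmod B" "hmod N"
  shows "hcomm A N"
  unfolding hcomm_def
proof (intro ext)
  fix k h
  show "val (ten A N) k h = val (ten N A) k h"
    using val_ten_biprod[OF assms(1,4-7)] assms(2,3) by (metis hcomm_def add_right_cancel)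
qed

lemma hcomm_yop_zero_block:
  assumes "hmod U" "yop U = 0" "block l V N"
  shows "hcomm U N"
proof -
  have V: "hmod V" "yop V = 0" using blockD[OF assms(3)] by auto
  have "ten V U \<asymp> ten U V"
    using assms V by (intro hiso_yop_zero hmod_ten) (simp_all add: mult.commute)
  then have "block l (ten U V) (ten N U)"
    using block_base[OF block_ten_right[OF assms(3,1,2)]] hmod_ten assms(1) V by blast
  then show ?thesis
    using block_unique[OF block_ten_left[OF assms(3,1,2)]] hcomm_hiso assms(1) blockD(1)[OF assms(3)] by blast
qed

text \<open>The two-dimensional block and the modules with \<open>yop U = 0\<close> generate all
  blocks: \<open>block_Suc_E2\<close> reaches the next length after the cancellation of a shorter
  block.\<close>

lemma hcomm_block_if:
  assumes L: "hmod L" "hcomm E2 L" "\<And>U. hmod U \<Longrightarrow> yop U = 0 \<Longrightarrow> hcomm U L" and "block k U N"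
  shows "hcomm N L"
  using assms(4)
proof (induction k arbitrary: U N rule: less_induct)
  case (less k)
  note D = blockD[OF less.prems]
  consider "k = 1" | m where "k = Suc (Suc m)" using D(4) by (metis One_nat_def Suc_le_D not0_implies_Suc)
  then show ?case
  proof cases
    case 1
    then have "U \<asymp> N" using block_unique[OF block_1[OF D(2,3)]] less.prems by simp
    then show ?thesis using hcomm_iso[OF L(3)[OF D(2,3)]] D L(1) by blast
  next
    case 2
    obtain N' where N': "block (Suc m) U N'" "m = 0 \<Longrightarrow> ten E2 N' \<asymp> N"
      "\<And>P. m > 0 \<Longrightarrow> (\<And>B. block m (tw 1 U) B \<Longrightarrow> biprod (ten E2 N') N B \<Longrightarrow> P) \<Longrightarrow> P"
      using block_Suc_E2[OF less.prems[unfolded 2]] by blast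
    note h = blockD(1)[OF N'(1)] hmod_ten[OF hmod_E2 blockD(1)[OF N'(1)]]
    have T: "hcomm (ten E2 N') L"
      using less.IH[OF _ N'(1)] 2 h L hmod_E2 by (intro hcomm_ten) auto
    show ?thesis
    proof (cases "m = 0")
      case True
      then show ?thesis using hcomm_iso[OF T N'(2)] h D L(1) by blast
    next
      case False
      show ?thesis
      proof (rule N'(3))
        fix B assume B: "block m (tw 1 U) B" "biprod (ten E2 N') N B"
        then have "hcomm B L" using less.IH[OF _ B(1)] 2 by simp
        then show ?thesis using hcomm_cancel[OF B(2) T] h D L(1) blockD(1)[OF B(1)] by blast
      qed (use False in simp)
    qed
  qed
qed

text \<open>\<open>hcomm_block_if\<close> is used twice, first against \<open>E2\<close> and then
  against any block. If y is invertible on \<open>L\<close>, it is so on both tensor products, and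
  these have the same group trace.\<close>

lemma hcomm_block:
  assumes "block k U N" "hmod L"
  shows "hcomm N L"
proof -
  have E2: "hcomm M E2" if "block l V M" for l V M
    using hcomm_yop_zero_block[OF _ _ block_E2] that
    by (intro hcomm_block_if[OF hmod_E2 _ _ that]) (auto simp: hcomm_def)
  note N = blockD(1)[OF assms(1)]
  show ?thesis using assms(2)
  proof (induction L rule: hmod_induct)
    case (iso A B)
    then show ?case using hcomm_iso[OF hcomm_sym] hcomm_sym N by blast
  next
    case (biprod M A B)
    show ?case unfolding hcomm_def
      using val_ten_biprod[OF biprod(4,1,2,3) N] biprod(5,6) by (intro ext) (simp add: hcomm_def)
  next
    case (block l V M)
    show ?case
      using hcomm_block_if[OF blockD(1)[OF block] hcomm_sym[OF E2[OF block]] _ assms(1)]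
        hcomm_yop_zero_block[OF _ _ block] by blast
  next
    case (einv M)
    then show ?case
      using einv_ten[OF einv N ypow_n_block[OF assms(1)]] hmod_ten N
      by (auto simp: hcomm_def fun_eq_iff val_einv mult.commute)
  qed
qed

text \<open>With S(k) = \<Sum>i<k. \<zeta>^i, the identity (1 + \<zeta>) S(m+1) = S(m+2) + \<zeta>
  S(m) is the Clebsch-Gordan recursion; on blocks of length \<open>n\<close> the block
  \<open>E2\<close> acts as multiplication by 1 + \<zeta>.\<close>

lemma val_block_ten_projective:
  assumes L: "block n W L" and h: "h \<in> carrier G" and j: "0 < j" "j \<le> n" and "block k U N"
  shows "val (ten N L) j h
    = (if j = n then tr (act U h) * tr (act W h) * (\<Sum>i<k. inverse (chi h) ^ i) else 0)"
  using assms(5) j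
proof (induction k arbitrary: U N j rule: less_induct)
  case (less k)
  let ?z = "inverse (chi h)"
  note D = blockD[OF less.prems(1)] and hL = blockD(1)[OF L]
  consider "k = 1" | m where "k = Suc (Suc m)" using D(4) by (metis One_nat_def Suc_le_D not0_implies_Suc)
  then show ?case
  proof cases
    case 1
    then have "U \<asymp> N" using block_unique[OF block_1[OF D(2,3)]] less.prems by simp
    then have "val (ten N L) = val (ten U L)" using val_ten_right_iso D hL by metis
    then show ?thesis using 1 h by (simp add: val_ten_yop_zero[OF D(2,3) h hL] val_block[OF L])
  next
    case 2
    obtain N' where N': "block (Suc m) U N'" "m = 0 \<Longrightarrow> ten E2 N' \<asymp> N"
      "\<And>P. m > 0 \<Longrightarrow> (\<And>B. block m (tw 1 U) B \<Longrightarrow> biprod (ten E2 N') N B \<Longrightarrow> P) \<Longrightarrow> P"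
      using block_Suc_E2[OF less.prems(1)[unfolded 2]] by blast
    note hN' = blockD(1)[OF N'(1)] 
    note hT = hmod_ten[OF hmod_E2 hN'] and hN'L = hmod_ten[OF hN' hL]
    let ?c = "tr (act U h) * tr (act W h)"
    let ?S = "\<lambda>k. \<Sum>i<k. ?z ^ i"
    have IH: "val (ten N' L) j h = (if j = n then ?c * ?S (Suc m) else 0)" if "0 < j" "j \<le> n" for j
      using less.IH[OF _ N'(1)] 2 that by simp
    have T: "val (ten (ten E2 N') L) j h = (if j = n then (1 + ?z) * (?c * ?S (Suc m)) else 0)"
      using IH[of "j - 1"] IH[of "j + 1"] IH[of n] less.prems(2,3) n_ge_2
      unfolding val_ten_assoc[OF hmod_E2 hN' hL] val_ten_E2[OF h hN'L less.prems(3)] by auto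
    show ?thesis
    proof (cases "m = 0")
      case True
      then have "val (ten N L) = val (ten (ten E2 N') L)"
        using val_ten_right_iso[OF N'(2) hT D(1) hL] by simp
      then show ?thesis using T True 2 by simp
    next
      case False
      show ?thesis
      proof (rule N'(3))
        fix B assume B: "block m (tw 1 U) B" "biprod (ten E2 N') N B"
        have "val (ten B L) j h = (if j = n then ?z * ?c * ?S m else 0)"
          using less.IH[OF _ B(1), of j] 2 less.prems(2,3) by simp
        moreover have "?z * ?S m = ?S (Suc m) - 1"
          by (simp add: sum.lessThan_Suc_shift sum_distrib_left del: sum.lessThan_Suc)
        then have "?z * ?c * ?S m = ?c * (?S (Suc m) - 1)" by (metis mult.assoc mult.commute)
        moreover have "?z * ?S (Suc m) = ?S (Suc (Suc m)) - 1"
          by (simp add: sum.lessThan_Suc_shift[of _ "Suc m"] sum_distrib_left del: sum.lessThan_Suc)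
        then have "(1 + ?z) * (?c * ?S (Suc m)) = ?c * (?S (Suc m) + ?S (Suc (Suc m)) - 1)"
          by (simp only: distrib_right mult_1 mult.left_commute[of ?z]) (simp add: distrib_left right_diff_distrib)
        ultimately show ?thesis
          using val_ten_biprod(1)[OF B(2) hT D(1) blockD(1)[OF B(1)] hL, of j h] T 2
          by (auto simp: algebra_simps)
      qed (use False in simp)
    qed
  qed
qed

subsection \<open>Characters of the Green ring\<close>

text \<open>
  The family \<open>F\<close> consists of the values at blocks of length \<open>k\<close> of a character; the recursion is the
  Clebsch-Gordan rule, and \<open>F n = 0\<close> says that the character vanishes on projective modules.
\<close>

definition jchar :: "'g \<Rightarrow> 'k \<Rightarrow> (nat \<Rightarrow> 'k) \<Rightarrow> bool" where
  "jchar h x F \<longleftrightarrow> F 0 = 0 \<and> F 1 = 1 \<and> F n = 0 \<and>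
     (\<forall>k. F (Suc (Suc k)) = x * F (Suc k) - inverse (chi h) * F k)"

text \<open>For \<open>F\<close> as in \<open>jchar\<close>, the value \<open>F 0 = 0\<close>
  discards the part where y is invertible, and \<open>F n = 0\<close> allows the sum to stop before
  \<open>n\<close>.\<close>

definition phi :: "(nat \<Rightarrow> 'k) \<Rightarrow> 'g \<Rightarrow> ('g, 'k) hm \<Rightarrow> 'k" where
  "phi F h M = (\<Sum>k<n. val M k h * F k)"

lemma phi_eqI: "val M = val N \<Longrightarrow> phi F h M = phi F h N"
  by (simp add: phi_def)

lemma phi_biprod:
  "biprod M A B \<Longrightarrow> hmod M \<Longrightarrow> hmod A \<Longrightarrow> hmod B \<Longrightarrow> phi F h M = phi F h A + phi F h B"
  by (simp add: phi_def val_biprod distrib_right sum.distrib)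

lemma phi_block:
  assumes "block l U N" "jchar h x F" "h \<in> carrier G"
  shows "phi F h N = tr (act U h) * F l"
proof -
  have "phi F h N = (\<Sum>k<n. if k = l then tr (act U h) * F l else 0)"
    unfolding phi_def using assms(3) by (intro sum.cong refl) (simp add: val_block[OF assms(1)])
  then show ?thesis using blockD(5)[OF assms(1)] assms(2) by (auto simp: jchar_def)
qed

lemma phi_einv:
  assumes "einv N" "hmod N" "jchar h x F"
  shows "phi F h N = 0"
  unfolding phi_def using assms(3)
  by (intro sum.neutral) (auto simp: val_einv[OF assms(1,2)] jchar_def)

lemma phi_ten_E2:
  assumes F: "jchar h x F" and h: "h \<in> carrier G" and N: "hmod N"
  shows "phi F h (ten E2 N) = x * phi F h N"
  using N
proof (induction N rule: hmod_induct)
  case (iso A B)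
  then show ?case
    using phi_eqI[OF val_iso, of A B] phi_eqI[OF val_ten_left_iso[OF _ _ _ hmod_E2], of A B] by metis
next
  case (biprod M A B)
  then have "phi F h (ten E2 M) = phi F h (ten E2 A) + phi F h (ten E2 B)"
    using phi_biprod[OF biprod_ten_right[OF _ hmod_E2]] hmod_ten[OF hmod_E2] by simp
  then show ?case using phi_biprod[OF \<open>biprod M A B\<close>] biprod by (simp add: distrib_left)
next
  case (block l U N)
  have l: "1 \<le> l" "l \<le> n" and T: "hmod (ten E2 N)" using blockD[OF block] hmod_ten[OF hmod_E2] by auto
  consider "l = n" | "l = 1" | "1 < l" "l < n" using l by linarith
  then show ?case
  proof cases
    case 1
    obtain N1 N2 where b: "biprod (ten E2 N) N1 N2" "block n U N1" "block n (tw 1 U) N2"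
      using clebsch_gordan(1)[OF block 1] by blast
    have "F n = 0" using F by (simp add: jchar_def)
    then show ?thesis
      using phi_biprod[OF b(1) T blockD(1)[OF b(2)] blockD(1)[OF b(3)]] 1
      by (simp add: phi_block[OF b(2) F h] phi_block[OF b(3) F h] phi_block[OF block F h])
  next
    case 2
    have b: "block 2 U (ten E2 N)" using clebsch_gordan(2)[OF block 2] .
    have "F 2 = x" using F unfolding jchar_def by (metis One_nat_def Suc_1 diff_zero mult_1_right mult_zero_right)
    then show ?thesis
      using 2 F by (simp add: phi_block[OF b F h] phi_block[OF block F h] jchar_def)
  next
    case 3
    obtain N1 N2 where b: "biprod (ten E2 N) N1 N2" "block (l + 1) U N1" "block (l - 1) (tw 1 U) N2"
      using clebsch_gordan(3)[OF block 3] by blast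
    obtain m where m: "l = Suc m" using l by (cases l) auto
    have "F (Suc l) = x * F l - inverse (chi h) * F m" using F m by (simp add: jchar_def)
    then show ?thesis
      using phi_biprod[OF b(1) T blockD(1)[OF b(2)] blockD(1)[OF b(3)]] m
      by (simp add: phi_block[OF b(2) F h] phi_block[OF b(3) F h] phi_block[OF block F h]
          right_diff_distrib mult.left_commute mult.commute)
  qed
next
  case (einv N)
  then show ?case
    using hmod_ten[OF hmod_E2] einv_ten(2)[OF _ _ hmod_E2 ypow_n_block[OF block_E2], of N] phi_einv F
    by simp
qed

lemma phi_ten_block:
  assumes F: "jchar h x F" and h: "h \<in> carrier G" and L: "hmod L" and "block k U N"
  shows "phi F h (ten N L) = tr (act U h) * F k * phi F h L"
  using assms(4)
proof (induction k arbitrary: U N rule: less_induct)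
  case (less k)
  note D = blockD[OF less.prems(1)]
  have FR: "F (Suc (Suc k)) = x * F (Suc k) - inverse (chi h) * F k" "F 0 = 0" "F (Suc 0) = 1" for k
    using F by (simp_all add: jchar_def)
  consider "k = 1" | m where "k = Suc (Suc m)" using D(4) by (metis One_nat_def Suc_le_D not0_implies_Suc)
  then show ?case
  proof cases
    case 1
    then have "U \<asymp> N" using block_unique[OF block_1[OF D(2,3)]] less.prems by simp
    then have "phi F h (ten N L) = phi F h (ten U L)"
      using phi_eqI[OF val_ten_right_iso] D L by metis
    also have "\<dots> = tr (act U h) * phi F h L"
      by (simp add: phi_def val_ten_yop_zero[OF D(2,3) h L] sum_distrib_left mult.assoc)
    finally show ?thesis using 1 FR by simp
  next
    case 2
    obtain N' where N': "block (Suc m) U N'" "m = 0 \<Longrightarrow> ten E2 N' \<asymp> N"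
      "\<And>P. m > 0 \<Longrightarrow> (\<And>B. block m (tw 1 U) B \<Longrightarrow> biprod (ten E2 N') N B \<Longrightarrow> P) \<Longrightarrow> P"
      using block_Suc_E2[OF less.prems(1)[unfolded 2]] by blast
    note hN' = blockD(1)[OF N'(1)]
    note hT = hmod_ten[OF hmod_E2 hN'] and hN'L = hmod_ten[OF hN' L]
    have T: "phi F h (ten (ten E2 N') L) = x * (tr (act U h) * F (Suc m) * phi F h L)"
      using phi_eqI[OF val_ten_assoc[OF hmod_E2 hN' L]] phi_ten_E2[OF F h hN'L] less.IH[OF _ N'(1)] 2 by simp
    show ?thesis
    proof (cases "m = 0")
      case True
      then have "phi F h (ten N L) = phi F h (ten (ten E2 N') L)"
        using phi_eqI[OF val_ten_right_iso[OF N'(2) hT D(1) L]] by simp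
      then show ?thesis using T True 2 FR(1)[of 0] FR(2,3) by simp
    next
      case False
      show ?thesis
      proof (rule N'(3))
        fix B assume B: "block m (tw 1 U) B" "biprod (ten E2 N') N B"
        have "phi F h (ten B L) = inverse (chi h) * tr (act U h) * F m * phi F h L"
          using less.IH[OF _ B(1)] 2 by simp
        moreover have "phi F h (ten (ten E2 N') L) = phi F h (ten N L) + phi F h (ten B L)"
          using phi_biprod[OF biprod_ten_left[OF B(2) L]] hmod_ten hT D(1) blockD(1)[OF B(1)] L by simp
        ultimately show ?thesis using T 2 by (simp add: FR algebra_simps)
      qed (use False in simp)
    qed
  qed
qed

primrec copies :: "nat \<Rightarrow> ('g, 'k) hm \<Rightarrow> ('g, 'k) hm" where
  "copies 0 M = HM 0 (\<lambda>_. 0) 0"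
| "copies (Suc m) M = dsum M (copies m M)"

lemma hmod_copies: "hmod M \<Longrightarrow> hmod (copies m M)"
  by (induction m) (auto simp: hmod_zero hmod_dsum)

lemma einv_zero: "einv (HM 0 (\<lambda>_. 0) 0)"
  unfolding einv_def by (intro exI[of _ 0]) simp

lemma val_copies: "hmod M \<Longrightarrow> val (copies m M) k h = of_nat m * val M k h"
  by (induction m) (simp_all add: val_einv[OF einv_zero hmod_zero] val_dsum hmod_copies distrib_right)

lemma phi_ten_copies:
  assumes "jchar h x F" "hmod M" "hmod N"
  shows "phi F h (ten (copies m M) N) = of_nat m * phi F h (ten M N)"
proof (induction m)
  case 0
  have "ten (HM 0 (\<lambda>_. 0) 0) N = HM 0 (\<lambda>_. 0) 0" by (simp add: ten_def)
  then show ?case using phi_einv[OF einv_zero hmod_zero assms(1)] by simp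
next
  case (Suc m)
  have "phi F h (ten (dsum M (copies m M)) N) = phi F h (ten M N) + phi F h (ten (copies m M) N)"
    using assms hmod_copies by (intro phi_biprod biprod_ten_left dsum_biprod hmod_ten hmod_dsum)
  then show ?case using Suc by (simp add: distrib_right)
qed

text \<open>If y is invertible on both factors, let \<open>P\<close> be the block of length
  \<open>n\<close> with trivial top. Then \<open>ten P M\<close> is isomorphic to \<open>n\<close>
  copies of \<open>M\<close>, while \<open>phi\<close> vanishes on every product with
  \<open>P\<close>. Hence \<open>n\<close> times the value at \<open>ten M N\<close> is
  zero.\<close>

lemma phi_ten_einv:
  assumes F: "jchar h x F" and h: "h \<in> carrier G" and M: "hmod M" "einv M" and N: "hmod N"
  shows "phi F h (ten M N) = 0"
  using N
proof (induction N rule: hmod_induct)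
  case (iso A B)
  then show ?case using phi_eqI[OF val_ten_left_iso[OF _ _ _ M(1)], of A B] by metis
next
  case (biprod N A B)
  then show ?case
    using phi_biprod[OF biprod_ten_right[OF _ M(1)], of N A B] hmod_ten[OF M(1)] by simp
next
  case (block l U N)
  show ?case
    using phi_einv[OF einv_ten(1)[OF M blockD(1)[OF block] ypow_n_block[OF block]] hmod_ten[OF M(1)] F]
      blockD(1)[OF block] by simp
next
  case (einv N)
  obtain P where P: "block n triv P"
    using block_exists[OF hmod_triv, of n] n_ge_2 by auto
  note hP = blockD(1)[OF P]
  have PM: "hmod (ten P M)" "einv (ten P M)"
    using hmod_ten[OF hP M(1)] einv_ten(2)[OF M hP ypow_n_block[OF P]] by auto
  \<comment> \<open>The trace of \<open>h\<close> on \<open>P\<close> is a sum of powers of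
    \<open>inverse (chi h)\<close>, each of which the trace on \<open>M\<close> absorbs by
    \<open>tr_einv\<close>.\<close>
  have "tr (act (ten P M) h) = of_nat n * tr (act M h)" if h: "h \<in> carrier G" for h
  proof -
    have "tr (act P h) = (\<Sum>i<n. inverse (chi h) ^ i)"
      using tinv_block[OF P h, of 0] tinv_0[OF hP h] by (simp add: tr_munit lessThan_atLeast0)
    then have "tr (act (ten P M) h) = (\<Sum>i<n. inverse (chi h) ^ i * tr (act M h))"
      by (simp add: sum_distrib_right)
    also have "\<dots> = (\<Sum>i<n. tr (act M h))" by (simp only: tr_einv[OF M(2,1) h, symmetric])
    finally show ?thesis by simp
  qed
  then have "val (ten P M) = val (copies n M)"
    by (intro ext) (simp add: val_copies[OF M(1)] val_einv[OF PM(2,1)] val_einv[OF M(2,1)])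
  then have "ten P M \<asymp> copies n M" using hiso_iff_val_eq[OF PM(1) hmod_copies[OF M(1)]] by simp
  then have "phi F h (ten (ten P M) N) = of_nat n * phi F h (ten M N)"
    using phi_eqI[OF val_ten_right_iso[OF _ PM(1) hmod_copies[OF M(1)] einv(1)]]
      phi_ten_copies[OF F M(1) einv(1)] by simp
  moreover have "phi F h (ten (ten P M) N) = 0"
    using phi_eqI[OF val_ten_assoc[OF hP M(1) einv(1)]]
      phi_ten_block[OF F h hmod_ten[OF M(1) einv(1)] P] F by (simp add: jchar_def)
  moreover have "of_nat n \<noteq> (0 :: 'k)" using n_ge_2 by simp
  ultimately show ?case by simp
qed

theorem phi_ten:
  assumes F: "jchar h x F" and h: "h \<in> carrier G" and M: "hmod M" and N: "hmod N"
  shows "phi F h (ten M N) = phi F h M * phi F h N"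
  using M
proof (induction M rule: hmod_induct)
  case (iso A B)
  then show ?case
    using phi_eqI[OF val_iso, of A B] phi_eqI[OF val_ten_right_iso[OF _ _ _ N], of A B] by metis
next
  case (biprod M A B)
  then show ?case
    using phi_biprod[OF biprod_ten_left[OF _ N], of M A B] phi_biprod[of M A B] hmod_ten N
    by (simp add: distrib_right)
next
  case (block l U M)
  show ?case using phi_ten_block[OF F h N block] phi_block[OF block F h] by simp
next
  case (einv M)
  then show ?case using phi_ten_einv[OF F h einv N] phi_einv[OF einv(2,1) F] by simp
qed

end

section \<open>Comparison with modules given by matrices\<close>

definition fm :: "'k :: field mat \<Rightarrow> 'k fmat" where
  "fm A = Abs_fmat (\<lambda>i j. if i < dim_row A \<and> j < dim_col A then A $$ (i, j) else 0)"

lemma ent_fm: "ent (fm A) i j = (if i < dim_row A \<and> j < dim_col A then A $$ (i, j) else 0)"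
  unfolding fm_def
  by (subst ent_Abs_bound[of _ "max (dim_row A) (dim_col A)"]) (auto split: if_splits)

lemma fm_mult:
  assumes "dim_col A = dim_row B"
  shows "fm (A * B) = fm A * fm B"
proof (rule fmat_eqI)
  fix i j
  have "ent (fm A * fm B) i j = (\<Sum>k<dim_row B. ent (fm A) i k * ent (fm B) k j)"
    by (rule ent_mult) (auto simp: ent_fm split: if_splits)
  then show "ent (fm (A * B)) i j = ent (fm A * fm B) i j"
    using assms by (auto simp: ent_fm scalar_prod_def lessThan_atLeast0)
qed

lemma fm_add: "dim_row A = dim_row B \<Longrightarrow> dim_col A = dim_col B \<Longrightarrow> fm (A + B) = fm A + fm B"
  by (rule fmat_eqI) (simp add: ent_fm ent_add)

lemma fm_smult: "fm (c \<cdot>\<^sub>m A) = c \<cdot> fm A"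
  by (rule fmat_eqI) (simp add: ent_fm ent_smul)

lemma fm_one: "fm (1\<^sub>m d) = idm d"
  by (rule fmat_eqI) (auto simp: ent_fm ent_idm)

lemma fm_inject:
  assumes "A \<in> carrier_mat a b" "B \<in> carrier_mat a b" "fm A = fm B"
  shows "A = B"
proof (rule eq_matI)
  fix i j assume "i < dim_row B" "j < dim_col B"
  then show "A $$ (i, j) = B $$ (i, j)"
    using arg_cong[OF assms(3), of "\<lambda>M. ent M i j"] assms(1,2) by (simp add: ent_fm)
qed (use assms in auto)

lemma fm_mat:
  assumes "idm d * A = A" "A * idm e = A"
  shows "fm (mat d e (\<lambda>(i, j). ent A i j)) = A"
proof (rule fmat_eqI)
  fix i j
  show "ent (fm (mat d e (\<lambda>(i, j). ent A i j))) i j = ent A i j"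
    using idm_mult[of d A i j] mult_idm[of A e i j] assms by (auto simp: ent_fm)
qed

lemma relabel_inject:
  assumes "inj p" "relabel p A = relabel p B"
  shows "A = B"
proof (rule fmat_eqI)
  fix i j
  show "ent A i j = ent B i j"
    using arg_cong[OF assms(2), of "\<lambda>M. ent M (p i) (p j)"] assms(1) by (simp add: ent_relabel inv_f_f)
qed

lemma relabel_id [simp]: "relabel (\<lambda>i. i) A = A"
  by (rule relabel_unique[symmetric]) auto

context datum
begin

abbreviation "HB \<equiv> hopf_basis G n"

text \<open>The action on \<open>T\<close> of an arbitrary element of the algebra, from its
  expansion in the basis elements y^i h.\<close>

definition ext :: "('g, 'k) hm \<Rightarrow> (nat \<times> 'g \<Rightarrow> 'k) \<Rightarrow> 'k fmat" where
  "ext T x = (\<Sum>b\<in>HB. x b \<cdot> (ypow T (fst b) * act T (snd b)))"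

definition hm_of :: "('g, 'k) hmodule \<Rightarrow> ('g, 'k) hm" where
  "hm_of M = HM (idm (fst M)) (\<lambda>h. fm (snd M (hopf_grp h))) (fm (snd M (hopf_y G)))"

lemma H_carrier: "x \<in> carrier H \<longleftrightarrow> (\<forall>b. b \<notin> HB \<longrightarrow> x b = 0)"
  by (simp add: hopf_def basis_algebra_def)

lemma H_one: "\<one>\<^bsub>H\<^esub> = hopf_grp \<one>"
  by (simp add: hopf_def basis_algebra_def hopf_grp_def)

lemma H_add: "x \<oplus>\<^bsub>H\<^esub> y = (\<lambda>b. x b + y b)"
  by (simp add: hopf_def basis_algebra_def)

lemma H_mult: "(x \<otimes>\<^bsub>H\<^esub> y) b =
    (if b \<in> HB then \<Sum>b1\<in>HB. \<Sum>b2\<in>HB. x b1 * y b2 * hopf_const G chi g n b1 b2 b else 0)"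
  by (simp add: hopf_def basis_algebra_def)

lemma basis_vec_carrier: "b \<in> HB \<Longrightarrow> basis_vec b \<in> carrier H"
  by (auto simp: H_carrier basis_vec_def)

lemma HB_iff: "(i, h) \<in> HB \<longleftrightarrow> i < n \<and> h \<in> carrier G"
  by (auto simp: hopf_basis_def)

lemma hopf_grp_carrier: "h \<in> carrier G \<Longrightarrow> hopf_grp h \<in> carrier H"
  unfolding hopf_grp_def using n_ge_2 by (intro basis_vec_carrier) (simp add: HB_iff)

lemma hopf_y_carrier: "hopf_y G \<in> carrier H"
  unfolding hopf_y_def using n_ge_2 by (intro basis_vec_carrier) (simp add: HB_iff)

lemma H_mult_carrier: "x \<otimes>\<^bsub>H\<^esub> y \<in> carrier H"
  by (auto simp: H_carrier H_mult)

lemma H_pow_carrier: "y \<in> carrier H \<Longrightarrow> y [^]\<^bsub>H\<^esub> (i :: nat) \<in> carrier H"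
  by (cases i) (simp_all add: nat_pow_def H_mult_carrier H_one hopf_grp_carrier)

lemma ext_basis_vec:
  assumes "b \<in> HB"
  shows "ext T (basis_vec b) = ypow T (fst b) * act T (snd b)"
proof -
  have "ext T (basis_vec b) = (\<Sum>c\<in>HB. if c = b then ypow T (fst b) * act T (snd b) else 0)"
    unfolding ext_def by (intro sum.cong refl) (simp add: basis_vec_def)
  then show ?thesis using assms finite_hopf_basis by simp
qed

lemma ext_scale: "ext T (\<lambda>b. c * x b) = c \<cdot> ext T x"
  by (simp add: ext_def smul_sum_right)

lemma ext_add: "ext T (\<lambda>b. x b + y b) = ext T x + ext T y"
  by (simp add: ext_def smul_add_left sum.distrib)

lemma ext_diff: "ext T (\<lambda>b. x b - y b) = ext T x - ext T y"
  by (simp add: ext_def smul_diff_left sum_subtractf)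

text \<open>The two cases of the structure constants are the two cases of the product of powers of
  y: beyond \<open>n\<close>, a factor y^n is replaced by g^n - 1.\<close>

lemma ext_const:
  assumes T: "hmod T" and "a \<in> HB" "b \<in> HB"
  shows "ext T (hopf_const G chi g n a b)
    = (ypow T (fst a) * act T (snd a)) * (ypow T (fst b) * act T (snd b))"
proof -
  obtain i h j k where ab: "a = (i, h)" "b = (j, k)" by fastforce
  have ij: "i < n" "j < n" and hk: "h \<in> carrier G" "k \<in> carrier G" using assms by (auto simp: ab HB_iff)
  note D = hmodD[OF T]
  have "act T h * ypow T j = inverse (chi h) ^ j \<cdot> (ypow T j * act T h)"
    using ypow_act[OF T hk(1), of j] chi_nonzero[OF hk(1)] by (simp add: power_inverse)
  then have "(ypow T i * act T h) * (ypow T j * act T k)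
      = inverse (chi h) ^ j \<cdot> (ypow T i * ypow T j * act T h * act T k)"
    by (simp add: mult.assoc) (simp flip: mult.assoc)
  then have RHS: "(ypow T i * act T h) * (ypow T j * act T k)
      = inverse (chi h) ^ j \<cdot> (ypow T (i + j) * act T (h \<otimes> k))"
    by (simp add: ypow_add[OF T] D(7)[OF hk] mult.assoc)
  have scale: "ext T (\<lambda>c. z * f c) = z \<cdot> ext T f" for z f by (rule ext_scale)
  show ?thesis
  proof (cases "i + j < n")
    case True
    then have "(i + j, h \<otimes> k) \<in> HB" using hk by (simp add: HB_iff)
    then show ?thesis using True RHS by (simp add: ab hopf_const_def scale ext_basis_vec)
  next
    case False
    have in_HB: "(i + j - n, h \<otimes> k) \<in> HB" "(i + j - n, (g [^] n) \<otimes> (h \<otimes> k)) \<in> HB"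
      using hk ij g_closed by (auto simp: HB_iff)
    have "ypow T (i + j) = ypow T (i + j - n) * ypow T n" using False by (simp add: ypow_add[OF T])
    then have "ypow T (i + j) * act T (h \<otimes> k)
        = ypow T (i + j - n) * act T ((g [^] n) \<otimes> (h \<otimes> k)) - ypow T (i + j - n) * act T (h \<otimes> k)"
      using D(5) D(7)[of "g [^] n" "h \<otimes> k"] D(9)[of "h \<otimes> k"] hk g_closed
      by (simp add: mult.assoc left_diff_distrib right_diff_distrib)
    then show ?thesis using False RHS in_HB
      by (simp add: ab hopf_const_def scale ext_diff ext_basis_vec)
  qed
qed

lemma ext_mult:
  assumes T: "hmod T"
  shows "ext T (x \<otimes>\<^bsub>H\<^esub> y) = ext T x * ext T y"
proof -
  let ?w = "\<lambda>b. ypow T (fst b) * act T (snd b)"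
  have "ext T (x \<otimes>\<^bsub>H\<^esub> y)
      = (\<Sum>b\<in>HB. \<Sum>b1\<in>HB. \<Sum>b2\<in>HB. (x b1 * y b2) \<cdot> (hopf_const G chi g n b1 b2 b \<cdot> ?w b))"
    by (simp add: ext_def H_mult smul_sum_left)
  also have "\<dots> = (\<Sum>b1\<in>HB. \<Sum>b2\<in>HB. \<Sum>b\<in>HB. (x b1 * y b2) \<cdot> (hopf_const G chi g n b1 b2 b \<cdot> ?w b))"
    by (rule trans[OF sum.swap], rule sum.cong[OF refl], rule sum.swap)
  also have "\<dots> = (\<Sum>b1\<in>HB. \<Sum>b2\<in>HB. (x b1 * y b2) \<cdot> ext T (hopf_const G chi g n b1 b2))"
    by (simp add: ext_def smul_sum_right)
  also have "\<dots> = (\<Sum>b1\<in>HB. \<Sum>b2\<in>HB. (x b1 \<cdot> ?w b1) * (y b2 \<cdot> ?w b2))"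
    by (intro sum.cong refl) (simp add: ext_const[OF T] mult.commute)
  finally show ?thesis by (simp add: ext_def sum_product)
qed

lemma ext_grp: "hmod T \<Longrightarrow> h \<in> carrier G \<Longrightarrow> ext T (hopf_grp h) = act T h"
  unfolding hopf_grp_def using n_ge_2 by (subst ext_basis_vec) (auto simp: HB_iff hmodD)

lemma ext_y: "hmod T \<Longrightarrow> ext T (hopf_y G) = yop T"
  unfolding hopf_y_def using n_ge_2 by (subst ext_basis_vec) (auto simp: HB_iff hmodD ypow_1)

lemma ext_one: "hmod T \<Longrightarrow> ext T \<one>\<^bsub>H\<^esub> = idn T"
  by (simp add: H_one ext_grp hmodD)

lemma hmodulesD:
  assumes "(d, r) \<in> hmodules G chi g n"
  shows "x \<in> carrier H \<Longrightarrow> r x \<in> carrier_mat d d"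
    "x \<in> carrier H \<Longrightarrow> y \<in> carrier H \<Longrightarrow> fm (r (x \<otimes>\<^bsub>H\<^esub> y)) = fm (r x) * fm (r y)"
    "x \<in> carrier H \<Longrightarrow> y \<in> carrier H \<Longrightarrow> fm (r (\<lambda>b. x b + y b)) = fm (r x) + fm (r y)"
    "fm (r \<one>\<^bsub>H\<^esub>) = idm d"
    "x \<in> carrier H \<Longrightarrow> fm (r (\<lambda>b. c * x b)) = c \<cdot> fm (r x)"
proof -
  have r: "r \<in> Ring.ring_hom H (ring_mat TYPE('k) d ())"
    and s: "\<And>c x. x \<in> carrier H \<Longrightarrow> r (\<lambda>b. c * x b) = c \<cdot>\<^sub>m r x"
    using assms by (auto simp: hmodules_def)
  show 1: "r x \<in> carrier_mat d d" if "x \<in> carrier H" for x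
    using r that by (auto simp: Ring.ring_hom_def ring_mat_simps)
  show "fm (r (x \<otimes>\<^bsub>H\<^esub> y)) = fm (r x) * fm (r y)" if "x \<in> carrier H" "y \<in> carrier H"
    using r that 1[OF that(1)] 1[OF that(2)]
    by (auto simp: Ring.ring_hom_def ring_mat_simps intro!: fm_mult)
  show "fm (r (\<lambda>b. x b + y b)) = fm (r x) + fm (r y)" if "x \<in> carrier H" "y \<in> carrier H"
  proof -
    have "r (x \<oplus>\<^bsub>H\<^esub> y) = r x + r y" using r that by (auto simp: Ring.ring_hom_def ring_mat_simps)
    then show ?thesis using 1[OF that(1)] 1[OF that(2)] by (simp add: H_add fm_add)
  qed
  show "fm (r \<one>\<^bsub>H\<^esub>) = idm d" using r by (simp add: Ring.ring_hom_def ring_mat_simps fm_one)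
  show "fm (r (\<lambda>b. c * x b)) = c \<cdot> fm (r x)" if "x \<in> carrier H" using s[OF that] by (simp add: fm_smult)
qed

lemma mpow_right: "e * A = A * e \<Longrightarrow> mpow e A i * A = A * mpow e A i"
  by (induction i) (simp_all add: mult.assoc)

lemma ypow_hm_of:
  assumes M: "(d, r) \<in> hmodules G chi g n"
  shows "fm (r (hopf_y G [^]\<^bsub>H\<^esub> (i :: nat))) = ypow (hm_of (d, r)) i"
proof (induction i)
  case 0
  show ?case using hmodulesD(4)[OF M] by (simp add: nat_pow_def hm_of_def)
next
  case (Suc i)
  note r = hmodulesD(1)[OF M hopf_y_carrier]
  have "idm d * fm (r (hopf_y G)) = fm (r (hopf_y G)) * idm d"
    using r by (simp flip: fm_one fm_mult)
  then have "ypow (hm_of (d, r)) i * yop (hm_of (d, r)) = ypow (hm_of (d, r)) (Suc i)"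
    by (simp add: ypow_def hm_of_def mpow_right)
  then show ?case
    using Suc hmodulesD(2)[OF M H_pow_carrier[OF hopf_y_carrier] hopf_y_carrier, of i]
    by (simp add: nat_pow_def hm_of_def)
qed

lemma hmod_hm_of:
  assumes "M \<in> hmodules G chi g n"
  shows "hmod (hm_of M)"
proof -
  obtain d r where Mdr: "M = (d, r)" by fastforce
  have M: "(d, r) \<in> hmodules G chi g n" using assms Mdr by simp
  note D = hmodulesD[OF M] and gc = hopf_grp_carrier
  have c: "idm d * fm (r x) = fm (r x)" "fm (r x) * idm d = fm (r x)" if "x \<in> carrier H" for x
    using D(1)[OF that] by (simp_all flip: fm_one fm_mult)
  have "fm (r (hopf_y G [^]\<^bsub>H\<^esub> n)) = fm (r (hopf_grp (g [^] n))) - fm (r \<one>\<^bsub>H\<^esub>)"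
  proof -
    have one: "\<one>\<^bsub>H\<^esub> \<in> carrier H" using gc[OF one_closed] H_one by simp
    then have neg: "(\<lambda>b. - \<one>\<^bsub>H\<^esub> b) \<in> carrier H" unfolding H_carrier by simp
    have "fm (r (\<lambda>b. - \<one>\<^bsub>H\<^esub> b)) = - fm (r \<one>\<^bsub>H\<^esub>)"
      using D(5)[OF one, of "- 1"] by (simp add: smul_minus_left)
    then show ?thesis
      using D(3)[OF gc neg, of "g [^] n"] g_closed by (simp add: hopf_y_pow_n)
  qed
  then have "ypow (hm_of M) n = act (hm_of M) (g [^] n) - idn (hm_of M)"
    using ypow_hm_of[OF M, of n] D(4) by (simp add: Mdr hm_of_def)
  moreover have "fm (r (hopf_y G)) * fm (r (hopf_grp h)) = chi h \<cdot> (fm (r (hopf_grp h)) * fm (r (hopf_y G)))"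
    if "h \<in> carrier G" for h
    using D(2)[OF hopf_y_carrier gc[OF that]] D(5)[OF H_mult_carrier]
      D(2)[OF gc[OF that] hopf_y_carrier] hopf_y_grp[OF that] by simp
  moreover have "fm (r (hopf_grp (h \<otimes> k))) = fm (r (hopf_grp h)) * fm (r (hopf_grp k))"
    if "h \<in> carrier G" "k \<in> carrier G" for h k
    using D(2)[OF gc[OF that(1)] gc[OF that(2)]] hopf_grp_mult[OF that] by simp
  ultimately show ?thesis
    unfolding hmod_def grep_def using c hopf_y_carrier gc D(4)
    by (simp add: Mdr hm_of_def flip: H_one)
qed

text \<open>A representation is determined by the generators, as the basis consists of the products
  y^i h. Linear combinations are built up one basis element at a time.\<close>

lemma fm_eq_ext:
  assumes M: "(d, r) \<in> hmodules G chi g n" and x: "x \<in> carrier H"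
  shows "fm (r x) = ext (hm_of (d, r)) x"
proof -
  note D = hmodulesD[OF M] and fin = finite_hopf_basis
  let ?T = "hm_of (d, r)"
  have basis: "fm (r (basis_vec b)) = ypow ?T (fst b) * act ?T (snd b)" if b: "b \<in> HB" for b
  proof -
    obtain i h where ih: "b = (i, h)" "i < n" "h \<in> carrier G" using b by (cases b) (auto simp: HB_iff)
    show ?thesis
      using D(2)[OF H_pow_carrier[OF hopf_y_carrier] hopf_grp_carrier[OF ih(3)], of i] ypow_hm_of[OF M, of i]
        hopf_y_pow_grp[OF ih(2,3)] by (simp add: ih(1)) (simp add: hm_of_def)
  qed
  have "fm (r (\<lambda>b. if b \<in> S then x b else 0)) = (\<Sum>b\<in>S. x b \<cdot> (ypow ?T (fst b) * act ?T (snd b)))"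
    if "S \<subseteq> HB" for S
    using finite_subset[OF that fin] that
  proof (induction S rule: finite_induct)
    case empty
    have "(\<lambda>b. 0 * \<one>\<^bsub>H\<^esub> b) = (\<lambda>b. 0 :: 'k)" by simp
    then show ?case using D(5)[of "\<one>\<^bsub>H\<^esub>" 0] hopf_grp_carrier[OF one_closed] by (simp add: H_one)
  next
    case (insert a S)
    then have a: "a \<in> HB" and S: "S \<subseteq> HB" by auto
    have 1: "(\<lambda>b. x a * basis_vec a b) \<in> carrier H"
      using basis_vec_carrier[OF a] by (simp add: H_carrier)
    have 2: "(\<lambda>b. if b \<in> S then x b else 0) \<in> carrier H" using S by (auto simp: H_carrier)
    have "(\<lambda>b. if b \<in> insert a S then x b else 0)
        = (\<lambda>b. x a * basis_vec a b + (if b \<in> S then x b else 0))"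
      using insert(2) by (auto simp: basis_vec_def)
    then show ?case
      using D(3)[OF 1 2] D(5)[OF basis_vec_carrier[OF a]] basis[OF a] insert S by simp
  qed
  from this[OF order_refl] have "fm (r (\<lambda>b. if b \<in> HB then x b else 0)) = ext ?T x" by (simp add: ext_def)
  moreover have "(\<lambda>b. if b \<in> HB then x b else 0) = x" using x by (auto simp: H_carrier)
  ultimately show ?thesis by simp
qed

text \<open>Relabelling along an injection is faithful and multiplicative, so the homomorphism laws
  for \<open>r\<close> are inherited from \<open>ext T\<close>. All matrix modules that are built
  from explicit formulas are recognised through this criterion.\<close>

lemma hmodules_interpret:
  assumes T: "hmod T" and p: "inj p" and idn: "relabel p (idm d) = idn T"
    and r: "\<And>x. x \<in> carrier H \<Longrightarrow> r x \<in> carrier_mat d d"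
      "\<And>x. x \<in> carrier H \<Longrightarrow> relabel p (fm (r x)) = ext T x"
  shows "(d, r) \<in> hmodules G chi g n" "hm_of (d, r) \<asymp> T"
proof -
  have one: "\<one>\<^bsub>H\<^esub> \<in> carrier H" by (simp add: H_one hopf_grp_carrier)
  have add_c: "(\<lambda>b. x b + y b) \<in> carrier H" if "x \<in> carrier H" "y \<in> carrier H" for x y
    using that by (simp add: H_carrier)
  have scale_c: "(\<lambda>b. c * x b) \<in> carrier H" if "x \<in> carrier H" for x c
    using that by (simp add: H_carrier)
  have eqI: "A = B" if "A \<in> carrier_mat d d" "B \<in> carrier_mat d d" "relabel p (fm A) = relabel p (fm B)"
    for A B :: "'k mat"
    using relabel_inject[OF p that(3)] fm_inject that by blast
  have mult: "r (x \<otimes>\<^bsub>H\<^esub> y) = r x * r y" if "x \<in> carrier H" "y \<in> carrier H" for x y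
    using r(1)[OF that(1)] r(1)[OF that(2)] r(1)[OF H_mult_carrier, of x y]
    by (intro eqI) (simp_all add: r(2) H_mult_carrier that ext_mult[OF T] fm_mult relabel_mult[OF p])
  have add: "r (x \<oplus>\<^bsub>H\<^esub> y) = r x + r y" if "x \<in> carrier H" "y \<in> carrier H" for x y
    unfolding H_add using r(1)[OF that(1)] r(1)[OF that(2)] r(1)[OF add_c[OF that]]
    by (intro eqI) (simp_all add: r(2) add_c that ext_add fm_add relabel_add)
  have scale: "r (\<lambda>b. c * x b) = c \<cdot>\<^sub>m r x" if "x \<in> carrier H" for x c
    using r(1)[OF that] r(1)[OF scale_c[OF that], of c]
    by (intro eqI) (simp_all add: r(2) scale_c that ext_scale fm_smult relabel_smul)
  have "r \<one>\<^bsub>H\<^esub> = 1\<^sub>m d"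
    using r(1)[OF one] by (intro eqI) (simp_all add: r(2)[OF one] ext_one[OF T] fm_one idn)
  then show M: "(d, r) \<in> hmodules G chi g n"
    unfolding hmodules_def using r(1) mult add scale by (auto simp: Ring.ring_hom_def ring_mat_simps)
  have hm: "hmod (hm_of (d, r))" using hmod_hm_of[OF M] .
  have "T \<asymp> relm p (hm_of (d, r))"
    by (rule hiso_cong[OF T])
      (simp_all add: relm_def hm_of_def idn r(2) hopf_y_carrier hopf_grp_carrier ext_y ext_grp T)
  then show "hm_of (d, r) \<asymp> T"
    using relm_iso[OF hm p] hiso_sym hiso_trans by blast
qed

lemma hmodule_of_interpret:
  assumes T: "hmod T" "idn T = idm d" "\<And>h. h \<in> carrier G \<Longrightarrow> act T h = fm (R h)" "yop T = fm Y"
    and R: "\<And>h. h \<in> carrier G \<Longrightarrow> R h \<in> carrier_mat d d" "Y \<in> carrier_mat d d"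
  shows "hmodule_of G n d R Y \<in> hmodules G chi g n" "hm_of (hmodule_of G n d R Y) \<asymp> T"
proof -
  define rho where "rho = snd (hmodule_of G n d R Y)"
  have Y: "fm (Y ^\<^sub>m i) = ypow T i" for i
  proof (induction i)
    case 0
    then show ?case using T(2) R(2) by (simp add: fm_one)
  next
    case (Suc i)
    have "Y ^\<^sub>m i \<in> carrier_mat d d" using R(2) by simp
    then show ?case using Suc R(2) T(4) ypow_Suc_right[OF T(1), of i] by (simp add: fm_mult)
  qed
  have r: "fm (rho x) = ext T x" for x
  proof (rule fmat_eqI)
    fix a b
    have YR: "dim_row (Y ^\<^sub>m i * R h) = d \<and> dim_col (Y ^\<^sub>m i * R h) = d"
        "fm (Y ^\<^sub>m i * R h) = ypow T i * act T h"
      if "(i, h) \<in> HB" for i h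
    proof -
      have "Y ^\<^sub>m i \<in> carrier_mat d d" "R h \<in> carrier_mat d d" "dim_row Y = d" "dim_col (Y ^\<^sub>m i) = d"
        using that R(1) R(2) pow_carrier_mat[OF R(2), of i] by (auto simp: HB_iff)
      then show "dim_row (Y ^\<^sub>m i * R h) = d \<and> dim_col (Y ^\<^sub>m i * R h) = d"
        "fm (Y ^\<^sub>m i * R h) = ypow T i * act T h"
        using that T(3) Y[of i] by (simp_all add: HB_iff fm_mult)
    qed
    have "ent (ext T x) a b = (\<Sum>(i, h)\<in>HB. x (i, h) * ent (fm (Y ^\<^sub>m i * R h)) a b)"
      unfolding ext_def ent_sum ent_smul by (intro sum.cong refl) (auto simp: YR)
    also have "\<dots> = ent (fm (rho x)) a b"
      unfolding ent_fm using YR(1)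
      by (auto simp: rho_def hmodule_of_def intro!: sum.cong sum.neutral)
    finally show "ent (fm (rho x)) a b = ent (ext T x) a b" by simp
  qed
  have d: "hmodule_of G n d R Y = (d, rho)" by (simp add: rho_def hmodule_of_def)
  have "rho x \<in> carrier_mat d d" for x by (simp add: rho_def hmodule_of_def)
  then show "hmodule_of G n d R Y \<in> hmodules G chi g n" "hm_of (hmodule_of G n d R Y) \<asymp> T"
    unfolding d using hmodules_interpret[OF T(1), of "\<lambda>i. i" d rho] r T(2) by auto
qed

lemma hmodule_M0_interpret:
  "hmodule_M0 G chi n \<in> hmodules G chi g n" "block n triv (hm_of (hmodule_M0 G chi n))"
proof -
  define m where "m = n - 1"
  have m: "n = Suc m" using n_ge_2 m_def by simp
  have B: "block n triv (stdm m)" using block_stdm[of m] m by simp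
  note h = blockD(1)[OF B]
  have "act (stdm m) h = fm (mat_diag n (\<lambda>k. inverse (chi h) ^ k))" for h
    by (rule fmat_eqI) (auto simp: stdm_def m ent_sum ent_smul ent_munit ent_fm mat_diag_def
        if_distrib[of "\<lambda>x. _ * x"] cong: if_cong intro: sum.neutral)
  moreover have "yop (stdm m) = fm (mat n n (\<lambda>(r, s). if r = Suc s then 1 else 0))"
    by (rule fmat_eqI) (auto simp: stdm_def m ent_sum_munit ent_fm)
  moreover have "idn (stdm m) = idm n" by (simp add: stdm_def m)
  ultimately have I: "hmodule_M0 G chi n \<in> hmodules G chi g n" "hm_of (hmodule_M0 G chi n) \<asymp> stdm m"
    unfolding hmodule_M0_def using h by (auto intro!: hmodule_of_interpret)
  then show "hmodule_M0 G chi n \<in> hmodules G chi g n" by simp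
  show "block n triv (hm_of (hmodule_M0 G chi n))"
    using block_iso[OF B hiso_sym[OF I(2)] hmod_hm_of[OF I(1)]] .
qed

lemma hmodule_V_interpret:
  "hmodule_V G n (\<lambda>h. inverse (chi h)) \<in> hmodules G chi g n"
  "hm_of (hmodule_V G n (\<lambda>h. inverse (chi h))) \<asymp> tw 1 triv"
proof -
  have "munit 0 0 = (idm 1 :: 'k fmat)" by (simp add: idm_Suc)
  moreover have "fm (0\<^sub>m 1 1) = (0 :: 'k fmat)" by (rule fmat_eqI) (simp add: ent_fm ent_zero)
  ultimately show "hmodule_V G n (\<lambda>h. inverse (chi h)) \<in> hmodules G chi g n"
    "hm_of (hmodule_V G n (\<lambda>h. inverse (chi h))) \<asymp> tw 1 triv"
    unfolding hmodule_V_def using hmod_tw[OF hmod_triv, of 1]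
    by (auto intro!: hmodule_of_interpret simp: fm_smult fm_one)
qed

text \<open>Splitting the idempotent \<open>idn T\<close> amounts to a choice of basis; conjugation
  with \<open>P\<close> and \<open>Q\<close> then yields honest matrices.\<close>

lemma hmodule_exists:
  assumes T: "hmod T"
  obtains M where "M \<in> hmodules G chi g n" "hm_of M \<asymp> T"
proof -
  note D = hmodD[OF T]
  obtain d P Q where PQ: "P * Q = idm d" "Q * P = idn T" "P * idn T = P" "idm d * P = P"
      "idn T * Q = Q" "Q * idm d = Q"
    using idempotent_split[OF D(8)] by metis
  define r where "r x = mat d d (\<lambda>(i, j). ent (P * ext T x * Q) i j)" for x
  have r: "fm (r x) = P * ext T x * Q" for x
    unfolding r_def using PQ by (intro fm_mat) (simp_all add: mult.assoc flip: mult.assoc[of "idm d"])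
  define T' where "T' = HM (idm d) (\<lambda>h. P * act T h * Q) (P * yop T * Q)"
  have QPx: "Q * (P * (act T h * x)) = act T h * x" "Q * (P * (yop T * x)) = yop T * x"
      "Q * (P * (ypow T i * x)) = ypow T i * x" if "h \<in> carrier G" for h i x
    using PQ(2) D(9)[OF that] D(2) ypow_idn[OF T] by (simp_all flip: mult.assoc)
  have y: "ypow T' i = P * ypow T i * Q" for i
  proof (induction i)
    case 0
    then show ?case using PQ by (simp add: T'_def)
  next
    case (Suc i)
    have "yop T' * (P * ypow T i * Q) = P * (yop T * (Q * P) * ypow T i) * Q"
      by (simp add: T'_def mult.assoc)
    then show ?case using Suc PQ(2) D(3) by (simp add: ypow_Suc)
  qed
  have actT': "act T' h * act T' k = P * (act T h * act T k) * Q" if "h \<in> carrier G" for h k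
  proof -
    have "act T' h * act T' k = P * (act T h * (Q * P) * act T k) * Q" by (simp add: T'_def mult.assoc)
    then show ?thesis using PQ(2) D(10)[OF that] by simp
  qed
  have T': "hmod T'"
    unfolding hmod_def grep_def y
  proof (intro conjI ballI)
    show "act T' \<one> = idn T'" using PQ D(6) by (simp add: T'_def)
    show "act T' (h \<otimes> k) = act T' h * act T' k" if "h \<in> carrier G" "k \<in> carrier G" for h k
      using that by (simp add: actT') (simp add: T'_def D(7))
    show "idn T' * yop T' = yop T'" "yop T' * idn T' = yop T'"
      using PQ by (simp_all add: T'_def mult.assoc) (simp flip: mult.assoc)
    show "yop T' * act T' h = chi h \<cdot> (act T' h * yop T')" if h: "h \<in> carrier G" for h
    proof -
      have "yop T' * act T' h = P * (yop T * act T h) * Q"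
        using QPx(1)[OF h] by (simp add: T'_def mult.assoc)
      moreover have "act T' h * yop T' = P * (act T h * yop T) * Q"
        using QPx(2)[OF h] by (simp add: T'_def mult.assoc)
      ultimately show ?thesis using D(4)[OF h] by simp
    qed
    show "P * ypow T n * Q = act T' (g [^] n) - idn T'"
      using D(5) PQ by (simp add: T'_def left_diff_distrib right_diff_distrib)
  qed
  have iso: "T' \<asymp> T"
    unfolding hiso_def
  proof (intro exI conjI)
    show "mor T' T Q" using PQ QPx[OF one_closed] D
      by (intro morI) (simp_all add: T'_def mult.assoc, simp_all add: PQ flip: mult.assoc)
    show "mor T T' P" using PQ D
      by (intro morI) (simp_all add: T'_def mult.assoc)
    show "P * Q = idn T'" "Q * P = idn T" using PQ by (simp_all add: T'_def)
  qed
  have "ext T' x = P * ext T x * Q" for x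
  proof -
    have "ypow T' i * act T' h = P * (ypow T i * act T h) * Q" if "h \<in> carrier G" for i h
      using QPx(1)[OF that] unfolding y by (simp add: T'_def mult.assoc)
    then show ?thesis
      by (auto simp: ext_def sum_distrib_left sum_distrib_right hopf_basis_def intro!: sum.cong)
  qed
  then have "(d, r) \<in> hmodules G chi g n" "hm_of (d, r) \<asymp> T'"
    using hmodules_interpret[OF T', of "\<lambda>i. i" d r] r by (auto simp: T'_def r_def)
  then show thesis using that iso hiso_trans by blast
qed

lemma hmodule_iso_iff:
  assumes M: "M \<in> hmodules G chi g n" and N: "N \<in> hmodules G chi g n"
  shows "hmodule_iso G chi g n M N \<longleftrightarrow> hm_of M \<asymp> hm_of N"
proof -
  obtain d r d' r' where dr: "M = (d, r)" "N = (d', r')" by fastforce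
  note M' = M[unfolded dr] and N' = N[unfolded dr]
  note hM = hmod_hm_of[OF M] and hN = hmod_hm_of[OF N]
  have c: "r x \<in> carrier_mat d d" "r' x \<in> carrier_mat d' d'" if "x \<in> carrier H" for x
    using hmodulesD(1)[OF M' that] hmodulesD(1)[OF N' that] by auto
  show ?thesis
  proof
    assume "hmodule_iso G chi g n M N"
    then obtain P where P: "d = d'" "P \<in> carrier_mat d d" "invertible_mat P"
      "\<And>x. x \<in> carrier H \<Longrightarrow> P * r x = r' x * P"
      by (auto simp: hmodule_iso_def dr)
    then obtain Q where Q: "P * Q = 1\<^sub>m d" "Q * P = 1\<^sub>m (dim_row Q)"
      unfolding invertible_mat_def inverts_mat_def by auto
    have "dim_col Q = d" "dim_row Q = d"
      using arg_cong[OF Q(1), of dim_col] arg_cong[OF Q(2), of dim_col] P(2) by auto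
    then have Qc: "Q \<in> carrier_mat d d" and Q': "Q * P = 1\<^sub>m d" using Q by auto
    have PQ: "fm P * fm Q = idm d" "fm Q * fm P = idm d" "idm d * fm P = fm P" "fm P * idm d = fm P"
        "idm d * fm Q = fm Q" "fm Q * idm d = fm Q"
      using P(2) Qc Q(1) Q' by (simp_all flip: fm_mult fm_one)
    have comm: "fm P * fm (r x) = fm (r' x) * fm P" if "x \<in> carrier H" for x
      using P(4)[OF that] c[OF that] P(1,2) fm_mult[of P "r x"] fm_mult[of "r' x" P] by simp
    have comm': "fm Q * fm (r' x) = fm (r x) * fm Q" if x: "x \<in> carrier H" for x
    proof -
      have i: "idm d * fm (r x) = fm (r x)" "fm (r' x) * idm d = fm (r' x)"
        using c[OF x] P(1) by (simp_all flip: fm_mult fm_one)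
      have "fm Q * fm (r' x) = fm Q * (fm (r' x) * fm P) * fm Q" using PQ i by (simp add: mult.assoc)
      also have "\<dots> = fm (r x) * fm Q" unfolding comm[OF x, symmetric] using PQ i by (simp flip: mult.assoc)
      finally show ?thesis .
    qed
    have "mor (hm_of M) (hm_of N) (fm P)" "mor (hm_of N) (hm_of M) (fm Q)"
      using PQ P(1) comm comm' hopf_y_carrier hopf_grp_carrier
      by (auto intro!: morI simp: hm_of_def dr)
    then show "hm_of M \<asymp> hm_of N"
      unfolding hiso_def using PQ P(1) by (intro exI[of _ "fm P"] exI[of _ "fm Q"]) (simp add: hm_of_def dr)
  next
    assume iso: "hm_of M \<asymp> hm_of N"
    then obtain P Q where PQ: "mor (hm_of M) (hm_of N) P" "mor (hm_of N) (hm_of M) Q" "Q * P = idm d"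
      "P * Q = idm d'" unfolding hiso_def by (auto simp: hm_of_def dr)
    \<comment> \<open>The dimensions are the traces of the two identities, and characteristic zero
      makes the natural numbers recoverable from them.\<close>
    have "(of_nat d :: 'k) = of_nat d'" using tr_mult_commute[of P Q] PQ by simp
    then have d: "d = d'" by simp
    have Pi: "idm d * P = P" "P * idm d = P" "idm d * Q = Q" "Q * idm d = Q"
      using morD(1,2)[OF PQ(1)] morD(1,2)[OF PQ(2)] by (simp_all add: hm_of_def dr d)
    let ?m = "\<lambda>A. mat d d (\<lambda>(i, j). ent A i j)"
    have fmP: "fm (?m P) = P" "fm (?m Q) = Q" using Pi by (simp_all add: fm_mat)
    have eqI: "A = B" if "A \<in> carrier_mat d d" "B \<in> carrier_mat d d" "fm A = fm B" for A B :: "'k mat"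
      using that fm_inject by blast
    have "?m P * ?m Q = 1\<^sub>m d" "?m Q * ?m P = 1\<^sub>m d"
      using PQ fmP d by (auto intro!: eqI simp: fm_mult fm_one)
    then have "invertible_mat (?m P)"
      unfolding invertible_mat_def inverts_mat_def by (auto intro!: exI[of _ "?m Q"])
    moreover have "?m P * r x = r' x * ?m P" if x: "x \<in> carrier H" for x
    proof (rule eqI)
      have "P * (ypow (hm_of M) i * act (hm_of M) h) = ypow (hm_of N) i * act (hm_of N) h * P"
        if "h \<in> carrier G" for i h
        using mor_ypow[OF PQ(1), of i] morD(3)[OF PQ(1) that] by (metis mult.assoc)
      then have "P * ext (hm_of M) x = ext (hm_of N) x * P"
        by (auto simp: ext_def sum_distrib_left sum_distrib_right hopf_basis_def intro!: sum.cong)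
      then show "fm (?m P * r x) = fm (r' x * ?m P)"
        using c[OF x] d fm_eq_ext[OF M' x] fm_eq_ext[OF N' x] by (simp add: fm_mult fmP[unfolded d] dr)
      show "?m P * r x \<in> carrier_mat d d" "r' x * ?m P \<in> carrier_mat d d"
        using c[OF x] d by (auto intro!: mult_carrier_mat[of _ d d])
    qed
    ultimately show "hmodule_iso G chi g n M N"
      unfolding hmodule_iso_def dr using d by (auto intro!: bexI[of _ "?m P"])
  qed
qed

end

lemma relabel_sum: "relabel p (\<Sum>x\<in>S. f x) = (\<Sum>x\<in>S. relabel p (f x))"
proof -
  have "relabel p 0 = 0" by (rule fmat_eqI) (simp add: ent_relabel ent_zero)
  then show ?thesis by (induction S rule: infinite_finite_induct) (simp_all add: relabel_add)
qed

lemma inj_split: "inj (\<lambda>i. if i < d then prod_encode (0, i) else prod_encode (Suc 0, i - d))"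
  by (rule injI) (auto simp: prod_encode_eq split: if_splits)

lemma relabel_four_block:
  assumes "A \<in> carrier_mat d d" "B \<in> carrier_mat d' d'"
  shows "munit 0 0 \<boxtimes> fm A + munit (Suc 0) (Suc 0) \<boxtimes> fm B
    = relabel (\<lambda>i. if i < d then prod_encode (0, i) else prod_encode (Suc 0, i - d))
        (fm (four_block_mat A (0\<^sub>m d d') (0\<^sub>m d' d) B))" (is "?L = relabel ?p ?R")
proof (rule relabel_unique[OF inj_split])
  fix i j
  show "ent ?L (?p i) (?p j) = ent ?R i j"
    using assms by (auto simp: ent_add ent_kron ent_munit ent_fm)
next
  fix r s
  assume *: "ent ?L r s \<noteq> 0"
  have r: "x \<in> range ?p" if "fst (prod_decode x) = 0 \<and> snd (prod_decode x) < d
      \<or> fst (prod_decode x) = Suc 0" for x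
  proof -
    obtain a b where x: "x = prod_encode (a, b)" by (metis prod.collapse prod_decode_inverse)
    then have "x = ?p (if a = 0 then b else b + d)" using that by auto
    then show ?thesis by blast
  qed
  have "(fst (prod_decode r) = 0 \<and> snd (prod_decode r) < d \<or> fst (prod_decode r) = Suc 0) \<and>
      (fst (prod_decode s) = 0 \<and> snd (prod_decode s) < d \<or> fst (prod_decode s) = Suc 0)"
    using * assms by (auto simp: ent_add ent_kron ent_munit ent_fm split: if_splits)
  then show "r \<in> range ?p \<and> s \<in> range ?p" using r by blast
qed

lemma inj_div_mod: "inj (\<lambda>i :: nat. prod_encode (i div d, i mod d))"
proof (rule injI)
  fix i j assume "prod_encode (i div d, i mod d) = prod_encode (j div d, j mod d)"
  then have "i div d = j div d" "i mod d = j mod d" by (auto simp: prod_encode_eq)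
  then show "i = j" by (metis div_mult_mod_eq)
qed

lemma relabel_kronecker:
  assumes "A \<in> carrier_mat d d" "B \<in> carrier_mat d' d'"
  shows "fm A \<boxtimes> fm B = relabel (\<lambda>i. prod_encode (i div d', i mod d')) (fm (kronecker_mat A B))"
    (is "?L = relabel ?p ?R")
proof (rule relabel_unique[OF inj_div_mod])
  fix i j
  have iff: "i div d' < d \<and> i mod d' < d' \<longleftrightarrow> i < d * d'" for i
    by (cases "d' = 0") (auto simp: less_mult_imp_div_less div_less_iff_less_mult)
  show "ent ?L (?p i) (?p j) = ent ?R i j"
    using assms iff[of i] iff[of j] by (auto simp: ent_kron ent_fm kronecker_mat_def)
next
  fix r s
  assume *: "ent ?L r s \<noteq> 0"
  have r: "x \<in> range ?p" if "snd (prod_decode x) < d'" for x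
  proof -
    obtain a b where x: "x = prod_encode (a, b)" by (metis prod.collapse prod_decode_inverse)
    then have "x = ?p (b + a * d')" using that by simp
    then show ?thesis by blast
  qed
  show "r \<in> range ?p \<and> s \<in> range ?p"
    using * assms by (intro conjI r) (auto simp: ent_kron ent_fm split: if_splits)
qed

lemma kronecker_mat_carrier:
  "A \<in> carrier_mat a b \<Longrightarrow> B \<in> carrier_mat c d \<Longrightarrow> kronecker_mat A B \<in> carrier_mat (a * c) (b * d)"
  by (simp add: kronecker_mat_def)

lemma fm_sum_entries:
  assumes "\<And>x. x \<in> S \<Longrightarrow> A x \<in> carrier_mat a b"
  shows "fm (mat a b (\<lambda>rs. \<Sum>x\<in>S. c x * A x $$ rs)) = (\<Sum>x\<in>S. c x \<cdot> fm (A x))"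
proof (rule fmat_eqI)
  fix i j
  have "ent (c x \<cdot> fm (A x)) i j = (if i < a \<and> j < b then c x * A x $$ (i, j) else 0)" if "x \<in> S" for x
    using assms[OF that] by (simp add: ent_smul ent_fm)
  then show "ent (fm (mat a b (\<lambda>rs. \<Sum>x\<in>S. c x * A x $$ rs))) i j = ent (\<Sum>x\<in>S. c x \<cdot> fm (A x)) i j"
    by (auto simp: ent_sum ent_fm intro: sum.neutral)
qed

context datum
begin

lemma ext_dsum: "ext (dsum A B) x = munit 0 0 \<boxtimes> ext A x + munit (Suc 0) (Suc 0) \<boxtimes> ext B x"
proof -
  have act: "act (dsum A B) h = munit 0 0 \<boxtimes> act A h + munit (Suc 0) (Suc 0) \<boxtimes> act B h" for h
    by (simp add: dsum_def)
  show ?thesis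
    by (simp add: ext_def ypow_dsum act kron_sum_right sum.distrib smul_add_right distrib_left
        distrib_right munit_mult)
qed

lemma fm_ext:
  assumes "M \<in> hmodules G chi g n" "x \<in> carrier H"
  shows "fm (snd M x) = ext (hm_of M) x" "snd M x \<in> carrier_mat (fst M) (fst M)"
  using fm_eq_ext[of "fst M" "snd M" x] hmodulesD(1)[of "fst M" "snd M" x] assms by auto

section \<open>Direct sums, unit and tensor products of matrix modules\<close>

lemma hmodule_sum_interpret:
  assumes M: "M \<in> hmodules G chi g n" and N: "N \<in> hmodules G chi g n"
  shows "hmodule_sum M N \<in> hmodules G chi g n" "biprod (hm_of (hmodule_sum M N)) (hm_of M) (hm_of N)"
proof -
  let ?T = "dsum (hm_of M) (hm_of N)" and ?d = "fst M" and ?d' = "fst N"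
  let ?p = "\<lambda>i. if i < ?d then prod_encode (0, i) else prod_encode (Suc 0, i - ?d)"
  let ?r = "\<lambda>x. four_block_mat (snd M x) (0\<^sub>m ?d ?d') (0\<^sub>m ?d' ?d) (snd N x)"
  have T: "hmod ?T" using hmod_dsum hmod_hm_of M N by blast
  have eq: "hmodule_sum M N = (?d + ?d', ?r)" by (auto simp: hmodule_sum_def split: prod.splits)
  have "relabel ?p (fm (1\<^sub>m (?d + ?d'))) = munit 0 0 \<boxtimes> fm (1\<^sub>m ?d) + munit (Suc 0) (Suc 0) \<boxtimes> fm (1\<^sub>m ?d')"
    by (subst relabel_four_block[of _ ?d _ ?d']) (simp_all add: four_block_one_mat)
  then have idn: "relabel ?p (idm (?d + ?d')) = idn ?T"
    by (simp add: fm_one dsum_def hm_of_def)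
  have r: "relabel ?p (fm (?r x)) = ext ?T x" "?r x \<in> carrier_mat (?d + ?d') (?d + ?d')"
    if x: "x \<in> carrier H" for x
  proof -
    note Mx = fm_ext[OF M x] and Nx = fm_ext[OF N x]
    show "relabel ?p (fm (?r x)) = ext ?T x"
      unfolding ext_dsum Mx(1)[symmetric] Nx(1)[symmetric]
      by (rule relabel_four_block[symmetric]) (use Mx Nx in auto)
    show "?r x \<in> carrier_mat (?d + ?d') (?d + ?d')" using Mx(2) Nx(2) by simp
  qed
  note I = hmodules_interpret[OF T inj_split idn r(2) r(1)]
  show "hmodule_sum M N \<in> hmodules G chi g n" unfolding eq by (rule I(1))
  have "hm_of (hmodule_sum M N) \<asymp> ?T" unfolding eq by (rule I(2))
  then show "biprod (hm_of (hmodule_sum M N)) (hm_of M) (hm_of N)"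
    using biprod_iso_total[OF dsum_biprod[OF hmod_hm_of[OF M] hmod_hm_of[OF N]]] hiso_sym by blast
qed

lemma hmodule_unit_interpret:
  "hmodule_unit G \<in> hmodules G chi g n" "hm_of (hmodule_unit G) \<asymp> triv"
proof -
  have idm: "munit 0 0 = (idm 1 :: 'k fmat)" by (simp add: idm_Suc)
  have "ext triv x = hopf_eps G x \<cdot> munit 0 0" for x
  proof -
    have "ext triv x = (\<Sum>i<n. \<Sum>h\<in>carrier G. x (i, h) \<cdot> (ypow triv i * munit 0 0))"
      by (simp add: ext_def hopf_basis_def sum.cartesian_product split_def)
    also have "\<dots> = (\<Sum>i<n. if i = 0 then \<Sum>h\<in>carrier G. x (i, h) \<cdot> munit 0 0 else 0)"
      by (intro sum.cong refl) (simp add: ypow_yop_zero munit_mult)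
    finally show ?thesis using n_ge_2 by (simp add: hopf_eps_def smul_sum_left)
  qed
  then show "hmodule_unit G \<in> hmodules G chi g n" "hm_of (hmodule_unit G) \<asymp> triv"
    unfolding hmodule_unit_def using hmod_triv
    by (auto intro!: hmodules_interpret[of _ "\<lambda>i. i"] simp: fm_smult fm_one idm)
qed

text \<open>The action of elements of the tensor square of the algebra on the space of
  \<open>ten A B\<close>.\<close>

definition ext2 :: "('g, 'k) hm \<Rightarrow> ('g, 'k) hm \<Rightarrow> ((nat \<times> 'g) \<times> (nat \<times> 'g) \<Rightarrow> 'k) \<Rightarrow> 'k fmat" where
  "ext2 A B t = (\<Sum>b\<in>HB \<times> HB. t b \<cdot> (ext A (basis_vec (fst b)) \<boxtimes> ext B (basis_vec (snd b))))"

abbreviation "HT \<equiv> hopf_tensor G chi g n"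

lemma ext_expand: "ext T x = (\<Sum>b\<in>HB. x b \<cdot> ext T (basis_vec b))"
  unfolding ext_def[of T x] by (intro sum.cong refl) (simp add: ext_basis_vec)

lemma ext2_pure: "ext2 A B (\<lambda>(b, c). x b * y c) = ext A x \<boxtimes> ext B y"
proof -
  have "ext A x \<boxtimes> ext B y = (\<Sum>b\<in>HB. \<Sum>c\<in>HB. (x b * y c) \<cdot> (ext A (basis_vec b) \<boxtimes> ext B (basis_vec c)))"
    unfolding ext_expand[of A x] ext_expand[of B y] kron_sum_left
    by (intro sum.cong refl) (simp add: kron_sum_right smul_sum_right mult.commute[of "y _"])
  then show ?thesis by (simp add: ext2_def sum.cartesian_product split_def)
qed

lemma ext2_add: "ext2 A B (\<lambda>b. x b + y b) = ext2 A B x + ext2 A B y"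
  by (simp add: ext2_def smul_add_left sum.distrib)

lemma ext2_mult:
  assumes "hmod A" "hmod B"
  shows "ext2 A B (x \<otimes>\<^bsub>HT\<^esub> y) = ext2 A B x * ext2 A B y"
proof -
  let ?w = "\<lambda>b. ext A (basis_vec (fst b)) \<boxtimes> ext B (basis_vec (snd b))"
  define C where "C b1 b2 b = hopf_const G chi g n (fst b1) (fst b2) (fst b) *
    hopf_const G chi g n (snd b1) (snd b2) (snd b)" for b1 b2 b
  let ?S = "HB \<times> HB"
  have "(x \<otimes>\<^bsub>HT\<^esub> y) b = (\<Sum>b1\<in>?S. \<Sum>b2\<in>?S. x b1 * y b2 * C b1 b2 b)" if "b \<in> ?S" for b
    using that by (auto simp: hopf_tensor_def basis_algebra_def C_def split_def)
  then have "ext2 A B (x \<otimes>\<^bsub>HT\<^esub> y)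
      = (\<Sum>b\<in>?S. \<Sum>b1\<in>?S. \<Sum>b2\<in>?S. (x b1 * y b2) \<cdot> (C b1 b2 b \<cdot> ?w b))"
    by (simp add: ext2_def smul_sum_left)
  also have "\<dots> = (\<Sum>b1\<in>?S. \<Sum>b2\<in>?S. \<Sum>b\<in>?S. (x b1 * y b2) \<cdot> (C b1 b2 b \<cdot> ?w b))"
    by (rule trans[OF sum.swap], rule sum.cong[OF refl], rule sum.swap)
  also have "\<dots> = (\<Sum>b1\<in>?S. \<Sum>b2\<in>?S. (x b1 * y b2) \<cdot> ext2 A B (C b1 b2))"
    by (simp add: ext2_def smul_sum_right)
  also have "\<dots> = (\<Sum>b1\<in>?S. \<Sum>b2\<in>?S. (x b1 \<cdot> ?w b1) * (y b2 \<cdot> ?w b2))"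
  proof (intro sum.cong refl)
    fix b1 b2 assume b: "b1 \<in> ?S" "b2 \<in> ?S"
    have "C b1 b2 = (\<lambda>(b, c). hopf_const G chi g n (fst b1) (fst b2) b * hopf_const G chi g n (snd b1) (snd b2) c)"
      by (auto simp: C_def)
    then have "ext2 A B (C b1 b2) = ?w b1 * ?w b2"
      using b by (auto simp: ext2_pure ext_const[OF assms(1)] ext_const[OF assms(2)] ext_basis_vec)
    then show "(x b1 * y b2) \<cdot> ext2 A B (C b1 b2) = (x b1 \<cdot> ?w b1) * (y b2 \<cdot> ?w b2)"
      by (simp add: mult.commute)
  qed
  finally show ?thesis by (simp add: ext2_def sum_product)
qed

lemma ext2_Delta_y:
  assumes "hmod A" "hmod B"
  shows "ext2 A B (hopf_Delta_y G chi g n) = yop (ten A B)"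
proof -
  have "hopf_Delta_y G chi g n = (\<lambda>b. (\<lambda>(b, c). hopf_y G b * hopf_grp g c) b + (\<lambda>(b, c). \<one>\<^bsub>H\<^esub> b * hopf_y G c) b)"
    by (simp add: hopf_Delta_y_def hopf_tensor_def basis_algebra_def pure_tensor_def)
  then show ?thesis
    using assms g_closed by (simp add: ext2_add ext2_pure ext_grp ext_y ext_one)
qed

text \<open>\<open>ext2\<close> is multiplicative, so it suffices to compare the two sides on the
  comultiplication of y and on group elements.\<close>

lemma ext2_Delta:
  assumes A: "hmod A" and B: "hmod B"
  shows "ext2 A B (hopf_Delta G chi g n x) = ext (ten A B) x"
proof -
  let ?T = "ten A B"
  have T: "hmod ?T" using hmod_ten A B .
  have one: "ext2 A B \<one>\<^bsub>HT\<^esub> = idn ?T"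
  proof -
    have "\<one>\<^bsub>HT\<^esub> = (\<lambda>(b, c). hopf_grp \<one> b * (hopf_grp \<one> c :: 'k))"
      by (auto simp: hopf_tensor_def basis_algebra_def hopf_grp_def basis_vec_def)
    then show ?thesis using A B by (simp add: ext2_pure ext_grp hmodD)
  qed
  have pow: "ext2 A B (hopf_Delta_y G chi g n [^]\<^bsub>HT\<^esub> i) = ypow ?T i" for i :: nat
  proof (induction i)
    case 0
    then show ?case using one by (simp add: nat_pow_def)
  next
    case (Suc i)
    then show ?case
      using ypow_Suc_right[OF T, of i] ext2_Delta_y[OF A B] by (simp add: nat_pow_def ext2_mult[OF A B])
  qed
  have grp: "ext2 A B (pure_tensor (hopf_grp h) (hopf_grp h)) = act ?T h" if "h \<in> carrier G" for h
    using that A B unfolding pure_tensor_def by (simp add: ext2_pure ext_grp)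
  let ?t = "\<lambda>b. (hopf_Delta_y G chi g n [^]\<^bsub>HT\<^esub> fst b) \<otimes>\<^bsub>HT\<^esub> pure_tensor (hopf_grp (snd b)) (hopf_grp (snd b))"
  let ?w = "\<lambda>c. ext A (basis_vec (fst c)) \<boxtimes> ext B (basis_vec (snd c))"
  have "ext2 A B (hopf_Delta G chi g n x) = (\<Sum>c\<in>HB \<times> HB. \<Sum>b\<in>HB. x b \<cdot> (?t b c \<cdot> ?w c))"
    by (simp add: ext2_def hopf_Delta_def split_def smul_sum_left)
  also have "\<dots> = (\<Sum>b\<in>HB. x b \<cdot> ext2 A B (?t b))"
    by (subst sum.swap) (simp add: ext2_def smul_sum_right)
  also have "\<dots> = ext ?T x"
    unfolding ext_def by (intro sum.cong refl) (auto simp: ext2_mult[OF A B] pow grp HB_iff)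
  finally show ?thesis .
qed

lemma hmodule_tensor_interpret:
  assumes M: "M \<in> hmodules G chi g n" and N: "N \<in> hmodules G chi g n"
  shows "hmodule_tensor G chi g n M N \<in> hmodules G chi g n"
    "hm_of (hmodule_tensor G chi g n M N) \<asymp> ten (hm_of M) (hm_of N)"
proof -
  let ?A = "hm_of M" and ?B = "hm_of N" and ?d = "fst M" and ?d' = "fst N"
  have hm: "hmod ?A" "hmod ?B" using hmod_hm_of M N by auto
  have T: "hmod (ten ?A ?B)" using hmod_ten hm by blast
  let ?p = "\<lambda>i. prod_encode (i div ?d', i mod ?d')"
  define K where "K b = kronecker_mat (snd M (basis_vec (fst b))) (snd N (basis_vec (snd b)))"
    for b :: "(nat \<times> 'g) \<times> (nat \<times> 'g)"
  define r where "r x = mat (?d * ?d') (?d * ?d') (\<lambda>rs. \<Sum>b\<in>HB \<times> HB. hopf_Delta G chi g n x b * K b $$ rs)" for x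
  have eq: "hmodule_tensor G chi g n M N = (?d * ?d', r)"
    by (auto simp: hmodule_tensor_def r_def K_def split_def)
  have K: "K b \<in> carrier_mat (?d * ?d') (?d * ?d')"
      "relabel ?p (fm (K b)) = ext ?A (basis_vec (fst b)) \<boxtimes> ext ?B (basis_vec (snd b))"
    if "b \<in> HB \<times> HB" for b
  proof -
    have b: "basis_vec (fst b) \<in> carrier H" "basis_vec (snd b) \<in> carrier H"
      using that by (auto intro: basis_vec_carrier)
    show "K b \<in> carrier_mat (?d * ?d') (?d * ?d')"
      unfolding K_def by (intro kronecker_mat_carrier fm_ext M N b)
    show "relabel ?p (fm (K b)) = ext ?A (basis_vec (fst b)) \<boxtimes> ext ?B (basis_vec (snd b))"
      unfolding K_def fm_ext(1)[OF M b(1), symmetric] fm_ext(1)[OF N b(2), symmetric]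
      by (rule relabel_kronecker[symmetric, OF fm_ext(2)[OF M b(1)] fm_ext(2)[OF N b(2)]])
  qed
  have r: "relabel ?p (fm (r x)) = ext (ten ?A ?B) x" for x
  proof -
    have "fm (r x) = (\<Sum>b\<in>HB \<times> HB. hopf_Delta G chi g n x b \<cdot> fm (K b))"
      unfolding r_def by (rule fm_sum_entries[OF K(1)])
    then have "relabel ?p (fm (r x)) = ext2 ?A ?B (hopf_Delta G chi g n x)"
      by (simp add: relabel_sum relabel_smul K(2) ext2_def)
    then show ?thesis by (simp add: ext2_Delta[OF hm])
  qed
  have "kronecker_mat (1\<^sub>m ?d) (1\<^sub>m ?d') = (1\<^sub>m (?d * ?d') :: 'k mat)"
  proof (rule eq_matI)
    fix i j assume ij: "i < dim_row (1\<^sub>m (?d * ?d') :: 'k mat)" "j < dim_col (1\<^sub>m (?d * ?d') :: 'k mat)"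
    then have "0 < ?d'" by (cases "?d' = 0") auto
    moreover have "i div ?d' = j div ?d' \<and> i mod ?d' = j mod ?d' \<longleftrightarrow> i = j" by (metis div_mult_mod_eq)
    ultimately show "kronecker_mat (1\<^sub>m ?d) (1\<^sub>m ?d') $$ (i, j) = (1\<^sub>m (?d * ?d') :: 'k mat) $$ (i, j)"
      using ij by (auto simp: kronecker_mat_def less_mult_imp_div_less)
  qed (simp_all add: kronecker_mat_def)
  then have idn: "relabel ?p (idm (?d * ?d')) = idn (ten ?A ?B)"
    using relabel_kronecker[of "1\<^sub>m ?d :: 'k mat" ?d "1\<^sub>m ?d'" ?d']
    by (simp add: fm_one hm_of_def)
  have rc: "r x \<in> carrier_mat (?d * ?d') (?d * ?d')" for x by (simp add: r_def)
  note I = hmodules_interpret[OF T inj_div_mod idn rc r]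
  show "hmodule_tensor G chi g n M N \<in> hmodules G chi g n" unfolding eq by (rule I(1))
  show "hm_of (hmodule_tensor G chi g n M N) \<asymp> ten ?A ?B" unfolding eq by (rule I(2))
qed

end

section \<open>The Green ring\<close>

definition frag_mult :: "('b \<Rightarrow> 'b \<Rightarrow> 'b) \<Rightarrow> ('b \<Rightarrow>\<^sub>0 int) \<Rightarrow> ('b \<Rightarrow>\<^sub>0 int) \<Rightarrow> 'b \<Rightarrow>\<^sub>0 int" where
  "frag_mult f p q = frag_extend (\<lambda>A. frag_extend (\<lambda>B. frag_of (f A B)) q) p"

lemma frag_cmul_diff_right: "frag_cmul c (a - b) = frag_cmul c a - frag_cmul c b"
  by (rule poly_mapping_eqI) (simp add: lookup_minus right_diff_distrib)

lemma frag_extend_fun_diff: "frag_extend (\<lambda>x. f x - g x) p = frag_extend f p - frag_extend g p"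
  by (simp add: frag_extend_def frag_cmul_diff_right sum_subtractf)

lemma frag_extend_fun_add: "frag_extend (\<lambda>x. f x + g x) p = frag_extend f p + frag_extend g p"
  by (simp add: frag_extend_def frag_cmul_distrib2 sum.distrib)

lemma frag_mult_simps [simp]:
  "frag_mult f 0 q = 0" "frag_mult f p 0 = 0"
  "frag_mult f (frag_of A) (frag_of B) = frag_of (f A B)"
  "frag_mult f (p + p') q = frag_mult f p q + frag_mult f p' q"
  "frag_mult f p (q + q') = frag_mult f p q + frag_mult f p q'"
  "frag_mult f (p - p') q = frag_mult f p q - frag_mult f p' q"
  "frag_mult f p (q - q') = frag_mult f p q - frag_mult f p q'"
  by (simp_all add: frag_mult_def frag_extend_add frag_extend_diff frag_extend_fun_add
      frag_extend_fun_diff frag_extend_eq_0)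

lemma frag_mult_keys:
  assumes f: "\<And>A B. A \<in> S \<Longrightarrow> B \<in> S \<Longrightarrow> f A B \<in> S"
    and p: "Poly_Mapping.keys p \<subseteq> S" and q: "Poly_Mapping.keys q \<subseteq> S"
  shows "Poly_Mapping.keys (frag_mult f p q) \<subseteq> S"
  using p
proof (induction p rule: frag_induction)
  case (one A)
  show ?case using q
  proof (induction q rule: frag_induction)
    case (one B)
    then show ?case using f \<open>A \<in> S\<close> by simp
  next
    case (diff a b)
    then show ?case using keys_diff[of "frag_mult f (frag_of A) a" "frag_mult f (frag_of A) b"] by auto
  qed simp
next
  case (diff a b)
  then show ?case using keys_diff[of "frag_mult f a q" "frag_mult f b q"] by auto
qed simp

lemma ring_frag_mult:
  assumes f: "\<And>A B. A \<in> S \<Longrightarrow> B \<in> S \<Longrightarrow> f A B \<in> S"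
    and assoc: "\<And>A B C. A \<in> S \<Longrightarrow> B \<in> S \<Longrightarrow> C \<in> S \<Longrightarrow> f (f A B) C = f A (f B C)"
    and e: "e \<in> S" "\<And>A. A \<in> S \<Longrightarrow> f e A = A" "\<And>A. A \<in> S \<Longrightarrow> f A e = A"
  shows "ring \<lparr>carrier = carrier (free_Abelian_group S), monoid.mult = frag_mult f,
    monoid.one = frag_of e, ring.zero = 0, ring.add = (+)\<rparr>" (is "ring ?R")
proof (rule ringI)
  show "abelian_group ?R"
  proof (rule abelian_groupI)
    show "x \<oplus>\<^bsub>?R\<^esub> y \<in> carrier ?R" if "x \<in> carrier ?R" "y \<in> carrier ?R" for x y
      using that keys_add[of x y] by auto
    show "\<exists>y\<in>carrier ?R. y \<oplus>\<^bsub>?R\<^esub> x = \<zero>\<^bsub>?R\<^esub>" if "x \<in> carrier ?R" for x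
      using that by (intro bexI[of _ "- x"]) auto
  qed (auto simp: algebra_simps)
  show "monoid ?R"
  proof (rule monoidI)
    show "x \<otimes>\<^bsub>?R\<^esub> y \<in> carrier ?R" if "x \<in> carrier ?R" "y \<in> carrier ?R" for x y
      using that frag_mult_keys[OF f] by simp
    show "x \<otimes>\<^bsub>?R\<^esub> y \<otimes>\<^bsub>?R\<^esub> z = x \<otimes>\<^bsub>?R\<^esub> (y \<otimes>\<^bsub>?R\<^esub> z)"
      if "x \<in> carrier ?R" "y \<in> carrier ?R" "z \<in> carrier ?R" for x y z
    proof -
      have x: "Poly_Mapping.keys x \<subseteq> S" and y: "Poly_Mapping.keys y \<subseteq> S" and z: "Poly_Mapping.keys z \<subseteq> S"
        using that by auto
      have "frag_mult f (frag_mult f x y) z = frag_mult f x (frag_mult f y z)"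
        using x
      proof (induction x rule: frag_induction)
        case (one A)
        show ?case using y
        proof (induction y rule: frag_induction)
          case (one B)
          show ?case using z by (induction z rule: frag_induction) (simp_all add: assoc one \<open>A \<in> S\<close>)
        qed simp_all
      qed simp_all
      then show ?thesis by simp
    qed
    show "\<one>\<^bsub>?R\<^esub> \<otimes>\<^bsub>?R\<^esub> x = x" if "x \<in> carrier ?R" for x
    proof -
      have "Poly_Mapping.keys x \<subseteq> S" using that by simp
      then have "frag_mult f (frag_of e) x = x" by (induction x rule: frag_induction) (simp_all add: e)
      then show ?thesis by simp
    qed
    show "x \<otimes>\<^bsub>?R\<^esub> \<one>\<^bsub>?R\<^esub> = x" if "x \<in> carrier ?R" for x
    proof -
      have "Poly_Mapping.keys x \<subseteq> S" using that by simp
      then have "frag_mult f x (frag_of e) = x" by (induction x rule: frag_induction) (simp_all add: e)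
      then show ?thesis by simp
    qed
  qed (use e in simp)
qed simp_all

definition frag_eval :: "('b \<Rightarrow> 'k :: field) \<Rightarrow> ('b \<Rightarrow>\<^sub>0 int) \<Rightarrow> 'k" where
  "frag_eval f p = (\<Sum>c\<in>Poly_Mapping.keys p. of_int (Poly_Mapping.lookup p c) * f c)"

lemma frag_eval_of [simp]: "frag_eval f (frag_of c) = f c"
  by (simp add: frag_eval_def)

lemma frag_eval_diff [simp]: "frag_eval f (p - q) = frag_eval f p - frag_eval f q"
proof -
  let ?K = "Poly_Mapping.keys p \<union> Poly_Mapping.keys q"
  have ext: "frag_eval f x = (\<Sum>c\<in>?K. of_int (Poly_Mapping.lookup x c) * f c)"
    if "Poly_Mapping.keys x \<subseteq> ?K" for x
    unfolding frag_eval_def using that by (intro sum.mono_neutral_left) (auto simp: in_keys_iff)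
  show ?thesis
    using ext[OF keys_diff] ext[of p] ext[of q] by (simp add: lookup_minus left_diff_distrib sum_subtractf)
qed

lemma frag_eval_0 [simp]: "frag_eval f 0 = 0"
  by (simp add: frag_eval_def)

lemma frag_eval_minus [simp]: "frag_eval f (- p) = - frag_eval f p"
  using frag_eval_diff[of f 0 p] by simp

lemma frag_eval_add [simp]: "frag_eval f (p + q) = frag_eval f p + frag_eval f q"
  using frag_eval_diff[of f p "- q"] by simp

context datum
begin

abbreviation "Hm \<equiv> hmodules G chi g n"
abbreviation "cls \<equiv> hmodule_class G chi g n"
abbreviation "clss \<equiv> hmodule_classes G chi g n"
abbreviation "fgr \<equiv> free_green_ring G chi g n"
abbreviation "rel \<equiv> green_relations G chi g n"
abbreviation "gring \<equiv> green_ring G chi g n"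

lemma mem_cls: "M \<in> Hm \<Longrightarrow> N \<in> cls M \<longleftrightarrow> N \<in> Hm \<and> hm_of M \<asymp> hm_of N"
  by (auto simp: hmodule_class_def hmodule_iso_iff)

lemma cls_eq_iff:
  assumes "M \<in> Hm" "N \<in> Hm"
  shows "cls M = cls N \<longleftrightarrow> hm_of M \<asymp> hm_of N"
proof
  assume eq: "cls M = cls N"
  have "N \<in> cls N" using assms hiso_refl[OF hmod_hm_of] mem_cls by blast
  then show "hm_of M \<asymp> hm_of N" using mem_cls[OF assms(1)] by (simp flip: eq)
next
  assume iso: "hm_of M \<asymp> hm_of N"
  have "hm_of M \<asymp> hm_of L \<longleftrightarrow> hm_of N \<asymp> hm_of L" for L
    using iso hiso_sym hiso_trans by blast
  then show "cls M = cls N" using assms by (auto simp: hmodule_class_def hmodule_iso_iff)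
qed

lemma class_tensor_cls:
  assumes "M \<in> Hm" "N \<in> Hm"
  shows "class_tensor G chi g n (cls M) (cls N) = cls (hmodule_tensor G chi g n M N)"
proof -
  have "cls (hmodule_tensor G chi g n M' N') = cls (hmodule_tensor G chi g n M N)"
    if "M' \<in> cls M" "N' \<in> cls N" for M' N'
  proof -
    have MN: "M' \<in> Hm" "N' \<in> Hm" "hm_of M' \<asymp> hm_of M" "hm_of N' \<asymp> hm_of N"
      using that assms mem_cls hiso_sym by auto
    have "hm_of (hmodule_tensor G chi g n M' N') \<asymp> hm_of (hmodule_tensor G chi g n M N)"
      using hmodule_tensor_interpret(2)[OF MN(1,2)] ten_iso[OF MN(3,4)]
        hmodule_tensor_interpret(2)[OF assms] hiso_sym hiso_trans by meson
    then show ?thesis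
      using cls_eq_iff[OF hmodule_tensor_interpret(1)[OF MN(1,2)] hmodule_tensor_interpret(1)[OF assms]]
      by blast
  qed
  moreover have "M \<in> cls M" "N \<in> cls N" using assms mem_cls hiso_refl[OF hmod_hm_of] by auto
  ultimately show ?thesis unfolding class_tensor_def by blast
qed

lemma fgr_eq: "fgr = \<lparr>carrier = carrier (free_Abelian_group clss), monoid.mult = frag_mult (class_tensor G chi g n),
    monoid.one = frag_of (cls (hmodule_unit G)), ring.zero = 0, ring.add = (+)\<rparr>"
  by (simp add: free_green_ring_def frag_mult_def fun_eq_iff)

lemma ring_fgr: "ring fgr"
  unfolding fgr_eq
proof (rule ring_frag_mult)
  note T = hmodule_tensor_interpret and U = hmodule_unit_interpret
  show "class_tensor G chi g n A B \<in> clss" if "A \<in> clss" "B \<in> clss" for A B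
    using that T(1) by (auto simp: hmodule_classes_def class_tensor_cls)
  show "class_tensor G chi g n (class_tensor G chi g n A B) C
      = class_tensor G chi g n A (class_tensor G chi g n B C)"
    if "A \<in> clss" "B \<in> clss" "C \<in> clss" for A B C
  proof -
    obtain L M N where LMN: "A = cls L" "B = cls M" "C = cls N" "L \<in> Hm" "M \<in> Hm" "N \<in> Hm"
      using \<open>A \<in> clss\<close> \<open>B \<in> clss\<close> \<open>C \<in> clss\<close> by (auto simp: hmodule_classes_def)
    note h = LMN(4-6) and hm = LMN(4-6)[THEN hmod_hm_of]
    have "hm_of (hmodule_tensor G chi g n (hmodule_tensor G chi g n L M) N)
        \<asymp> ten (ten (hm_of L) (hm_of M)) (hm_of N)"
      using T(2)[OF T(1)[OF h(1,2)] h(3)] ten_iso[OF T(2)[OF h(1,2)] hiso_refl[OF hm(3)]] hiso_trans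
      by blast
    moreover have "hm_of (hmodule_tensor G chi g n L (hmodule_tensor G chi g n M N))
        \<asymp> ten (hm_of L) (ten (hm_of M) (hm_of N))"
      using T(2)[OF h(1) T(1)[OF h(2,3)]] ten_iso[OF hiso_refl[OF hm(1)] T(2)[OF h(2,3)]] hiso_trans
      by blast
    ultimately have "hm_of (hmodule_tensor G chi g n (hmodule_tensor G chi g n L M) N)
        \<asymp> hm_of (hmodule_tensor G chi g n L (hmodule_tensor G chi g n M N))"
      using ten_assoc[OF hm] hiso_sym hiso_trans by meson
    then show ?thesis using h T(1) by (simp add: LMN class_tensor_cls cls_eq_iff)
  qed
  show "cls (hmodule_unit G) \<in> clss" using U by (simp add: hmodule_classes_def)
  show "class_tensor G chi g n (cls (hmodule_unit G)) A = A" if A: "A \<in> clss" for A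
  proof -
    obtain M where M: "A = cls M" "M \<in> Hm" using A by (auto simp: hmodule_classes_def)
    have "hm_of (hmodule_tensor G chi g n (hmodule_unit G) M) \<asymp> hm_of M"
      using T(2)[OF U(1) M(2)] ten_iso[OF U(2) hiso_refl[OF hmod_hm_of[OF M(2)]]]
        ten_triv_left[OF hmod_hm_of[OF M(2)]] hiso_trans by blast
    then show ?thesis using M U T(1) by (simp add: class_tensor_cls cls_eq_iff)
  qed
  show "class_tensor G chi g n A (cls (hmodule_unit G)) = A" if A: "A \<in> clss" for A
  proof -
    obtain M where M: "A = cls M" "M \<in> Hm" using A by (auto simp: hmodule_classes_def)
    have "hm_of (hmodule_tensor G chi g n M (hmodule_unit G)) \<asymp> hm_of M"
      using T(2)[OF M(2) U(1)] ten_iso[OF hiso_refl[OF hmod_hm_of[OF M(2)]] U(2)]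
        ten_triv_right[OF hmod_hm_of[OF M(2)]] hiso_trans by blast
    then show ?thesis using M U T(1) by (simp add: class_tensor_cls cls_eq_iff)
  qed
qed

text \<open>Every biproduct gives a relation, not only the chosen model \<open>hmodule_sum\<close>.
  The set is the same, since isomorphic modules have the same class (\<open>rel_eq\<close>), and in
  this form its stability under tensor products is visible.\<close>

definition rel_gens :: "(('g, 'k) hmodule set \<Rightarrow>\<^sub>0 int) set" where
  "rel_gens = {frag_of (cls L) - (frag_of (cls M) + frag_of (cls N)) | L M N.
     L \<in> Hm \<and> M \<in> Hm \<and> N \<in> Hm \<and> biprod (hm_of L) (hm_of M) (hm_of N)}"

lemma rel_gensI:
  assumes "L \<in> Hm" "M \<in> Hm" "N \<in> Hm" "biprod (hm_of L) (hm_of M) (hm_of N)"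
  shows "frag_of (cls L) - (frag_of (cls M) + frag_of (cls N)) \<in> rel_gens"
  unfolding rel_gens_def mem_Collect_eq using assms by (intro exI[of _ L] exI[of _ M] exI[of _ N] conjI refl)

lemma rel_eq: "rel = generate (free_Abelian_group clss) rel_gens"
proof -
  let ?S = "{frag_of (cls (hmodule_sum M N)) - (frag_of (cls M) + frag_of (cls N)) | M N. M \<in> Hm \<and> N \<in> Hm}"
  have "rel_gens = ?S"
  proof (intro equalityI subsetI)
    fix x assume "x \<in> rel_gens"
    then obtain L M N where x: "x = frag_of (cls L) - (frag_of (cls M) + frag_of (cls N))"
      "L \<in> Hm" "M \<in> Hm" "N \<in> Hm" "biprod (hm_of L) (hm_of M) (hm_of N)" unfolding rel_gens_def by blast
    then have "cls L = cls (hmodule_sum M N)"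
      using hmodule_sum_interpret biprod_unique by (simp add: cls_eq_iff)
    then show "x \<in> ?S" unfolding mem_Collect_eq using x by (intro exI[of _ M] exI[of _ N]) simp
  next
    fix x assume "x \<in> ?S"
    then obtain M N where x: "x = frag_of (cls (hmodule_sum M N)) - (frag_of (cls M) + frag_of (cls N))"
      "M \<in> Hm" "N \<in> Hm" by blast
    then show "x \<in> rel_gens" using rel_gensI[OF hmodule_sum_interpret(1)] hmodule_sum_interpret(2) by simp
  qed
  then show ?thesis by (simp add: green_relations_def)
qed

lemma cls_in: "M \<in> Hm \<Longrightarrow> cls M \<in> clss"
  by (simp add: hmodule_classes_def)

lemma rel_gens_keys: "rel_gens \<subseteq> carrier (free_Abelian_group clss)"
proof
  fix x assume "x \<in> rel_gens"
  then obtain L M N where x: "x = frag_of (cls L) - (frag_of (cls M) + frag_of (cls N))"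
    "L \<in> Hm" "M \<in> Hm" "N \<in> Hm" by (auto simp: rel_gens_def)
  have "Poly_Mapping.keys x \<subseteq> {cls L, cls M, cls N}"
    unfolding x(1) using keys_diff[of "frag_of (cls L)" "frag_of (cls M) + frag_of (cls N)"]
      keys_add[of "frag_of (cls M)" "frag_of (cls N)"] by auto
  then show "x \<in> carrier (free_Abelian_group clss)" using x(2-4)[THEN cls_in] by auto
qed

lemma subgroup_rel: "subgroup rel (free_Abelian_group clss)"
  unfolding rel_eq by (rule group.generate_is_subgroup[OF group_free_Abelian_group rel_gens_keys])

lemma rel_uminus: "x \<in> rel \<Longrightarrow> - x \<in> rel"
  using subgroup.m_inv_closed[OF subgroup_rel, of x] subgroup.mem_carrier[OF subgroup_rel, of x] by simp

lemma rel_add: "x \<in> rel \<Longrightarrow> y \<in> rel \<Longrightarrow> x + y \<in> rel"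
  using subgroup.m_closed[OF subgroup_rel, of x y] by simp

lemma rel_zero: "0 \<in> rel"
  using subgroup.one_closed[OF subgroup_rel] by simp

lemma rel_diff: "x \<in> rel \<Longrightarrow> y \<in> rel \<Longrightarrow> x - y \<in> rel"
  using rel_add[of x "- y"] rel_uminus[of y] by simp

lemma rel_induct [consumes 1, case_names zero gen diff]:
  assumes "x \<in> rel" "P 0" "\<And>y. y \<in> rel_gens \<Longrightarrow> P y" "\<And>y z. P y \<Longrightarrow> P z \<Longrightarrow> P (y - z)"
  shows "P x"
  using assms(1) unfolding rel_eq
proof (induction rule: generate.induct)
  case (inv h)
  then show ?case using rel_gens_keys assms(4)[OF assms(2) assms(3)[of h]] by auto
next
  case (eng h1 h2)
  then show ?case using assms(4)[OF assms(2), of h2] assms(4)[of h1 "- h2"] by simp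
qed (use assms in auto)

text \<open>Tensoring on either side takes biproducts to biproducts; additivity in both arguments
  does the rest.\<close>

lemma ideal_rel: "ideal rel fgr"
proof (rule idealI[OF ring_fgr])
  note T = hmodule_tensor_interpret
  have "add_monoid fgr = free_Abelian_group clss"
    by (simp add: fgr_eq free_Abelian_group_def)
  then show "subgroup rel (add_monoid fgr)" using subgroup_rel by simp
  fix a x assume a: "a \<in> rel" and x: "x \<in> carrier fgr"
  have x: "Poly_Mapping.keys x \<subseteq> clss" using x by (simp add: fgr_eq)
  have "frag_mult (class_tensor G chi g n) x a \<in> rel \<and> frag_mult (class_tensor G chi g n) a x \<in> rel"
    using a
  proof (induction rule: rel_induct)
    case zero
    then show ?case by (simp add: rel_zero)
  next
    case (diff y z)
    then show ?case by (simp add: rel_diff)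
  next
    case (gen y)
    then obtain L M N where y: "y = frag_of (cls L) - (frag_of (cls M) + frag_of (cls N))"
      "L \<in> Hm" "M \<in> Hm" "N \<in> Hm" "biprod (hm_of L) (hm_of M) (hm_of N)" by (auto simp: rel_gens_def)
    have gen: "frag_of (cls L) - (frag_of (cls M) + frag_of (cls N)) \<in> rel"
      if "L \<in> Hm" "M \<in> Hm" "N \<in> Hm" "biprod (hm_of L) (hm_of M) (hm_of N)" for L M N
      unfolding rel_eq using that by (intro generate.incl rel_gensI)
    show ?case
      using x
    proof (induction x rule: frag_induction)
      case zero
      then show ?case by (simp add: rel_zero)
    next
      case (diff p q)
      then show ?case by (simp add: rel_diff)
    next
      case (one A)
      then obtain K where K: "A = cls K" "K \<in> Hm" by (auto simp: hmodule_classes_def)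
      note hK = hmod_hm_of[OF K(2)]
      have iso: "biprod (hm_of (hmodule_tensor G chi g n K L)) (hm_of (hmodule_tensor G chi g n K M))
          (hm_of (hmodule_tensor G chi g n K N))"
        by (rule biprod_iso_total[OF biprod_iso[OF biprod_ten_right[OF y(5) hK]]])
          (use T(2) K y hiso_sym in blast)+
      have iso': "biprod (hm_of (hmodule_tensor G chi g n L K)) (hm_of (hmodule_tensor G chi g n M K))
          (hm_of (hmodule_tensor G chi g n N K))"
        by (rule biprod_iso_total[OF biprod_iso[OF biprod_ten_left[OF y(5) hK]]])
          (use T(2) K y hiso_sym in blast)+
      show ?case
        using gen[OF T(1)[OF K(2) y(2)] T(1)[OF K(2) y(3)] T(1)[OF K(2) y(4)] iso]
          gen[OF T(1)[OF y(2) K(2)] T(1)[OF y(3) K(2)] T(1)[OF y(4) K(2)] iso']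
        by (simp add: K y class_tensor_cls)
    qed
  qed
  then show "x \<otimes>\<^bsub>fgr\<^esub> a \<in> rel" "a \<otimes>\<^bsub>fgr\<^esub> x \<in> rel" by (simp_all add: fgr_eq)
qed

lemma ring_gring: "ring gring"
  unfolding green_ring_def by (rule ideal.quotient_is_ring[OF ideal_rel])

sublocale gr: ring gring
  by (rule ring_gring)

text \<open>The class of a module given by idempotents, through an arbitrary matrix model; the
  choice is immaterial by \<open>gcl_eq\<close>.\<close>

definition gcl :: "('g, 'k) hm \<Rightarrow> (('g, 'k) hmodule set \<Rightarrow>\<^sub>0 int) set" where
  "gcl T = green_class G chi g n (SOME M. M \<in> Hm \<and> hm_of M \<asymp> T)"

lemma green_class_carrier: "M \<in> Hm \<Longrightarrow> green_class G chi g n M \<in> carrier gring"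
  using ring_hom_closed[OF ideal.rcos_ring_hom[OF ideal_rel], of "frag_of (cls M)"] cls_in[of M]
  by (simp add: green_class_def green_ring_def fgr_eq)

lemma coset_eq_iff:
  assumes "x \<in> carrier fgr" "y \<in> carrier fgr"
  shows "rel +>\<^bsub>fgr\<^esub> x = rel +>\<^bsub>fgr\<^esub> y \<longleftrightarrow> x - y \<in> rel"
proof -
  interpret ideal rel fgr by (rule ideal_rel)
  have inv: "\<ominus>\<^bsub>fgr\<^esub> y = - y"
    using assms keys_minus[of y] by (intro minus_equality) (auto simp: fgr_eq)
  have "rel +>\<^bsub>fgr\<^esub> x = rel +>\<^bsub>fgr\<^esub> y \<longleftrightarrow> x \<ominus>\<^bsub>fgr\<^esub> y \<in> rel"
    using quotient_eq_iff_same_a_r_cos[OF ideal_rel assms] by simp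
  then show ?thesis unfolding a_minus_def inv by (simp add: fgr_eq)
qed

text \<open>Each value of \<open>val\<close> extends additively to the free group and vanishes on
  the relations. Modules with equal classes thus have the same \<open>val\<close>, which decides
  isomorphism.\<close>

lemma green_class_eq_iff:
  assumes M: "M \<in> Hm" and N: "N \<in> Hm"
  shows "green_class G chi g n M = green_class G chi g n N \<longleftrightarrow> hm_of M \<asymp> hm_of N"
proof
  assume "hm_of M \<asymp> hm_of N"
  then have "cls M = cls N" using cls_eq_iff M N by blast
  then show "green_class G chi g n M = green_class G chi g n N" by (simp add: green_class_def)
next
  assume "green_class G chi g n M = green_class G chi g n N"
  moreover have "frag_of (cls M) \<in> carrier fgr" "frag_of (cls N) \<in> carrier fgr"
    using M N cls_in by (simp_all add: fgr_eq)
  ultimately have mem: "frag_of (cls M) - frag_of (cls N) \<in> rel"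
    by (simp add: green_class_def coset_eq_iff)
  have "val (hm_of M) k h = val (hm_of N) k h" for k h
  proof -
    define f where "f c = val (hm_of (SOME L. L \<in> c)) k h" for c
    have f: "f (cls L) = val (hm_of L) k h" if L: "L \<in> Hm" for L
    proof -
      have "L \<in> cls L" using mem_cls[OF L] hiso_refl[OF hmod_hm_of[OF L]] L by simp
      then have "(SOME L'. L' \<in> cls L) \<in> cls L" by (rule someI)
      then show ?thesis using mem_cls[OF L] val_iso hmod_hm_of L unfolding f_def by metis
    qed
    have "frag_eval f x = 0" if "x \<in> rel" for x
      using that
    proof (induction rule: rel_induct)
      case (gen y)
      then obtain L A B where y: "y = frag_of (cls L) - (frag_of (cls A) + frag_of (cls B))"
        "L \<in> Hm" "A \<in> Hm" "B \<in> Hm" "biprod (hm_of L) (hm_of A) (hm_of B)" by (auto simp: rel_gens_def)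
      then show ?case
        using val_biprod[OF y(5) hmod_hm_of[OF y(2)] hmod_hm_of[OF y(3)] hmod_hm_of[OF y(4)]]
        by (simp add: f)
    qed simp_all
    from this[OF mem] show ?thesis using M N by (simp add: f)
  qed
  then show "hm_of M \<asymp> hm_of N"
    using hiso_iff_val_eq[OF hmod_hm_of[OF M] hmod_hm_of[OF N]] by (simp add: fun_eq_iff)
qed

lemma gcl_eq:
  assumes "M \<in> Hm" "hm_of M \<asymp> T"
  shows "gcl T = green_class G chi g n M"
proof -
  define N where "N = (SOME M. M \<in> Hm \<and> hm_of M \<asymp> T)"
  have "N \<in> Hm \<and> hm_of N \<asymp> T" unfolding N_def by (rule someI) (use assms in blast)
  then have "green_class G chi g n N = green_class G chi g n M"
    using green_class_eq_iff assms hiso_sym hiso_trans by blast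
  then show ?thesis by (simp add: gcl_def N_def)
qed

lemma gcl_closed: "hmod T \<Longrightarrow> gcl T \<in> carrier gring"
  using hmodule_exists gcl_eq green_class_carrier by metis

lemma gcl_eq_iff:
  assumes "hmod A" "hmod B"
  shows "gcl A = gcl B \<longleftrightarrow> A \<asymp> B"
proof -
  obtain M N where MN: "M \<in> Hm" "hm_of M \<asymp> A" "N \<in> Hm" "hm_of N \<asymp> B"
    using hmodule_exists assms by metis
  show ?thesis
    using gcl_eq[OF MN(1,2)] gcl_eq[OF MN(3,4)] green_class_eq_iff[OF MN(1,3)] MN hiso_sym hiso_trans by metis
qed

lemma rcos_hom: "(+>\<^bsub>fgr\<^esub>) rel \<in> Ring.ring_hom fgr gring"
  unfolding green_ring_def by (rule ideal.rcos_ring_hom[OF ideal_rel])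

lemma gcl_biprod:
  assumes "biprod M A B" "hmod M" "hmod A" "hmod B"
  shows "gcl M = gcl A \<oplus>\<^bsub>gring\<^esub> gcl B"
proof -
  obtain M' A' B' where *: "M' \<in> Hm" "hm_of M' \<asymp> M" "A' \<in> Hm" "hm_of A' \<asymp> A" "B' \<in> Hm" "hm_of B' \<asymp> B"
    using hmodule_exists assms by metis
  have "biprod (hm_of M') (hm_of A') (hm_of B')"
    using biprod_iso_total[OF biprod_iso[OF assms(1) hiso_sym[OF *(4)] hiso_sym[OF *(6)]] hiso_sym[OF *(2)]] .
  then have rel: "frag_of (cls M') - (frag_of (cls A') + frag_of (cls B')) \<in> rel"
    unfolding rel_eq using * by (intro generate.incl rel_gensI)
  have c: "frag_of (cls L) \<in> carrier fgr" if "L \<in> Hm" for L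
    using that cls_in by (simp add: fgr_eq)
  have sum: "frag_of (cls A') + frag_of (cls B') = frag_of (cls A') \<oplus>\<^bsub>fgr\<^esub> frag_of (cls B')"
    by (simp add: fgr_eq)
  have "green_class G chi g n M' = rel +>\<^bsub>fgr\<^esub> (frag_of (cls A') \<oplus>\<^bsub>fgr\<^esub> frag_of (cls B'))"
    unfolding green_class_def using rel sum
    by (subst coset_eq_iff) (auto intro!: c * ring.ring_simprules(1)[OF ring_fgr])
  also have "\<dots> = green_class G chi g n A' \<oplus>\<^bsub>gring\<^esub> green_class G chi g n B'"
    using ring_hom_add[OF rcos_hom c[OF *(3)] c[OF *(5)]] by (simp add: green_class_def)
  finally show ?thesis using gcl_eq * by metis
qed

lemma gcl_ten:
  assumes "hmod A" "hmod B"
  shows "gcl (ten A B) = gcl A \<otimes>\<^bsub>gring\<^esub> gcl B"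
proof -
  obtain A' B' where *: "A' \<in> Hm" "hm_of A' \<asymp> A" "B' \<in> Hm" "hm_of B' \<asymp> B"
    using hmodule_exists assms by metis
  note T = hmodule_tensor_interpret[OF *(1,3)]
  have c: "frag_of (cls L) \<in> carrier fgr" if "L \<in> Hm" for L
    using that cls_in by (simp add: fgr_eq)
  have "frag_of (cls (hmodule_tensor G chi g n A' B')) = frag_of (cls A') \<otimes>\<^bsub>fgr\<^esub> frag_of (cls B')"
    using * by (simp add: fgr_eq class_tensor_cls)
  then have "green_class G chi g n (hmodule_tensor G chi g n A' B')
      = green_class G chi g n A' \<otimes>\<^bsub>gring\<^esub> green_class G chi g n B'"
    using ring_hom_mult[OF rcos_hom c[OF *(1)] c[OF *(3)]] by (simp add: green_class_def)
  moreover have "hm_of (hmodule_tensor G chi g n A' B') \<asymp> ten A B"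
    using T(2) ten_iso[OF *(2,4)] hiso_trans by blast
  ultimately show ?thesis using gcl_eq * T(1) by metis
qed

lemma gcl_triv: "gcl triv = \<one>\<^bsub>gring\<^esub>"
proof -
  have "gcl triv = green_class G chi g n (hmodule_unit G)"
    using gcl_eq hmodule_unit_interpret by metis
  also have "\<dots> = \<one>\<^bsub>gring\<^esub>"
    using ring_hom_one[OF rcos_hom] by (simp add: green_class_def fgr_eq)
  finally show ?thesis .
qed

lemma gcl_dsum: "hmod A \<Longrightarrow> hmod B \<Longrightarrow> gcl (dsum A B) = gcl A \<oplus>\<^bsub>gring\<^esub> gcl B"
  by (rule gcl_biprod[OF dsum_biprod hmod_dsum])

lemma gring_cases:
  assumes "x \<in> carrier gring"
  obtains A B where "hmod A" "hmod B" "x = gcl A \<ominus>\<^bsub>gring\<^esub> gcl B"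
proof -
  let ?Z = "HM 0 (\<lambda>_. 0) 0 :: ('g, 'k) hm"
  obtain p where p: "p \<in> carrier fgr" "x = rel +>\<^bsub>fgr\<^esub> p"
    using assms by (auto simp: green_ring_def FactRing_def A_RCOSETS_def' a_r_coset_def)
  have c: "p \<in> carrier fgr" if "Poly_Mapping.keys p \<subseteq> clss" for p
    using that by (simp add: fgr_eq)
  have "Poly_Mapping.keys p \<subseteq> clss" using p(1) by (simp add: fgr_eq)
  then have "Poly_Mapping.keys p \<subseteq> clss \<and>
      (\<exists>A B. hmod A \<and> hmod B \<and> rel +>\<^bsub>fgr\<^esub> p = gcl A \<ominus>\<^bsub>gring\<^esub> gcl B)"
  proof (induction p rule: frag_induction)
    case zero
    have "rel +>\<^bsub>fgr\<^esub> 0 = \<zero>\<^bsub>gring\<^esub>"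
      using ring_hom_zero[OF rcos_hom ring_fgr ring_gring] by (simp add: fgr_eq)
    moreover have "gcl ?Z \<ominus>\<^bsub>gring\<^esub> gcl ?Z = \<zero>\<^bsub>gring\<^esub>"
      using gcl_closed[OF hmod_zero] by (simp add: gr.r_right_minus_eq)
    ultimately show ?case using hmod_zero by (metis bot.extremum keys_zero)
  next
    case (one C)
    then obtain M where M: "C = cls M" "M \<in> Hm" by (auto simp: hmodule_classes_def)
    note hM = hmod_hm_of[OF M(2)]
    have "gcl (hm_of M) = rel +>\<^bsub>fgr\<^esub> frag_of C"
      using gcl_eq[OF M(2) hiso_refl[OF hM]] by (simp add: green_class_def M)
    moreover have "gcl (dsum (hm_of M) (hm_of M)) \<ominus>\<^bsub>gring\<^esub> gcl (hm_of M) = gcl (hm_of M)"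
      using gcl_closed[OF hM] by (simp add: gcl_dsum[OF hM hM] a_minus_def gr.a_assoc gr.r_neg)
    ultimately show ?case using hM hmod_dsum[OF hM hM] one by (metis bot.extremum insert_subset keys_frag_of)
  next
    case (diff p q)
    then obtain A B A' B' where *: "hmod A" "hmod B" "rel +>\<^bsub>fgr\<^esub> p = gcl A \<ominus>\<^bsub>gring\<^esub> gcl B"
      "hmod A'" "hmod B'" "rel +>\<^bsub>fgr\<^esub> q = gcl A' \<ominus>\<^bsub>gring\<^esub> gcl B'" by blast
    have pq: "p \<in> carrier fgr" "q \<in> carrier fgr" "p - q \<in> carrier fgr" "Poly_Mapping.keys (p - q) \<subseteq> clss"
      using diff keys_diff[of p q] by (auto simp: fgr_eq)
    have "p = (p - q) \<oplus>\<^bsub>fgr\<^esub> q" by (simp add: fgr_eq)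
    then have "rel +>\<^bsub>fgr\<^esub> p = (rel +>\<^bsub>fgr\<^esub> (p - q)) \<oplus>\<^bsub>gring\<^esub> (rel +>\<^bsub>fgr\<^esub> q)"
      using ring_hom_add[OF rcos_hom pq(3,2)] by simp
    moreover have "rel +>\<^bsub>fgr\<^esub> (p - q) \<in> carrier gring" "rel +>\<^bsub>fgr\<^esub> q \<in> carrier gring"
      using ring_hom_closed[OF rcos_hom] pq by auto
    ultimately have "rel +>\<^bsub>fgr\<^esub> (p - q) = (rel +>\<^bsub>fgr\<^esub> p) \<ominus>\<^bsub>gring\<^esub> (rel +>\<^bsub>fgr\<^esub> q)"
      by (simp add: a_minus_def gr.a_assoc gr.r_neg)
    also have "\<dots> = gcl (dsum A B') \<ominus>\<^bsub>gring\<^esub> gcl (dsum B A')"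
      unfolding *(3,6) using *(1,2,4,5)[THEN gcl_closed]
      by (simp add: gcl_dsum * a_minus_def gr.minus_add gr.a_ac)
    finally have eq: "rel +>\<^bsub>fgr\<^esub> (p - q) = gcl (dsum A B') \<ominus>\<^bsub>gring\<^esub> gcl (dsum B A')" .
    show ?case using pq(4) hmod_dsum[OF *(1,5)] hmod_dsum[OF *(2,4)] by (intro conjI exI[of _ "dsum A B'"] exI[of _ "dsum B A'"] eq)
  qed
  then show thesis using that p(2) by blast
qed

section \<open>Extension of additive functions to the Green ring\<close>

definition additive :: "(('g, 'k) hm \<Rightarrow> 'k) \<Rightarrow> bool" where
  "additive t \<longleftrightarrow> (\<forall>M A B. biprod M A B \<longrightarrow> hmod M \<longrightarrow> hmod A \<longrightarrow> hmod B \<longrightarrow> t M = t A + t B)"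

lemma additive_iso:
  assumes t: "additive t" and "A \<asymp> B" "hmod A" "hmod B"
  shows "t A = t B"
proof -
  let ?Z = "HM 0 (\<lambda>_. 0) 0 :: ('g, 'k) hm"
  have "t B = t A + t ?Z"
    using t assms biprod_zero[OF assms(2)] hmod_zero unfolding additive_def by blast
  moreover have "t ?Z = t ?Z + t ?Z"
    using t biprod_zero[OF hiso_refl[OF hmod_zero]] hmod_zero unfolding additive_def by blast
  ultimately show ?thesis by simp
qed

text \<open>The value at a difference of classes is the difference of the values. For additive
  \<open>t\<close> this does not depend on the representation, by
  \<open>gcl_diff_eq_iff\<close>.\<close>

definition ghat :: "(('g, 'k) hm \<Rightarrow> 'k) \<Rightarrow> (('g, 'k) hmodule set \<Rightarrow>\<^sub>0 int) set \<Rightarrow> 'k" where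
  "ghat t x = (THE v. \<exists>A B. hmod A \<and> hmod B \<and> x = gcl A \<ominus>\<^bsub>gring\<^esub> gcl B \<and> v = t A - t B)"

lemma gcl_diff_eq_iff:
  assumes "hmod A" "hmod B" "hmod A'" "hmod B'"
  shows "gcl A \<ominus>\<^bsub>gring\<^esub> gcl B = gcl A' \<ominus>\<^bsub>gring\<^esub> gcl B' \<longleftrightarrow> dsum A B' \<asymp> dsum A' B"
proof -
  note c = assms[THEN gcl_closed]
  have "gcl A \<ominus>\<^bsub>gring\<^esub> gcl B = gcl A' \<ominus>\<^bsub>gring\<^esub> gcl B' \<longleftrightarrow> gcl A \<oplus>\<^bsub>gring\<^esub> gcl B' = gcl A' \<oplus>\<^bsub>gring\<^esub> gcl B"
  proof
    assume *: "gcl A \<ominus>\<^bsub>gring\<^esub> gcl B = gcl A' \<ominus>\<^bsub>gring\<^esub> gcl B'"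
    have "gcl A \<oplus>\<^bsub>gring\<^esub> gcl B' = (gcl A \<ominus>\<^bsub>gring\<^esub> gcl B) \<oplus>\<^bsub>gring\<^esub> (gcl B \<oplus>\<^bsub>gring\<^esub> gcl B')"
      using c by (simp add: a_minus_def gr.a_assoc gr.r_neg1)
    also have "\<dots> = (gcl A' \<ominus>\<^bsub>gring\<^esub> gcl B') \<oplus>\<^bsub>gring\<^esub> (gcl B' \<oplus>\<^bsub>gring\<^esub> gcl B)"
      unfolding * using c by (simp add: gr.a_comm)
    finally show "gcl A \<oplus>\<^bsub>gring\<^esub> gcl B' = gcl A' \<oplus>\<^bsub>gring\<^esub> gcl B"
      using c by (simp add: a_minus_def gr.a_assoc gr.r_neg1)
  next
    assume *: "gcl A \<oplus>\<^bsub>gring\<^esub> gcl B' = gcl A' \<oplus>\<^bsub>gring\<^esub> gcl B"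
    have "gcl A \<ominus>\<^bsub>gring\<^esub> gcl B = (gcl A \<oplus>\<^bsub>gring\<^esub> gcl B') \<ominus>\<^bsub>gring\<^esub> gcl B' \<ominus>\<^bsub>gring\<^esub> gcl B"
      using c by (simp add: a_minus_def gr.a_assoc gr.r_neg)
    also have "\<dots> = gcl A' \<oplus>\<^bsub>gring\<^esub> ((gcl B \<ominus>\<^bsub>gring\<^esub> gcl B) \<ominus>\<^bsub>gring\<^esub> gcl B')"
      unfolding * using c by (simp add: a_minus_def gr.a_ac)
    finally show "gcl A \<ominus>\<^bsub>gring\<^esub> gcl B = gcl A' \<ominus>\<^bsub>gring\<^esub> gcl B'"
      using c by (simp add: a_minus_def gr.r_neg)
  qed
  then show ?thesis using assms hmod_dsum by (simp add: gcl_eq_iff flip: gcl_dsum)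
qed

lemma ghat_diff:
  assumes t: "additive t" and A: "hmod A" and B: "hmod B"
  shows "ghat t (gcl A \<ominus>\<^bsub>gring\<^esub> gcl B) = t A - t B"
  unfolding ghat_def
proof (rule the_equality)
  show "\<exists>A' B'. hmod A' \<and> hmod B' \<and> gcl A \<ominus>\<^bsub>gring\<^esub> gcl B = gcl A' \<ominus>\<^bsub>gring\<^esub> gcl B' \<and> t A - t B = t A' - t B'"
    using A B by blast
  fix v assume "\<exists>A' B'. hmod A' \<and> hmod B' \<and> gcl A \<ominus>\<^bsub>gring\<^esub> gcl B = gcl A' \<ominus>\<^bsub>gring\<^esub> gcl B' \<and> v = t A' - t B'"
  then obtain A' B' where *: "hmod A'" "hmod B'" "dsum A B' \<asymp> dsum A' B" "v = t A' - t B'"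
    using gcl_diff_eq_iff[OF A B] by blast
  have "t (dsum A B') = t (dsum A' B)"
    using additive_iso[OF t *(3)] hmod_dsum A B * by blast
  moreover have "t (dsum A B') = t A + t B'" "t (dsum A' B) = t A' + t B"
    using t A B * dsum_biprod hmod_dsum unfolding additive_def by blast+
  ultimately have "t A = t A' + t B - t B'" by (simp add: eq_diff_eq)
  then show "v = t A - t B" using *(4) by simp
qed

lemma ghat_gcl:
  assumes t: "additive t" and A: "hmod A"
  shows "ghat t (gcl A) = t A"
proof -
  have "gcl (dsum A A) \<ominus>\<^bsub>gring\<^esub> gcl A = gcl A"
    using gcl_closed[OF A] by (simp add: gcl_dsum[OF A A] a_minus_def gr.a_assoc gr.r_neg)
  then have "ghat t (gcl A) = t (dsum A A) - t A" using ghat_diff[OF t hmod_dsum[OF A A] A] by simp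
  moreover have "t (dsum A A) = t A + t A"
    using t dsum_biprod[OF A A] hmod_dsum[OF A A] A unfolding additive_def by blast
  ultimately show ?thesis by simp
qed

lemma ghat_add:
  assumes t: "additive t" and "x \<in> carrier gring" "y \<in> carrier gring"
  shows "ghat t (x \<oplus>\<^bsub>gring\<^esub> y) = ghat t x + ghat t y"
proof -
  obtain A B where A: "hmod A" "hmod B" "x = gcl A \<ominus>\<^bsub>gring\<^esub> gcl B" using gring_cases assms(2) .
  obtain C D where C: "hmod C" "hmod D" "y = gcl C \<ominus>\<^bsub>gring\<^esub> gcl D" using gring_cases assms(3) .
  have "x \<oplus>\<^bsub>gring\<^esub> y = gcl (dsum A C) \<ominus>\<^bsub>gring\<^esub> gcl (dsum B D)"
    using A C gcl_closed by (simp add: gcl_dsum a_minus_def gr.minus_add gr.a_ac)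
  moreover have "t (dsum A C) = t A + t C" "t (dsum B D) = t B + t D"
    using t A C dsum_biprod hmod_dsum unfolding additive_def by blast+
  ultimately show ?thesis using A C by (simp add: ghat_diff[OF t] hmod_dsum)
qed

lemma ghat_mult:
  assumes t: "additive t" "\<And>A B. hmod A \<Longrightarrow> hmod B \<Longrightarrow> t (ten A B) = t A * t B"
    and "x \<in> carrier gring" "y \<in> carrier gring"
  shows "ghat t (x \<otimes>\<^bsub>gring\<^esub> y) = ghat t x * ghat t y"
proof -
  obtain A B where A: "hmod A" "hmod B" "x = gcl A \<ominus>\<^bsub>gring\<^esub> gcl B" using gring_cases assms(3) .
  obtain C D where C: "hmod C" "hmod D" "y = gcl C \<ominus>\<^bsub>gring\<^esub> gcl D" using gring_cases assms(4) .
  note c = A(1,2)[THEN gcl_closed] C(1,2)[THEN gcl_closed]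
  let ?P = "dsum (ten A C) (ten B D)" and ?Q = "dsum (ten A D) (ten B C)"
  have h: "hmod (ten A C)" "hmod (ten B D)" "hmod (ten A D)" "hmod (ten B C)" using A C hmod_ten by auto
  have "x \<otimes>\<^bsub>gring\<^esub> y = gcl ?P \<ominus>\<^bsub>gring\<^esub> gcl ?Q"
    using A C c by (simp add: gcl_dsum h gcl_ten a_minus_def gr.minus_add gr.l_distr gr.r_distr gr.l_minus gr.r_minus
        gr.a_ac)
  moreover have "t ?P = t A * t C + t B * t D" "t ?Q = t A * t D + t B * t C"
    using t(1) h dsum_biprod hmod_dsum unfolding additive_def t(2)[OF A(1) C(1), symmetric]
      t(2)[OF A(1) C(2), symmetric] t(2)[OF A(2) C(1), symmetric] t(2)[OF A(2) C(2), symmetric] by blast+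
  ultimately show ?thesis using A C h by (simp add: ghat_diff[OF t(1)] hmod_dsum algebra_simps)
qed

end

section \<open>Algebraic integers and the Jacobson radical\<close>

text \<open>The elements of \<open>S\<close> form a vector, nonzero because of \<open>b0\<close>,
  which is an eigenvector with eigenvalue \<open>v\<close> of an integer matrix. So \<open>v\<close>
  is a root of a monic integer polynomial, the characteristic polynomial.\<close>

lemma algebraic_int_if_stable:
  fixes v :: "'a :: field_char_0"
  assumes S: "finite S" "b0 \<in> S" "b0 \<noteq> 0"
    and stable: "\<And>b. b \<in> S \<Longrightarrow> \<exists>c :: 'a \<Rightarrow> int. v * b = (\<Sum>x\<in>S. of_int (c x) * x)"
  shows "algebraic_int v"
proof -
  define m where "m = card S"
  obtain f where f: "bij_betw f {..<m} S"
    using ex_bij_betw_nat_finite[OF S(1)] by (auto simp: m_def atLeast0LessThan)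
  obtain c :: "'a \<Rightarrow> 'a \<Rightarrow> int" where c: "\<And>b. b \<in> S \<Longrightarrow> v * b = (\<Sum>x\<in>S. of_int (c b x) * x)"
    using stable by metis
  define A where "A = mat m m (\<lambda>(i, j). c (f i) (f j))"
  have A: "A \<in> carrier_mat m m" by (simp add: A_def)
  let ?A = "map_mat (of_int :: int \<Rightarrow> 'a) A" and ?v = "vec m f"
  have "eigenvector ?A ?v v"
    unfolding eigenvector_def
  proof (intro conjI)
    obtain i where "i < m" "f i = b0" using f S(2) unfolding bij_betw_def by (metis imageE lessThan_iff)
    then show "?v \<noteq> 0\<^sub>v (dim_row ?A)" using S(3) A by (metis carrier_matD(1) index_map_mat(2) index_vec index_zero_vec(1))
    show "?A *\<^sub>v ?v = v \<cdot>\<^sub>v ?v"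
    proof (rule eq_vecI)
      fix i assume "i < dim_vec (v \<cdot>\<^sub>v ?v)"
      then have i: "i < m" by simp
      then have "f i \<in> S" using f unfolding bij_betw_def by auto
      have "v * f i = (\<Sum>j<m. of_int (c (f i) (f j)) * f j)"
        unfolding c[OF \<open>f i \<in> S\<close>] by (rule sum.reindex_bij_betw[OF f, symmetric])
      then show "(?A *\<^sub>v ?v) $ i = (v \<cdot>\<^sub>v ?v) $ i"
        using i A by (simp add: scalar_prod_def A_def atLeast0LessThan)
    qed (simp add: A_def)
  qed (simp add: A_def)
  then have "poly (char_poly ?A) v = 0"
    using eigenvalue_root_char_poly[of ?A m v] A by (auto simp: eigenvalue_def)
  then have "poly (map_poly of_int (char_poly A)) v = 0"
    by (simp add: of_int_hom.char_poly_hom[OF A])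
  moreover have "lead_coeff (char_poly A) = 1" using degree_monic_char_poly[OF A] by simp
  ultimately show ?thesis unfolding algebraic_int_altdef_ipoly by blast
qed

text \<open>For \<open>N > 0\<close> this is the ring generated by the N-th roots of unity,
  presented as a finitely generated group so that \<open>algebraic_int_if_stable\<close>
  applies.\<close>

definition zspan :: "nat \<Rightarrow> 'k :: field \<Rightarrow> bool" where
  "zspan N v \<longleftrightarrow> (\<exists>c :: 'k \<Rightarrow> int. v = (\<Sum>x\<in>runity N. of_int (c x) * x))"

lemma zspan_0: "zspan N 0"
  unfolding zspan_def by (intro exI[of _ "\<lambda>_. 0"]) simp

lemma zspan_add:
  assumes "zspan N v" "zspan N w"
  shows "zspan N (v + w)"
proof -
  obtain c d :: "'a \<Rightarrow> int" where "v = (\<Sum>x\<in>runity N. of_int (c x) * x)" "w = (\<Sum>x\<in>runity N. of_int (d x) * x)"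
    using assms unfolding zspan_def by blast
  then show ?thesis
    unfolding zspan_def by (intro exI[of _ "\<lambda>x. c x + d x"]) (simp add: distrib_right sum.distrib)
qed

lemma zspan_of_int_mult:
  assumes "zspan N v"
  shows "zspan N (of_int m * v)"
proof -
  obtain c :: "'a \<Rightarrow> int" where "v = (\<Sum>x\<in>runity N. of_int (c x) * x)"
    using assms unfolding zspan_def by blast
  then show ?thesis
    unfolding zspan_def by (intro exI[of _ "\<lambda>x. m * c x"]) (simp add: sum_distrib_left mult.assoc)
qed

lemma zspan_diff: "zspan N v \<Longrightarrow> zspan N w \<Longrightarrow> zspan N (v - w)"
  using zspan_add[of N v "- w"] zspan_of_int_mult[of N w "- 1"] by simp

lemma zspan_sum: "(\<And>x. x \<in> S \<Longrightarrow> zspan N (f x)) \<Longrightarrow> zspan N (\<Sum>x\<in>S. f x)"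
  by (induction S rule: infinite_finite_induct) (simp_all add: zspan_0 zspan_add)

lemma zspan_runity:
  fixes x :: "'k :: {alg_closed_field, field_char_0}"
  assumes "x \<in> runity N" "N > 0"
  shows "zspan N x"
proof -
  have "(\<Sum>y\<in>runity N. of_int (if y = x then 1 else 0) * y) = (\<Sum>y\<in>runity N. if y = x then x else 0)"
    by (intro sum.cong) auto
  also have "\<dots> = x" using assms card_runity(2)[OF assms(2), where 'k = 'k] by simp
  finally show ?thesis
    unfolding zspan_def by (intro exI[of _ "\<lambda>y. if y = x then 1 else 0"]) (rule sym)
qed

lemma zspan_mono:
  fixes v :: "'k :: {alg_closed_field, field_char_0}"
  assumes "zspan M v" "M dvd N" "N > 0"
  shows "zspan N v"
proof -
  have "runity M \<subseteq> (runity N :: 'k set)" using assms(2) by (auto simp: runity_def power_mult)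
  then show ?thesis
    using assms(1,3) unfolding zspan_def[of M]
    by (auto intro!: zspan_sum zspan_of_int_mult zspan_runity)
qed

lemma zspan_mult:
  fixes v w :: "'k :: {alg_closed_field, field_char_0}"
  assumes v: "zspan N v" and w: "zspan N w" and N: "N > 0"
  shows "zspan N (v * w)"
proof -
  have *: "zspan N (y * x)" if "x \<in> runity N" "y \<in> runity N" for x y :: 'k
    using that N by (intro zspan_runity) (auto simp: runity_def power_mult_distrib)
  obtain c d :: "'k \<Rightarrow> int" where cd: "v = (\<Sum>x\<in>runity N. of_int (c x) * x)" "w = (\<Sum>x\<in>runity N. of_int (d x) * x)"
    using assms unfolding zspan_def by blast
  have "v * w = (\<Sum>x\<in>runity N. \<Sum>y\<in>runity N. of_int (c x * d y) * (x * y))"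
    unfolding cd sum_product by (intro sum.cong refl) simp
  then show ?thesis by (simp only:) (intro zspan_sum zspan_of_int_mult *)
qed

lemma zspan_algebraic_int:
  fixes v :: "'k :: {alg_closed_field, field_char_0}"
  assumes v: "zspan N v" and N: "N > 0"
  shows "algebraic_int v"
proof (rule algebraic_int_if_stable[OF card_runity(2)[OF N], of 1])
  show "\<exists>c :: 'k \<Rightarrow> int. v * b = (\<Sum>x\<in>runity N. of_int (c x) * x)" if "b \<in> runity N" for b
    using zspan_mult[OF v zspan_runity[OF that N] N] unfolding zspan_def .
qed (simp_all add: runity_def)

section \<open>Maximal ideals and homomorphisms into a field of characteristic zero\<close>

lemma (in ring) exists_maximalideal:
  assumes K: "ideal K R" "\<one> \<notin> K"
  obtains I where "maximalideal I R" "K \<subseteq> I" "\<one> \<notin> I"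
proof -
  let ?A = "{I. ideal I R \<and> K \<subseteq> I \<and> \<one> \<notin> I}"
  have "\<exists>M\<in>?A. \<forall>I\<in>?A. M \<subseteq> I \<longrightarrow> I = M"
  proof (rule subset_Zorn_nonempty)
    show "?A \<noteq> {}" using K by blast
    fix C assume C: "C \<noteq> {}" "subset.chain ?A C"
    then have "subset.chain {I. ideal I R} C" unfolding subset_chain_def by blast
    then have "ideal (\<Union>C) R" using chain_Union_is_ideal[of C] C(1) by simp
    moreover have "K \<subseteq> \<Union>C" "\<one> \<notin> \<Union>C" using C unfolding subset_chain_def by blast+
    ultimately show "\<Union>C \<in> ?A" by blast
  qed
  then obtain I where "I \<in> ?A" and max: "\<forall>J\<in>?A. I \<subseteq> J \<longrightarrow> J = I" by (rule bexE)
  then have I: "ideal I R" "K \<subseteq> I" "\<one> \<notin> I" by simp_all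
  have "maximalideal I R"
  proof (rule maximalidealI[OF I(1)])
    show "carrier R \<noteq> I" using I(3) one_closed by blast
    fix J assume J: "ideal J R" "I \<subseteq> J" "J \<subseteq> carrier R"
    show "J = I \<or> J = carrier R"
    proof (cases "\<one> \<in> J")
      case True
      then show ?thesis using ideal.one_imp_carrier[OF J(1)] by blast
    next
      case False
      then have "J \<in> ?A" using J I(2) by simp
      then show ?thesis using max J(2) by simp
    qed
  qed
  then show thesis using that I by blast
qed

text \<open>As \<open>a \<noteq> 0\<close>, factors of the variable can be divided out of the
  equation until the constant term is nonzero.\<close>

lemma poly_root_nonzero_coeff:
  fixes a :: "'a :: field"
  assumes "p \<noteq> 0" "\<And>i. coeff p i \<in> \<int>" "poly p a = 0" "a \<noteq> 0"
  shows "\<exists>q. (\<forall>i. coeff q i \<in> \<int>) \<and> coeff q 0 \<noteq> 0 \<and> poly q a = 0"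
  using assms
proof (induction p)
  case (pCons b p)
  show ?case
  proof (cases "b = 0")
    case True
    have "coeff p i \<in> \<int>" for i using pCons.prems(2)[of "Suc i"] by simp
    then show ?thesis using pCons True by auto
  next
    case False
    then show ?thesis using pCons.prems(2,3) by (intro exI[of _ "pCons b p"]) auto
  qed
qed simp

text \<open>
  If \<open>f x \<noteq> 0\<close>, the constant term of an integral equation of \<open>f x\<close> is a nonzero integer in the image
  of the ideal generated by \<open>x\<close>, so that a maximal ideal that contains the preimage of a prime not
  dividing it omits \<open>x\<close>.
\<close>

lemma (in ring) jacobson_radical_hom_zero:
  fixes f :: "'a \<Rightarrow> 'k :: field_char_0"
  assumes add: "\<And>x y. x \<in> carrier R \<Longrightarrow> y \<in> carrier R \<Longrightarrow> f (x \<oplus> y) = f x + f y"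
    and mult: "\<And>x y. x \<in> carrier R \<Longrightarrow> y \<in> carrier R \<Longrightarrow> f (x \<otimes> y) = f x * f y"
    and one: "f \<one> = 1"
    and alg: "\<And>x. x \<in> carrier R \<Longrightarrow> algebraic_int (f x)"
    and x: "x \<in> jacobson_radical R"
  shows "f x = 0"
proof (rule ccontr)
  assume fx: "f x \<noteq> 0"
  have xc: "x \<in> carrier R" and xI: "\<And>I. maximalideal I R \<Longrightarrow> x \<in> I"
    using x by (auto simp: jacobson_radical_def)
  have zero: "f \<zero> = 0" using add[of \<zero> \<zero>] by simp
  have minus: "f (\<ominus> y) = - f y" if "y \<in> carrier R" for y
    using add[of y "\<ominus> y"] that zero by (simp add: r_neg eq_neg_iff_add_eq_0 add.commute)
  have "\<exists>y\<in>carrier R. f y = of_nat m" for m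
  proof (induction m)
    case 0
    then show ?case using zero by (intro bexI[of _ \<zero>]) auto
  next
    case (Suc m)
    then obtain y where "y \<in> carrier R" "f y = of_nat m" by blast
    then show ?case using add[of y \<one>] one by (intro bexI[of _ "y \<oplus> \<one>"]) auto
  qed
  then have ints: "\<exists>y\<in>carrier R. f y = of_int m" for m
    using minus by (cases m rule: int_cases2) (metis of_int_of_nat_eq, metis a_inv_closed of_int_minus of_int_of_nat_eq)
  have polys: "\<exists>y\<in>carrier R. f y = poly s (f x)" if "\<And>i. Polynomial.coeff s i \<in> \<int>" for s
    using that
  proof (induction s)
    case 0
    then show ?case using zero by (intro bexI[of _ \<zero>]) auto
  next
    case (pCons b s)
    have "b \<in> \<int>" using pCons.prems[of 0] by simp
    then obtain y where y: "y \<in> carrier R" "f y = b" using ints by (metis Ints_cases)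
    have "Polynomial.coeff s i \<in> \<int>" for i using pCons.prems[of "Suc i"] by simp
    then obtain z where z: "z \<in> carrier R" "f z = poly s (f x)" using pCons.IH by blast
    then show ?case using y xc by (intro bexI[of _ "y \<oplus> x \<otimes> z"]) (simp_all add: add mult)
  qed
  obtain p where "lead_coeff p = 1" "\<forall>i. Polynomial.coeff p i \<in> \<int>" "poly p (f x) = 0"
    using alg[OF xc] by (auto elim: algebraic_int.cases)
  then obtain q where q: "\<And>i. Polynomial.coeff q i \<in> \<int>" "Polynomial.coeff q 0 \<noteq> 0" "poly q (f x) = 0"
    using poly_root_nonzero_coeff[of p "f x"] fx by (metis leading_coeff_0_iff zero_neq_one)
  obtain b s where bs: "q = pCons b s" by (cases q)
  have "Polynomial.coeff s i \<in> \<int>" for i using q(1)[of "Suc i"] by (simp add: bs)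
  then obtain y where y: "y \<in> carrier R" "f y = poly s (f x)" using polys by blast
  obtain c where c: "b = of_int c" "c \<noteq> 0" using q(1)[of 0] q(2) by (auto simp: bs elim: Ints_cases)
  \<comment> \<open>The integral equation reads c + f(x) s(f(x)) = 0, so the image of this multiple
    of \<open>x\<close> is the nonzero integer \<open>c\<close>.\<close>
  define w where "w = \<ominus> (x \<otimes> y)"
  have "of_int c = - (f x * poly s (f x))" using q(3) by (simp add: bs c(1) eq_neg_iff_add_eq_0)
  then have w: "w \<in> carrier R" "f w = of_int c"
    using y xc by (simp_all add: w_def minus mult)
  \<comment> \<open>Any prime larger than the absolute value of \<open>c\<close> is prime to
    \<open>c\<close>.\<close>
  obtain p :: nat where p: "Factorial_Ring.prime p" "nat \<bar>c\<bar> < p" using bigger_prime by blast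
  have "\<not> int p dvd c" using p(2) c(2) dvd_imp_le_int[of c "int p"] by linarith
  then have "coprime (int p) c" using p(1) by (simp add: prime_imp_coprime)
  then obtain u v where uv: "u * int p + v * c = 1" using bezout_int[of "int p" c] by (metis coprime_iff_gcd_eq_1)
  \<comment> \<open>The preimage of the ideal which \<open>p\<close> generates in the image of
    \<open>f\<close>.\<close>
  define K where "K = {y \<in> carrier R. \<exists>z\<in>carrier R. f y = of_nat p * f z}"
  have "ideal K R"
  proof (rule idealI[OF ring_axioms])
    show "subgroup K (add_monoid R)"
    proof (rule add.subgroupI)
      show "K \<subseteq> carrier R" by (auto simp: K_def)
      show "K \<noteq> {}" using zero by (auto simp: K_def intro!: exI[of _ \<zero>])
      show "\<ominus> a \<in> K" if a: "a \<in> K" for a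
      proof -
        obtain z where "z \<in> carrier R" "a \<in> carrier R" "f a = of_nat p * f z" using a by (auto simp: K_def)
        then show ?thesis by (auto simp: K_def minus intro!: bexI[of _ "\<ominus> z"])
      qed
      show "a \<oplus> b \<in> K" if ab: "a \<in> K" "b \<in> K" for a b
      proof -
        obtain z z' where "z \<in> carrier R" "a \<in> carrier R" "f a = of_nat p * f z"
          "z' \<in> carrier R" "b \<in> carrier R" "f b = of_nat p * f z'" using ab by (auto simp: K_def)
        then show ?thesis by (auto simp: K_def add distrib_left intro!: bexI[of _ "z \<oplus> z'"])
      qed
    qed
    fix a y assume a: "a \<in> K" and y: "y \<in> carrier R"
    obtain z where z: "z \<in> carrier R" "a \<in> carrier R" "f a = of_nat p * f z" using a by (auto simp: K_def)
    then show "y \<otimes> a \<in> K" using y by (auto simp: K_def mult intro!: bexI[of _ "y \<otimes> z"])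
    show "a \<otimes> y \<in> K" using y z by (auto simp: K_def mult intro!: bexI[of _ "z \<otimes> y"])
  qed
  moreover have "\<one> \<notin> K"
  proof
    assume "\<one> \<in> K"
    then obtain z where z: "z \<in> carrier R" "1 = of_nat p * f z" by (auto simp: K_def one)
    have p0: "(of_nat p :: 'k) \<noteq> 0" using p(1) by (simp add: prime_gt_0_nat)
    then have fz: "f z = 1 / of_nat p" using z(2) by (simp add: field_simps)
    \<comment> \<open>If 1 lay in \<open>K\<close>, then 1/p would be an algebraic integer, and a
      rational algebraic integer is an integer.\<close>
    then have "f z \<in> \<rat>" by simp
    then obtain m where m: "f z = of_int m"
      using rational_algebraic_int_is_int alg[OF z(1)] by (metis Ints_cases)
    have "(of_int (int p * m) :: 'k) = of_int 1" using z(2) by (simp add: m)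
    then have "int p * m = 1" by (simp only: of_int_eq_iff)
    then have "int p dvd 1" by (metis dvd_triv_left)
    then show False using p(1) by (simp add: prime_nat_iff)
  qed
  ultimately obtain I where I: "maximalideal I R" "K \<subseteq> I" "\<one> \<notin> I" using exists_maximalideal by blast
  interpret I: ideal I R using I(1) by (rule maximalideal.axioms)
  have "x \<otimes> y \<in> I" using I.I_r_closed[OF xI[OF I(1)] y(1)] .
  then have wI: "w \<in> I" by (simp add: w_def I.a_inv_closed)
  obtain v' where v': "v' \<in> carrier R" "f v' = of_int v" using ints by blast
  obtain u' where u': "u' \<in> carrier R" "f u' = of_int u" using ints by blast
  have vw: "v' \<otimes> w \<in> I" "v' \<otimes> w \<in> carrier R" using I.I_l_closed[OF wI v'(1)] v' w by auto
  \<comment> \<open>By the Bezout identity 1 - v' w lies in \<open>K\<close> and hence in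
    \<open>I\<close>. As \<open>x\<close>, and with it \<open>w\<close>, lies in \<open>I\<close>,
    so does 1.\<close>
  have "f (\<one> \<oplus> \<ominus> (v' \<otimes> w)) = of_int (1 - v * c)"
    using v' w vw by (simp add: add minus mult one)
  also have "\<dots> = of_nat p * f u'"
  proof -
    have "1 - v * c = int p * u" using uv by (simp add: algebra_simps)
    then show ?thesis unfolding u'(2) by simp
  qed
  finally have "\<one> \<oplus> \<ominus> (v' \<otimes> w) \<in> K" using u' vw by (auto simp: K_def intro!: bexI[of _ u'])
  then have "(\<one> \<oplus> \<ominus> (v' \<otimes> w)) \<oplus> v' \<otimes> w \<in> I" using I(2) vw(1) I.a_closed by blast
  then show False using I(3) vw(2) by (simp add: a_assoc l_neg)
qed

context datum
begin

section \<open>Vanishing of the characters on the radical\<close>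

lemma tr_biprod:
  assumes "biprod M A B" "hmod M" "hmod A" "hmod B" "h \<in> carrier G"
  shows "tr (act M h) = tr (act A h) + tr (act B h)"
  using tinv_biprod[OF assms, of 0] assms by (simp add: tinv_0)

lemma zspan_tr:
  assumes "hmod M" "h \<in> carrier G"
  shows "zspan gsz (tr (act M h))"
proof -
  obtain d :: "'k \<Rightarrow> nat" where "tr (act M h) = (\<Sum>x\<in>runity gsz. of_nat (d x) * x)"
    using tr_eq_sum_runity[OF hmodD(1)[OF assms(1)] assms(2)] by blast
  then show ?thesis unfolding zspan_def by (intro exI[of _ "\<lambda>x. int (d x)"]) simp
qed

lemma ghat_hom_zero:
  assumes t: "additive t" "\<And>A B. hmod A \<Longrightarrow> hmod B \<Longrightarrow> t (ten A B) = t A * t B" "t triv = 1"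
    and N: "N > 0" "\<And>A. hmod A \<Longrightarrow> zspan N (t A)"
    and A: "hmod A" "hmod B" "gcl A \<ominus>\<^bsub>gring\<^esub> gcl B \<in> jacobson_radical gring"
  shows "t A = t B"
proof -
  have "ghat t (gcl A \<ominus>\<^bsub>gring\<^esub> gcl B) = 0"
  proof (rule gr.jacobson_radical_hom_zero[OF _ _ _ _ A(3)])
    show "ghat t \<one>\<^bsub>gring\<^esub> = 1" using ghat_gcl[OF t(1) hmod_triv] t(3) by (simp add: gcl_triv)
    show "algebraic_int (ghat t x)" if x: "x \<in> carrier gring" for x
    proof -
      obtain A B where "hmod A" "hmod B" "x = gcl A \<ominus>\<^bsub>gring\<^esub> gcl B" using gring_cases[OF x] .
      then show ?thesis
        using zspan_algebraic_int[OF zspan_diff[OF N(2) N(2)] N(1)] by (simp add: ghat_diff[OF t(1)])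
    qed
  qed (simp_all add: ghat_add[OF t(1)] ghat_mult[OF t(1,2)])
  then show ?thesis using ghat_diff[OF t(1) A(1,2)] by simp
qed

lemma jacobson_tr_eq:
  assumes A: "hmod A" "hmod B" "gcl A \<ominus>\<^bsub>gring\<^esub> gcl B \<in> jacobson_radical gring" and h: "h \<in> carrier G"
  shows "tr (act A h) = tr (act B h)"
proof (rule ghat_hom_zero[OF _ _ _ order_pos _ A])
  show "additive (\<lambda>M. tr (act M h))" unfolding additive_def using tr_biprod h by blast
  show "tr (act (ten A B) h) = tr (act A h) * tr (act B h)" for A B by simp
  show "tr (act triv h) = 1" by (simp add: tr_munit)
  show "zspan gsz (tr (act A h))" if "hmod A" for A using zspan_tr that h by blast
qed

lemma zspan_phi:
  assumes F: "jchar h x F" and h: "h \<in> carrier G" and N: "N > 0" "gsz dvd N" "zspan N x" "zspan N (inverse (chi h))"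
    and M: "hmod M"
  shows "zspan N (phi F h M)"
proof -
  note F' = F[unfolded jchar_def]
  have 1: "zspan N (1 :: 'k)" using N(1) by (intro zspan_runity) (auto simp: runity_def)
  have zF: "zspan N (F k) \<and> zspan N (F (Suc k))" for k
    by (induction k) (use F' 1 N in \<open>auto intro!: zspan_diff zspan_mult simp: zspan_0\<close>)
  show ?thesis
    using M
  proof (induction rule: hmod_induct)
    case (iso A B)
    then show ?case using phi_eqI[OF val_iso, of A B] by metis
  next
    case (biprod M A B)
    then show ?case using phi_biprod zspan_add by metis
  next
    case (block l U M)
    show ?case
      unfolding phi_block[OF block F h]
      using zspan_mult[OF zspan_mono[OF zspan_tr[OF blockD(2)[OF block] h] N(2,1)] _ N(1)] zF by blast
  next
    case (einv M)
    then show ?case using phi_einv[OF _ _ F] zspan_0 by metis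
  qed
qed

lemma jacobson_phi_eq:
  assumes A: "hmod A" "hmod B" "gcl A \<ominus>\<^bsub>gring\<^esub> gcl B \<in> jacobson_radical gring" and h: "h \<in> carrier G"
    and F: "jchar h x F" and N: "N > 0" "gsz dvd N" "zspan N x" "zspan N (inverse (chi h))"
  shows "phi F h A = phi F h B"
proof (rule ghat_hom_zero[OF _ _ _ N(1) _ A])
  show "additive (phi F h)" unfolding additive_def using phi_biprod by blast
  show "phi F h (ten A B) = phi F h A * phi F h B" if "hmod A" "hmod B" for A B
    using phi_ten[OF F h that] .
  have "tr (act triv h) = 1" by (simp add: tr_munit)
  then show "phi F h triv = 1"
    using phi_block[OF block_1[OF hmod_triv] F h] F by (simp add: jchar_def)
  show "zspan N (phi F h A)" if "hmod A" for A using zspan_phi[OF F h N that] .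
qed

text \<open>
  The quotients \<open>(u\<^sup>k - v\<^sup>k) / (u - v)\<close> with \<open>uv = inverse (chi h)\<close>, \<open>u\<^sup>n = v\<^sup>n\<close> and \<open>u \<noteq> v\<close> satisfy \<open>jchar\<close>.
  With \<open>u = c s\<close> and \<open>v = c / s\<close>, the vanishing of these characters shows that a polynomial \<open>P\<close> of degree less
  than \<open>2n\<close> has all the roots \<open>s\<close> with \<open>s\<^sup>2\<^sup>n = 1\<close>; those with \<open>s\<^sup>2 = 1\<close> are roots for symmetry reasons.
\<close>

lemma jacobson_val_eq:
  assumes A: "hmod A" "hmod B" "gcl A \<ominus>\<^bsub>gring\<^esub> gcl B \<in> jacobson_radical gring"
    and h: "h \<in> carrier G" and k: "0 < k" "k < n"
  shows "val A k h = val B k h"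
proof -
  define d where "d k = val A k h - val B k h" for k
  \<comment> \<open>With a square root \<open>c\<close> of \<zeta>, the pairs with product \<zeta>
    are parametrised symmetrically as cs and c/s.\<close>
  obtain c where c: "c ^ 2 = inverse (chi h)" using nth_root_exists[of 2 "inverse (chi h)"] by auto
  have chi0: "chi h \<noteq> 0" "chi h ^ n = 1" using chi_nonzero chi_pow_n h by auto
  have c0: "c \<noteq> 0" using c chi0 by auto
  have c2n: "c ^ (2 * n) = 1" using chi0 by (simp add: power_mult c power_inverse)
  have n0: "2 * n > 0" using n_ge_2 by simp
  \<comment> \<open>At a root of unity with s^(2n) = 1 the monomial of degree 2n - k takes the value
    s^(-k), so \<open>P\<close> takes the value \<Sum>k. d(k) ((cs)^k - (c/s)^k). The exponents k
    and 2n - k with 0 < k < n are all different, which lets d(k) be read off from a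
    coefficient.\<close>
  define P where "P = (\<Sum>k\<in>{1..<n}. smult (d k * c ^ k) (monom 1 k - monom 1 (2 * n - k)))"
  have "poly P s = 0" if s: "s \<in> runity (2 * n)" for s
  proof -
    have s0: "s \<noteq> 0" and s1: "s ^ (2 * n) = 1" using s n0 by (auto simp: runity_def power_0_left)
    have inv: "s ^ (2 * n - k) = inverse s ^ k" if "k < n" for k
    proof -
      have "s ^ (2 * n - k) * s ^ k = 1" using that s1 by (simp flip: power_add)
      then show ?thesis using s0 by (simp add: power_inverse field_simps)
    qed
    have P: "poly P s = (\<Sum>k\<in>{1..<n}. d k * ((c * s) ^ k - (c * inverse s) ^ k))"
      unfolding P_def poly_sum by (intro sum.cong refl)
        (simp add: poly_monom inv power_mult_distrib right_diff_distrib mult.assoc)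
    show "poly P s = 0"
    proof (cases "s ^ 2 = 1")
      case True
      then have "inverse s = s" using s0 by (simp add: power2_eq_square field_simps)
      then show ?thesis unfolding P by simp
    next
      case False
      let ?s = "c * s" and ?t = "c * inverse s"
      define F where "F k = (?s ^ k - ?t ^ k) / (?s - ?t)" for k
      have st0: "?s - ?t \<noteq> 0"
        using False c0 s0 by (auto simp: right_diff_distrib[symmetric] power2_eq_square field_simps)
      have st: "?s * ?t = inverse (chi h)" using s0 by (simp add: c[symmetric] power2_eq_square)
      have sn: "s ^ n = inverse s ^ n"
      proof -
        have "s ^ n * s ^ n = 1" using s1 by (simp flip: power_add mult_2)
        then show ?thesis using s0 by (simp add: power_inverse field_simps)
      qed
      have F: "jchar h (?s + ?t) F"
        unfolding jchar_def
      proof (intro conjI allI)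
        show "F n = 0" by (simp add: F_def power_mult_distrib sn)
        fix k
        have "?s ^ Suc (Suc k) - ?t ^ Suc (Suc k)
            = (?s + ?t) * (?s ^ Suc k - ?t ^ Suc k) - (?s * ?t) * (?s ^ k - ?t ^ k)"
          by (simp only: power_Suc) (simp only: algebra_simps)
        then show "F (Suc (Suc k)) = (?s + ?t) * F (Suc k) - inverse (chi h) * F k"
          unfolding st F_def by (simp only: times_divide_eq_right diff_divide_distrib[symmetric])
      qed (use st0 in \<open>simp_all add: F_def\<close>)
      \<comment> \<open>A common order: cs and c/s are roots of unity of order dividing 2n, because
        chi^n = 1, and the traces on the tops are sums of roots of order dividing
        \<open>gsz\<close>.\<close>
      define N where "N = 2 * n * gsz"
      have N: "N > 0" "gsz dvd N" using n0 order_pos by (simp_all add: N_def)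
      have ru: "zspan N z" if "z ^ (2 * n) = 1" for z :: 'k
        using that N(1) by (intro zspan_runity) (simp_all add: runity_def N_def power_mult)
      have z1: "zspan N ?s" "zspan N ?t"
        using c2n s1 by (auto intro!: ru simp: power_mult_distrib power_inverse)
      have "zspan N (inverse (chi h))" using zspan_mult[OF z1 N(1)] by (simp add: st)
      then have "phi F h A = phi F h B"
        using jacobson_phi_eq[OF A h F N] z1 zspan_add by blast
      then have "(\<Sum>k<n. d k * F k) = 0"
        by (simp add: phi_def d_def left_diff_distrib sum_subtractf)
      moreover have "{..<n} = insert 0 {1..<n}" using n_ge_2 by auto
      ultimately have "(\<Sum>k\<in>{1..<n}. d k * F k) = 0" using F by (simp add: jchar_def)
      moreover have "poly P s = (?s - ?t) * (\<Sum>k\<in>{1..<n}. d k * F k)"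
        unfolding P sum_distrib_left using st0 by (intro sum.cong refl) (simp add: F_def)
      ultimately show ?thesis by simp
    qed
  qed
  moreover have "degree P < 2 * n"
    unfolding P_def using n_ge_2
    by (intro degree_sum_less) (auto intro!: le_less_trans[OF degree_smult_le] degree_diff_less
        simp: degree_monom_eq)
  ultimately have "P = 0"
    using poly_eqI_degree[of "runity (2 * n)" P 0] n0 by (simp add: card_runity)
  have "coeff P k = (\<Sum>j\<in>{1..<n}. if j = k then d k * c ^ k else 0)"
    unfolding P_def coeff_sum using k by (intro sum.cong refl) auto
  then have "d k * c ^ k = 0" using k \<open>P = 0\<close> by simp
  then show ?thesis using c0 by (simp add: d_def)
qed

end

text \<open>If a maximal ideal I omits \<open>z\<close>, then I + Rz, which is two-sided because
  \<open>z\<close> is central, contains 1 = i + y z. Multiplying by \<open>z\<close> gives z = i z,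
  an element of I.\<close>

lemma (in ring) central_nilpotent_jacobson:
  assumes z: "z \<in> carrier R" "\<And>y. y \<in> carrier R \<Longrightarrow> z \<otimes> y = y \<otimes> z" "z \<otimes> z = \<zero>"
  shows "z \<in> jacobson_radical R"
proof -
  have "z \<in> I" if I: "maximalideal I R" for I
  proof (rule ccontr)
    assume zI: "z \<notin> I"
    interpret I: maximalideal I R by (rule I)
    define J where "J = {i \<oplus> y \<otimes> z | i y. i \<in> I \<and> y \<in> carrier R}"
    have J: "i \<oplus> y \<otimes> z \<in> J" if "i \<in> I" "y \<in> carrier R" for i y
      using that by (auto simp: J_def)
    have "ideal J R"
    proof (rule idealI[OF ring_axioms])
      show "subgroup J (add_monoid R)"
      proof (rule add.subgroupI)
        show "J \<subseteq> carrier R" using z(1) by (auto simp: J_def I.Icarr)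
        show "J \<noteq> {}" using J[OF I.zero_closed zero_closed] by blast
        show "\<ominus> a \<in> J" if a: "a \<in> J" for a
        proof -
          obtain i y where iy: "a = i \<oplus> y \<otimes> z" "i \<in> I" "y \<in> carrier R" using a by (auto simp: J_def)
          then have "\<ominus> a = \<ominus> i \<oplus> (\<ominus> y) \<otimes> z" using z(1) by (simp add: I.Icarr minus_add l_minus)
          then show ?thesis using J iy I.a_inv_closed by simp
        qed
        show "a \<oplus> b \<in> J" if ab: "a \<in> J" "b \<in> J" for a b
        proof -
          obtain i y i' y' where iy: "a = i \<oplus> y \<otimes> z" "i \<in> I" "y \<in> carrier R"
            "b = i' \<oplus> y' \<otimes> z" "i' \<in> I" "y' \<in> carrier R" using ab by (auto simp: J_def)
          then have "a \<oplus> b = (i \<oplus> i') \<oplus> (y \<oplus> y') \<otimes> z" using z(1) by (simp add: I.Icarr l_distr a_ac)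
          then show ?thesis using J iy I.a_closed by simp
        qed
      qed
      fix a x assume a: "a \<in> J" and x: "x \<in> carrier R"
      obtain i y where iy: "a = i \<oplus> y \<otimes> z" "i \<in> I" "y \<in> carrier R" using a by (auto simp: J_def)
      have "x \<otimes> a = x \<otimes> i \<oplus> (x \<otimes> y) \<otimes> z" using iy x z(1) by (simp add: I.Icarr r_distr m_assoc)
      then show "x \<otimes> a \<in> J" using J iy x I.I_l_closed by simp
      have "a \<otimes> x = i \<otimes> x \<oplus> (y \<otimes> x) \<otimes> z"
        using iy x z(1) z(2)[OF x] by (simp add: I.Icarr l_distr m_assoc)
      then show "a \<otimes> x \<in> J" using J iy x I.I_r_closed by simp
    qed
    moreover have "I \<subseteq> J"
    proof
      fix i assume i: "i \<in> I"
      then have "i \<oplus> \<zero> \<otimes> z = i" using z(1) by (simp add: I.Icarr)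
      then show "i \<in> J" using J[OF i zero_closed] by simp
    qed
    moreover have "z \<in> J" using J[OF I.zero_closed one_closed] z(1) by simp
    moreover have "J \<subseteq> carrier R" using z(1) by (auto simp: J_def I.Icarr)
    ultimately have "J = carrier R" using I.I_maximal zI by blast
    then obtain i y where iy: "\<one> = i \<oplus> y \<otimes> z" "i \<in> I" "y \<in> carrier R"
      using one_closed unfolding J_def by blast
    have "z = (i \<oplus> y \<otimes> z) \<otimes> z" using z(1) by (simp flip: iy(1))
    also have "\<dots> = i \<otimes> z" using iy(2,3) z(1,3) by (simp add: l_distr m_assoc I.Icarr)
    finally show False using zI I.I_r_closed[OF iy(2) z(1)] by simp
  qed
  then show ?thesis using z(1) by (auto simp: jacobson_radical_def)
qed

subsection \<open>The radical of the Green ring\<close>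

context datum
begin

lemma ypow_n_zero_iff: "hmod M \<Longrightarrow> ypow M n = 0 \<longleftrightarrow> act M (g [^] n) = idn M"
  by (simp add: hmodD(5))

lemma ypow_n_ten_zero:
  assumes "hmod M" "hmod N" "ypow M n = 0" "ypow N n = 0"
  shows "ypow (ten M N) n = 0"
  using assms by (simp add: ypow_n_zero_iff hmod_ten)

text \<open>The telescoping identity with chi^n = 1. It makes twists invisible after multiplication
  by the norm, and for this reason the generator of the radical has square zero.\<close>

lemma norm_twist: "h \<in> carrier G \<Longrightarrow> inverse (chi h) * (\<Sum>i<n. inverse (chi h) ^ i) = (\<Sum>i<n. inverse (chi h) ^ i)"
proof -
  assume h: "h \<in> carrier G"
  let ?c = "inverse (chi h)"
  have "?c * (\<Sum>i<n. ?c ^ i) + 1 = (\<Sum>i<n. ?c ^ i) + ?c ^ n"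
  proof -
    have "?c * (\<Sum>i<n. ?c ^ i) + 1 = (\<Sum>i<Suc n. ?c ^ i)"
      by (subst sum.lessThan_Suc_shift) (simp add: sum_distrib_left)
    then show ?thesis by simp
  qed
  moreover have "?c ^ n = 1" using chi_pow_n[OF h] by (simp add: power_inverse)
  ultimately show ?thesis by simp
qed

lemma gcl_block_eq:
  assumes P: "block n U P" and Q: "block n V Q"
    and tr: "\<And>h. h \<in> carrier G \<Longrightarrow> tr (act U h) = tr (act V h)"
  shows "gcl P = gcl Q"
proof -
  have "val P = val Q" by (intro ext) (simp add: val_block[OF P] val_block[OF Q] tr)
  then show ?thesis using hiso_iff_val_eq gcl_eq_iff blockD(1)[OF P] blockD(1)[OF Q] by blast
qed

lemma gcl_block_add:
  assumes P: "block n U P" and Q: "block n V Q" and R: "block n W R"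
    and tr: "\<And>h. h \<in> carrier G \<Longrightarrow> tr (act U h) = tr (act V h) + tr (act W h)"
  shows "gcl P = gcl Q \<oplus>\<^bsub>gring\<^esub> gcl R"
proof -
  note D = blockD(1)[OF P] blockD(1)[OF Q] blockD(1)[OF R]
  have "val P = val (dsum Q R)"
    by (intro ext) (simp add: val_dsum D val_block[OF P] val_block[OF Q] val_block[OF R] tr)
  then have "gcl P = gcl (dsum Q R)"
    using hiso_iff_val_eq[OF D(1) hmod_dsum[OF D(2,3)]] gcl_eq_iff[OF D(1) hmod_dsum[OF D(2,3)]] by simp
  then show ?thesis using D by (simp add: gcl_dsum)
qed

lemma gcl_block_central:
  assumes P: "block n U P" and y: "y \<in> carrier gring"
  shows "gcl P \<otimes>\<^bsub>gring\<^esub> y = y \<otimes>\<^bsub>gring\<^esub> gcl P"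
proof -
  note hP = blockD(1)[OF P]
  have comm: "gcl P \<otimes>\<^bsub>gring\<^esub> gcl A = gcl A \<otimes>\<^bsub>gring\<^esub> gcl P" if A: "hmod A" for A
  proof -
    have "ten P A \<asymp> ten A P"
      using hcomm_block[OF P A] hcomm_hiso[OF hP A] by simp
    then show ?thesis using gcl_eq_iff[OF hmod_ten hmod_ten] hP A by (simp flip: gcl_ten)
  qed
  obtain A B where "hmod A" "hmod B" "y = gcl A \<ominus>\<^bsub>gring\<^esub> gcl B" using gring_cases[OF y] .
  then show ?thesis
    using hP comm gcl_closed by (simp add: a_minus_def gr.r_distr gr.l_distr gr.r_minus gr.l_minus)
qed

definition M0 :: "('g, 'k) hm" where "M0 = hm_of (hmodule_M0 G chi n)"

definition zel :: "(('g, 'k) hmodule set \<Rightarrow>\<^sub>0 int) set" where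
  "zel = gcl M0 \<ominus>\<^bsub>gring\<^esub> gcl (tw 1 M0)"

lemma block_M0: "block n triv M0"
  using hmodule_M0_interpret(2) by (simp add: M0_def)

lemma hmod_M0: "hmod M0" "hmod (tw m M0)"
  using blockD(1)[OF block_M0] hmod_tw by auto

lemma zel_closed: "zel \<in> carrier gring"
  using gcl_closed hmod_M0 by (simp add: zel_def)

lemma zel_eq:
  "(\<one>\<^bsub>gring\<^esub> \<ominus>\<^bsub>gring\<^esub> green_class G chi g n (hmodule_V G n (\<lambda>h. inverse (chi h)))) \<otimes>\<^bsub>gring\<^esub>
     green_class G chi g n (hmodule_M0 G chi n) = zel"
proof -
  have a: "green_class G chi g n (hmodule_V G n (\<lambda>h. inverse (chi h))) = gcl (tw 1 triv)"
    using gcl_eq hmodule_V_interpret by metis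
  have m: "green_class G chi g n (hmodule_M0 G chi n) = gcl M0"
    using gcl_eq[OF hmodule_M0_interpret(1)] hiso_refl hmod_M0(1) by (simp add: M0_def)
  have t: "hmod (tw 1 triv)" using hmod_tw hmod_triv by blast
  have "gcl (tw 1 triv) \<otimes>\<^bsub>gring\<^esub> gcl M0 = gcl (tw 1 M0)"
    using ten_tw_triv[OF hmod_M0(1), of 1] gcl_eq_iff[OF hmod_ten[OF t hmod_M0(1)] hmod_M0(2)]
    unfolding gcl_ten[OF t hmod_M0(1)] by blast
  then show ?thesis
    using gcl_closed[OF t] gcl_closed[OF hmod_M0(1)]
    by (simp add: a m zel_def a_minus_def gr.l_distr gr.l_minus)
qed

text \<open>Expanding the square gives four products of \<open>M0\<close> and its twist, two with
  each sign. All four consist of blocks of length \<open>n\<close> whose top has the norm as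
  character, twisted at most by powers of \<open>chi\<close>, and these twists have no effect; so
  they cancel.\<close>

lemma zel_jacobson: "zel \<in> jacobson_radical gring"
proof (rule gr.central_nilpotent_jacobson[OF zel_closed])
  let ?P = M0 and ?Q = "tw 1 M0"
  note P = block_M0 and Q = block_tw[OF block_M0, of 1]
  note h = hmod_M0(1) hmod_M0(2)[of 1]
  note c = h[THEN gcl_closed]
  show "zel \<otimes>\<^bsub>gring\<^esub> y = y \<otimes>\<^bsub>gring\<^esub> zel" if "y \<in> carrier gring" for y
    using that c gcl_block_central[OF P that] gcl_block_central[OF Q that]
    by (simp add: zel_def a_minus_def gr.r_distr gr.l_distr gr.r_minus gr.l_minus)
  have "val (dsum (ten ?P ?P) (ten ?Q ?Q)) j x = val (dsum (ten ?P ?Q) (ten ?Q ?P)) j x" for j x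
  proof (cases "x \<in> carrier G \<and> 0 < j \<and> j \<le> n")
    case True
    let ?c = "inverse (chi x)" and ?s = "\<Sum>i<n. inverse (chi x) ^ i"
    have x: "x \<in> carrier G" "0 < j" "j \<le> n" using True by auto
    have s: "?c * ?s = ?s" using norm_twist[OF x(1)] .
    have t: "tr (act triv x) = 1" "tr (act (tw 1 triv) x) = ?c" by (simp_all add: tr_munit tr_smul)
    have "val (ten A B) j x = (if j = n then ?s else 0)"
      if "block n U A" "block n V B" "U = triv \<or> U = tw 1 triv" "V = triv \<or> V = tw 1 triv" for A B U V
    proof -
      have "tr (act U x) * tr (act V x) * ?s = ?s" using that(3,4) t s by (auto simp: mult.assoc)
      then show ?thesis by (simp only: val_block_ten_projective[OF that(2) x that(1)])
    qed
    then have "val (ten A B) j x = (if j = n then ?s else 0)" if "A = ?P \<or> A = ?Q" "B = ?P \<or> B = ?Q" for A B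
      using that P Q by blast
    then show ?thesis using h by (simp add: val_dsum hmod_ten)
  next
    case False
    have "ypow (ten A B) n = 0" if "A = ?P \<or> A = ?Q" "B = ?P \<or> B = ?Q" for A B
      using that h ypow_n_ten_zero blockD(6)[OF P] blockD(6)[OF Q] by blast
    then have "val (ten A B) 0 x = 0" if "A = ?P \<or> A = ?Q" "B = ?P \<or> B = ?Q" for A B
      using that h val_nil_0 hmod_ten by blast
    then show ?thesis using False h by (cases "j = 0") (auto simp: val_dsum hmod_ten, auto simp: val_def)
  qed
  then have "dsum (ten ?P ?P) (ten ?Q ?Q) \<asymp> dsum (ten ?P ?Q) (ten ?Q ?P)"
    using hiso_iff_val_eq h hmod_ten hmod_dsum by (simp add: fun_eq_iff)
  then have "gcl (dsum (ten ?P ?P) (ten ?Q ?Q)) = gcl (dsum (ten ?P ?Q) (ten ?Q ?P))"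
    using gcl_eq_iff h by (simp add: hmod_ten hmod_dsum)
  then have eq: "gcl ?P \<otimes>\<^bsub>gring\<^esub> gcl ?P \<oplus>\<^bsub>gring\<^esub> gcl ?Q \<otimes>\<^bsub>gring\<^esub> gcl ?Q
      = gcl ?P \<otimes>\<^bsub>gring\<^esub> gcl ?Q \<oplus>\<^bsub>gring\<^esub> gcl ?Q \<otimes>\<^bsub>gring\<^esub> gcl ?P"
    using h by (simp add: gcl_dsum hmod_ten gcl_ten)
  have "zel \<otimes>\<^bsub>gring\<^esub> zel = (gcl ?P \<otimes>\<^bsub>gring\<^esub> gcl ?P \<oplus>\<^bsub>gring\<^esub> gcl ?Q \<otimes>\<^bsub>gring\<^esub> gcl ?Q) \<ominus>\<^bsub>gring\<^esub>
      (gcl ?P \<otimes>\<^bsub>gring\<^esub> gcl ?Q \<oplus>\<^bsub>gring\<^esub> gcl ?Q \<otimes>\<^bsub>gring\<^esub> gcl ?P)"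
    using c by (simp add: zel_def a_minus_def gr.r_distr gr.l_distr gr.r_minus gr.l_minus gr.minus_add gr.a_ac)
  also have "\<dots> = \<zero>\<^bsub>gring\<^esub>" unfolding eq using c by (simp add: a_minus_def gr.r_neg)
  finally show "zel \<otimes>\<^bsub>gring\<^esub> zel = \<zero>\<^bsub>gring\<^esub>" .
qed

lemma PIdl_zel_closed:
  assumes "x \<in> PIdl\<^bsub>gring\<^esub> zel" "y \<in> PIdl\<^bsub>gring\<^esub> zel"
  shows "x \<oplus>\<^bsub>gring\<^esub> y \<in> PIdl\<^bsub>gring\<^esub> zel"
proof -
  obtain u v where "u \<in> carrier gring" "v \<in> carrier gring" "x = u \<otimes>\<^bsub>gring\<^esub> zel" "y = v \<otimes>\<^bsub>gring\<^esub> zel"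
    using assms by (auto simp: cgenideal_def)
  then show ?thesis
    using zel_closed by (auto simp: cgenideal_def gr.l_distr intro!: exI[of _ "u \<oplus>\<^bsub>gring\<^esub> v"])
qed

lemma PIdl_zel_zero: "\<zero>\<^bsub>gring\<^esub> \<in> PIdl\<^bsub>gring\<^esub> zel"
  unfolding cgenideal_def using zel_closed by (auto intro!: exI[of _ "\<zero>\<^bsub>gring\<^esub>"])

text \<open>A block of length \<open>n\<close> is determined by the character of its top, and
  \<open>U\<close> tensored with \<open>M0\<close> is one with top \<open>U\<close>.\<close>

lemma gcl_block_ten:
  assumes P: "block n U P"
  shows "gcl P = gcl U \<otimes>\<^bsub>gring\<^esub> gcl M0" "gcl (tw 1 P) = gcl U \<otimes>\<^bsub>gring\<^esub> gcl (tw 1 M0)"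
proof -
  note U = blockD(2,3)[OF P]
  show "gcl P = gcl U \<otimes>\<^bsub>gring\<^esub> gcl M0"
    unfolding gcl_ten[OF U(1) hmod_M0(1), symmetric]
    by (rule gcl_block_eq[OF P block_ten_left[OF block_M0 U]]) (simp add: tr_munit)
  show "gcl (tw 1 P) = gcl U \<otimes>\<^bsub>gring\<^esub> gcl (tw 1 M0)"
    unfolding gcl_ten[OF U(1) hmod_M0(2), symmetric]
    by (rule gcl_block_eq[OF block_tw[OF P] block_ten_left[OF block_tw[OF block_M0] U]])
      (simp add: tr_munit tr_smul)
qed

text \<open>The difference telescopes over the single twists, and each of these is
  \<open>zel\<close> times minus the class of the twisted top.\<close>

lemma gcl_tw_diff:
  assumes P: "block n U P"
  shows "gcl (tw i P) \<ominus>\<^bsub>gring\<^esub> gcl P \<in> PIdl\<^bsub>gring\<^esub> zel"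
proof (induction i)
  case 0
  have "gcl (tw 0 P) = gcl P"
    by (rule gcl_block_eq[OF block_tw[OF P] P]) simp
  then show ?case using PIdl_zel_zero gcl_closed[OF blockD(1)[OF P]] by (simp add: a_minus_def gr.r_neg)
next
  case (Suc i)
  let ?U = "tw i U"
  have B: "block n ?U (tw i P)" using block_tw[OF P] .
  note c = gcl_closed[OF blockD(1)[OF P]] gcl_closed[OF blockD(1)[OF B]] gcl_closed[OF blockD(2)[OF B]]
    hmod_M0[THEN gcl_closed]
  have "gcl (tw (Suc i) P) = gcl (tw 1 (tw i P))"
    by (rule gcl_block_eq[OF block_tw[OF P] block_tw[OF B]]) (simp add: tr_smul mult.assoc)
  then have "gcl (tw (Suc i) P) \<ominus>\<^bsub>gring\<^esub> gcl (tw i P) = (\<ominus>\<^bsub>gring\<^esub> gcl ?U) \<otimes>\<^bsub>gring\<^esub> zel"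
    unfolding gcl_block_ten(1)[OF B] gcl_block_ten(2)[OF B] zel_def using c
    by (simp add: a_minus_def gr.r_distr gr.l_minus gr.r_minus gr.a_comm gr.minus_add)
  then have mem: "gcl (tw (Suc i) P) \<ominus>\<^bsub>gring\<^esub> gcl (tw i P) \<in> PIdl\<^bsub>gring\<^esub> zel"
    using c by (auto simp: cgenideal_def)
  have "gcl (tw (Suc i) P) \<in> carrier gring"
    using gcl_closed blockD(1)[OF block_tw[OF P]] by blast
  then have "gcl (tw (Suc i) P) \<ominus>\<^bsub>gring\<^esub> gcl P
      = (gcl (tw (Suc i) P) \<ominus>\<^bsub>gring\<^esub> gcl (tw i P)) \<oplus>\<^bsub>gring\<^esub> (gcl (tw i P) \<ominus>\<^bsub>gring\<^esub> gcl P)"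
    using c by (simp add: a_minus_def gr.a_assoc gr.r_neg1 gr.r_neg2)
  then show ?case using PIdl_zel_closed[OF mem Suc] by simp
qed

text \<open>
  The hypothesis says that the sums of all twists of \<open>U\<close> and of \<open>V\<close> by powers of \<open>inverse chi\<close> have
  the same character, so that \<open>U\<close> shares a summand with some twist of \<open>V\<close>.
\<close>

lemma block_diff_in_PIdl:
  assumes "block n U P" "block n V Q"
    and "\<And>h. h \<in> carrier G \<Longrightarrow>
      (\<Sum>i<n. inverse (chi h) ^ i) * tr (act U h) = (\<Sum>i<n. inverse (chi h) ^ i) * tr (act V h)"
    and "tr (idn U) = of_nat d"
  shows "gcl P \<ominus>\<^bsub>gring\<^esub> gcl Q \<in> PIdl\<^bsub>gring\<^esub> zel"
  using assms
proof (induction d arbitrary: U V P Q rule: less_induct)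
  case (less d)
  note P = less.prems(1) and Q = less.prems(2) and eq = less.prems(3) and d = less.prems(4)
  note U = blockD(2,3)[OF P] and V = blockD(2,3)[OF Q]
  note cP = gcl_closed[OF blockD(1)[OF P]] and cQ = gcl_closed[OF blockD(1)[OF Q]]
  let ?N = "\<lambda>h. \<Sum>i<n. inverse (chi h) ^ i"
  show ?case
  proof (cases "idn U = 0")
    case True
    have "of_nat n * tr (idn V) = 0"
      using eq[OF one_closed] True U V by (simp add: chi_one hmodD(6))
    then have "tr (idn V) = 0" using n_ge_2 by simp
    then have V0: "idn V = 0" using idempotent_tr(2)[OF hmodD(8)[OF V(1)]] by simp
    have "act W h = 0" if "hmod W" "idn W = 0" "h \<in> carrier G" for W h
      using hmodD(9)[OF that(1,3)] that(2) by simp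
    then have "gcl P = gcl Q" using U V True V0 by (intro gcl_block_eq[OF P Q]) simp
    then show ?thesis using PIdl_zel_zero cQ by (simp add: a_minus_def gr.r_neg)
  next
    case False
    have twU: "grep (idn U) (act (tw i U))" and twV: "grep (idn V) (act (tw i V))" for i
      using hmodD(1)[OF hmod_tw[OF U(1)], of i] hmodD(1)[OF hmod_tw[OF V(1)], of i] by simp_all
    \<comment> \<open>Summing over all twists inserts the norm into the inner product of characters,
      so the hypothesis allows \<open>U\<close> to be replaced by \<open>V\<close>.\<close>
    have sum: "(\<Sum>i<n. intertw (act U) (act (tw i W))) = (\<Sum>h\<in>carrier G. ?N h * tr (act W h) * tr (act U (inv h)))" for W
      unfolding intertw_def by (subst sum.swap) (simp add: tr_smul sum_distrib_right mult.assoc)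
    have "\<exists>d. intertw (act U) (act (tw i U)) = of_nat d" for i
      using intertw_nat[OF hmodD(1)[OF U(1)] twU] .
    then obtain e where e: "\<And>i. intertw (act U) (act (tw i U)) = of_nat (e i)" by metis
    have "intertw (act U) (act (tw 0 U)) = intertw (act U) (act U)" by (simp add: intertw_def)
    then have "e 0 \<noteq> 0"
      using intertw_self[OF hmodD(1)[OF U(1)]] False e[of 0] by (metis of_nat_0)
    \<comment> \<open>All terms are natural numbers and the one without twist is positive, so
      nothing cancels.\<close>
    then have "(\<Sum>i<n. e i) \<noteq> 0" using n_ge_2 by auto
    then have "(\<Sum>i<n. intertw (act U) (act (tw i U))) \<noteq> 0" unfolding e by (simp flip: of_nat_sum)
    moreover have "(\<Sum>i<n. intertw (act U) (act (tw i U))) = (\<Sum>i<n. intertw (act U) (act (tw i V)))"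
      unfolding sum by (intro sum.cong refl) (simp add: eq)
    ultimately obtain i where i: "intertw (act U) (act (tw i V)) \<noteq> 0"
      by (metis sum.neutral)
    obtain f z where fz: "z * f \<noteq> 0" "gmor (idn U) (act U) (idn V) (act (tw i V)) f"
      "gmor (idn V) (act (tw i V)) (idn U) (act U) z" "f * z * f = f" "z * f * z = z"
      using common_summand[OF hmodD(1)[OF U(1)] twV i] .
    note f = fz(2)[unfolded gmor_def] and z = fz(3)[unfolded gmor_def]
    let ?p = "z * f" and ?q = "f * z"
    have mor: "mor U (tw i V) f" "mor (tw i V) U z" using fz(2,3) U V by (simp_all add: mor_def)
    have p: "mor U U ?p" using mor mor_comp by blast
    have q': "mor (tw i V) (tw i V) ?q" using mor mor_comp by blast
    \<comment> \<open>An endomorphism of the twist of \<open>V\<close> is one of \<open>V\<close>,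
      since the scalar appears on both sides.\<close>
    have q: "mor V V ?q"
    proof (rule morI)
      fix h assume h: "h \<in> carrier G"
      have "inverse (chi h) ^ i \<cdot> (?q * act V h) = inverse (chi h) ^ i \<cdot> (act V h * ?q)"
        using morD(3)[OF q' h] by simp
      then show "?q * act V h = act V h * ?q"
        using chi_nonzero[OF h] smul_smul[of "chi h ^ i" "inverse (chi h) ^ i"] by (metis power_mult_distrib right_inverse power_one smul_one)
    qed (use morD(1,2)[OF q'] V in simp_all)
    have pp: "?p * ?p = ?p" and qq: "?q * ?q = ?q" using fz(4,5) by (simp_all flip: mult.assoc)
    let ?S = "cut U ?p" and ?U' = "cut U (idn U - ?p)" and ?T = "cut V ?q" and ?V' = "cut V (idn V - ?q)"
    have S: "hmod ?S" "yop ?S = 0" "hmod ?T" "yop ?T = 0" "hmod ?U'" "yop ?U' = 0" "hmod ?V'" "yop ?V' = 0"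
      using hmod_cut[OF U(1) p pp] hmod_cut[OF V(1) q qq] hmod_idn_diff[OF U(1) p pp] hmod_idn_diff[OF V(1) q qq] U V
      by simp_all
    have trST: "tr (act ?S h) = inverse (chi h) ^ i * tr (act ?T h)" if h: "h \<in> carrier G" for h
    proof -
      have "tr (z * f * act U h) = tr (z * (act (tw i V) h * f))" using f h by (simp add: mult.assoc)
      also have "\<dots> = tr (act (tw i V) h * f * z)" by (rule tr_mult_commute)
      also have "\<dots> = inverse (chi h) ^ i * tr (act V h * ?q)" by (simp add: tr_smul mult.assoc)
      finally show ?thesis by (simp add: tr_mult_commute[of _ "act V h"])
    qed
    have U_tr: "tr (act U h) = tr (act ?S h) + tr (act ?U' h)" and V_tr: "tr (act V h) = tr (act ?T h) + tr (act ?V' h)"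
      if "h \<in> carrier G" for h
      using tr_biprod[OF biprod_cut[OF U(1) p pp] U(1) S(1,5) that]
        tr_biprod[OF biprod_cut[OF V(1) q qq] V(1) S(3,7) that] by auto
    have n1: "1 \<le> n" using n_ge_2 by simp
    obtain PS PU PT PV where B: "block n ?S PS" "block n ?U' PU" "block n ?T PT" "block n ?V' PV"
      using block_exists[OF S(1,2) n1 order_refl] block_exists[OF S(3,4) n1 order_refl]
        block_exists[OF S(5,6) n1 order_refl] block_exists[OF S(7,8) n1 order_refl] by metis
    have gP: "gcl P = gcl PS \<oplus>\<^bsub>gring\<^esub> gcl PU" using gcl_block_add[OF P B(1,2)] U_tr by blast
    have gQ: "gcl Q = gcl PT \<oplus>\<^bsub>gring\<^esub> gcl PV" using gcl_block_add[OF Q B(3,4)] V_tr by blast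
    have gS: "gcl PS = gcl (tw i PT)"
      by (rule gcl_block_eq[OF B(1) block_tw[OF B(3)]]) (simp add: trST tr_smul del: cut_simps)
    have "?N h * tr (act ?U' h) = ?N h * tr (act ?V' h)" if h: "h \<in> carrier G" for h
    proof -
      \<comment> \<open>The split summands of \<open>U\<close> and \<open>V\<close> agree up to a
        twist, which the norm does not see; hence the hypothesis passes to the complements.\<close>
      have tw: "inverse (chi h) ^ j * ?N h = ?N h" for j
        by (induction j) (simp, simp only: power_Suc mult.assoc norm_twist[OF h])
      have "?N h * tr (act ?S h) = inverse (chi h) ^ i * ?N h * tr (act ?T h)"
        unfolding trST[OF h] by (simp only: ac_simps)
      then have "?N h * tr (act ?S h) = ?N h * tr (act ?T h)" unfolding tw .
      then show ?thesis using eq[OF h] unfolding U_tr[OF h] V_tr[OF h] distrib_left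
        by (simp only: add_left_cancel)
    qed
    moreover obtain d' where d': "tr (idn ?U') = of_nat d'" using idempotent_tr(1)[OF hmodD(8)[OF S(5)]] by blast
    moreover have "d' < d"
    proof -
      obtain m where m: "tr ?p = of_nat m" using idempotent_tr(1)[OF pp] by blast
      then have "m \<noteq> 0" using idempotent_tr(2)[OF pp] fz(1) by auto
      moreover have "tr (idn ?U') = tr (idn U) - tr ?p" by (simp add: tr_diff)
      then have "(of_nat (d' + m) :: 'k) = of_nat d"
        unfolding d d' m of_nat_add by (simp only: diff_add_cancel)
      then have "d' + m = d" by (simp only: of_nat_eq_iff)
      ultimately show ?thesis by simp
    qed
    ultimately have "gcl PU \<ominus>\<^bsub>gring\<^esub> gcl PV \<in> PIdl\<^bsub>gring\<^esub> zel" using less.IH[OF _ B(2,4)] by blast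
    then have mem: "(gcl (tw i PT) \<ominus>\<^bsub>gring\<^esub> gcl PT) \<oplus>\<^bsub>gring\<^esub> (gcl PU \<ominus>\<^bsub>gring\<^esub> gcl PV) \<in> PIdl\<^bsub>gring\<^esub> zel"
      using PIdl_zel_closed[OF gcl_tw_diff[OF B(3)]] by blast
    have "gcl P \<ominus>\<^bsub>gring\<^esub> gcl Q = (gcl (tw i PT) \<ominus>\<^bsub>gring\<^esub> gcl PT) \<oplus>\<^bsub>gring\<^esub> (gcl PU \<ominus>\<^bsub>gring\<^esub> gcl PV)"
      unfolding gP gQ gS
      using gcl_closed[OF blockD(1)[OF B(3)]] gcl_closed[OF blockD(1)[OF B(2)]]
        gcl_closed[OF blockD(1)[OF B(4)]] gcl_closed[OF hmod_tw[OF blockD(1)[OF B(3)]]]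
      by (simp add: a_minus_def gr.minus_add gr.a_ac)
    then show ?thesis using mem by simp
  qed
qed

lemma gcl_diff_cancel:
  assumes A: "biprod A C A'" "hmod A" "hmod C" "hmod A'" and B: "biprod B D B'" "hmod B" "hmod D" "hmod B'"
    and iso: "C \<asymp> D"
  shows "gcl A \<ominus>\<^bsub>gring\<^esub> gcl B = gcl A' \<ominus>\<^bsub>gring\<^esub> gcl B'"
proof -
  have CD: "gcl C = gcl D" using gcl_eq_iff[OF A(3) B(3)] iso by blast
  show ?thesis
    unfolding gcl_biprod[OF A] gcl_biprod[OF B] CD using A B gcl_closed
    by (simp add: a_minus_def gr.minus_add gr.a_ac) (simp add: gr.a_lcomm[of "gcl D"] gr.r_neg)
qed

lemma biprod_sym: "biprod M A B \<Longrightarrow> biprod M B A"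
  unfolding biprod_def by (metis add.commute)

text \<open>On a nilpotent module \<open>g\<^sup>n\<close> acts trivially; on a module on which \<open>y\<close> is invertible, so is \<open>g\<^sup>n - 1\<close>.\<close>

lemma sum_tr_act_g:
  assumes M: "hmod M" and h: "h \<in> carrier G"
  shows "ypow M n = 0 \<Longrightarrow> (\<Sum>m<gsz. tr (act M (h \<otimes> (g [^] n) [^] m))) = of_nat gsz * tr (act M h)"
    "einv M \<Longrightarrow> (\<Sum>m<gsz. tr (act M (h \<otimes> (g [^] n) [^] m))) = 0"
proof -
  note D = hmodD[OF M]
  define u where "u = g [^] n"
  have u: "u \<in> carrier G" "\<And>m :: nat. u [^] m \<in> carrier G" using g_closed by (simp_all add: u_def)
  show "(\<Sum>m<gsz. tr (act M (h \<otimes> (g [^] n) [^] m))) = of_nat gsz * tr (act M h)" if "ypow M n = 0"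
  proof -
    have "act M u = idn M" using that ypow_n_zero_iff[OF M] by (simp add: u_def)
    then have "act M (u [^] m) = idn M" for m :: nat
      using u D by (induction m) (simp_all add: D(6,7))
    then have "act M (h \<otimes> u [^] m) = act M h" for m :: nat using u h D by (simp add: D(7))
    then show ?thesis by (simp flip: u_def)
  qed
  assume "einv M"
  then obtain Z where Z: "\<And>j. mpow (idn M) Z j * ypow M j = idn M" using einvD M by metis
  let ?s = "\<Sum>m<gsz. act M (u [^] m)"
  have step: "act M u * act M (u [^] m) = act M (u [^] Suc m)" for m :: nat
    using u D(7)[of u "u [^] m"] nat_pow_Suc2[OF u(1)] by simp
  \<comment> \<open>As y^n = u - 1, the product telescopes, and u^gsz = 1 makes it zero.\<close>
  have "ypow M n * ?s = (\<Sum>m<gsz. act M (u [^] Suc m) - act M (u [^] m))"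
    using u D by (simp add: D(5) u_def[symmetric] left_diff_distrib sum_distrib_left step sum_subtractf
        del: nat_pow_Suc)
  also have "\<dots> = act M (u [^] gsz) - act M (u [^] (0 :: nat))" by (rule sum_lessThan_telescope)
  also have "\<dots> = 0" using pow_gsz[OF u(1)] by simp
  finally have "ypow M n * ?s = 0" .
  then have "mpow (idn M) Z n * ypow M n * ?s = 0" by (simp add: mult.assoc)
  then have "idn M * ?s = 0" unfolding Z .
  then have s0: "?s = 0" using u D by (simp add: sum_distrib_left)
  have "(\<Sum>m<gsz. tr (act M (h \<otimes> u [^] m))) = tr (act M h * ?s)"
    using u h by (simp add: sum_distrib_left tr_sum D(7))
  then show "(\<Sum>m<gsz. tr (act M (h \<otimes> (g [^] n) [^] m))) = 0" unfolding s0 by (simp add: u_def)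
qed

text \<open>Isomorphic summands are removed from \<open>A\<close> and \<open>B\<close> without
  changing the difference of the classes: the parts on which y is invertible, and then the blocks
  shorter than \<open>n\<close>. The equality of group traces which remains for the longest blocks
  is the hypothesis of \<open>block_diff_in_PIdl\<close>.\<close>

lemma jacobson_subset:
  assumes x: "x \<in> jacobson_radical gring"
  shows "x \<in> PIdl\<^bsub>gring\<^esub> zel"
proof -
  have "x \<in> carrier gring" using x by (simp add: jacobson_radical_def)
  then obtain A B where AB: "hmod A" "hmod B" "x = gcl A \<ominus>\<^bsub>gring\<^esub> gcl B" using gring_cases by blast
  note J = AB(1,2) x[unfolded AB(3)]
  have trAB: "tr (act A h) = tr (act B h)" if "h \<in> carrier G" for h using jacobson_tr_eq[OF J that] .
  obtain p where p: "mor A A p" "p * p = p" "ypow (cut A p) n = 0" "einv (cut A (idn A - p))"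
    using fitting[OF AB(1)] .
  obtain q where q: "mor B B q" "q * q = q" "ypow (cut B q) n = 0" "einv (cut B (idn B - q))"
    using fitting[OF AB(2)] .
  let ?A0 = "cut A p" and ?A1 = "cut A (idn A - p)" and ?B0 = "cut B q" and ?B1 = "cut B (idn B - q)"
  have h: "hmod ?A0" "hmod ?A1" "hmod ?B0" "hmod ?B1"
    using hmod_cut hmod_idn_diff AB p q by blast+
  have bA: "biprod A ?A0 ?A1" and bB: "biprod B ?B0 ?B1" using biprod_cut AB p q by blast+
  \<comment> \<open>Summing the trace over the products of \<open>k\<close> with the powers of g^n
    retains only the nilpotent part. In this way the equality of the group characters of
    \<open>A\<close> and \<open>B\<close> passes to their nilpotent parts.\<close>
  have sum_tr: "(\<Sum>m<gsz. tr (act M (k \<otimes> (g [^] n) [^] m))) = of_nat gsz * tr (act C k)"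
    if "biprod M C D" "hmod M" "hmod C" "hmod D" "ypow C n = 0" "einv D" "k \<in> carrier G" for M C D k
  proof -
    have "tr (act M (k \<otimes> (g [^] n) [^] m)) = tr (act C (k \<otimes> (g [^] n) [^] m)) + tr (act D (k \<otimes> (g [^] n) [^] m))"
      for m :: nat using tr_biprod[OF that(1-4)] that(7) g_closed by simp
    then show ?thesis
      using sum_tr_act_g(1)[OF that(3,7,5)] sum_tr_act_g(2)[OF that(4,7,6)] by (simp add: sum.distrib)
  qed
  have tr0: "tr (act ?A0 k) = tr (act ?B0 k)" if k: "k \<in> carrier G" for k
  proof -
    have "(of_nat gsz :: 'k) * tr (act ?A0 k) = of_nat gsz * tr (act ?B0 k)"
      unfolding sum_tr[OF bA AB(1) h(1,2) p(3,4) k, symmetric] sum_tr[OF bB AB(2) h(3,4) q(3,4) k, symmetric]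
      using k g_closed by (intro sum.cong refl trAB) simp
    then show ?thesis using order_pos by simp
  qed
  have tr1: "tr (act ?A1 k) = tr (act ?B1 k)" if k: "k \<in> carrier G" for k
    using trAB[OF k] tr0[OF k] unfolding tr_biprod[OF bA AB(1) h(1,2) k] tr_biprod[OF bB AB(2) h(3,4) k]
    by simp
  have "?A1 \<asymp> ?B1" using einv_iso[OF h(2) p(4) h(4) q(4) tr1] .
  then have x0: "x = gcl ?A0 \<ominus>\<^bsub>gring\<^esub> gcl ?B0"
    unfolding AB(3) using gcl_diff_cancel[OF biprod_sym[OF bA] AB(1) h(2,1) biprod_sym[OF bB] AB(2) h(4,3)] by blast
  have val0: "val ?A0 k a = val ?B0 k a" if k: "0 < k" "k < n" and a: "a \<in> carrier G" for k a
    using jacobson_val_eq[OF J a k] val_biprod[OF bA AB(1) h(1,2), of k a] val_biprod[OF bB AB(2) h(3,4), of k a]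
      val_einv[OF p(4) h(2), of k a] val_einv[OF q(4) h(4), of k a] k by simp
  obtain m where m: "n = Suc m" using n_ge_2 by (cases n) auto
  have mn: "m < n" using m by simp
  have nil: "ypow ?A0 (Suc m) = 0" "ypow ?B0 (Suc m) = 0" using p(3) q(3) m by simp_all
  obtain U s where s: "mor ?A0 ?A0 s" "s * s = s" "block (Suc m) U (cut ?A0 s)" "ypow (cut ?A0 (idn ?A0 - s)) m = 0"
    using split_block[OF h(1) mn nil(1)] .
  obtain V t where t: "mor ?B0 ?B0 t" "t * t = t" "block (Suc m) V (cut ?B0 t)" "ypow (cut ?B0 (idn ?B0 - t)) m = 0"
    using split_block[OF h(3) mn nil(2)] .
  define P Q A2 B2 where defs: "P = cut ?A0 s" "Q = cut ?B0 t" "A2 = cut ?A0 (idn ?A0 - s)" "B2 = cut ?B0 (idn ?B0 - t)"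
  have P: "block n U P" and Q: "block n V Q" using s(3) t(3) by (simp_all add: defs m)
  have h2: "hmod A2" "hmod B2" "hmod P" "hmod Q"
    using hmod_idn_diff[OF h(1) s(1,2)] hmod_idn_diff[OF h(3) t(1,2)] blockD(1)[OF P] blockD(1)[OF Q]
    by (simp_all add: defs)
  have b2: "biprod ?A0 P A2" "biprod ?B0 Q B2"
    unfolding defs using biprod_cut h s t by blast+
  have iso2: "A2 \<asymp> B2"
  proof (rule hiso_nil[OF h2(1,2), of m])
    show "ypow A2 m = 0" "ypow B2 m = 0" using s(4) t(4) by (simp_all add: defs)
    show "m \<le> n" using mn by simp
    show "val A2 k a = val B2 k a" if "0 < k" "k \<le> m" "a \<in> carrier G" for k a
      using val0[of k a] that m val_biprod[OF b2(1) h(1) h2(3,1), of k a]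
        val_biprod[OF b2(2) h(3) h2(4,2), of k a] val_block[OF P, of k a] val_block[OF Q, of k a] by simp
  qed
  then have xPQ: "x = gcl P \<ominus>\<^bsub>gring\<^esub> gcl Q"
    unfolding x0 using gcl_diff_cancel[OF biprod_sym[OF b2(1)] h(1) h2(1,3) biprod_sym[OF b2(2)] h(3) h2(2,4)] by blast
  have "tr (act P k) = tr (act Q k)" if k: "k \<in> carrier G" for k
    using tr0[OF k] hiso_tr[OF iso2 h2(1,2) k]
    unfolding tr_biprod[OF b2(1) h(1) h2(3,1) k] tr_biprod[OF b2(2) h(3) h2(4,2) k] by simp
  moreover have "tr (act P k) = (\<Sum>i<n. inverse (chi k) ^ i) * tr (act U k)"
      "tr (act Q k) = (\<Sum>i<n. inverse (chi k) ^ i) * tr (act V k)" if k: "k \<in> carrier G" for k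
    using tinv_block[OF P k, of 0] tinv_block[OF Q k, of 0] tinv_0[OF h2(3) k] tinv_0[OF h2(4) k]
    by (simp_all add: atLeast0LessThan)
  ultimately have eq: "(\<Sum>i<n. inverse (chi k) ^ i) * tr (act U k) = (\<Sum>i<n. inverse (chi k) ^ i) * tr (act V k)"
    if "k \<in> carrier G" for k using that by metis
  obtain d where "tr (idn U) = of_nat d" using idempotent_tr(1)[OF hmodD(8)[OF blockD(2)[OF P]]] by blast
  from block_diff_in_PIdl[OF P Q eq this] show ?thesis unfolding xPQ .
qed

theorem jacobson_radical_gring: "jacobson_radical gring = PIdl\<^bsub>gring\<^esub> zel"
proof
  show "jacobson_radical gring \<subseteq> PIdl\<^bsub>gring\<^esub> zel" using jacobson_subset by blast
  have "y \<otimes>\<^bsub>gring\<^esub> zel \<in> I" if "y \<in> carrier gring" "maximalideal I gring" for y I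
  proof -
    interpret I: ideal I gring using that(2) by (rule maximalideal.axioms)
    have "zel \<in> I" using zel_jacobson that(2) by (simp add: jacobson_radical_def)
    then show ?thesis using I.I_l_closed that(1) by blast
  qed
  then show "PIdl\<^bsub>gring\<^esub> zel \<subseteq> jacobson_radical gring"
    using zel_closed by (auto simp: cgenideal_def jacobson_radical_def)
qed

end

theorem theorem6p3:
  fixes G :: "('g, 'm) monoid_scheme"
    and chi :: "'g \<Rightarrow> 'k :: {alg_closed_field, field_char_0}"
    and g :: 'g and n :: nat
  assumes "nonnilpotent_group_datum G chi g n"
  defines "r \<equiv> green_ring G chi g n"
  defines "a \<equiv> green_class G chi g n (hmodule_V G n (\<lambda>h. inverse (chi h)))"
  defines "M0 \<equiv> green_class G chi g n (hmodule_M0 G chi n)"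
  shows "jacobson_radical r = PIdl\<^bsub>r\<^esub> ((\<one>\<^bsub>r\<^esub> \<ominus>\<^bsub>r\<^esub> a) \<otimes>\<^bsub>r\<^esub> M0)"
proof -
  interpret datum G chi g n unfolding datum_def by (rule assms(1))
  show ?thesis
    unfolding assms(2-4) zel_eq by (rule jacobson_radical_gring)
qed

end
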